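(* Let $f_{i,j}:\mathbb S^2\to(0,\infty)$, $i,j=1,2,\dots$, be positive smooth functions such that (i) for some $0<T<\infty$, $\int_{\mathbb S^2}f_{i,j}\,d\mathrm{Vol}_{\mathbb S^2}\le T$ for all $i,j$; and (ii) $f_{i,j}\ge2$ and $\Delta f_{i,j}\le f_{i,j}$ on $\mathbb S^2$ for all $i,j$. Let $(A_i)_{i\ge1}$ be real numbers with $A_i\ge0$ for all $i$, $A_1>0$ and $\sum_{i=1}^\infty A_i=K<\infty$. For each $j\ge1$ let $h_j=\sum_{i=1}^jA_if_{i,j}$ and $g_j=g_{\mathbb S^2}+h_j^2\,g_{\mathbb S^1}$ on $\mathbb S^2\times\mathbb S^1$. Then there exist a subsequence $(g_{j_k})_k$ and a (weak) warped product Riemannian metric $g_\infty$ such that $g_\infty\in W^{1,p}(\mathbb S^2\times\mathbb S^1,g_0)$ for $p\in[1,2)$ and $g_{j_k}\to g_\infty$ in $L^q(\mathbb S^2\times\mathbb S^1,g_0)$ for all $q\in[1,\infty)$ as $k\to\infty$. Moreover, $g_\infty$ has non-negative distributional scalar curvature, and the total scalar curvature of $g_{j_k}$ converges to the (distributional) total scalar curvature of $g_\infty$ as $k\to\infty$.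
   Context: $(\mathbb S^2,g_{\mathbb S^2})$ is the standard unit round sphere, $d\mathrm{Vol}_{\mathbb S^2}$ its volume form and $\Delta$ its Laplacian ($\Delta=\mathrm{div}\,\nabla$); $(\mathbb S^1,g_{\mathbb S^1})$ is the standard circle of length $2\pi$; $g_0=g_{\mathbb S^2}+g_{\mathbb S^1}$ is the product metric. A (weak) warped product Riemannian metric on $\mathbb S^2\times\mathbb S^1$ is $g=g_{\mathbb S^2}+\eta^2g_{\mathbb S^1}$ with $\eta$ an almost everywhere defined positive function on $\mathbb S^2$. $L^q(\mathbb S^2\times\mathbb S^1,g_0)$ and $W^{1,p}(\mathbb S^2\times\mathbb S^1,g_0)$ are the spaces of symmetric 2-tensors whose norm (resp. whose norm together with that of the weak covariant derivative $\overline\nabla$) is in $L^q$ (resp. $L^p$), all norms, measures and derivatives being those of $g_0$. Distributional scalar curvature (Lee–LeFloch): for a metric $g$ of weak regularity and the smooth background metric $g_0$ with Levi-Civita connection $\overline\nabla$ and volume measure $\mu_0$, put $\Gamma^k_{ij}=\tfrac12g^{kl}(\overline\nabla_ig_{jl}+\overline\nabla_jg_{il}-\overline\nabla_lg_{ij})$, $V^k=g^{ij}\Gamma^k_{ij}-g^{ik}\Gamma^j_{ji}$, and $F=g^{ij}\overline{\mathrm{Ric}}_{ij}-\overline\nabla_kg^{ij}\,\Gamma^k_{ij}+\overline\nabla_kg^{ik}\,\Gamma^j_{ji}+g^{ij}(\Gamma^k_{kl}\Gamma^l_{ij}-\Gamma^k_{jl}\Gamma^l_{ik})$, where $\overline{\mathrm{Ric}}$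 is the Ricci tensor of $g_0$. The scalar curvature distribution is $$\langle\mathrm{Scal}_g,u\rangle=\int_{\mathbb S^2\times\mathbb S^1}\Big(-V\cdot\overline\nabla\big(u\tfrac{d\mu_g}{d\mu_0}\big)+Fu\tfrac{d\mu_g}{d\mu_0}\Big)d\mu_0,\qquad u\in C^\infty(\mathbb S^2\times\mathbb S^1),$$ where the integrand is regarded as one almost everywhere defined function (terms are combined before integrating). For $g=g_{\mathbb S^2}+\eta^2g_{\mathbb S^1}$ this integrand equals $2\langle\overline\nabla\eta,\overline\nabla u\rangle_{g_0}+2\eta u$. "Non-negative distributional scalar curvature" means the pairing is well defined (finite) for all such $u$ and $\langle\mathrm{Scal}_g,u\rangle\ge0$ for every $u\ge0$. The total scalar curvature of a smooth metric $g$ is $\int\mathrm{Scal}_g\,d\mu_g$; the distributional total scalar curvature of $g_\infty$ is $\langle\mathrm{Scal}_{g_\infty},1\rangle$. *)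

theory Defs
  imports "HOL-Analysis.Analysis"
begin

section \<open>Smooth maps on open sets\<close>

primrec Ck_on :: "nat \<Rightarrow> ('a::real_normed_vector \<Rightarrow> 'b::real_normed_vector) \<Rightarrow> 'a set \<Rightarrow> bool" where
  "Ck_on 0 f S \<longleftrightarrow> continuous_on S f"
| "Ck_on (Suc k) f S \<longleftrightarrow> (\<forall>x\<in>S. f differentiable (at x)) \<and>
     (\<forall>v. Ck_on k (\<lambda>x. frechet_derivative f (at x) v) S)"

definition smooth_open :: "('a::real_normed_vector \<Rightarrow> 'b::real_normed_vector) \<Rightarrow> 'a set \<Rightarrow> bool" where
  "smooth_open f S \<longleftrightarrow> (\<forall>k. Ck_on k f S)"


section \<open>Calculus on the unit sphere of a Euclidean space\<close>

text \<open>
  A function on the unit sphere is represented by a function on the ambient space, of which only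
  the values on the sphere matter. It is differentiated through its extension
  \<open>\<lambda>y. F (sgn y)\<close> (constant along rays), where \<open>sgn y = y /\<^sub>R norm y\<close>. At a
  point \<open>x\<close> of the sphere this derivative in the ambient direction \<open>v\<close> is the differential of
  the function on the sphere in the direction of the tangential part of \<open>v\<close>. As \<open>sgn\<close> is
  a smooth retraction onto the sphere, smoothness of this extension is smoothness on the
  submanifold. Traces and norms over
  the tangent space are sums over the ambient orthonormal basis \<open>Basis\<close> of expressions that
  vanish on normal vectors.
\<close>

definition sproj :: "'a::euclidean_space \<Rightarrow> 'a \<Rightarrow> 'a" where
  "sproj x v = v - (v \<bullet> x) *\<^sub>R x"

definition sderiv :: "('a::euclidean_space \<Rightarrow> 'b::real_normed_vector) \<Rightarrow> 'a \<Rightarrow> 'a \<Rightarrow> 'b" where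
  "sderiv F x v = frechet_derivative (\<lambda>y. F (sgn y)) (at x) v"

definition smooth_on_sphere :: "('a::euclidean_space \<Rightarrow> 'b::real_normed_vector) \<Rightarrow> bool" where
  "smooth_on_sphere F \<longleftrightarrow> smooth_open (\<lambda>y. F (sgn y)) (- {0})"

definition sgrad :: "('a::euclidean_space \<Rightarrow> real) \<Rightarrow> 'a \<Rightarrow> 'a" where
  "sgrad f x = (\<Sum>b\<in>Basis. sderiv f x b *\<^sub>R b)"

text \<open>The Levi-Civita connection of the round metric is the tangential part of the flat derivative;
  the divergence of a tangent field \<open>X\<close> is the trace of its covariant derivative.\<close>

definition sdiv :: "('a::euclidean_space \<Rightarrow> 'a) \<Rightarrow> 'a \<Rightarrow> real" where
  "sdiv X x = (\<Sum>b\<in>Basis. sproj x (sderiv X x b) \<bullet> b)"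

definition slaplacian :: "('a::euclidean_space \<Rightarrow> real) \<Rightarrow> 'a \<Rightarrow> real" where
  "slaplacian f = sdiv (sgrad f)"

text \<open>The Riemannian volume of the round unit sphere: \<open>n\<close> times the Lebesgue measure
  of the cone over a set (total mass \<open>4 * pi\<close> for the 2-sphere, \<open>2 * pi\<close> for the circle).\<close>

definition sphere_measure :: "'a::euclidean_space measure" where
  "sphere_measure = scale_measure (ennreal (DIM('a)))
     (distr (restrict_space lborel (ball 0 1 - {0})) (restrict_space borel (sphere 0 1)) sgn)"


section \<open>The product of the 2-sphere and the circle\<close>

type_synonym amb = "(real^3) \<times> (real^2)"

abbreviation S2xS1 :: "amb set" where
  "S2xS1 \<equiv> sphere 0 1 \<times> sphere 0 1"

definition mu0 :: "amb measure" where
  "mu0 = sphere_measure \<Otimes>\<^sub>M sphere_measure"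

definition retr :: "amb \<Rightarrow> amb" where
  "retr p = (sgn (fst p), sgn (snd p))"

definition tproj :: "amb \<Rightarrow> amb \<Rightarrow> amb" where
  "tproj p v = (sproj (fst p) (fst v), sproj (snd p) (snd v))"

definition mderiv :: "(amb \<Rightarrow> 'b::real_normed_vector) \<Rightarrow> amb \<Rightarrow> amb \<Rightarrow> 'b" where
  "mderiv F p v = frechet_derivative (\<lambda>q. F (retr q)) (at p) v"

definition smooth_on_M :: "(amb \<Rightarrow> 'b::real_normed_vector) \<Rightarrow> bool" where
  "smooth_on_M F \<longleftrightarrow> smooth_open (\<lambda>q. F (retr q)) {q. fst q \<noteq> 0 \<and> snd q \<noteq> 0}"

text \<open>Covariant 2- and 3-tensors at a point of \<open>S2xS1\<close> are multilinear forms on the ambient space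
  that only depend on the tangential parts of their arguments. Components are taken in the
  ambient orthonormal \<open>Basis\<close>; since it is orthonormal for \<open>g0\<close> up to normal
  directions, contracting over it is contracting over a \<open>g0\<close>-orthonormal basis of the tangent
  space, and the position (upper or lower) of an index is not recorded.\<close>

type_synonym tensor2 = "amb \<Rightarrow> amb \<Rightarrow> amb \<Rightarrow> real"
type_synonym tensor3 = "amb \<Rightarrow> amb \<Rightarrow> amb \<Rightarrow> amb \<Rightarrow> real"

definition tangent2 :: "amb \<Rightarrow> (amb \<Rightarrow> amb \<Rightarrow> real) \<Rightarrow> bool" where
  "tangent2 p t \<longleftrightarrow> bilinear t \<and> (\<forall>a b. t a b = t (tproj p a) (tproj p b))"

definition tangent3 :: "amb \<Rightarrow> (amb \<Rightarrow> amb \<Rightarrow> amb \<Rightarrow> real) \<Rightarrow> bool" where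
  "tangent3 p t \<longleftrightarrow> (\<forall>a. bilinear (t a)) \<and> (\<forall>b c. linear (\<lambda>a. t a b c)) \<and>
     (\<forall>a b c. t a b c = t (tproj p a) (tproj p b) (tproj p c))"


section \<open>Metrics, Levi-Civita connection and curvature\<close>

definition warped_metric :: "(real^3 \<Rightarrow> real) \<Rightarrow> tensor2" where
  "warped_metric \<eta> p v w =
     sproj (fst p) (fst v) \<bullet> sproj (fst p) (fst w) +
     (\<eta> (fst p))\<^sup>2 * (sproj (snd p) (snd v) \<bullet> sproj (snd p) (snd w))"

definition g0 :: tensor2 where
  "g0 p v w = tproj p v \<bullet> tproj p w"

definition weak_warped_metric :: "tensor2 \<Rightarrow> bool" where
  "weak_warped_metric g \<longleftrightarrow> (\<exists>\<eta>. \<eta> \<in> borel_measurable sphere_measure \<and>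
     (AE x in sphere_measure. \<eta> x > 0) \<and> g = warped_metric \<eta>)"

text \<open>The inverse metric on the tangent space, with components \<open>g^{ij}\<close>.\<close>

definition cometric :: "tensor2 \<Rightarrow> tensor2" where
  "cometric g p = (THE k. tangent2 p k \<and>
     (\<forall>a b. (\<Sum>c\<in>Basis. g p a c * k c b) = g0 p a b))"

text \<open>The density \<open>d\<mu>_g / d\<mu>_0\<close>: the root of the determinant of \<open>g\<close> in a
  \<open>g0\<close>-orthonormal basis of the tangent space (independent of the basis).\<close>

definition orthonormal_frame :: "amb \<Rightarrow> (3 \<Rightarrow> amb) \<Rightarrow> bool" where
  "orthonormal_frame p e \<longleftrightarrow> (\<forall>i. tproj p (e i) = e i) \<and>
     (\<forall>i j. g0 p (e i) (e j) = (if i = j then 1 else 0))"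

definition vol_density :: "tensor2 \<Rightarrow> amb \<Rightarrow> real" where
  "vol_density g p = (let e = (SOME e. orthonormal_frame p e) in
     sqrt (det (\<chi> i j. g p (e i) (e j))))"

definition vol_measure :: "tensor2 \<Rightarrow> amb measure" where
  "vol_measure g = density mu0 (\<lambda>p. ennreal (vol_density g p))"

text \<open>The tangential parts of constant ambient vectors; at each point they span the tangent space.\<close>

definition tfield :: "amb \<Rightarrow> amb \<Rightarrow> amb" where
  "tfield a p = tproj p a"

definition lie_bracket :: "(amb \<Rightarrow> amb) \<Rightarrow> (amb \<Rightarrow> amb) \<Rightarrow> amb \<Rightarrow> amb" where
  "lie_bracket X Y p = mderiv Y p (X p) - mderiv X p (Y p)"

text \<open>The right-hand side of the Koszul formula for \<open>2 g(\<nabla>_X Y, Z)\<close>.\<close>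

definition koszul :: "tensor2 \<Rightarrow> (amb \<Rightarrow> amb) \<Rightarrow> (amb \<Rightarrow> amb) \<Rightarrow> (amb \<Rightarrow> amb) \<Rightarrow> amb \<Rightarrow> real" where
  "koszul g X Y Z p =
     mderiv (\<lambda>q. g q (Y q) (Z q)) p (X p)
   + mderiv (\<lambda>q. g q (X q) (Z q)) p (Y p)
   - mderiv (\<lambda>q. g q (X q) (Y q)) p (Z p)
   + g p (lie_bracket X Y p) (Z p)
   - g p (lie_bracket X Z p) (Y p)
   - g p (lie_bracket Y Z p) (X p)"

definition levi_civita :: "tensor2 \<Rightarrow> (amb \<Rightarrow> amb) \<Rightarrow> (amb \<Rightarrow> amb) \<Rightarrow> amb \<Rightarrow> amb" where
  "levi_civita g X Y p =
     (\<Sum>a\<in>Basis. (\<Sum>b\<in>Basis. cometric g p a b * (koszul g X Y (tfield b) p / 2)) *\<^sub>R a)"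

definition riemann :: "tensor2 \<Rightarrow> (amb \<Rightarrow> amb) \<Rightarrow> (amb \<Rightarrow> amb) \<Rightarrow> (amb \<Rightarrow> amb) \<Rightarrow> amb \<Rightarrow> amb" where
  "riemann g X Y Z p =
     levi_civita g X (levi_civita g Y Z) p - levi_civita g Y (levi_civita g X Z) p
     - levi_civita g (lie_bracket X Y) Z p"

text \<open>\<open>Ric(Y, Z)\<close> is the trace of \<open>X \<mapsto> R(X, Y) Z\<close>.\<close>

definition ricci :: "tensor2 \<Rightarrow> tensor2" where
  "ricci g p b c = (\<Sum>a\<in>Basis. riemann g (tfield a) (tfield b) (tfield c) p \<bullet> a)"

definition scalar_curvature :: "tensor2 \<Rightarrow> amb \<Rightarrow> real" where
  "scalar_curvature g p = (\<Sum>b\<in>Basis. \<Sum>c\<in>Basis. cometric g p b c * ricci g p b c)"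

definition total_scalar_curvature :: "tensor2 \<Rightarrow> real" where
  "total_scalar_curvature g = (\<integral>p. scalar_curvature g p \<partial>vol_measure g)"


section \<open>Weak covariant derivatives with respect to the product metric\<close>

text \<open>\<open>cov_deriv3 \<Phi> p a b c d\<close> is \<open>(\<nabla>_a \<Phi>)(b, c, d)\<close> for the Levi-Civita connection of
  \<open>g0\<close>, computed by the Leibniz rule on the fields \<open>tfield\<close>.\<close>

definition cov_deriv3 :: "tensor3 \<Rightarrow> amb \<Rightarrow> amb \<Rightarrow> amb \<Rightarrow> amb \<Rightarrow> amb \<Rightarrow> real" where
  "cov_deriv3 \<Phi> p a b c d =
     mderiv (\<lambda>q. \<Phi> q (tfield b q) (tfield c q) (tfield d q)) p (tfield a p)
   - \<Phi> p (levi_civita g0 (tfield a) (tfield b) p) (tfield c p) (tfield d p)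
   - \<Phi> p (tfield b p) (levi_civita g0 (tfield a) (tfield c) p) (tfield d p)
   - \<Phi> p (tfield b p) (tfield c p) (levi_civita g0 (tfield a) (tfield d) p)"

definition div3 :: "tensor3 \<Rightarrow> tensor2" where
  "div3 \<Phi> p c d = (\<Sum>a\<in>Basis. cov_deriv3 \<Phi> p a a c d)"

definition smooth_tensor3 :: "tensor3 \<Rightarrow> bool" where
  "smooth_tensor3 \<Phi> \<longleftrightarrow> (\<forall>p\<in>S2xS1. tangent3 p (\<Phi> p)) \<and>
     (\<forall>a b c. smooth_on_M (\<lambda>p. \<Phi> p a b c))"

text \<open>\<open>has_weak_cov T S\<close>: the 3-tensor \<open>S p a b c = (\<nabla>_a T)(b, c)\<close> is the weak covariant
  derivative of \<open>T\<close>. As the manifold is closed, all smooth tensors are test tensors.\<close>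

definition has_weak_cov :: "tensor2 \<Rightarrow> tensor3 \<Rightarrow> bool" where
  "has_weak_cov T S \<longleftrightarrow>
     (AE p in mu0. tangent2 p (T p)) \<and> (AE p in mu0. tangent3 p (S p)) \<and>
     (\<forall>a b. integrable mu0 (\<lambda>p. T p a b)) \<and> (\<forall>a b c. integrable mu0 (\<lambda>p. S p a b c)) \<and>
     (\<forall>\<Phi>. smooth_tensor3 \<Phi> \<longrightarrow>
        (\<integral>p. (\<Sum>a\<in>Basis. \<Sum>b\<in>Basis. \<Sum>c\<in>Basis. S p a b c * \<Phi> p a b c) \<partial>mu0) =
        - (\<integral>p. (\<Sum>b\<in>Basis. \<Sum>c\<in>Basis. T p b c * div3 \<Phi> p b c) \<partial>mu0))"

definition weak_cov :: "tensor2 \<Rightarrow> tensor3" where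
  "weak_cov T = (SOME S. has_weak_cov T S)"

definition div1 :: "(amb \<Rightarrow> amb) \<Rightarrow> amb \<Rightarrow> real" where
  "div1 X p = (\<Sum>a\<in>Basis. levi_civita g0 (tfield a) X p \<bullet> a)"

definition smooth_vector_field :: "(amb \<Rightarrow> amb) \<Rightarrow> bool" where
  "smooth_vector_field X \<longleftrightarrow> (\<forall>p\<in>S2xS1. tproj p (X p) = X p) \<and> smooth_on_M X"

definition has_weak_grad :: "(amb \<Rightarrow> real) \<Rightarrow> (amb \<Rightarrow> amb) \<Rightarrow> bool" where
  "has_weak_grad v W \<longleftrightarrow>
     (AE p in mu0. tproj p (W p) = W p) \<and> integrable mu0 v \<and> integrable mu0 W \<and>
     (\<forall>X. smooth_vector_field X \<longrightarrow>
        (\<integral>p. W p \<bullet> X p \<partial>mu0) = - (\<integral>p. v p * div1 X p \<partial>mu0))"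

definition weak_grad :: "(amb \<Rightarrow> real) \<Rightarrow> amb \<Rightarrow> amb" where
  "weak_grad v = (SOME W. has_weak_grad v W)"


section \<open>Lebesgue and Sobolev spaces of symmetric 2-tensors\<close>

definition norm2 :: "(amb \<Rightarrow> amb \<Rightarrow> real) \<Rightarrow> real" where
  "norm2 t = sqrt (\<Sum>a\<in>Basis. \<Sum>b\<in>Basis. (t a b)\<^sup>2)"

definition norm3 :: "(amb \<Rightarrow> amb \<Rightarrow> amb \<Rightarrow> real) \<Rightarrow> real" where
  "norm3 t = sqrt (\<Sum>a\<in>Basis. \<Sum>b\<in>Basis. \<Sum>c\<in>Basis. (t a b c)\<^sup>2)"

definition Lq_tensor :: "real \<Rightarrow> tensor2 \<Rightarrow> bool" where
  "Lq_tensor q T \<longleftrightarrow>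
     (AE p in mu0. tangent2 p (T p) \<and> (\<forall>a b. T p a b = T p b a)) \<and>
     (\<forall>a b. (\<lambda>p. T p a b) \<in> borel_measurable mu0) \<and>
     integrable mu0 (\<lambda>p. norm2 (T p) powr q)"

definition W1p_tensor :: "real \<Rightarrow> tensor2 \<Rightarrow> bool" where
  "W1p_tensor r T \<longleftrightarrow> Lq_tensor r T \<and>
     (\<exists>S. has_weak_cov T S \<and> integrable mu0 (\<lambda>p. norm3 (S p) powr r))"

definition Lq_tendsto :: "real \<Rightarrow> (nat \<Rightarrow> tensor2) \<Rightarrow> tensor2 \<Rightarrow> bool" where
  "Lq_tendsto q Tn T \<longleftrightarrow> (\<forall>n. Lq_tensor q (Tn n)) \<and> Lq_tensor q T \<and>
     (\<lambda>n. \<integral>p. norm2 (\<lambda>a b. Tn n p a b - T p a b) powr q \<partial>mu0) \<longlonglongrightarrow> 0"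


section \<open>The scalar curvature distribution\<close>

text \<open>The background metric is \<open>g0\<close>. The coefficients depend on \<open>g\<close> through its inverse and the
  weak covariant derivatives of \<open>g\<close> and of the inverse: \<open>weak_cov g p i j l\<close> is
  \<open>\<nabla>_i g_{jl}\<close> and \<open>weak_cov (cometric g) p k i j\<close> is \<open>\<nabla>_k g^{ij}\<close>.\<close>

definition Gam :: "tensor2 \<Rightarrow> tensor3" where
  "Gam g p k i j = (1/2) * (\<Sum>l\<in>Basis. cometric g p k l *
     (weak_cov g p i j l + weak_cov g p j i l - weak_cov g p l i j))"

definition Vvec :: "tensor2 \<Rightarrow> amb \<Rightarrow> amb \<Rightarrow> real" where
  "Vvec g p k =
     (\<Sum>i\<in>Basis. \<Sum>j\<in>Basis. cometric g p i j * Gam g p k i j)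
   - (\<Sum>i\<in>Basis. \<Sum>j\<in>Basis. cometric g p i k * Gam g p j j i)"

definition Ffun :: "tensor2 \<Rightarrow> amb \<Rightarrow> real" where
  "Ffun g p =
     (\<Sum>i\<in>Basis. \<Sum>j\<in>Basis. cometric g p i j * ricci g0 p i j)
   - (\<Sum>i\<in>Basis. \<Sum>j\<in>Basis. \<Sum>k\<in>Basis. weak_cov (cometric g) p k i j * Gam g p k i j)
   + (\<Sum>i\<in>Basis. \<Sum>j\<in>Basis. \<Sum>k\<in>Basis. weak_cov (cometric g) p k i k * Gam g p j j i)
   + (\<Sum>i\<in>Basis. \<Sum>j\<in>Basis. \<Sum>k\<in>Basis. \<Sum>l\<in>Basis. cometric g p i j *
        (Gam g p k k l * Gam g p l i j - Gam g p k j l * Gam g p l i k))"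

definition scal_integrand :: "tensor2 \<Rightarrow> (amb \<Rightarrow> real) \<Rightarrow> amb \<Rightarrow> real" where
  "scal_integrand g u p =
     - (\<Sum>k\<in>Basis. Vvec g p k * (weak_grad (\<lambda>q. u q * vol_density g q) p \<bullet> k))
     + Ffun g p * u p * vol_density g p"

definition scal_dist :: "tensor2 \<Rightarrow> (amb \<Rightarrow> real) \<Rightarrow> real" where
  "scal_dist g u = (\<integral>p. scal_integrand g u p \<partial>mu0)"

text \<open>All weak derivatives entering the pairing exist and the combined integrand is integrable.\<close>

definition scal_dist_defined :: "tensor2 \<Rightarrow> (amb \<Rightarrow> real) \<Rightarrow> bool" where
  "scal_dist_defined g u \<longleftrightarrow>
     (\<exists>S. has_weak_cov g S) \<and> (\<exists>S. has_weak_cov (cometric g) S) \<and>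
     (\<exists>W. has_weak_grad (\<lambda>q. u q * vol_density g q) W) \<and>
     integrable mu0 (scal_integrand g u)"

definition nonneg_scal_dist :: "tensor2 \<Rightarrow> bool" where
  "nonneg_scal_dist g \<longleftrightarrow> (\<forall>u. smooth_on_M u \<longrightarrow>
     scal_dist_defined g u \<and> ((\<forall>p\<in>S2xS1. 0 \<le> u p) \<longrightarrow> 0 \<le> scal_dist g u))"

end

(*
  The heart of the matter is a compactness theorem for positive functions h_k on the 2-sphere with
  Delta h_k <= h_k and bounded integral. Since Delta h_k integrates to 0 and h_k - Delta h_k >= 0, the
  functions Delta h_k are bounded in L^1. By Green's formula h_k minus its mean is, up to a constant
  factor, the integral operator with kernel ln (1 - x . y) applied to Delta h_k. This kernel is in every
  L^p and its gradient in L^p for p < 2; it is the limit, in these norms, of the smooth kernels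
  ln (1 + e - x . y), whose operators map bounded subsets of L^1 to equicontinuous families. So a
  subsequence of h_k converges in every L^p, with gradients converging in L^p for p < 2.

  The lower bound h_k >= 2 A_1 makes t -> t^2 and t -> t^-2 smooth on the range of the limit, which gives
  the weak derivatives of the limit metric and of its inverse. As weak derivatives are unique almost
  everywhere, the scalar curvature pairing of the limit is the integral of
  2 <grad eta, grad u> + 2 eta u, i.e. the limit of the integrals of 2 u (h_k - Delta h_k) >= 0. For u = 1
  it is the limit of the total scalar curvatures, as the metric of h_k has scalar curvature
  2 - 2 Delta h_k / h_k and volume density h_k.
*)

theory Submission
  imports Defs "HOL-Complex_Analysis.Great_Picard" "HOL-Library.Diagonal_Subsequence"
begin

section \<open>The surface measure of the sphere\<close>

text \<open>The surface measure is given only through Lebesgue measure of cones, so integration by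
  parts has to come from its symmetries: derivatives along rotation fields integrate to 0, and the
  tangential part of each axis is a combination of rotation fields. The singular kernel itself never
  enters. All operators are built from the shifted kernels, which are continuous on a compact set;
  the estimates concern differences of two of them, uniformly in the smaller shift, and Fatou's
  lemma removes that shift. The decisive obstacle is that the limit gradient is controlled only in
  L^p for p < 2. Its square need not be integrable, yet both halves of the curvature pairing contain
  it. It cancels pointwise, so the coefficients are computed at almost every point and only their
  sum is integrated. This also fixes the exponents 3 for functions and 3/2 < 2 for gradients when
  products of sequences pass to the limit. As weak derivatives are picked by an abstract choice,
  they have to be identified almost everywhere, by testing against polynomials.\<close>

abbreviation "\<sigma> \<equiv> sphere_measure"

lemma measurable_sgn_sphere:
  "(sgn :: 'a::euclidean_space \<Rightarrow> 'a) \<in>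
     measurable (restrict_space lborel (ball 0 1 - {0})) (restrict_space borel (sphere 0 1))"
proof (rule measurable_restrict_space2)
  show "sgn \<in> space (restrict_space lborel (ball 0 1 - {0::'a})) \<rightarrow> sphere 0 1"
    by (auto simp: space_restrict_space norm_sgn)
  have "continuous_on (ball 0 1 - {0::'a}) sgn"
    by (intro continuous_intros) auto
  then show "sgn \<in> borel_measurable (restrict_space lborel (ball 0 1 - {0::'a}))"
    using borel_measurable_continuous_on_restrict
      measurable_cong_sets[OF sets_restrict_space_cong[OF sets_lborel] refl] by blast
qed

lemma space_sphere_measure [simp]: "space \<sigma> = sphere 0 1"
  by (simp add: sphere_measure_def space_scale_measure space_restrict_space)

lemma sets_sphere_measure: "sets \<sigma> = sets (restrict_space borel (sphere 0 1))"
  by (simp add: sphere_measure_def)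

lemma emeasure_sphere_measure:
  fixes A :: "'a::euclidean_space set"
  assumes "A \<in> sets \<sigma>"
  shows "emeasure \<sigma> A = DIM('a) * emeasure lborel (sgn -` A \<inter> (ball 0 1 - {0}))"
proof -
  have [simp]: "sgn -` A \<inter> space (restrict_space lborel (ball 0 1 - {0::'a})) \<subseteq> (ball 0 1 - {0})"
    by (auto simp: space_restrict_space)
  have "ball 0 1 - {0::'a} \<in> sets lborel" by auto
  then show ?thesis
    using assms unfolding sphere_measure_def
    by (simp add: emeasure_distr measurable_sgn_sphere emeasure_restrict_space space_restrict_space
        ennreal_of_nat_eq_real_of_nat)
qed

interpretation sphere_measure: finite_measure "\<sigma> :: 'a::euclidean_space measure"
proof
  have "emeasure lborel (sgn -` sphere 0 1 \<inter> (ball 0 1 - {0::'a})) \<le> emeasure lborel (ball 0 1 :: 'a set)"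
    by (intro emeasure_mono) auto
  also have "\<dots> < \<infinity>" using emeasure_lborel_ball_finite[of "0::'a" 1] by simp
  finally have "emeasure (\<sigma> :: 'a measure) (space \<sigma>) < \<infinity>"
    using sets.top[of "\<sigma> :: 'a measure"]
    by (simp add: emeasure_sphere_measure ennreal_mult_less_top ennreal_of_nat_eq_real_of_nat)
  then show "emeasure (\<sigma> :: 'a measure) (space \<sigma>) \<noteq> \<infinity>" by simp
qed

text \<open>The punctured ball is the preimage of the whole sphere under \<open>sgn\<close>;
  restoring its centre adds a null set, and an open ball is not null. Later estimates divide by this
  mass.\<close>

lemma measure_sphere_measure_pos: "measure \<sigma> (sphere 0 (1::real) :: 'a::euclidean_space set) > 0"
proof -
  have "emeasure lborel (sgn -` sphere 0 1 \<inter> (ball 0 1 - {0::'a})) = emeasure lborel (ball 0 1 - {0 :: 'a})"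
    by (intro arg_cong[where f="emeasure lborel"]) (auto simp: norm_sgn)
  also have "\<dots> \<noteq> 0"
  proof
    assume "emeasure lborel (ball 0 1 - {0 :: 'a}) = 0"
    then have "ball 0 1 - {0::'a} \<in> null_sets lborel" by (intro null_setsI) auto
    then have "ball 0 1 - {0::'a} \<union> {0} \<in> null_sets lborel"
      by (intro null_sets.Un) (auto intro!: null_setsI)
    then have "(ball 0 1 :: 'a set) \<in> null_sets lborel"
      by (metis Un_Diff_cancel2 centre_in_ball insert_Diff insert_is_Un sup_commute zero_less_one)
    then have "negligible (ball 0 1 :: 'a set)"
      using negligible_iff_null_sets null_sets_completionI by blast
    then show False using open_not_negligible[of "ball 0 1 :: 'a set"] by auto
  qed
  finally have "emeasure \<sigma> (sphere 0 (1::real) :: 'a set) \<noteq> 0"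
    using sets.top[of "\<sigma> :: 'a measure"]
    by (auto simp: emeasure_sphere_measure)
  then show ?thesis
    by (simp add: sphere_measure.emeasure_eq_measure less_le)
qed

text \<open>Lebesgue measure is pinned down by its values on boxes. The preimage of a box under R is
  its image under the inverse of R, again orthogonal, and so has the measure of the box.\<close>

lemma distr_lborel_orthogonal:
  fixes R :: "real^'n::{finite,wellorder} \<Rightarrow> real^'n::_"
  assumes R: "orthogonal_transformation R"
  shows "distr lborel borel R = lborel"
proof (rule lborel_eqI[symmetric])
  fix l u :: "real^'n::_" assume lu: "\<And>b. b \<in> Basis \<Longrightarrow> l \<bullet> b \<le> u \<bullet> b"
  have [measurable]: "R \<in> borel_measurable borel"
    using orthogonal_transformation_linear[OF R] by (intro borel_measurable_continuous_onI)
      (simp add: linear_continuous_on linear_conv_bounded_linear)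
  have bij: "bij R" using R by (rule orthogonal_transformation_bij)
  have inv: "orthogonal_transformation (inv R)" using R by (rule orthogonal_transformation_inv)
  have "emeasure (distr lborel borel R) (box l u) = emeasure lborel (R -` box l u)"
    by (simp add: emeasure_distr)
  also have "R -` box l u = inv R ` box l u"
    using bij by (rule bij_vimage_eq_inv_image)
  also have "emeasure lborel \<dots> = emeasure lebesgue (inv R ` box l u)"
  proof -
    have "R -` box l u \<in> sets lborel" using measurable_sets[OF \<open>R \<in> borel_measurable borel\<close>, of "box l u"] by simp
    then show ?thesis using \<open>R -` box l u = inv R ` box l u\<close> by simp
  qed
  also have "\<dots> = ennreal (measure lebesgue (inv R ` box l u))"
    using measurable_orthogonal_image[OF inv, of "box l u"]
    by (intro emeasure_eq_measure2) (auto simp: lmeasurable_box)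
  also have "\<dots> = ennreal (measure lebesgue (box l u))"
    using measure_orthogonal_image[OF inv, of "box l u"] by (simp add: lmeasurable_box)
  also have "\<dots> = (\<Prod>b\<in>Basis. (u - l) \<bullet> b)"
    using lu by (simp add: measure_lborel_box_eq)
  finally show "emeasure (distr lborel borel R) (box l u) = (\<Prod>b\<in>Basis. (u - l) \<bullet> b)" .
qed simp

lemma measurable_orthogonal_sphere:
  fixes R :: "'a::euclidean_space \<Rightarrow> 'a"
  assumes R: "orthogonal_transformation R"
  shows "R \<in> measurable \<sigma> \<sigma>"
proof -
  have "continuous_on (sphere 0 1) R"
    using orthogonal_transformation_linear[OF R] by (simp add: linear_continuous_on linear_conv_bounded_linear)
  then have "R \<in> measurable (restrict_space borel (sphere 0 1)) (restrict_space borel (sphere 0 1))"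
    using R by (intro measurable_restrict_space2 borel_measurable_continuous_on_restrict)
      (auto simp: space_restrict_space orthogonal_transformation_norm)
  then show ?thesis by (simp add: sets_sphere_measure cong: measurable_cong_sets)
qed

text \<open>\<open>sgn\<close> commutes with R, which is linear and norm preserving. The cone over a
  preimage is therefore the preimage of the cone, and the invariance of Lebesgue measure carries
  over.\<close>

lemma distr_sphere_measure_orthogonal:
  fixes R :: "real^'n::{finite,wellorder} \<Rightarrow> real^'n::_"
  assumes R: "orthogonal_transformation R"
  shows "distr \<sigma> \<sigma> R = \<sigma>"
proof (rule measure_eqI)
  fix A assume "A \<in> sets (distr \<sigma> \<sigma> R)"
  then have A: "A \<in> sets \<sigma>" by simp
  note Rm = measurable_orthogonal_sphere[OF R]
  have norm_R [simp]: "norm (R x) = norm x" for x using R by (simp add: orthogonal_transformation_norm)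
  have lin: "linear R" using R by (rule orthogonal_transformation_linear)
  have R0 [simp]: "R x = 0 \<longleftrightarrow> x = 0" for x using norm_R[of x] by (metis norm_eq_zero)
  have sgn_R: "sgn (R x) = R (sgn x)" for x
    by (simp add: sgn_div_norm linear_scale[OF lin])
  have RA: "R -` A \<inter> sphere 0 1 \<in> sets \<sigma>"
    using measurable_sets[OF Rm A] by simp
  have set1: "sgn -` A \<inter> (ball 0 1 - {0}) \<in> sets borel"
  proof -
    have "sgn -` A \<inter> space (restrict_space lborel (ball 0 1 - {0})) \<in> sets (restrict_space lborel (ball 0 1 - {0}))"
      using measurable_sets[OF measurable_sgn_sphere] A unfolding sets_sphere_measure by blast
    then show ?thesis by (auto simp: sets_restrict_space space_restrict_space)
  qed
  have "emeasure (distr \<sigma> \<sigma> R) A = emeasure \<sigma> (R -` A \<inter> sphere 0 1)"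
    using A Rm by (simp add: emeasure_distr)
  also have "\<dots> = DIM(real^'n::_) * emeasure lborel (sgn -` (R -` A \<inter> sphere 0 1) \<inter> (ball 0 1 - {0}))"
    by (rule emeasure_sphere_measure[OF RA])
  also have "sgn -` (R -` A \<inter> sphere 0 1) \<inter> (ball 0 1 - {0}) = R -` (sgn -` A \<inter> (ball 0 1 - {0}))"
    by (auto simp: sgn_R norm_sgn)
  also have "emeasure lborel \<dots> = emeasure (distr lborel borel R) (sgn -` A \<inter> (ball 0 1 - {0}))"
  proof -
    have "R \<in> borel_measurable borel"
      using lin by (intro borel_measurable_continuous_onI)
        (simp add: linear_continuous_on linear_conv_bounded_linear)
    then show ?thesis using set1 by (simp add: emeasure_distr)
  qed
  also have "DIM(real^'n::_) * \<dots> = emeasure \<sigma> A"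
    by (simp only: distr_lborel_orthogonal[OF R] emeasure_sphere_measure[OF A])
  finally show "emeasure (distr \<sigma> \<sigma> R) A = emeasure \<sigma> A" .
qed simp

section \<open>Continuous functions on the sphere and measure-preserving flows\<close>

lemma continuous_on_sphere_measurable:
  fixes F :: "'a::euclidean_space \<Rightarrow> 'b::topological_space"
  assumes "continuous_on (sphere 0 1) F"
  shows "F \<in> borel_measurable \<sigma>"
  using borel_measurable_continuous_on_restrict[OF assms]
  by (simp add: sets_sphere_measure cong: measurable_cong_sets)

lemma continuous_on_sphere_integrable:
  fixes F :: "'a::euclidean_space \<Rightarrow> 'b::{banach, second_countable_topology}"
  assumes "continuous_on (sphere 0 1) F"
  shows "integrable \<sigma> F"
proof -
  have "compact (F ` sphere 0 1)" using assms by (intro compact_continuous_image) auto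
  then obtain B where "\<And>x. x \<in> sphere 0 1 \<Longrightarrow> norm (F x) \<le> B"
    by (meson bounded_iff compact_imp_bounded imageI)
  then show ?thesis
    by (intro sphere_measure.integrable_const_bound[where B=B] continuous_on_sphere_measurable assms AE_I2) auto
qed

text \<open>Invariance makes the integral of \<open>G (\<phi> t x)\<close> independent of t, so the
  difference quotients at 0 integrate to 0. The derivative formula at all times t, not only at 0,
  gives through the mean value theorem the bound B for dominated convergence.\<close>

lemma integral_flow_derivative_eq_0:
  fixes \<phi> :: "real \<Rightarrow> 'a \<Rightarrow> 'a" and G D :: "'a \<Rightarrow> real"
  assumes fin: "finite_measure M"
    and \<phi>: "\<And>t. \<phi> t \<in> measurable M M" and inv: "\<And>t. distr M M (\<phi> t) = M"
    and id: "\<And>x. x \<in> space M \<Longrightarrow> \<phi> 0 x = x"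
    and G: "integrable M G"
    and D: "D \<in> borel_measurable M" "\<And>x. x \<in> space M \<Longrightarrow> \<bar>D x\<bar> \<le> B"
    and der: "\<And>x t. x \<in> space M \<Longrightarrow> ((\<lambda>t. G (\<phi> t x)) has_real_derivative D (\<phi> t x)) (at t)"
  shows "(\<integral>x. D x \<partial>M) = 0"
proof -
  interpret finite_measure M by fact
  define q where "q n x = real (Suc n) * (G (\<phi> (1 / Suc n) x) - G x)" for n x
  have Gm: "G \<in> borel_measurable M" using G by simp
  have int: "integrable M (\<lambda>x. G (\<phi> t x))" "(\<integral>x. G (\<phi> t x) \<partial>M) = (\<integral>x. G x \<partial>M)" for t
  proof -
    have "integrable (distr M M (\<phi> t)) G" using G by (simp add: inv)
    then show "integrable M (\<lambda>x. G (\<phi> t x))" using integrable_distr[OF \<phi>] by blast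
    have "(\<integral>x. G x \<partial>distr M M (\<phi> t)) = (\<integral>x. G (\<phi> t x) \<partial>M)"
      using integral_distr[OF \<phi> Gm] .
    then show "(\<integral>x. G (\<phi> t x) \<partial>M) = (\<integral>x. G x \<partial>M)" by (simp add: inv)
  qed
  have "(\<integral>x. q n x \<partial>M) = 0" for n
    unfolding q_def using int[of "1 / Suc n"] G by simp
  moreover have "(\<lambda>n. \<integral>x. q n x \<partial>M) \<longlonglongrightarrow> (\<integral>x. D x \<partial>M)"
  proof (rule integral_dominated_convergence[where w="\<lambda>_. B"])
    show "q n \<in> borel_measurable M" for n
      unfolding q_def using int(1) Gm by measurable
    show "AE x in M. (\<lambda>n. q n x) \<longlonglongrightarrow> D x"
    proof (rule AE_I2)
      fix x assume x: "x \<in> space M"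
      have "((\<lambda>t. (G (\<phi> t x) - G (\<phi> 0 x)) / (t - 0)) \<longlongrightarrow> D (\<phi> 0 x)) (at 0)"
        using der[OF x, of 0] by (simp add: has_field_derivative_iff)
      moreover have "filterlim (\<lambda>n. 1 / real (Suc n)) (at 0) sequentially"
        unfolding filterlim_at using LIMSEQ_inverse_real_of_nat
        by (auto simp: inverse_eq_divide)
      ultimately have "((\<lambda>n. (G (\<phi> (1 / Suc n) x) - G (\<phi> 0 x)) / (1 / Suc n - 0)) \<longlonglongrightarrow> D (\<phi> 0 x))"
        by (rule filterlim_compose)
      then show "(\<lambda>n. q n x) \<longlonglongrightarrow> D x"
        by (simp add: q_def id[OF x] mult.commute)
    qed
    show "AE x in M. norm (q n x) \<le> B" for n
    proof (rule AE_I2)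
      fix x assume x: "x \<in> space M"
      have sp: "\<phi> t x \<in> space M" for t using \<phi>[of t] x by (rule measurable_space)
      have "\<exists>z>0. z < 1 / Suc n \<and> G (\<phi> (1 / Suc n) x) - G (\<phi> 0 x) = (1 / Suc n - 0) * D (\<phi> z x)"
        using der[OF x] by (intro MVT2) auto
      then obtain z where "G (\<phi> (1 / Suc n) x) - G x = 1 / Suc n * D (\<phi> z x)"
        using id[OF x] by auto
      then have "q n x = D (\<phi> z x)" by (simp add: q_def)
      then show "norm (q n x) \<le> B" using D(2)[OF sp] by simp
    qed
  qed (use D in auto)
  ultimately show ?thesis by (simp add: LIMSEQ_const_iff)
qed

section \<open>First-order calculus on the sphere\<close>

text \<open>Derivatives are required only at points of the sphere, and continuity only for each
  fixed ambient direction v, so membership is proved by exhibiting one formula for the derivative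
  (\<open>C1_sphereI\<close>).\<close>

definition C1_sphere :: "('a::euclidean_space \<Rightarrow> real) \<Rightarrow> bool" where
  "C1_sphere F \<longleftrightarrow> (\<forall>x\<in>sphere 0 1. (\<lambda>y. F (sgn y)) differentiable (at x)) \<and>
     (\<forall>v. continuous_on (sphere 0 1) (\<lambda>x. sderiv F x v))"

lemma sproj_inner_self: "norm x = 1 \<Longrightarrow> sproj x v \<bullet> x = 0"
  by (simp add: sproj_def inner_diff_left dot_square_norm)

lemma sproj_self: "norm x = 1 \<Longrightarrow> sproj x x = 0"
  by (simp add: sproj_def dot_square_norm)

lemma sproj_id: "w \<bullet> x = 0 \<Longrightarrow> sproj x w = w"
  by (simp add: sproj_def)

lemma inner_sproj_commute: "sproj x v \<bullet> w = v \<bullet> sproj x w"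
  by (simp add: sproj_def inner_diff_left inner_diff_right inner_commute)

lemma sproj_sproj: "norm x = 1 \<Longrightarrow> sproj x (sproj x v) = sproj x v"
  by (simp add: sproj_id sproj_inner_self)

lemma linear_sproj: "linear (sproj x)"
  by (rule linearI) (simp_all add: sproj_def algebra_simps)

lemma sgn_id: "norm x = 1 \<Longrightarrow> sgn (x::'a::real_normed_vector) = x"
  by (simp add: sgn_div_norm)

lemma sgn_sgn_normed: "sgn (sgn (y::'a::real_normed_vector)) = sgn y"
  by (cases "y = 0") (simp_all add: sgn_id norm_sgn)

lemma has_derivative_sgn_at:
  assumes "(x::'a::euclidean_space) \<noteq> 0"
  shows "(sgn has_derivative (\<lambda>v. (v - (v \<bullet> sgn x) *\<^sub>R sgn x) /\<^sub>R norm x)) (at x)"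
proof -
  have "((\<lambda>y. inverse (norm y) *\<^sub>R y) has_derivative
      (\<lambda>v. inverse (norm x) *\<^sub>R v + (- (inverse (norm x) * (v \<bullet> sgn x) * inverse (norm x))) *\<^sub>R x)) (at x)"
    using assms by (auto intro!: derivative_eq_intros has_derivative_norm simp: inner_commute)
  then show ?thesis
    by (rule has_derivative_eq_rhs[OF has_derivative_transform[of x UNIV, rotated 2]])
       (auto simp: sgn_div_norm fun_eq_iff algebra_simps)
qed

lemma has_derivative_sgn:
  "norm (x::'a::euclidean_space) = 1 \<Longrightarrow> (sgn has_derivative sproj x) (at x)"
  using has_derivative_sgn_at[of x] by (force simp: sgn_id sproj_def[abs_def])

lemma sderiv_eqI:
  "((\<lambda>y. F (sgn y)) has_derivative D) (at x) \<Longrightarrow> sderiv F x v = D v"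
  by (metis frechet_derivative_at sderiv_def)

lemma sphere_has_derivative_iff:
  "(\<lambda>y. F (sgn y)) differentiable (at x) \<longleftrightarrow> ((\<lambda>y. F (sgn y)) has_derivative sderiv F x) (at x)"
  by (metis differentiable_def frechet_derivative_works sderiv_def[abs_def] ext sderiv_eqI)

lemma C1_sphere_has_derivative:
  "C1_sphere F \<Longrightarrow> norm x = 1 \<Longrightarrow> ((\<lambda>y. F (sgn y)) has_derivative sderiv F x) (at x)"
  by (simp add: C1_sphere_def sphere_has_derivative_iff)

lemma C1_sphere_continuous_sderiv:
  "C1_sphere F \<Longrightarrow> continuous_on (sphere 0 1) (\<lambda>x. sderiv F x v)"
  by (simp add: C1_sphere_def)

lemma C1_sphere_continuous:
  assumes "C1_sphere F" shows "continuous_on (sphere 0 1) F"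
proof (rule continuous_on_eq)
  show "continuous_on (sphere 0 1) (\<lambda>y. F (sgn y))"
    using assms by (auto intro!: continuous_at_imp_continuous_on dest!: C1_sphere_has_derivative
        has_derivative_continuous)
qed (simp add: sgn_id)

lemma linear_sderiv: "C1_sphere F \<Longrightarrow> norm x = 1 \<Longrightarrow> linear (sderiv F x)"
  by (meson C1_sphere_has_derivative has_derivative_linear)

lemma C1_sphereI:
  assumes "\<And>x. norm x = 1 \<Longrightarrow> ((\<lambda>y. F (sgn y)) has_derivative D x) (at x)"
    and "\<And>v. continuous_on (sphere 0 1) (\<lambda>x. D x v)"
  shows "C1_sphere F" "norm x = 1 \<Longrightarrow> sderiv F x v = D x v"
proof -
  have *: "sderiv F x v = D x v" if "norm x = 1" for x v
    using sderiv_eqI assms(1) that by blast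
  then show "norm x = 1 \<Longrightarrow> sderiv F x v = D x v" .
  have "continuous_on (sphere 0 1) (\<lambda>x. sderiv F x v)" for v
    using assms(2)[of v] by (rule continuous_on_eq) (simp add: *)
  then show "C1_sphere F"
    using assms(1) unfolding C1_sphere_def differentiable_def by fastforce
qed

text \<open>\<open>sgn\<close> sends a neighbourhood of x into the sphere, so only the values there
  enter the derivative.\<close>

lemma has_derivative_sphere_cong:
  assumes "\<And>x. norm x = 1 \<Longrightarrow> F x = G x" "norm x = 1"
  shows "((\<lambda>y. F (sgn y)) has_derivative D) (at x) \<longleftrightarrow> ((\<lambda>y. G (sgn y)) has_derivative D) (at x)"
proof -
  have "x \<in> - {0}" "open (- {0::'a})" using assms by auto
  moreover have "F (sgn y) = G (sgn y)" if "y \<in> - {0}" for y using that assms by (simp add: norm_sgn)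
  ultimately show ?thesis
    by (metis (no_types, lifting) has_derivative_transform_within_open)
qed

lemma sderiv_cong:
  assumes "\<And>x. norm x = 1 \<Longrightarrow> F x = G x" "norm x = 1"
  shows "sderiv F x v = sderiv G x v"
  unfolding sderiv_def frechet_derivative_def by (subst has_derivative_sphere_cong[OF assms]) auto

lemma C1_sphere_cong:
  assumes "\<And>x. norm x = 1 \<Longrightarrow> F x = G x" "C1_sphere F"
  shows "C1_sphere G"
proof (rule C1_sphereI(1))
  show "((\<lambda>y. G (sgn y)) has_derivative sderiv F x) (at x)" if "norm x = 1" for x
    using has_derivative_sphere_cong[of F G x "sderiv F x"] assms that
    by (simp add: C1_sphere_has_derivative)
qed (rule C1_sphere_continuous_sderiv[OF assms(2)])

text \<open>Since \<open>sgn\<close> is idempotent, composing F with it once or twice gives the same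
  function; the chain rule then precomposes the derivative with \<open>sproj x\<close>, the
  derivative of \<open>sgn\<close>.\<close>

lemma sderiv_sproj:
  assumes "(\<lambda>y. F (sgn y)) differentiable (at x)" "norm x = 1"
  shows "sderiv F x (sproj x v) = sderiv F x v"
proof -
  have "((\<lambda>y. F (sgn y)) has_derivative sderiv F x) (at (sgn x))"
    using assms by (simp add: sphere_has_derivative_iff sgn_id)
  then have "((\<lambda>y. F (sgn (sgn y))) has_derivative (\<lambda>v. sderiv F x (sproj x v))) (at x)"
    using has_derivative_compose has_derivative_sgn assms(2) by blast
  then have "((\<lambda>y. F (sgn y)) has_derivative (\<lambda>v. sderiv F x (sproj x v))) (at x)"
    by (simp only: sgn_sgn_normed)
  from sderiv_eqI[OF this] show ?thesis by simp
qed

lemma sderiv_self: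
  assumes "(\<lambda>y. F (sgn y)) differentiable (at x)" "norm x = 1"
  shows "sderiv F x x = 0"
  using sderiv_sproj[OF assms, of x] assms
  by (simp add: sproj_self sphere_has_derivative_iff has_derivative_linear linear_0)

lemma has_derivative_sphere_ambient:
  assumes "(F has_derivative D) (at x)" "norm x = 1"
  shows "((\<lambda>y. F (sgn y)) has_derivative (\<lambda>v. D (sproj x v))) (at x)"
  using has_derivative_compose[OF has_derivative_sgn[OF assms(2)], of F D] assms by (simp add: sgn_id)

lemma C1_sphere_const: "C1_sphere (\<lambda>_. c)" "norm x = 1 \<Longrightarrow> sderiv (\<lambda>_. c) x v = 0"
  for c :: real
  by (rule C1_sphereI[where D="\<lambda>_ _. 0"]; simp)+

lemma C1_sphere_add:
  assumes "C1_sphere F" "C1_sphere G"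
  shows "C1_sphere (\<lambda>x. F x + G x)"
    "norm x = 1 \<Longrightarrow> sderiv (\<lambda>x. F x + G x) x v = sderiv F x v + sderiv G x v"
  by (rule C1_sphereI[where D="\<lambda>x v. sderiv F x v + sderiv G x v"];
      auto intro!: continuous_intros has_derivative_add C1_sphere_has_derivative
        C1_sphere_continuous_sderiv assms)+

lemma C1_sphere_mult:
  assumes "C1_sphere F" "C1_sphere G"
  shows "C1_sphere (\<lambda>x. F x * G x)"
    "norm x = 1 \<Longrightarrow> sderiv (\<lambda>x. F x * G x) x v = F x * sderiv G x v + sderiv F x v * G x"
proof -
  note * = C1_sphereI[where D="\<lambda>x v. F x * sderiv G x v + sderiv F x v * G x"]
  have 1: "((\<lambda>y. F (sgn y) * G (sgn y)) has_derivative (\<lambda>v. F x * sderiv G x v + sderiv F x v * G x)) (at x)"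
    if "norm x = 1" for x
    using has_derivative_mult[OF C1_sphere_has_derivative[OF assms(1) that] C1_sphere_has_derivative[OF assms(2) that]]
      that by (simp add: sgn_id)
  have 2: "continuous_on (sphere 0 1) (\<lambda>x. F x * sderiv G x v + sderiv F x v * G x)" for v
    by (intro continuous_intros C1_sphere_continuous C1_sphere_continuous_sderiv assms)
  show "C1_sphere (\<lambda>x. F x * G x)"
    "norm x = 1 \<Longrightarrow> sderiv (\<lambda>x. F x * G x) x v = F x * sderiv G x v + sderiv F x v * G x"
    using *[OF 1 2] by blast+
qed

lemma C1_sphere_inner:
  "C1_sphere (\<lambda>x. x \<bullet> w)" "norm x = 1 \<Longrightarrow> sderiv (\<lambda>x. x \<bullet> w) x v = sproj x v \<bullet> w"
proof -
  note * = C1_sphereI[where D="\<lambda>x v. sproj x v \<bullet> w"]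
  have 1: "((\<lambda>y. sgn y \<bullet> w) has_derivative (\<lambda>v. sproj x v \<bullet> w)) (at x)" if "norm x = 1" for x
    using that by (intro has_derivative_sphere_ambient[where F="\<lambda>y. y \<bullet> w"]) (auto intro!: derivative_eq_intros)
  have 2: "continuous_on (sphere 0 1) (\<lambda>x. sproj x v \<bullet> w)" for v
    unfolding sproj_def by (intro continuous_intros)
  show "C1_sphere (\<lambda>x. x \<bullet> w)" "norm x = 1 \<Longrightarrow> sderiv (\<lambda>x. x \<bullet> w) x v = sproj x v \<bullet> w"
    using *[OF 1 2] by blast+
qed

lemma C1_sphere_compose:
  assumes F: "C1_sphere F" and \<phi>: "\<And>x. norm x = 1 \<Longrightarrow> (\<phi> has_real_derivative \<phi>' (F x)) (at (F x))"
    and cont: "continuous_on (F ` sphere 0 1) \<phi>'"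
  shows "C1_sphere (\<lambda>x. \<phi> (F x))"
    "norm x = 1 \<Longrightarrow> sderiv (\<lambda>x. \<phi> (F x)) x v = \<phi>' (F x) * sderiv F x v"
proof -
  note * = C1_sphereI[where D="\<lambda>x v. \<phi>' (F x) * sderiv F x v"]
  have 1: "((\<lambda>y. \<phi> (F (sgn y))) has_derivative (\<lambda>v. \<phi>' (F x) * sderiv F x v)) (at x)" if "norm x = 1" for x
    using has_derivative_compose[OF C1_sphere_has_derivative[OF F that], of \<phi> "(*) (\<phi>' (F x))"] \<phi>[OF that] that
    by (simp add: sgn_id has_field_derivative_def)
  have 2: "continuous_on (sphere 0 1) (\<lambda>x. \<phi>' (F x) * sderiv F x v)" for v
    by (intro continuous_intros continuous_on_compose2[OF cont C1_sphere_continuous[OF F]]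
        C1_sphere_continuous_sderiv F) auto
  show "C1_sphere (\<lambda>x. \<phi> (F x))"
    "norm x = 1 \<Longrightarrow> sderiv (\<lambda>x. \<phi> (F x)) x v = \<phi>' (F x) * sderiv F x v"
    using *[OF 1 2] by blast+
qed

lemma C1_sphere_cmult:
  assumes "C1_sphere F"
  shows "C1_sphere (\<lambda>x. c * F x)" "norm x = 1 \<Longrightarrow> sderiv (\<lambda>x. c * F x) x v = c * sderiv F x v"
  using C1_sphere_mult[OF C1_sphere_const(1) assms] by (simp_all add: C1_sphere_const)

lemma C1_sphere_sum:
  assumes "finite I" "\<And>i. i \<in> I \<Longrightarrow> C1_sphere (F i)"
  shows "C1_sphere (\<lambda>x. \<Sum>i\<in>I. F i x) \<and>
    (norm x = 1 \<longrightarrow> sderiv (\<lambda>x. \<Sum>i\<in>I. F i x) x v = (\<Sum>i\<in>I. sderiv (F i) x v))"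
  using assms by (induction I) (auto simp: C1_sphere_const C1_sphere_add)

section \<open>The divergence theorem on the sphere\<close>

text \<open>Rotation by the angle t in the plane of the axes i and j, written as a perturbation of
  the identity so that the remaining coordinates need no case distinction.\<close>

definition rot :: "'n \<Rightarrow> 'n \<Rightarrow> real \<Rightarrow> real^'n \<Rightarrow> real^'n" where
  "rot i j t x = x + ((cos t - 1) * x $ i - sin t * x $ j) *\<^sub>R axis i 1
                   + (sin t * x $ i + (cos t - 1) * x $ j) *\<^sub>R axis j 1"

text \<open>Velocity field of \<open>rot i j\<close>, a Killing field of the sphere.\<close>

definition rotgen :: "'n \<Rightarrow> 'n \<Rightarrow> real^'n \<Rightarrow> real^'n" where
  "rotgen i j x = x $ i *\<^sub>R axis j 1 - x $ j *\<^sub>R axis i 1"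

lemma rotgen_inner_self: "rotgen i j x \<bullet> x = 0"
  by (simp add: rotgen_def inner_diff_left inner_axis' )

lemma orthogonal_transformation_rot:
  assumes "i \<noteq> j"
  shows "orthogonal_transformation (rot i j t)"
  unfolding orthogonal_transformation_def
proof (intro conjI allI)
  show "linear (rot i j t)"
    by (rule linearI) (simp_all add: rot_def algebra_simps)
  fix v w :: "real^'a"
  have e: "axis i (1::real) \<bullet> axis j 1 = 0" "axis j (1::real) \<bullet> axis i 1 = 0"
    "axis i (1::real) \<bullet> axis i 1 = 1" "axis j (1::real) \<bullet> axis j 1 = 1"
    using assms by (auto simp: inner_axis_axis)
  have a: "axis i (1::real) $ j = 0" "axis j (1::real) $ i = 0" "axis i (1::real) $ i = 1" "axis j (1::real) $ j = 1"
    using assms by (auto simp: axis_def)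
  have s: "sin t * sin t = 1 - cos t * cos t"
    using sin_cos_squared_add[of t] by (simp add: power2_eq_square algebra_simps)
  have "rot i j t v \<bullet> rot i j t w = v \<bullet> w + (cos t * cos t + sin t * sin t - 1) * (v $ i * w $ i + v $ j * w $ j)"
    by (simp add: rot_def inner_add_left inner_add_right e a inner_axis inner_axis' del: sin_cos_squared_add3)
      (simp add: algebra_simps del: sin_cos_squared_add3)
  then show "rot i j t v \<bullet> rot i j t w = v \<bullet> w" by (simp add: s)
qed

lemma rot_has_vector_derivative:
  assumes "i \<noteq> j"
  shows "((\<lambda>t. rot i j t x) has_vector_derivative rotgen i j (rot i j t x)) (at t)"
proof -
  have "((\<lambda>t. rot i j t x) has_vector_derivative
      (- sin t * x $ i - cos t * x $ j) *\<^sub>R axis i 1 + (cos t * x $ i - sin t * x $ j) *\<^sub>R axis j 1) (at t)"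
    unfolding rot_def by (auto intro!: derivative_eq_intros simp: has_real_derivative_iff_has_vector_derivative[symmetric])
  also have "(- sin t * x $ i - cos t * x $ j) *\<^sub>R axis i 1 + (cos t * x $ i - sin t * x $ j) *\<^sub>R axis j 1
      = rotgen i j (rot i j t x)"
    using assms by (simp add: rotgen_def rot_def axis_def vec_eq_iff algebra_simps)
  finally show ?thesis .
qed

text \<open>\<open>rot i j\<close> moves points by isometries with velocity
  \<open>rotgen i j\<close>, so \<open>integral_flow_derivative_eq_0\<close> applies; for i = j the
  field is 0.\<close>

lemma integral_sderiv_rotgen:
  fixes F :: "real^'n::{finite,wellorder} \<Rightarrow> real"
  assumes F: "C1_sphere F"
  shows "(\<integral>x. sderiv F x (rotgen i j x) \<partial>\<sigma>) = 0"
proof (cases "i = j")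
  case True
  have "(\<integral>x. sderiv F x (rotgen i j x) \<partial>\<sigma>) = (\<integral>x. 0 \<partial>(\<sigma> :: (real^'n::_) measure))"
    using True F by (intro Bochner_Integration.integral_cong) (auto simp: rotgen_def linear_0[OF linear_sderiv])
  then show ?thesis by simp
next
  case False
  have eq: "sderiv F x (rotgen i j x) = x $ i * sderiv F x (axis j 1) - x $ j * sderiv F x (axis i 1)"
    if "x \<in> sphere 0 1" for x
    using linear_sderiv[OF F, of x] that by (simp add: rotgen_def linear_diff linear_scale)
  have cont: "continuous_on (sphere 0 1) (\<lambda>x. sderiv F x (rotgen i j x))"
    by (rule continuous_on_eq[OF _ eq[symmetric]])
      (intro continuous_intros C1_sphere_continuous_sderiv F)
  then have "compact ((\<lambda>x. sderiv F x (rotgen i j x)) ` sphere 0 1)"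
    by (intro compact_continuous_image) auto
  then obtain B where B: "\<And>x. x \<in> sphere 0 1 \<Longrightarrow> \<bar>sderiv F x (rotgen i j x)\<bar> \<le> B"
    by (metis (no_types, lifting) bounded_iff compact_imp_bounded imageI real_norm_def)
  note orth = orthogonal_transformation_rot[OF False]
  show ?thesis
  proof (rule integral_flow_derivative_eq_0[where \<phi>="rot i j" and G=F and B=B])
    show "finite_measure (\<sigma> :: (real^'n::_) measure)" by unfold_locales
    show "rot i j t \<in> measurable \<sigma> \<sigma>" for t :: real
      by (rule measurable_orthogonal_sphere[OF orth])
    show "distr \<sigma> \<sigma> (rot i j t) = \<sigma>" for t :: real
      by (rule distr_sphere_measure_orthogonal[OF orth])
    show "integrable \<sigma> F"
      by (intro continuous_on_sphere_integrable C1_sphere_continuous F)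
    show "(\<lambda>x. sderiv F x (rotgen i j x)) \<in> borel_measurable \<sigma>"
      by (intro continuous_on_sphere_measurable cont)
    fix x :: "real^'n::_" and t assume "x \<in> space \<sigma>"
    then have n: "norm (rot i j s x) = 1" for s
      using orthogonal_transformation_norm[OF orth, of s x] by simp
    have "((\<lambda>t. F (sgn (rot i j t x))) has_derivative
        (\<lambda>h. sderiv F (rot i j t x) (h *\<^sub>R rotgen i j (rot i j t x)))) (at t)"
      using rot_has_vector_derivative[OF False]
      by (intro has_derivative_compose[where g="\<lambda>y. F (sgn y)" and f="\<lambda>t. rot i j t x", OF _ C1_sphere_has_derivative[OF F n]])
        (simp add: has_vector_derivative_def)
    then show "((\<lambda>t. F (rot i j t x)) has_real_derivative sderiv F (rot i j t x) (rotgen i j (rot i j t x))) (at t)"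
      by (simp add: has_field_derivative_def sgn_id[OF n] linear_scale[OF linear_sderiv[OF F n]] mult.commute[of _ "sderiv F (rot i j t x) _"])
  qed (auto simp: rot_def B)
qed

text \<open>The tangential part of the axis j is the sum over i of \<open>x $ i\<close> times
  \<open>rotgen i j x\<close>. Pulling the factors \<open>x $ i\<close> under the derivative
  produces derivatives along rotation fields, which integrate to 0. What is left over is the
  dimension of the sphere times \<open>x $ j\<close> times F.\<close>

lemma integral_sderiv_Basis:
  fixes F :: "real^'n::{finite,wellorder} \<Rightarrow> real"
  assumes F: "C1_sphere F" and b: "b \<in> Basis"
  shows "(\<integral>x. sderiv F x b \<partial>\<sigma>) = (real CARD('n::_) - 1) * (\<integral>x. (x \<bullet> b) * F x \<partial>\<sigma>)"
proof -
  obtain j where bj: "b = axis j 1" using b by (auto simp: Basis_vec_def)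
  define H where "H i x = x $ i * F x" for i and x :: "real^'n::_"
  have H: "C1_sphere (H i)"
    "norm x = 1 \<Longrightarrow> sderiv (H i) x v = x $ i * sderiv F x v + sproj x v $ i * F x" for i x v
    using C1_sphere_mult[OF C1_sphere_inner(1)[of "axis i 1"] F] C1_sphere_inner(2)[of x "axis i 1"]
    by (simp_all add: H_def[abs_def] cart_eq_inner_axis)
  have eq: "sderiv F x b = (\<Sum>i\<in>UNIV. sderiv (H i) x (rotgen i j x)) + (real CARD('n::_) - 1) * ((x \<bullet> b) * F x)"
    if x: "norm x = 1" for x
  proof -
    have "(\<Sum>i\<in>UNIV. x $ i *\<^sub>R rotgen i j x) = (x \<bullet> x) *\<^sub>R axis j 1 - x $ j *\<^sub>R (\<Sum>i\<in>UNIV. x $ i *\<^sub>R axis i 1)"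
      by (simp add: rotgen_def scaleR_diff_right sum_subtractf inner_vec_def scaleR_sum_left scaleR_sum_right
          mult.commute)
    also have "(\<Sum>i\<in>UNIV. x $ i *\<^sub>R axis i 1) = x"
      by (simp add: vec_eq_iff axis_def if_distrib cong: if_cong)
    also have "(x \<bullet> x) *\<^sub>R axis j 1 - x $ j *\<^sub>R x = sproj x b"
      using x by (simp add: sproj_def bj inner_axis' dot_square_norm)
    finally have "sderiv F x b = sderiv F x (\<Sum>i\<in>UNIV. x $ i *\<^sub>R rotgen i j x)"
      using F x by (simp add: sderiv_sproj C1_sphere_def)
    also have "\<dots> = (\<Sum>i\<in>UNIV. x $ i * sderiv F x (rotgen i j x))"
      using linear_sderiv[OF F x] by (simp add: linear_sum linear_scale)
    \<comment> \<open>A tangent vector v differentiates the coordinate \<open>x $ i\<close> to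
      \<open>v $ i\<close>, which is the correction in the product rule for
      \<open>H i\<close>.\<close>
    also have "\<dots> = (\<Sum>i\<in>UNIV. sderiv (H i) x (rotgen i j x) - rotgen i j x $ i * F x)"
      using x by (simp add: H sproj_id rotgen_inner_self)
    also have "\<dots> = (\<Sum>i\<in>UNIV. sderiv (H i) x (rotgen i j x)) - (\<Sum>i\<in>UNIV. rotgen i j x $ i) * F x"
      by (simp add: sum_subtractf sum_distrib_right)
    also have "(\<Sum>i\<in>UNIV. rotgen i j x $ i) = (1 - real CARD('n::_)) * (x \<bullet> b)"
    proof -
      have "(\<Sum>i\<in>UNIV. rotgen i j x $ i) = (\<Sum>i\<in>UNIV. (if i = j then x $ i else 0) - x $ j)"
        by (intro sum.cong) (auto simp: rotgen_def axis_def)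
      then show ?thesis by (simp add: sum_subtractf bj inner_axis algebra_simps)
    qed
    finally show ?thesis by (simp add: algebra_simps)
  qed
  have i1: "integrable \<sigma> (\<lambda>x. sderiv (H i) x (rotgen i j x))" for i
  proof (intro continuous_on_sphere_integrable)
    have "continuous_on (sphere 0 1) (\<lambda>x. x $ i * sderiv (H i) x (axis j 1) - x $ j * sderiv (H i) x (axis i 1))"
      by (intro continuous_intros C1_sphere_continuous_sderiv H)
    then show "continuous_on (sphere 0 1) (\<lambda>x. sderiv (H i) x (rotgen i j x))"
      by (rule continuous_on_eq)
         (use linear_sderiv[OF H(1), of _ i] in \<open>simp add: rotgen_def linear_diff linear_scale\<close>)
  qed
  have i2: "integrable \<sigma> (\<lambda>x. (x \<bullet> b) * F x)"
    by (intro continuous_on_sphere_integrable continuous_intros C1_sphere_continuous F)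
  have "(\<integral>x. sderiv F x b \<partial>\<sigma>) =
      (\<integral>x. (\<Sum>i\<in>UNIV. sderiv (H i) x (rotgen i j x)) + (real CARD('n::_) - 1) * ((x \<bullet> b) * F x) \<partial>\<sigma>)"
    by (intro Bochner_Integration.integral_cong) (auto simp: eq)
  also have "\<dots> = (real CARD('n::_) - 1) * (\<integral>x. (x \<bullet> b) * F x \<partial>\<sigma>)"
    using i1 i2 by (simp add: integral_sderiv_rotgen H)
  finally show ?thesis .
qed

text \<open>Summing \<open>integral_sderiv_Basis\<close> over the components leaves only the
  integral of the normal component of Z, which is 0. The ambient trace serves as divergence because
  derivatives in the normal direction vanish.\<close>

lemma integral_sphere_divergence_eq_0:
  fixes Z :: "real^'n::{finite,wellorder} \<Rightarrow> real^'n::_ \<Rightarrow> real"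
  assumes Z: "\<And>b. b \<in> Basis \<Longrightarrow> C1_sphere (Z b)"
    and tangent: "\<And>x. norm x = 1 \<Longrightarrow> (\<Sum>b\<in>Basis. Z b x * (x \<bullet> b)) = 0"
  shows "(\<integral>x. (\<Sum>b\<in>Basis. sderiv (Z b) x b) \<partial>\<sigma>) = 0"
proof -
  have i: "integrable \<sigma> (\<lambda>x. sderiv (Z b) x b)" "integrable \<sigma> (\<lambda>x. (x \<bullet> b) * Z b x)"
    if "b \<in> Basis" for b
    by (intro continuous_on_sphere_integrable C1_sphere_continuous_sderiv Z that continuous_intros
        C1_sphere_continuous)+
  have "(\<integral>x. (\<Sum>b\<in>Basis. sderiv (Z b) x b) \<partial>\<sigma>)
     = (real CARD('n::_) - 1) * (\<integral>x. (\<Sum>b\<in>Basis. (x \<bullet> b) * Z b x) \<partial>\<sigma>)"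
    using i by (simp add: integral_sderiv_Basis Z sum_distrib_left)
  also have "(\<integral>x. (\<Sum>b\<in>Basis. (x \<bullet> b) * Z b x) \<partial>\<sigma>) = (\<integral>x. 0 \<partial>(\<sigma> :: (real^'n::_) measure))"
    using tangent by (intro Bochner_Integration.integral_cong) (auto simp: mult.commute)
  finally show ?thesis by simp
qed

lemma integral_sphere_by_parts:
  fixes Z :: "real^'n::{finite,wellorder} \<Rightarrow> real^'n::_ \<Rightarrow> real"
  assumes F: "C1_sphere F" and Z: "\<And>b. b \<in> Basis \<Longrightarrow> C1_sphere (Z b)"
    and tangent: "\<And>x. norm x = 1 \<Longrightarrow> (\<Sum>b\<in>Basis. Z b x * (x \<bullet> b)) = 0"
  shows "(\<integral>x. F x * (\<Sum>b\<in>Basis. sderiv (Z b) x b) \<partial>\<sigma>) =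
    - (\<integral>x. (\<Sum>b\<in>Basis. sderiv F x b * Z b x) \<partial>\<sigma>)"
proof -
  have "(\<integral>x. (\<Sum>b\<in>Basis. sderiv (\<lambda>x. F x * Z b x) x b) \<partial>\<sigma>) = 0"
  proof (rule integral_sphere_divergence_eq_0)
    show "(\<Sum>b\<in>Basis. F x * Z b x * (x \<bullet> b)) = 0" if "norm x = 1" for x
      using tangent[OF that] by (simp add: mult.assoc sum_distrib_left[symmetric])
  qed (intro C1_sphere_mult F Z)
  also have "(\<integral>x. (\<Sum>b\<in>Basis. sderiv (\<lambda>x. F x * Z b x) x b) \<partial>\<sigma>) =
    (\<integral>x. F x * (\<Sum>b\<in>Basis. sderiv (Z b) x b) + (\<Sum>b\<in>Basis. sderiv F x b * Z b x) \<partial>\<sigma>)"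
    by (intro Bochner_Integration.integral_cong)
      (auto simp: C1_sphere_mult F Z sum.distrib sum_distrib_left)
  also have "\<dots> = (\<integral>x. F x * (\<Sum>b\<in>Basis. sderiv (Z b) x b) \<partial>\<sigma>) +
      (\<integral>x. (\<Sum>b\<in>Basis. sderiv F x b * Z b x) \<partial>\<sigma>)"
    by (intro Bochner_Integration.integral_add continuous_on_sphere_integrable continuous_intros
        C1_sphere_continuous C1_sphere_continuous_sderiv F Z)
  finally show ?thesis by simp
qed

section \<open>The Laplacian\<close>

definition C2_sphere :: "('a::euclidean_space \<Rightarrow> real) \<Rightarrow> bool" where
  "C2_sphere F \<longleftrightarrow> C1_sphere F \<and> (\<forall>b. C1_sphere (\<lambda>x. sderiv F x b))"

lemma sgrad_has_derivative:
  assumes "C2_sphere F" "norm x = 1"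
  shows "((\<lambda>y. sgrad F (sgn y)) has_derivative (\<lambda>v. \<Sum>b\<in>Basis. sderiv (\<lambda>x. sderiv F x b) x v *\<^sub>R b)) (at x)"
  unfolding sgrad_def using assms
  by (auto intro!: derivative_eq_intros C1_sphere_has_derivative simp: C2_sphere_def)

lemma sgrad_inner: "C1_sphere F \<Longrightarrow> norm x = 1 \<Longrightarrow> sgrad F x \<bullet> v = sderiv F x v"
proof -
  assume "C1_sphere F" "norm x = 1"
  then have "linear (sderiv F x)" by (rule linear_sderiv)
  then have "sderiv F x (\<Sum>b\<in>Basis. (v \<bullet> b) *\<^sub>R b) = (\<Sum>b\<in>Basis. (v \<bullet> b) * sderiv F x b)"
    by (simp add: linear_sum linear_scale)
  then show ?thesis by (simp add: euclidean_representation sgrad_def inner_sum_left)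
    (simp add: inner_commute mult.commute)
qed

lemma sum_sderiv_normal: "C1_sphere F \<Longrightarrow> norm x = 1 \<Longrightarrow> (\<Sum>b\<in>Basis. sderiv F x b * (x \<bullet> b)) = 0"
  using sgrad_inner[of F x x] sderiv_self[of F x] inner_commute[of x]
  by (simp add: C1_sphere_def sgrad_def inner_sum_left)

text \<open>The projection in \<open>sdiv\<close> subtracts \<open>W x \<bullet> x\<close> from the
  ambient trace, and the derivative W of the gradient vanishes in the normal direction x.\<close>

lemma slaplacian_eq:
  assumes "C2_sphere F" "norm x = 1"
  shows "slaplacian F x = (\<Sum>b\<in>Basis. sderiv (\<lambda>x. sderiv F x b) x b)"
proof -
  define W where "W v = (\<Sum>b\<in>Basis. sderiv (\<lambda>x. sderiv F x b) x v *\<^sub>R b)" for v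
  have W: "((\<lambda>y. sgrad F (sgn y)) has_derivative W) (at x)"
    using sgrad_has_derivative[OF assms] by (simp add: W_def[abs_def])
  then have lin: "linear W" by (rule has_derivative_linear)
  have Wx: "W x = 0"
    unfolding W_def using assms by (auto intro!: sum.neutral sderiv_self simp: C2_sphere_def C1_sphere_def)
  have "slaplacian F x = (\<Sum>b\<in>Basis. W b \<bullet> b - (W b \<bullet> x) * (x \<bullet> b))"
    unfolding slaplacian_def sdiv_def sderiv_eqI[OF W] by (simp add: sproj_def inner_diff_left)
  also have "\<dots> = (\<Sum>b\<in>Basis. W b \<bullet> b) - W (\<Sum>b\<in>Basis. (x \<bullet> b) *\<^sub>R b) \<bullet> x"
    by (simp only: linear_sum[OF lin] linear_scale[OF lin]) (simp add: sum_subtractf inner_sum_left mult.commute)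
  also have "\<dots> = (\<Sum>b\<in>Basis. W b \<bullet> b)" by (simp add: euclidean_representation Wx)
  also have "\<dots> = (\<Sum>b\<in>Basis. sderiv (\<lambda>x. sderiv F x b) x b)"
    by (intro sum.cong refl) (simp add: W_def inner_sum_left inner_Basis if_distrib cong: if_cong)
  finally show ?thesis .
qed

lemma slaplacian_continuous: "C2_sphere F \<Longrightarrow> continuous_on (sphere 0 1) (slaplacian F)"
proof -
  assume F: "C2_sphere F"
  have "continuous_on (sphere 0 1) (\<lambda>x. \<Sum>b\<in>Basis. sderiv (\<lambda>x. sderiv F x b) x b)"
    using F by (auto intro!: continuous_intros C1_sphere_continuous_sderiv simp: C2_sphere_def)
  then show ?thesis by (rule continuous_on_eq) (simp add: slaplacian_eq[OF F])
qed

text \<open>Green's first identity: the gradient of F is tangent by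
  \<open>sum_sderiv_normal\<close>, so integration by parts leaves no normal term.\<close>

lemma integral_slaplacian:
  fixes F :: "real^'n::{finite,wellorder} \<Rightarrow> real"
  assumes F: "C2_sphere F" and G: "C1_sphere G"
  shows "(\<integral>x. G x * slaplacian F x \<partial>\<sigma>) = - (\<integral>x. (\<Sum>b\<in>Basis. sderiv G x b * sderiv F x b) \<partial>\<sigma>)"
proof -
  have "(\<integral>x. G x * slaplacian F x \<partial>\<sigma>) =
      (\<integral>x. G x * (\<Sum>b\<in>Basis. sderiv (\<lambda>x. sderiv F x b) x b) \<partial>\<sigma>)"
    by (intro Bochner_Integration.integral_cong) (auto simp: slaplacian_eq[OF F])
  also have "\<dots> = - (\<integral>x. (\<Sum>b\<in>Basis. sderiv G x b * sderiv F x b) \<partial>\<sigma>)"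
    using F by (intro integral_sphere_by_parts G) (auto simp: C2_sphere_def sum_sderiv_normal)
  finally show ?thesis .
qed

lemma C2_sphere_sum:
  assumes "finite I" "\<And>i. i \<in> I \<Longrightarrow> C2_sphere (F i)"
  shows "C2_sphere (\<lambda>x. \<Sum>i\<in>I. c i * F i x)"
    "norm x = 1 \<Longrightarrow> slaplacian (\<lambda>x. \<Sum>i\<in>I. c i * F i x) x = (\<Sum>i\<in>I. c i * slaplacian (F i) x)"
proof -
  let ?S = "\<lambda>x. \<Sum>i\<in>I. c i * F i x"
  have C1: "C1_sphere ?S" "norm x = 1 \<Longrightarrow> sderiv ?S x v = (\<Sum>i\<in>I. c i * sderiv (F i) x v)" for x v
    using C1_sphere_sum[OF assms(1), of "\<lambda>i x. c i * F i x" x v] assms(2)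
    by (auto simp: C2_sphere_def C1_sphere_cmult)
  have C2': "C1_sphere (\<lambda>x. \<Sum>i\<in>I. c i * sderiv (F i) x b)"
    "norm x = 1 \<Longrightarrow> sderiv (\<lambda>x. \<Sum>i\<in>I. c i * sderiv (F i) x b) x v = (\<Sum>i\<in>I. c i * sderiv (\<lambda>x. sderiv (F i) x b) x v)"
    for b x v
    using C1_sphere_sum[OF assms(1), of "\<lambda>i x. c i * sderiv (F i) x b" x v] assms(2)
    by (auto simp: C2_sphere_def C1_sphere_cmult)
  have "C1_sphere (\<lambda>x. sderiv ?S x b)" for b
    by (rule C1_sphere_cong[OF _ C2'(1)]) (simp add: C1)
  then show C2: "C2_sphere ?S" using C1 by (simp add: C2_sphere_def)
  assume x: "norm x = 1"
  have "sderiv (\<lambda>x. sderiv ?S x b) x v = (\<Sum>i\<in>I. c i * sderiv (\<lambda>x. sderiv (F i) x b) x v)" for b v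
    using sderiv_cong[OF C1(2) x] C2'(2)[OF x] by simp
  then have "slaplacian ?S x = (\<Sum>b\<in>Basis. \<Sum>i\<in>I. c i * sderiv (\<lambda>x. sderiv (F i) x b) x b)"
    using slaplacian_eq[OF C2 x] by simp
  also have "\<dots> = (\<Sum>i\<in>I. \<Sum>b\<in>Basis. c i * sderiv (\<lambda>x. sderiv (F i) x b) x b)"
    by (rule sum.swap)
  finally show "slaplacian ?S x = (\<Sum>i\<in>I. c i * slaplacian (F i) x)"
    using assms(2) x by (simp add: slaplacian_eq sum_distrib_left)
qed

text \<open>Smoothness controls second derivatives of the ambient extension of F, whereas
  \<open>C2_sphere\<close> restricts the first derivative to the sphere and extends it anew along
  rays before differentiating again. \<open>has_derivative_sphere_ambient\<close> passes from one to
  the other by projecting the direction.\<close>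

lemma smooth_on_sphere_imp_C2:
  assumes "smooth_on_sphere F" shows "C2_sphere F"
proof -
  let ?f = "\<lambda>y. F (sgn y)"
  have "Ck_on (Suc 1) ?f (- {0})" using assms by (auto simp: smooth_on_sphere_def smooth_open_def)
  then have d: "x \<noteq> 0 \<Longrightarrow> ?f differentiable (at x)" and c1: "Ck_on 1 (\<lambda>x. frechet_derivative ?f (at x) v) (- {0})" for x v
    by auto
  have d2: "(\<lambda>x. frechet_derivative ?f (at x) v) differentiable (at x)" if "x \<noteq> 0" for x v
    using c1[of v] that by auto
  have c2: "continuous_on (- {0}) (\<lambda>x. frechet_derivative (\<lambda>x. frechet_derivative ?f (at x) v) (at x) w)" for v w
    using c1[of v] by simp
  have cd: "continuous_on (sphere 0 1) (\<lambda>x. sderiv F x v)" for v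
    unfolding sderiv_def
    by (intro continuous_at_imp_continuous_on ballI differentiable_imp_continuous_within d2) auto
  have C1: "C1_sphere F"
    unfolding C1_sphere_def
  proof (intro conjI ballI allI cd)
    show "?f differentiable (at x)" if "x \<in> sphere 0 1" for x
      using that by (intro d) auto
  qed
  have "C1_sphere (\<lambda>x. sderiv F x b)" for b
  proof (rule C1_sphereI(1))
    fix x :: 'a assume x: "norm x = 1"
    then have "x \<noteq> 0" by auto
    from d2[OF this, of b] have "((\<lambda>x. sderiv F x b) has_derivative frechet_derivative (\<lambda>x. sderiv F x b) (at x)) (at x)"
      unfolding sderiv_def by (simp add: frechet_derivative_works)
    from has_derivative_sphere_ambient[OF this x]
    \<comment> \<open>Continuity is known for each constant direction c, so the projected direction,
      which depends on x, is expanded in \<open>Basis\<close>.\<close>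
    show "((\<lambda>y. sderiv F (sgn y) b) has_derivative
        (\<lambda>v. \<Sum>c\<in>Basis. (sproj x v \<bullet> c) * frechet_derivative (\<lambda>x. sderiv F x b) (at x) c)) (at x)"
    proof (rule has_derivative_eq_rhs)
      have lin: "linear (frechet_derivative (\<lambda>x. sderiv F x b) (at x))"
        using \<open>((\<lambda>x. sderiv F x b) has_derivative _) (at x)\<close> has_derivative_linear by blast
      have eq: "frechet_derivative (\<lambda>x. sderiv F x b) (at x) (\<Sum>c\<in>Basis. (w \<bullet> c) *\<^sub>R c) =
          (\<Sum>c\<in>Basis. (w \<bullet> c) * frechet_derivative (\<lambda>x. sderiv F x b) (at x) c)" for w
        by (simp add: linear_sum[OF lin] linear_scale[OF lin])
      show "(\<lambda>v. frechet_derivative (\<lambda>x. sderiv F x b) (at x) (sproj x v)) =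
          (\<lambda>v. \<Sum>c\<in>Basis. (sproj x v \<bullet> c) * frechet_derivative (\<lambda>x. sderiv F x b) (at x) c)"
        using eq[of "sproj x _", unfolded euclidean_representation] by (rule ext)
    qed
  next
    fix v
    have "continuous_on (sphere 0 1) (\<lambda>x. frechet_derivative (\<lambda>x. sderiv F x b) (at x) c)" for c
      unfolding sderiv_def by (rule continuous_on_subset[OF c2]) auto
    then show "continuous_on (sphere 0 1) (\<lambda>x. \<Sum>c\<in>Basis. (sproj x v \<bullet> c) * frechet_derivative (\<lambda>x. sderiv F x b) (at x) c)"
      unfolding sproj_def by (intro continuous_intros)
  qed
  with C1 show ?thesis by (simp add: C2_sphere_def)
qed

section \<open>Convergence in the mean\<close>

text \<open>Fatou's lemma with integrability of the limit as part of the conclusion. This is how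
  uniform bounds on approximations reach their limits.\<close>

lemma fatou_integral:
  fixes f :: "nat \<Rightarrow> 'a \<Rightarrow> real"
  assumes f: "\<And>m. integrable M (f m)" "\<And>m x. x \<in> space M \<Longrightarrow> 0 \<le> f m x"
    and lim: "AE x in M. (\<lambda>m. f m x) \<longlonglongrightarrow> g x" and g: "g \<in> borel_measurable M"
    and R: "\<forall>\<^sub>F m in sequentially. (\<integral>x. f m x \<partial>M) \<le> R"
  shows "integrable M g \<and> (\<integral>x. g x \<partial>M) \<le> R"
proof -
  have g0: "AE x in M. 0 \<le> g x"
    using lim f(2) by (auto intro!: LIMSEQ_le_const elim!: AE_mp)
  have "(\<integral>\<^sup>+x. ennreal (g x) \<partial>M) = (\<integral>\<^sup>+x. liminf (\<lambda>m. ennreal (f m x)) \<partial>M)"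
    using lim by (intro nn_integral_cong_AE, elim AE_mp)
      (auto intro!: AE_I2 lim_imp_Liminf[symmetric] tendsto_ennrealI)
  also have "\<dots> \<le> liminf (\<lambda>m. \<integral>\<^sup>+x. ennreal (f m x) \<partial>M)"
    using f(1) by (intro nn_integral_liminf) (auto dest: borel_measurable_integrable)
  also have "\<dots> = liminf (\<lambda>m. ennreal (\<integral>x. f m x \<partial>M))"
    using f by (intro arg_cong[where f=liminf] ext nn_integral_eq_integral) (auto intro!: AE_I2)
  also have "\<dots> \<le> liminf (\<lambda>m. ennreal R)"
    using R by (intro Liminf_mono) (auto elim!: eventually_mono intro: ennreal_leI)
  also have "\<dots> = ennreal R" by (simp add: Liminf_const)
  finally have *: "(\<integral>\<^sup>+x. ennreal (g x) \<partial>M) \<le> ennreal R" .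
  then have int: "integrable M g"
    using g g0 by (intro integrableI_nonneg) (auto simp: le_less_trans)
  have "eventually (\<lambda>m. 0 \<le> R) sequentially"
    using R by eventually_elim (meson Bochner_Integration.integral_nonneg f(2) order_trans)
  then have "0 \<le> R" by simp
  moreover have "ennreal (\<integral>x. g x \<partial>M) \<le> ennreal R"
    using * int g0 by (simp add: nn_integral_eq_integral)
  ultimately show ?thesis using int by (simp add: ennreal_le_iff)
qed

text \<open>Twice the larger summand dominates the sum. The constant is cruder than in Minkowski's
  inequality, but only finiteness and boundedness are drawn from it.\<close>

lemma abs_add_powr:
  assumes "0 \<le> p"
  shows "\<bar>a + b :: real\<bar> powr p \<le> 2 powr p * (\<bar>a\<bar> powr p + \<bar>b\<bar> powr p)"
proof -
  have "\<bar>a + b\<bar> powr p \<le> (2 * max \<bar>a\<bar> \<bar>b\<bar>) powr p" using assms by (intro powr_mono2) auto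
  also have "\<dots> = 2 powr p * max \<bar>a\<bar> \<bar>b\<bar> powr p" by (simp add: powr_mult)
  also have "\<dots> \<le> 2 powr p * (\<bar>a\<bar> powr p + \<bar>b\<bar> powr p)"
    by (intro mult_left_mono) (auto simp: max_def)
  finally show ?thesis .
qed

lemma powr_add_integrable:
  fixes f g :: "'a \<Rightarrow> real"
  assumes "0 \<le> p" "f \<in> borel_measurable M" "g \<in> borel_measurable M"
    and i: "integrable M (\<lambda>x. \<bar>f x\<bar> powr p)" "integrable M (\<lambda>x. \<bar>g x\<bar> powr p)"
  shows "integrable M (\<lambda>x. \<bar>f x + g x\<bar> powr p)"
    "(\<integral>x. \<bar>f x + g x\<bar> powr p \<partial>M) \<le>
       2 powr p * ((\<integral>x. \<bar>f x\<bar> powr p \<partial>M) + (\<integral>x. \<bar>g x\<bar> powr p \<partial>M))"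
proof -
  have b: "integrable M (\<lambda>x. 2 powr p * (\<bar>f x\<bar> powr p + \<bar>g x\<bar> powr p))" using i by simp
  show 1: "integrable M (\<lambda>x. \<bar>f x + g x\<bar> powr p)"
    using assms abs_add_powr by (intro Bochner_Integration.integrable_bound[OF b]) auto
  have "(\<integral>x. \<bar>f x + g x\<bar> powr p \<partial>M) \<le> (\<integral>x. 2 powr p * (\<bar>f x\<bar> powr p + \<bar>g x\<bar> powr p) \<partial>M)"
    using 1 b abs_add_powr[OF assms(1)] by (intro integral_mono) auto
  then show "(\<integral>x. \<bar>f x + g x\<bar> powr p \<partial>M) \<le>
       2 powr p * ((\<integral>x. \<bar>f x\<bar> powr p \<partial>M) + (\<integral>x. \<bar>g x\<bar> powr p \<partial>M))"
    using i by simp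
qed

text \<open>The exponent 1 supplies a subsequence converging almost everywhere, hence one limit
  function g. For each exponent in P, Fatou's lemma along that subsequence bounds the distance of
  \<open>f n\<close> to this same g, so that a single limit serves all exponents.\<close>

lemma Cauchy_mean_limit:
  fixes f :: "nat \<Rightarrow> 'a \<Rightarrow> real"
  assumes meas: "\<And>n. f n \<in> borel_measurable M"
    and int: "\<And>n p. p \<in> P \<Longrightarrow> integrable M (\<lambda>x. \<bar>f n x\<bar> powr p)"
    and Cauchy: "\<And>p e. p \<in> P \<Longrightarrow> e > 0 \<Longrightarrow> \<exists>N. \<forall>k\<ge>N. \<forall>l\<ge>N. (\<integral>x. \<bar>f k x - f l x\<bar> powr p \<partial>M) < e"
    and P: "1 \<in> P" "P \<subseteq> {1..}"
  obtains r g where "strict_mono (r :: nat \<Rightarrow> nat)" "g \<in> borel_measurable M"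
    "AE x in M. (\<lambda>n. f (r n) x) \<longlonglongrightarrow> g x"
    "\<And>p. p \<in> P \<Longrightarrow> integrable M (\<lambda>x. \<bar>g x\<bar> powr p)"
    "\<And>n p. p \<in> P \<Longrightarrow> integrable M (\<lambda>x. \<bar>f n x - g x\<bar> powr p)"
    "\<And>p. p \<in> P \<Longrightarrow> (\<lambda>n. \<integral>x. \<bar>f n x - g x\<bar> powr p \<partial>M) \<longlonglongrightarrow> 0"
proof -
  have "integrable M (f n)" for n
  proof (rule integrable_abs_cancel)
    show "integrable M (\<lambda>x. \<bar>f n x\<bar>)" using int[OF P(1), of n] by simp
  qed (rule meas)
  moreover have "\<exists>N. \<forall>i\<ge>N. \<forall>j\<ge>N. (LINT x|M. norm (f i x - f j x)) < e" if "e > 0" for e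
    using Cauchy[OF P(1) that] by simp
  ultimately obtain r where r: "strict_mono r" "AE x in M. Cauchy (\<lambda>i. f (r i) x)"
    by (rule cauchy_L1_AE_cauchy_subseq[of M f])
  define g where "g x = lim (\<lambda>i. f (r i) x)" for x
  have g: "g \<in> borel_measurable M"
    unfolding g_def using meas by (rule borel_measurable_lim_metric)
  have lim: "AE x in M. (\<lambda>n. f (r n) x) \<longlonglongrightarrow> g x"
    using r(2) by eventually_elim (metis g_def Cauchy_convergent convergent_LIMSEQ_iff)
  have diff: "integrable M (\<lambda>x. \<bar>f k x - f l x\<bar> powr p)" if "p \<in> P" for k l p
    using powr_add_integrable(1)[of p "f k" M "\<lambda>x. - f l x", OF _ meas _ int[OF that]] that P meas[of l] int[OF that, of l] by force
  have key: "\<exists>N. \<forall>n\<ge>N. integrable M (\<lambda>x. \<bar>f n x - g x\<bar> powr p) \<and> (\<integral>x. \<bar>f n x - g x\<bar> powr p \<partial>M) \<le> e"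
    if p: "p \<in> P" and e: "e > 0" for p e
  proof -
    obtain N where N: "\<And>k l. k \<ge> N \<Longrightarrow> l \<ge> N \<Longrightarrow> (\<integral>x. \<bar>f k x - f l x\<bar> powr p \<partial>M) < e"
      using Cauchy[OF p e] by blast
    show ?thesis
    proof (intro exI allI impI)
      fix n assume n: "n \<ge> N"
      have p0: "p > 0" using p P by force
      show "integrable M (\<lambda>x. \<bar>f n x - g x\<bar> powr p) \<and> (\<integral>x. \<bar>f n x - g x\<bar> powr p \<partial>M) \<le> e"
      \<comment> \<open>The index n stays fixed while the second index runs to infinity along
        r.\<close>
      proof (rule fatou_integral[where f="\<lambda>m x. \<bar>f n x - f (r m) x\<bar> powr p"])
        show "AE x in M. (\<lambda>m. \<bar>f n x - f (r m) x\<bar> powr p) \<longlonglongrightarrow> \<bar>f n x - g x\<bar> powr p"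
          using lim by eventually_elim (use p0 in \<open>auto intro!: tendsto_intros\<close>)
        show "\<forall>\<^sub>F m in sequentially. (\<integral>x. \<bar>f n x - f (r m) x\<bar> powr p \<partial>M) \<le> e"
          using eventually_ge_at_top[of N]
        proof eventually_elim
          case (elim m)
          then have "r m \<ge> N" using seq_suble[OF r(1), of m] by linarith
          then show ?case using N[OF n, of "r m"] by simp
        qed
      qed (use diff p meas g in auto)
    qed
  qed
  have ig: "integrable M (\<lambda>x. \<bar>g x\<bar> powr p)" if p: "p \<in> P" for p
  proof -
    obtain n where "integrable M (\<lambda>x. \<bar>f n x - g x\<bar> powr p)" using key[OF p, of 1] by auto
    then have "integrable M (\<lambda>x. \<bar>g x - f n x\<bar> powr p)" by (simp add: abs_minus_commute)
    from powr_add_integrable(1)[OF _ _ _ this int[OF p, of n]] show ?thesis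
      using p P meas g by force
  qed
  have ifg: "integrable M (\<lambda>x. \<bar>f n x - g x\<bar> powr p)" if p: "p \<in> P" for n p
    using powr_add_integrable(1)[of p "f n" M "\<lambda>x. - g x", OF _ meas _ int[OF p]] p P g ig[OF p] by force
  have conv: "(\<lambda>n. \<integral>x. \<bar>f n x - g x\<bar> powr p \<partial>M) \<longlonglongrightarrow> 0" if p: "p \<in> P" for p
  proof (rule LIMSEQ_I)
    fix e :: real assume "e > 0"
    then obtain N where "\<forall>n\<ge>N. (\<integral>x. \<bar>f n x - g x\<bar> powr p \<partial>M) \<le> e / 2" using key[OF p, of "e/2"] by auto
    then show "\<exists>N. \<forall>n\<ge>N. norm ((\<integral>x. \<bar>f n x - g x\<bar> powr p \<partial>M) - 0) < e"
      using \<open>e > 0\<close> by (intro exI[of _ N]) (auto simp: field_sum_of_halves intro: le_less_trans[of _ "e/2"])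
  qed
  show thesis by (rule that[OF r(1) g lim ig ifg conv])
qed

section \<open>Convexity of powers and Jensen's inequality\<close>

lemma powr_pred_mult: "0 \<le> c \<Longrightarrow> c powr (p - 1) * c = c powr (p :: real)"
  using powr_mult_base[of c "p - 1"] by (simp add: mult.commute)

text \<open>The power function lies above its tangent at c: this is Young's inequality for t and
  \<open>c powr (p - 1)\<close>, with q the exponent conjugate to p.\<close>

lemma powr_tangent:
  fixes t c p :: real
  assumes "1 \<le> p" "0 \<le> t" "0 < c"
  shows "c powr p + p * c powr (p - 1) * (t - c) \<le> t powr p"
proof (cases "p = 1")
  case False
  then have p: "p > 1" using assms by simp
  define q where "q = p / (p - 1)"
  have q: "q > 1" "1 / p + 1 / q = 1" using p by (auto simp: q_def field_simps)
  have "t * c powr (p - 1) \<le> t powr p / p + (c powr (p - 1)) powr q / q"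
    using p q assms by (intro Youngs_inequality) auto
  also have "(c powr (p - 1)) powr q = c powr p" using p by (simp add: powr_powr q_def)
  also have "c powr p / q = c powr p - c powr p / p" using p by (simp add: q_def field_simps)
  finally have "p * (t * c powr (p - 1)) \<le> p * (t powr p / p + (c powr p - c powr p / p))"
    using p by (intro mult_left_mono) auto
  also have "\<dots> = t powr p + p * c powr p - c powr p" using p by (simp add: distrib_left right_diff_distrib)
  finally have "p * c powr (p - 1) * t \<le> t powr p + p * c powr p - c powr p" by (simp add: mult_ac)
  moreover have "c powr (p - 1) * c = c powr p" using assms by (simp add: powr_pred_mult)
  ultimately show ?thesis by (simp add: algebra_simps)
qed (use assms in simp)

text \<open>Jensen's inequality for the measure whose density is the absolute value of \<mu> and
  whose mass is at most C: the tangent inequality is integrated against it.\<close>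

lemma powr_integral_mult_le:
  fixes b \<mu> :: "'a \<Rightarrow> real"
  assumes p: "1 \<le> p" and \<mu>: "integrable M \<mu>" "(\<integral>y. \<bar>\<mu> y\<bar> \<partial>M) \<le> C" "0 < C"
    and b: "b \<in> borel_measurable M" "\<And>y. y \<in> space M \<Longrightarrow> \<bar>b y\<bar> \<le> B"
  shows "\<bar>\<integral>y. b y * \<mu> y \<partial>M\<bar> powr p \<le> C powr (p - 1) * (\<integral>y. \<bar>b y\<bar> powr p * \<bar>\<mu> y\<bar> \<partial>M)"
proof -
  have i1: "integrable M (\<lambda>y. \<bar>b y\<bar> * \<bar>\<mu> y\<bar>)"
  proof (rule Bochner_Integration.integrable_bound[where f="\<lambda>y. B * \<bar>\<mu> y\<bar>"])
    show "AE y in M. norm (\<bar>b y\<bar> * \<bar>\<mu> y\<bar>) \<le> norm (B * \<bar>\<mu> y\<bar>)"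
      using b(2) by (intro AE_I2) (fastforce simp: abs_mult intro!: mult_right_mono)
  qed (use \<mu> b in auto)
  have i2: "integrable M (\<lambda>y. \<bar>b y\<bar> powr p * \<bar>\<mu> y\<bar>)"
  proof (rule Bochner_Integration.integrable_bound[where f="\<lambda>y. \<bar>B\<bar> powr p * \<bar>\<mu> y\<bar>"])
    show "AE y in M. norm (\<bar>b y\<bar> powr p * \<bar>\<mu> y\<bar>) \<le> norm (\<bar>B\<bar> powr p * \<bar>\<mu> y\<bar>)"
      using b(2) p by (intro AE_I2) (fastforce simp: abs_mult intro!: mult_right_mono powr_mono2)
  qed (use \<mu> b in auto)
  define A where "A = (\<integral>y. \<bar>b y\<bar> * \<bar>\<mu> y\<bar> \<partial>M)"
  have A0: "A \<ge> 0" unfolding A_def by (intro Bochner_Integration.integral_nonneg) auto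
  have "\<bar>\<integral>y. b y * \<mu> y \<partial>M\<bar> \<le> A"
    unfolding A_def using integral_abs_bound[of M "\<lambda>y. b y * \<mu> y"] by (simp add: abs_mult)
  then have le: "\<bar>\<integral>y. b y * \<mu> y \<partial>M\<bar> powr p \<le> A powr p" using p by (intro powr_mono2) auto
  show ?thesis
  proof (cases "A = 0")
    case True
    have "0 \<le> (\<integral>y. \<bar>b y\<bar> powr p * \<bar>\<mu> y\<bar> \<partial>M)" by (intro Bochner_Integration.integral_nonneg) auto
    then have "0 \<le> C powr (p - 1) * (\<integral>y. \<bar>b y\<bar> powr p * \<bar>\<mu> y\<bar> \<partial>M)" by simp
    then show ?thesis using le True by simp
  next
    case False
    \<comment> \<open>The tangent point is the mean of the absolute value of b, with the bound C in
      place of the true mass.\<close>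
    define c where "c = A / C"
    have c: "c > 0" using False A0 \<mu> by (simp add: c_def)
    let ?m = "\<integral>y. \<bar>\<mu> y\<bar> \<partial>M"
    \<comment> \<open>Replacing the true mass by C costs \<open>c powr p * (C - ?m)\<close> on the
      left and gains p times as much on the right, so 1 <= p absorbs it.\<close>
    have "c powr p * C \<le> c powr p * ?m + p * c powr (p - 1) * (A - c * ?m)"
    proof -
      have "c powr p * C = c powr p * ?m + c powr p * (C - ?m)" by (simp add: algebra_simps)
      also have "\<dots> \<le> c powr p * ?m + p * (c powr p * (C - ?m))"
        using p \<mu>(2) mult_right_mono[of 1 p "c powr p * (C - ?m)"] by simp
      also have "p * (c powr p * (C - ?m)) = p * c powr (p - 1) * (A - c * ?m)"
      proof -
        have "A = c * C" using \<mu>(3) by (simp add: c_def)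
        then show ?thesis using c by (simp add: powr_pred_mult[of c p, symmetric] algebra_simps)
      qed
      finally show ?thesis .
    qed
    also have "\<dots> = (\<integral>y. (c powr p + p * c powr (p - 1) * (\<bar>b y\<bar> - c)) * \<bar>\<mu> y\<bar> \<partial>M)"
    proof -
      have "(\<integral>y. (c powr p + p * c powr (p - 1) * (\<bar>b y\<bar> - c)) * \<bar>\<mu> y\<bar> \<partial>M) =
          (\<integral>y. (c powr p - p * c powr (p - 1) * c) * \<bar>\<mu> y\<bar> + (p * c powr (p - 1)) * (\<bar>b y\<bar> * \<bar>\<mu> y\<bar>) \<partial>M)"
        by (intro Bochner_Integration.integral_cong) (auto simp: algebra_simps)
      also have "\<dots> = (c powr p - p * c powr (p - 1) * c) * ?m + (p * c powr (p - 1)) * A"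
        using i1 \<mu> by (simp add: A_def)
      finally show ?thesis by (simp add: algebra_simps)
    qed
    also have "\<dots> \<le> (\<integral>y. \<bar>b y\<bar> powr p * \<bar>\<mu> y\<bar> \<partial>M)"
    proof (rule integral_mono[OF _ i2])
      have "integrable M (\<lambda>y. (c powr p - p * c powr (p - 1) * c) * \<bar>\<mu> y\<bar> + (p * c powr (p - 1)) * (\<bar>b y\<bar> * \<bar>\<mu> y\<bar>))"
        using i1 \<mu> by simp
      then show "integrable M (\<lambda>y. (c powr p + p * c powr (p - 1) * (\<bar>b y\<bar> - c)) * \<bar>\<mu> y\<bar>)"
        by (simp add: algebra_simps)
      fix y
      show "(c powr p + p * c powr (p - 1) * (\<bar>b y\<bar> - c)) * \<bar>\<mu> y\<bar> \<le> \<bar>b y\<bar> powr p * \<bar>\<mu> y\<bar>"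
        using p c by (intro mult_right_mono powr_tangent) auto
    qed
    finally have "c powr p * C \<le> (\<integral>y. \<bar>b y\<bar> powr p * \<bar>\<mu> y\<bar> \<partial>M)" .
    then have "C powr (p - 1) * (c powr p * C) \<le> C powr (p - 1) * (\<integral>y. \<bar>b y\<bar> powr p * \<bar>\<mu> y\<bar> \<partial>M)"
      by (intro mult_left_mono) auto
    moreover have "C powr (p - 1) * (c powr p * C) = A powr p"
    proof -
      have "C powr (p - 1) * C = C powr p" using \<mu>(3) by (simp add: powr_pred_mult)
      then have "C powr (p - 1) * (c powr p * C) = (C * c) powr p"
        using \<mu>(3) c by (simp add: powr_mult algebra_simps)
      then show ?thesis using \<mu>(3) by (simp add: c_def)
    qed
    ultimately show ?thesis using le by simp
  qed
qed

section \<open>Integral operators with continuous kernels\<close>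

text \<open>Measurability of the identity relates the product of the two trace sigma-algebras to the
  Borel sets of the ambient product; continuous functions of both variables become measurable
  through it.\<close>

lemma measurable_pair_sphere_borel:
  "(\<lambda>p. p) \<in> borel_measurable (\<sigma> \<Otimes>\<^sub>M \<sigma> :: ('a::euclidean_space \<times> 'b::euclidean_space) measure)"
proof -
  have 1: "fst \<in> borel_measurable (\<sigma> \<Otimes>\<^sub>M \<sigma> :: ('a \<times> 'b) measure)"
    by (rule measurable_compose[OF measurable_fst continuous_on_sphere_measurable[OF continuous_on_id]])
  have 2: "snd \<in> borel_measurable (\<sigma> \<Otimes>\<^sub>M \<sigma> :: ('a \<times> 'b) measure)"
    by (rule measurable_compose[OF measurable_snd continuous_on_sphere_measurable[OF continuous_on_id]])
  show ?thesis using borel_measurable_Pair[OF 1 2] by simp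
qed

lemma continuous_on_pair_sphere_measurable:
  fixes F :: "'a::euclidean_space \<times> 'b::euclidean_space \<Rightarrow> 'c::topological_space"
  assumes "continuous_on (sphere 0 1 \<times> sphere 0 1) F"
  shows "F \<in> borel_measurable (\<sigma> \<Otimes>\<^sub>M \<sigma>)"
proof -
  have "(\<lambda>p. p) \<in> measurable (\<sigma> \<Otimes>\<^sub>M \<sigma>) (restrict_space borel (sphere 0 1 \<times> sphere 0 1 :: ('a \<times> 'b) set))"
    by (intro measurable_restrict_space2 measurable_pair_sphere_borel) (auto simp: space_pair_measure)
  from measurable_compose[OF this borel_measurable_continuous_on_restrict[OF assms]] show ?thesis by simp
qed

interpretation sphere_pair: pair_sigma_finite
  "\<sigma> :: 'a::euclidean_space measure" "\<sigma> :: 'b::euclidean_space measure" ..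

interpretation sphere_pair: finite_measure
  "\<sigma> \<Otimes>\<^sub>M \<sigma> :: ('a::euclidean_space \<times> 'b::euclidean_space) measure"
  by (rule finite_measure_pair_measure) unfold_locales

lemma continuous_on_pair_sphere_integrable:
  fixes F :: "'a::euclidean_space \<times> 'b::euclidean_space \<Rightarrow> 'c::{banach, second_countable_topology}"
  assumes "continuous_on (sphere 0 1 \<times> sphere 0 1) F"
  shows "integrable (\<sigma> \<Otimes>\<^sub>M \<sigma>) F"
proof -
  have "compact (F ` (sphere 0 1 \<times> sphere 0 1))"
    using assms by (intro compact_continuous_image compact_Times) auto
  then obtain B where "\<And>x. x \<in> sphere 0 1 \<times> sphere 0 1 \<Longrightarrow> norm (F x) \<le> B"
    by (meson bounded_iff compact_imp_bounded imageI)
  then show ?thesis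
    by (intro sphere_pair.integrable_const_bound[where B=B] continuous_on_pair_sphere_measurable assms AE_I2)
      (auto simp: space_pair_measure)
qed

section \<open>Bounds, equicontinuity and compactness for kernel operators\<close>

lemma kernel_bounded:
  fixes \<kappa> :: "'a::euclidean_space \<Rightarrow> 'a \<Rightarrow> real"
  assumes "continuous_on (sphere 0 1 \<times> sphere 0 1) (case_prod \<kappa>)"
  obtains B where "B > 0" "\<And>x y. norm x = 1 \<Longrightarrow> norm y = 1 \<Longrightarrow> \<bar>\<kappa> x y\<bar> \<le> B"
proof -
  have "compact (case_prod \<kappa> ` (sphere 0 1 \<times> sphere 0 1))"
    using assms by (intro compact_continuous_image compact_Times) auto
  then have "bounded (case_prod \<kappa> ` (sphere 0 1 \<times> sphere 0 1))" by (rule compact_imp_bounded)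
  then show thesis by (auto simp: bounded_pos intro: that)
qed

lemma kernel_section_continuous:
  fixes \<kappa> :: "'a::euclidean_space \<Rightarrow> 'a \<Rightarrow> real"
  assumes "continuous_on (sphere 0 1 \<times> sphere 0 1) (case_prod \<kappa>)" "norm x = 1"
  shows "continuous_on (sphere 0 1) (\<kappa> x)" "continuous_on (sphere 0 1) (\<lambda>z. \<kappa> z x)"
proof -
  have "continuous_on (sphere 0 1) (\<lambda>y. case_prod \<kappa> (x, y))" "continuous_on (sphere 0 1) (\<lambda>y. case_prod \<kappa> (y, x))"
    using assms(2) by (intro continuous_on_compose2[OF assms(1)] continuous_intros; auto)+
  then show "continuous_on (sphere 0 1) (\<kappa> x)" "continuous_on (sphere 0 1) (\<lambda>z. \<kappa> z x)" by simp_all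
qed

text \<open>Uniform continuity of the kernel on the compact product. The radius d is fixed before g,
  so the operator maps families bounded in L^1 to equicontinuous ones.\<close>

lemma kernel_equicontinuous:
  fixes \<kappa> :: "'a::euclidean_space \<Rightarrow> 'a \<Rightarrow> real"
  assumes \<kappa>: "continuous_on (sphere 0 1 \<times> sphere 0 1) (case_prod \<kappa>)" and e: "e > 0"
  shows "\<exists>d>0. \<forall>x x' g. norm x = 1 \<longrightarrow> norm x' = 1 \<longrightarrow> norm (x - x') < d \<longrightarrow>
    continuous_on (sphere 0 1) g \<longrightarrow>
    \<bar>(\<integral>y. \<kappa> x y * g y \<partial>\<sigma>) - (\<integral>y. \<kappa> x' y * g y \<partial>\<sigma>)\<bar> \<le> e * (\<integral>y. \<bar>g y\<bar> \<partial>\<sigma>)"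
proof -
  have "uniformly_continuous_on (sphere 0 1 \<times> sphere 0 1) (case_prod \<kappa>)"
    using \<kappa> by (intro compact_uniformly_continuous compact_Times) auto
  then obtain d where d: "d > 0" "\<And>p q. p \<in> sphere 0 1 \<times> sphere 0 1 \<Longrightarrow> q \<in> sphere 0 1 \<times> sphere 0 1 \<Longrightarrow> dist p q < d
      \<Longrightarrow> dist (case_prod \<kappa> p) (case_prod \<kappa> q) < e"
    using e unfolding uniformly_continuous_on_def by (metis dist_commute)
  show ?thesis
  proof (intro exI[of _ d] conjI allI impI d(1))
    fix x x' :: 'a and g :: "'a \<Rightarrow> real"
    assume x: "norm x = 1" "norm x' = 1" "norm (x - x') < d" and g: "continuous_on (sphere 0 1) g"
    have i: "integrable \<sigma> (\<lambda>y. \<kappa> x y * g y)" if "norm x = 1" for x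
      by (intro continuous_on_sphere_integrable continuous_intros kernel_section_continuous[OF \<kappa> that] g)
    have ig: "integrable \<sigma> g" by (intro continuous_on_sphere_integrable g)
    have "\<bar>(\<integral>y. \<kappa> x y * g y \<partial>\<sigma>) - (\<integral>y. \<kappa> x' y * g y \<partial>\<sigma>)\<bar>
      = \<bar>\<integral>y. \<kappa> x y * g y - \<kappa> x' y * g y \<partial>\<sigma>\<bar>"
      using i x by simp
    also have "\<dots> \<le> (\<integral>y. \<bar>\<kappa> x y * g y - \<kappa> x' y * g y\<bar> \<partial>\<sigma>)" by (rule integral_abs_bound)
    also have "\<dots> \<le> (\<integral>y. e * \<bar>g y\<bar> \<partial>\<sigma>)"
    proof (rule integral_mono)
      fix y :: 'a assume "y \<in> space \<sigma>"
      then have "\<bar>\<kappa> x y - \<kappa> x' y\<bar> \<le> e"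
        using d(2)[of "(x, y)" "(x', y)"] x by (simp add: dist_Pair_Pair dist_norm)
      then have "\<bar>\<kappa> x y - \<kappa> x' y\<bar> * \<bar>g y\<bar> \<le> e * \<bar>g y\<bar>" by (intro mult_right_mono) auto
      then show "\<bar>\<kappa> x y * g y - \<kappa> x' y * g y\<bar> \<le> e * \<bar>g y\<bar>"
        by (simp add: abs_mult[symmetric] left_diff_distrib)
    qed (use i x ig in auto)
    finally show "\<bar>(\<integral>y. \<kappa> x y * g y \<partial>\<sigma>) - (\<integral>y. \<kappa> x' y * g y \<partial>\<sigma>)\<bar> \<le> e * (\<integral>y. \<bar>g y\<bar> \<partial>\<sigma>)"
      by simp
  qed
qed

lemma kernel_operator_continuous:
  fixes \<kappa> :: "'a::euclidean_space \<Rightarrow> 'a \<Rightarrow> real"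
  assumes \<kappa>: "continuous_on (sphere 0 1 \<times> sphere 0 1) (case_prod \<kappa>)" and g: "continuous_on (sphere 0 1) g"
  shows "continuous_on (sphere 0 1) (\<lambda>x. \<integral>y. \<kappa> x y * g y \<partial>\<sigma>)"
  unfolding continuous_on_iff
proof (intro ballI allI impI)
  fix x :: 'a and e :: real assume x: "x \<in> sphere 0 1" and e: "e > 0"
  define C where "C = (\<integral>y. \<bar>g y\<bar> \<partial>\<sigma>)"
  have C: "C \<ge> 0" unfolding C_def by (intro Bochner_Integration.integral_nonneg) auto
  from e C have e': "e / (C + 1) > 0" by simp
  obtain d where d: "d > 0" "\<And>x x' g. norm x = 1 \<Longrightarrow> norm x' = 1 \<Longrightarrow> norm (x - x') < d \<Longrightarrow>
    continuous_on (sphere 0 1) g \<Longrightarrow>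
    \<bar>(\<integral>y. \<kappa> x y * g y \<partial>\<sigma>) - (\<integral>y. \<kappa> x' y * g y \<partial>\<sigma>)\<bar> \<le> e / (C + 1) * (\<integral>y. \<bar>g y\<bar> \<partial>\<sigma>)"
    using kernel_equicontinuous[OF \<kappa> e'] by blast
  have "e / (C + 1) * C < e" using e C by (simp add: field_simps)
  then show "\<exists>d>0. \<forall>x'\<in>sphere 0 1. dist x' x < d \<longrightarrow>
      dist (\<integral>y. \<kappa> x' y * g y \<partial>\<sigma>) (\<integral>y. \<kappa> x y * g y \<partial>\<sigma>) < e"
    using d(1) d(2)[of x _ g] x g unfolding C_def
    by (intro exI[of _ d]) (force simp: dist_norm norm_minus_commute)
qed

text \<open>An estimate from L^1 to L^p: Jensen's inequality at fixed x, followed by Fubini, leaves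
  the integral over y of the p-th means of \<open>b x y\<close> in x, weighted by the absolute value
  of \<mu>.\<close>

lemma kernel_operator_mean_le:
  fixes b :: "'a::euclidean_space \<Rightarrow> 'a \<Rightarrow> real"
  assumes b: "continuous_on (sphere 0 1 \<times> sphere 0 1) (case_prod b)" and p: "1 \<le> p"
    and R: "\<And>y. norm y = 1 \<Longrightarrow> (\<integral>x. \<bar>b x y\<bar> powr p \<partial>\<sigma>) \<le> R" "0 \<le> R"
    and \<mu>: "continuous_on (sphere 0 1) \<mu>" "(\<integral>y. \<bar>\<mu> y\<bar> \<partial>\<sigma>) \<le> C" "0 < C"
  shows "(\<integral>x. \<bar>\<integral>y. b x y * \<mu> y \<partial>\<sigma>\<bar> powr p \<partial>\<sigma>) \<le> C powr p * R"
proof -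
  obtain B where B: "\<And>x y. norm x = 1 \<Longrightarrow> norm y = 1 \<Longrightarrow> \<bar>b x y\<bar> \<le> B" using kernel_bounded[OF b] by metis
  have p0: "p > 0" using p by simp
  have "continuous_on (sphere 0 1 \<times> sphere 0 1) (case_prod (\<lambda>x y. \<bar>b x y\<bar> powr p * \<bar>\<mu> y\<bar>))"
  proof -
    have "continuous_on (sphere 0 1 \<times> sphere 0 1) (\<lambda>q. \<bar>case_prod b q\<bar> powr p * \<bar>\<mu> (snd q)\<bar>)"
      using b p0 by (intro continuous_intros continuous_on_powr' continuous_on_compose2[OF \<mu>(1)]) auto
    then show ?thesis by (simp add: case_prod_beta')
  qed
  then have i2: "integrable (\<sigma> \<Otimes>\<^sub>M \<sigma>) (case_prod (\<lambda>x y. \<bar>b x y\<bar> powr p * \<bar>\<mu> y\<bar>))"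
    by (rule continuous_on_pair_sphere_integrable)
  have i\<mu>: "integrable \<sigma> \<mu>" using \<mu> by (intro continuous_on_sphere_integrable)
  have "(\<integral>x. \<bar>\<integral>y. b x y * \<mu> y \<partial>\<sigma>\<bar> powr p \<partial>\<sigma>) \<le>
      (\<integral>x. C powr (p - 1) * (\<integral>y. \<bar>b x y\<bar> powr p * \<bar>\<mu> y\<bar> \<partial>\<sigma>) \<partial>\<sigma>)"
  proof (rule integral_mono)
    show "integrable \<sigma> (\<lambda>x. \<bar>\<integral>y. b x y * \<mu> y \<partial>\<sigma>\<bar> powr p)"
      using p0 by (intro continuous_on_sphere_integrable continuous_on_powr' continuous_intros
          kernel_operator_continuous b \<mu>) auto
    show "integrable \<sigma> (\<lambda>x. C powr (p - 1) * (\<integral>y. \<bar>b x y\<bar> powr p * \<bar>\<mu> y\<bar> \<partial>\<sigma>))"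
      using sphere_pair.integrable_fst[OF i2] by simp
    fix x :: 'a assume "x \<in> space \<sigma>"
    then show "\<bar>\<integral>y. b x y * \<mu> y \<partial>\<sigma>\<bar> powr p \<le>
        C powr (p - 1) * (\<integral>y. \<bar>b x y\<bar> powr p * \<bar>\<mu> y\<bar> \<partial>\<sigma>)"
      using B kernel_section_continuous(1)[OF b, of x]
      by (intro powr_integral_mult_le[where B=B] p i\<mu> \<mu> continuous_on_sphere_measurable) auto
  qed
  also have "\<dots> = C powr (p - 1) * (\<integral>x. \<integral>y. \<bar>b x y\<bar> powr p * \<bar>\<mu> y\<bar> \<partial>\<sigma> \<partial>\<sigma>)"
    by simp
  finally have 1: "(\<integral>x. \<bar>\<integral>y. b x y * \<mu> y \<partial>\<sigma>\<bar> powr p \<partial>\<sigma>) \<le>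
      C powr (p - 1) * (\<integral>x. \<integral>y. \<bar>b x y\<bar> powr p * \<bar>\<mu> y\<bar> \<partial>\<sigma> \<partial>\<sigma>)" .
  have "(\<integral>x. \<integral>y. \<bar>b x y\<bar> powr p * \<bar>\<mu> y\<bar> \<partial>\<sigma> \<partial>\<sigma>) =
      (\<integral>y. \<integral>x. \<bar>b x y\<bar> powr p * \<bar>\<mu> y\<bar> \<partial>\<sigma> \<partial>\<sigma>)"
    by (rule sphere_pair.Fubini_integral[OF i2, symmetric])
  also have "\<dots> \<le> (\<integral>y. R * \<bar>\<mu> y\<bar> \<partial>\<sigma>)"
  proof (rule integral_mono)
    show "integrable \<sigma> (\<lambda>y. \<integral>x. \<bar>b x y\<bar> powr p * \<bar>\<mu> y\<bar> \<partial>\<sigma>)"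
      by (rule sphere_pair.integrable_snd[OF i2])
    fix y :: 'a assume "y \<in> space \<sigma>"
    then show "(\<integral>x. \<bar>b x y\<bar> powr p * \<bar>\<mu> y\<bar> \<partial>\<sigma>) \<le> R * \<bar>\<mu> y\<bar>"
      using R(1)[of y] by (simp add: mult_right_mono)
  qed (use i\<mu> in auto)
  also have "\<dots> \<le> R * C" using \<mu>(2) R(2) by (simp add: mult_left_mono)
  finally have "C powr (p - 1) * (\<integral>x. \<integral>y. \<bar>b x y\<bar> powr p * \<bar>\<mu> y\<bar> \<partial>\<sigma> \<partial>\<sigma>)
      \<le> C powr (p - 1) * (R * C)"
    by (rule mult_left_mono) auto
  also have "C powr (p - 1) * (R * C) = C powr p * R"
    using powr_pred_mult[of C p] \<mu>(3) by (simp add: mult.commute mult.left_commute)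
  finally show ?thesis using 1 by linarith
qed

text \<open>Arzela-Ascoli for each of the countably many kernels, with bound and equicontinuity
  coming from the L^1 bound on \<open>h k\<close>, and a diagonal sequence over the kernels.\<close>

lemma kernel_diagonal_subsequence:
  fixes \<kappa> :: "'i::countable \<Rightarrow> 'a::euclidean_space \<Rightarrow> 'a \<Rightarrow> real" and h :: "nat \<Rightarrow> 'a \<Rightarrow> real"
  assumes \<kappa>: "\<And>i. continuous_on (sphere 0 1 \<times> sphere 0 1) (case_prod (\<kappa> i))"
    and h: "\<And>k. continuous_on (sphere 0 1) (h k)" "\<And>k. (\<integral>y. \<bar>h k y\<bar> \<partial>\<sigma>) \<le> C"
  shows "\<exists>s. strict_mono (s :: nat \<Rightarrow> nat) \<and>
    (\<forall>i e. e > 0 \<longrightarrow> (\<exists>N. \<forall>k\<ge>N. \<forall>l\<ge>N. \<forall>x. norm x = 1 \<longrightarrow>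
      \<bar>(\<integral>y. \<kappa> i x y * h (s k) y \<partial>\<sigma>) - (\<integral>y. \<kappa> i x y * h (s l) y \<partial>\<sigma>)\<bar> < e))"
proof -
  define I where "I i k x = (\<integral>y. \<kappa> i x y * h k y \<partial>\<sigma>)" for i k x
  define P where "P n s \<longleftrightarrow> (\<forall>e>0. \<exists>N. \<forall>k\<ge>N. \<forall>l\<ge>N. \<forall>x. norm x = 1 \<longrightarrow>
      \<bar>I (from_nat n) (s k) x - I (from_nat n) (s l) x\<bar> < e)" for n and s :: "nat \<Rightarrow> nat"
  have C: "C \<ge> 0"
    using order_trans[OF _ h(2)[of 0]] by simp
  interpret subseqs P
  proof
    fix n and s :: "nat \<Rightarrow> nat" assume "strict_mono s"
    let ?i = "from_nat n :: 'i"
    obtain B where B: "B > 0" "\<And>x y. norm x = 1 \<Longrightarrow> norm y = 1 \<Longrightarrow> \<bar>\<kappa> ?i x y\<bar> \<le> B"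
      using kernel_bounded[OF \<kappa>] by metis
    obtain g r where r: "strict_mono (r :: nat \<Rightarrow> nat)"
      and g: "\<And>e. 0 < e \<Longrightarrow> \<exists>N. \<forall>n x. n \<ge> N \<and> x \<in> sphere 0 1 \<longrightarrow> norm (I ?i (s (r n)) x - g x) < e"
    proof (rule Arzela_Ascoli[of "sphere 0 1" "\<lambda>k x. I ?i (s k) x" "B * C"])
      fix k :: nat and x :: 'a assume x: "x \<in> sphere 0 1"
      have "\<bar>I ?i (s k) x\<bar> \<le> (\<integral>y. \<bar>\<kappa> ?i x y * h (s k) y\<bar> \<partial>\<sigma>)"
        unfolding I_def by (rule integral_abs_bound)
      also have "\<dots> \<le> (\<integral>y. B * \<bar>h (s k) y\<bar> \<partial>\<sigma>)"
        using x B(2) kernel_section_continuous(1)[OF \<kappa>, of x] h(1)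
        by (intro integral_mono continuous_on_sphere_integrable continuous_intros)
          (auto simp: abs_mult intro!: mult_right_mono)
      also have "\<dots> \<le> B * C" using B(1) h(2) by simp
      finally show "norm (I ?i (s k) x) \<le> B * C" by simp
    next
      fix x :: 'a and e :: real assume x: "x \<in> sphere 0 1" and e: "e > 0"
      from e C have e': "e / (C + 1) > 0" by simp
      have lt: "e / (C + 1) * C < e" using e C by (simp add: field_simps)
      obtain d where d: "d > 0" "\<And>x x' g. norm x = 1 \<Longrightarrow> norm x' = 1 \<Longrightarrow> norm (x - x') < d \<Longrightarrow>
    continuous_on (sphere 0 1) g \<Longrightarrow>
    \<bar>(\<integral>y. \<kappa> ?i x y * g y \<partial>\<sigma>) - (\<integral>y. \<kappa> ?i x' y * g y \<partial>\<sigma>)\<bar> \<le> e / (C + 1) * (\<integral>y. \<bar>g y\<bar> \<partial>\<sigma>)"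
        using kernel_equicontinuous[OF \<kappa> e'] by blast
      have "norm (I ?i (s k) x - I ?i (s k) y) < e" if "y \<in> sphere 0 1" "norm (x - y) < d" for k y
      proof -
        have "norm (I ?i (s k) x - I ?i (s k) y) \<le> e / (C + 1) * (\<integral>y. \<bar>h (s k) y\<bar> \<partial>\<sigma>)"
          unfolding I_def using d(2)[of x y "h (s k)"] that x h(1)[of "s k"] by simp
        also have "\<dots> \<le> e / (C + 1) * C" using e' h(2) by (intro mult_left_mono) auto
        finally show ?thesis using lt by simp
      qed
      then show "\<exists>d>0. \<forall>n y. y \<in> sphere 0 1 \<and> norm (x - y) < d \<longrightarrow> norm (I ?i (s n) x - I ?i (s n) y) < e"
        using d(1) by blast
    qed auto
    have "P n (s \<circ> r)"
      unfolding P_def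
    proof (intro allI impI)
      fix e :: real assume "e > 0"
      then obtain N where N: "\<And>n x. n \<ge> N \<Longrightarrow> norm x = 1 \<Longrightarrow> \<bar>I ?i (s (r n)) x - g x\<bar> < e / 2"
        using g[of "e / 2"] by auto
      have "\<bar>I ?i (s (r k)) x - I ?i (s (r l)) x\<bar> < e" if "k \<ge> N" "l \<ge> N" "norm x = 1" for k l x
        using N[OF that(1,3)] N[OF that(2,3)] by linarith
      then show "\<exists>N. \<forall>k\<ge>N. \<forall>l\<ge>N. \<forall>x. norm x = 1 \<longrightarrow> \<bar>I ?i ((s \<circ> r) k) x - I ?i ((s \<circ> r) l) x\<bar> < e"
        by (auto intro!: exI[of _ N])
    qed
    then show "\<exists>r'. strict_mono r' \<and> P n (s \<circ> r')" using r by blast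
  qed
  \<comment> \<open>The diagonal sequence is a subsequence of the one extracted for kernel n only
    from index \<open>Suc n\<close> on; the shift is undone below by enlarging N.\<close>
  have Pd: "P n (diagseq \<circ> ((+) (Suc n)))" for n
  proof (rule diagseq_holds)
    fix r s :: "nat \<Rightarrow> nat" and n assume "strict_mono r" "P n s"
    then show "P n (s \<circ> r)"
      unfolding P_def by (metis comp_apply order_trans seq_suble)
  qed
  have PD: "P n s \<Longrightarrow> e > 0 \<Longrightarrow> \<exists>N. \<forall>k\<ge>N. \<forall>l\<ge>N. \<forall>x. norm x = 1 \<longrightarrow>
      \<bar>I (from_nat n) (s k) x - I (from_nat n) (s l) x\<bar> < e" for n s e
    unfolding P_def by blast
  show ?thesis
  proof (intro exI[of _ diagseq] conjI allI impI subseq_diagseq)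
    fix i :: 'i and e :: real assume "e > 0"
    from PD[OF Pd[of "to_nat i"] this] have "\<exists>N. \<forall>k\<ge>N. \<forall>l\<ge>N. \<forall>x. norm x = 1 \<longrightarrow>
        \<bar>I i (diagseq (Suc (to_nat i) + k)) x - I i (diagseq (Suc (to_nat i) + l)) x\<bar> < e"
      by simp
    then obtain N where N: "\<And>k l x. k \<ge> N \<Longrightarrow> l \<ge> N \<Longrightarrow> norm x = 1 \<Longrightarrow>
        \<bar>I i (diagseq (Suc (to_nat i) + k)) x - I i (diagseq (Suc (to_nat i) + l)) x\<bar> < e"
      by blast
    have "\<bar>I i (diagseq k) x - I i (diagseq l) x\<bar> < e"
      if "k \<ge> N + Suc (to_nat i)" "l \<ge> N + Suc (to_nat i)" "norm x = 1" for k l x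
      using N[of "k - Suc (to_nat i)" "l - Suc (to_nat i)" x] that by simp
    then show "\<exists>N. \<forall>k\<ge>N. \<forall>l\<ge>N. \<forall>x. norm x = 1 \<longrightarrow>
      \<bar>(\<integral>y. \<kappa> i x y * h (diagseq k) y \<partial>\<sigma>) - (\<integral>y. \<kappa> i x y * h (diagseq l) y \<partial>\<sigma>)\<bar> < e"
      unfolding I_def by blast
  qed
qed

text \<open>The kernels \<open>a n\<close> regularize \<open>h k\<close> to functions that converge to \<open>\<psi> k\<close>, and the error made at stage
  \<open>n\<close> is controlled in the mean, uniformly in \<open>k\<close>, by expressing it through other kernels \<open>b n\<close>
  that act on the densities \<open>\<mu> k\<close>.\<close>

lemma kernel_regularization_Cauchy:
  fixes a b :: "nat \<Rightarrow> 'a::euclidean_space \<Rightarrow> 'a \<Rightarrow> real" and \<psi> h \<mu> :: "nat \<Rightarrow> 'a \<Rightarrow> real"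
  assumes a: "\<And>n. continuous_on (sphere 0 1 \<times> sphere 0 1) (case_prod (a n))"
    and b: "\<And>n. continuous_on (sphere 0 1 \<times> sphere 0 1) (case_prod (b n))"
    and \<psi>: "\<And>k. continuous_on (sphere 0 1) (\<psi> k)"
    and h: "\<And>k. continuous_on (sphere 0 1) (h k)"
    and \<mu>: "\<And>k. continuous_on (sphere 0 1) (\<mu> k)" "\<And>k. (\<integral>y. \<bar>\<mu> k y\<bar> \<partial>\<sigma>) \<le> C" "0 < C"
    and lim: "\<And>k x. norm x = 1 \<Longrightarrow> (\<lambda>n. \<integral>y. a n x y * h k y \<partial>\<sigma>) \<longlonglongrightarrow> \<psi> k x"
    and eq: "\<And>k m n x. norm x = 1 \<Longrightarrow>
      (\<integral>y. a n x y * h k y \<partial>\<sigma>) - (\<integral>y. a m x y * h k y \<partial>\<sigma>) =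
      (\<integral>y. (b n x y - b m x y) * \<mu> k y \<partial>\<sigma>)"
    and p: "1 \<le> p"
    and \<rho>: "\<rho> \<longlonglongrightarrow> 0" "\<And>n. 0 \<le> \<rho> n"
      "\<And>n m y. n \<le> m \<Longrightarrow> norm y = 1 \<Longrightarrow> (\<integral>x. \<bar>b n x y - b m x y\<bar> powr p \<partial>\<sigma>) \<le> \<rho> n"
    and Cauchy: "\<And>n e. e > 0 \<Longrightarrow> \<exists>N. \<forall>k\<ge>N. \<forall>l\<ge>N. \<forall>x. norm x = 1 \<longrightarrow>
      \<bar>(\<integral>y. a n x y * h k y \<partial>\<sigma>) - (\<integral>y. a n x y * h l y \<partial>\<sigma>)\<bar> < e"
    and e: "e > 0"
  shows "\<exists>N. \<forall>k\<ge>N. \<forall>l\<ge>N. (\<integral>x. \<bar>\<psi> k x - \<psi> l x\<bar> powr p \<partial>\<sigma>) < e"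
proof -
  define I where "I n k x = (\<integral>y. a n x y * h k y \<partial>\<sigma>)" for n k x
  define m where "m = measure \<sigma> (sphere 0 (1::real) :: 'a set)"
  have p0: "p > 0" using p by simp
  have cI: "continuous_on (sphere 0 1) (I n k)" for n k
    unfolding I_def using kernel_operator_continuous[OF a h] .
  \<comment> \<open>The estimate for the pair n, m is uniform in m >= n; Fatou's lemma for m to
    infinity replaces the second regularization by \<open>\<psi> k\<close>.\<close>
  have err: "(\<integral>x. \<bar>I n k x - \<psi> k x\<bar> powr p \<partial>\<sigma>) \<le> C powr p * \<rho> n" for n k
  proof -
    have "integrable \<sigma> (\<lambda>x. \<bar>I n k x - \<psi> k x\<bar> powr p) \<and> (\<integral>x. \<bar>I n k x - \<psi> k x\<bar> powr p \<partial>\<sigma>) \<le> C powr p * \<rho> n"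
    proof (rule fatou_integral[where f="\<lambda>m x. \<bar>I n k x - I m k x\<bar> powr p"])
      show "integrable \<sigma> (\<lambda>x. \<bar>I n k x - I m k x\<bar> powr p)" for m
        using p0 by (intro continuous_on_sphere_integrable continuous_on_powr' continuous_intros cI) auto
      show "AE x in sphere_measure. (\<lambda>m. \<bar>I n k x - I m k x\<bar> powr p) \<longlonglongrightarrow> \<bar>I n k x - \<psi> k x\<bar> powr p"
        using lim p0 unfolding I_def by (intro AE_I2 tendsto_intros) auto
      show "(\<lambda>x. \<bar>I n k x - \<psi> k x\<bar> powr p) \<in> borel_measurable \<sigma>"
        using p0 by (intro continuous_on_sphere_measurable continuous_on_powr' continuous_intros cI \<psi>) auto
      show "\<forall>\<^sub>F m in sequentially. (\<integral>x. \<bar>I n k x - I m k x\<bar> powr p \<partial>\<sigma>) \<le> C powr p * \<rho> n"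
        using eventually_ge_at_top[of n]
      proof eventually_elim
        case (elim m)
        have "(\<integral>x. \<bar>I n k x - I m k x\<bar> powr p \<partial>\<sigma>) =
            (\<integral>x. \<bar>\<integral>y. (b n x y - b m x y) * \<mu> k y \<partial>\<sigma>\<bar> powr p \<partial>\<sigma>)"
          by (intro Bochner_Integration.integral_cong) (auto simp: I_def eq)
        also have "\<dots> \<le> C powr p * \<rho> n"
        proof (rule kernel_operator_mean_le)
          show "continuous_on (sphere 0 1 \<times> sphere 0 1) (case_prod (\<lambda>x y. b n x y - b m x y))"
            using continuous_on_diff[OF b[of n] b[of m]] by (simp add: case_prod_beta')
        qed (use \<mu> \<rho> p elim in auto)
        finally show ?case .
      qed
    qed auto
    then show ?thesis by simp
  qed
  \<comment> \<open>The difference of \<open>\<psi> k\<close> and \<open>\<psi> l\<close> is split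
    into three terms, hence is at most 4 times their maximum.\<close>
  define D where "D = 4 powr p"
  have D: "D > 0" by (simp add: D_def)
  obtain n where n: "D * (2 * (C powr p * \<rho> n)) < e / 2"
  proof -
    have "(\<lambda>n. D * (2 * (C powr p * \<rho> n))) \<longlonglongrightarrow> D * (2 * (C powr p * 0))"
      by (intro tendsto_intros \<rho>)
    then have "\<forall>\<^sub>F n in sequentially. D * (2 * (C powr p * \<rho> n)) < e / 2"
      using e by (intro order_tendstoD(2)) auto
    then show thesis using that by (auto simp: eventually_sequentially)
  qed
  have m: "m > 0" unfolding m_def by (rule measure_sphere_measure_pos)
  \<comment> \<open>Solves \<open>D * (e' powr p * m) = e / 2\<close>: a uniform distance below e'
    of the n-th regularizations costs at most e / 2.\<close>
  define e' where "e' = (e / 2 / (D * m)) powr (1 / p)"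
  have e': "e' > 0" using e D m by (simp add: e'_def)
  have e'p: "D * (e' powr p * m) = e / 2"
    using e D m p0 by (simp add: e'_def powr_powr)
  obtain N where N: "\<And>k l x. k \<ge> N \<Longrightarrow> l \<ge> N \<Longrightarrow> norm x = 1 \<Longrightarrow> \<bar>I n k x - I n l x\<bar> < e'"
    using Cauchy[OF e', of n] unfolding I_def by blast
  have "(\<integral>x. \<bar>\<psi> k x - \<psi> l x\<bar> powr p \<partial>\<sigma>) < e" if kl: "k \<ge> N" "l \<ge> N" for k l
  proof -
    note c = continuous_on_sphere_integrable continuous_on_powr' continuous_intros cI \<psi>
    have i: "integrable \<sigma> (\<lambda>x. \<bar>I n k x - \<psi> k x\<bar> powr p)" for k
      using p0 by (intro c) auto
    have "(\<integral>x. \<bar>\<psi> k x - \<psi> l x\<bar> powr p \<partial>\<sigma>) \<le>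
      (\<integral>x. D * ((\<bar>I n k x - \<psi> k x\<bar> powr p + \<bar>I n l x - \<psi> l x\<bar> powr p) + e' powr p) \<partial>\<sigma>)"
    proof (rule integral_mono)
      show "integrable \<sigma> (\<lambda>x. \<bar>\<psi> k x - \<psi> l x\<bar> powr p)" using p0 by (intro c) auto
      show "integrable \<sigma> (\<lambda>x. D * ((\<bar>I n k x - \<psi> k x\<bar> powr p + \<bar>I n l x - \<psi> l x\<bar> powr p) + e' powr p))"
        using i by simp
      fix x :: 'a assume x: "x \<in> space \<sigma>"
      let ?A = "\<bar>I n k x - \<psi> k x\<bar>" and ?B = "\<bar>I n l x - \<psi> l x\<bar>"
      let ?M = "max (max ?A ?B) e'"
      have "\<bar>\<psi> k x - \<psi> l x\<bar> \<le> 4 * ?M"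
      proof -
        have "?A \<le> ?M" "?B \<le> ?M" "e' \<le> ?M" by auto
        moreover have "\<bar>I n k x - I n l x\<bar> < e'" using N[OF kl, of x] x by simp
        then have "\<bar>\<psi> k x - \<psi> l x\<bar> \<le> ?A + ?B + e'" by linarith
        moreover have "0 \<le> ?M" by auto
        ultimately show ?thesis by linarith
      qed
      then have "\<bar>\<psi> k x - \<psi> l x\<bar> powr p \<le> (4 * ?M) powr p"
        using p0 by (intro powr_mono2) auto
      also have "\<dots> = D * ?M powr p" using e' by (simp add: D_def powr_mult)
      also have "?M powr p \<le> (?A powr p + ?B powr p) + e' powr p"
        by (auto simp: max_def add_nonneg_nonneg)
      finally show "\<bar>\<psi> k x - \<psi> l x\<bar> powr p \<le> D * ((?A powr p + ?B powr p) + e' powr p)"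
        using D by simp
    qed
    also have "\<dots> = D * ((\<integral>x. \<bar>I n k x - \<psi> k x\<bar> powr p \<partial>\<sigma>) + (\<integral>x. \<bar>I n l x - \<psi> l x\<bar> powr p \<partial>\<sigma>))
        + D * (e' powr p * m)"
      using i by (simp add: m_def algebra_simps)
    also have "\<dots> \<le> D * (C powr p * \<rho> n + C powr p * \<rho> n) + e / 2"
      using D e'p err by (intro add_mono mult_left_mono) auto
    also have "\<dots> < e" using n by (simp add: algebra_simps)
    finally show ?thesis .
  qed
  then show ?thesis by blast
qed

section \<open>Zonal functions\<close>

lemma sum_Basis_inner_mult: "(\<Sum>b\<in>Basis. (u \<bullet> b) * (w \<bullet> b)) = u \<bullet> (w :: 'a::euclidean_space)"
  by (simp add: euclidean_inner[of u w])

lemma inner_unit_bound: "norm y = 1 \<Longrightarrow> y \<bullet> x \<in> {-norm x..norm (x :: 'a::euclidean_space)}"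
  using Cauchy_Schwarz_ineq2[of y x] by auto

text \<open>For unit y the product y . x stays between -|x| and |x|, so \<phi> has to be controlled
  only there.\<close>

lemma C1_sphere_zonal:
  fixes x :: "'a::euclidean_space"
  assumes \<phi>: "\<And>s. s \<in> {-norm x..norm x} \<Longrightarrow> (\<phi> has_real_derivative \<phi>' s) (at s)"
    and cont: "continuous_on {-norm x..norm x} \<phi>'"
  shows "C1_sphere (\<lambda>y. \<phi> (y \<bullet> x))"
    "norm y = 1 \<Longrightarrow> sderiv (\<lambda>y. \<phi> (y \<bullet> x)) y v = \<phi>' (y \<bullet> x) * (sproj y v \<bullet> x)"
proof -
  have 1: "norm y = 1 \<Longrightarrow> (\<phi> has_real_derivative \<phi>' (y \<bullet> x)) (at (y \<bullet> x))" for y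
    using \<phi> inner_unit_bound by blast
  have 2: "continuous_on ((\<lambda>y. y \<bullet> x) ` sphere 0 1) \<phi>'"
    using inner_unit_bound by (intro continuous_on_subset[OF cont]) force
  show "C1_sphere (\<lambda>y. \<phi> (y \<bullet> x))"
    by (rule C1_sphere_compose(1)[OF C1_sphere_inner(1) 1 2])
  show "norm y = 1 \<Longrightarrow> sderiv (\<lambda>y. \<phi> (y \<bullet> x)) y v = \<phi>' (y \<bullet> x) * (sproj y v \<bullet> x)"
    using C1_sphere_compose(2)[OF C1_sphere_inner(1) 1 2] by (simp add: C1_sphere_inner)
qed

lemma slaplacian_zonal:
  fixes x :: "'a::euclidean_space"
  assumes \<phi>: "\<And>s. s \<in> {-norm x..norm x} \<Longrightarrow> (\<phi> has_real_derivative \<phi>' s) (at s)"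
    and \<phi>': "\<And>s. s \<in> {-norm x..norm x} \<Longrightarrow> (\<phi>' has_real_derivative \<phi>'' s) (at s)"
    and cont: "continuous_on {-norm x..norm x} \<phi>''"
  shows "C2_sphere (\<lambda>y. \<phi> (y \<bullet> x))"
    "norm y = 1 \<Longrightarrow> slaplacian (\<lambda>y. \<phi> (y \<bullet> x)) y =
      \<phi>'' (y \<bullet> x) * (x \<bullet> x - (y \<bullet> x)\<^sup>2) - (real DIM('a) - 1) * (y \<bullet> x) * \<phi>' (y \<bullet> x)"
proof -
  have cont': "continuous_on {-norm x..norm x} \<phi>'"
    using \<phi>' by (intro continuous_at_imp_continuous_on ballI DERIV_isCont) auto
  note d1 = C1_sphere_zonal[OF \<phi> cont'] and d2 = C1_sphere_zonal[OF \<phi>' cont]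
  \<comment> \<open>Component b of the gradient, which is \<phi>' (y . x) times
    \<open>sproj y x\<close>, in a form that depends on y only through inner products.\<close>
  define G where "G b y = \<phi>' (y \<bullet> x) * (b \<bullet> x + (-1) * ((y \<bullet> b) * (y \<bullet> x)))" for b y
  have G: "C1_sphere (G b)" "norm y = 1 \<Longrightarrow> sderiv (G b) y v =
     \<phi>' (y \<bullet> x) * ((-1) * ((y \<bullet> b) * (sproj y v \<bullet> x) + (sproj y v \<bullet> b) * (y \<bullet> x)))
     + \<phi>'' (y \<bullet> x) * (sproj y v \<bullet> x) * (b \<bullet> x + (-1) * ((y \<bullet> b) * (y \<bullet> x)))" for b y v
  proof -
    have c: "C1_sphere (\<lambda>y. (y \<bullet> b) * (y \<bullet> x))" "norm y = 1 \<Longrightarrow> sderiv (\<lambda>y. (y \<bullet> b) * (y \<bullet> x)) y v =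
        (y \<bullet> b) * (sproj y v \<bullet> x) + (sproj y v \<bullet> b) * (y \<bullet> x)" for y v
      using C1_sphere_mult[OF C1_sphere_inner(1)[of b] C1_sphere_inner(1)[of x]] by (simp_all add: C1_sphere_inner)
    have c': "C1_sphere (\<lambda>y. (b \<bullet> x + (-1) * ((y \<bullet> b) * (y \<bullet> x))))"
      "norm y = 1 \<Longrightarrow> sderiv (\<lambda>y. (b \<bullet> x + (-1) * ((y \<bullet> b) * (y \<bullet> x)))) y v =
        (-1) * ((y \<bullet> b) * (sproj y v \<bullet> x) + (sproj y v \<bullet> b) * (y \<bullet> x))" for y v
      using C1_sphere_add[OF C1_sphere_const(1)[of "b \<bullet> x"] C1_sphere_cmult(1)[OF c(1), of "-1"]]
      by (simp_all only: C1_sphere_const(2) C1_sphere_cmult(2)[OF c(1)] c(2) add_0_left)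
    show "C1_sphere (G b)"
      unfolding G_def by (rule C1_sphere_mult(1)[OF d2(1) c'(1)])
    show "norm y = 1 \<Longrightarrow> sderiv (G b) y v =
     \<phi>' (y \<bullet> x) * ((-1) * ((y \<bullet> b) * (sproj y v \<bullet> x) + (sproj y v \<bullet> b) * (y \<bullet> x)))
     + \<phi>'' (y \<bullet> x) * (sproj y v \<bullet> x) * (b \<bullet> x + (-1) * ((y \<bullet> b) * (y \<bullet> x)))"
      unfolding G_def using C1_sphere_mult(2)[OF d2(1) c'(1)] d2(2) c'(2) by simp
  qed
  have eq: "norm y = 1 \<Longrightarrow> sderiv (\<lambda>y. \<phi> (y \<bullet> x)) y b = G b y" for y b
    by (subst d1(2)) (auto simp: G_def sproj_def inner_diff_left inner_diff_right inner_commute)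
  have "C1_sphere (\<lambda>y. sderiv (\<lambda>y. \<phi> (y \<bullet> x)) y b)" for b
    by (rule C1_sphere_cong[OF _ G(1)]) (simp add: eq)
  then show C2: "C2_sphere (\<lambda>y. \<phi> (y \<bullet> x))" using d1 by (simp add: C2_sphere_def)
  assume y: "norm y = 1"
  have inner_y: "y \<bullet> y = 1" using y by (simp add: dot_square_norm)
  define P where "P = sproj y x"
  have Pb: "sproj y b \<bullet> x = P \<bullet> b" for b
    unfolding P_def using inner_sproj_commute[of y x b] inner_commute[of x] by simp
  have "slaplacian (\<lambda>y. \<phi> (y \<bullet> x)) y = (\<Sum>b\<in>Basis. sderiv (G b) y b)"
    unfolding slaplacian_eq[OF C2 y] by (intro sum.cong refl sderiv_cong eq y)
  also have "\<dots> = (\<Sum>b\<in>Basis. - \<phi>' (y \<bullet> x) * ((P \<bullet> b) * (y \<bullet> b)) - \<phi>' (y \<bullet> x) * (y \<bullet> x) * (1 - (y \<bullet> b) * (y \<bullet> b))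
      + \<phi>'' (y \<bullet> x) * ((P \<bullet> b) * (x \<bullet> b)) - \<phi>'' (y \<bullet> x) * (y \<bullet> x) * ((P \<bullet> b) * (y \<bullet> b)))"
  proof (intro sum.cong refl)
    fix b :: 'a assume "b \<in> Basis"
    then have sb: "sproj y b \<bullet> b = 1 - (y \<bullet> b) * (y \<bullet> b)"
      by (simp add: sproj_def inner_diff_left inner_diff_right inner_commute)
    show "sderiv (G b) y b = - \<phi>' (y \<bullet> x) * ((P \<bullet> b) * (y \<bullet> b)) - \<phi>' (y \<bullet> x) * (y \<bullet> x) * (1 - (y \<bullet> b) * (y \<bullet> b))
      + \<phi>'' (y \<bullet> x) * ((P \<bullet> b) * (x \<bullet> b)) - \<phi>'' (y \<bullet> x) * (y \<bullet> x) * ((P \<bullet> b) * (y \<bullet> b))"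
      unfolding G(2)[OF y] Pb sb inner_commute[of b x] by (simp add: algebra_simps)
  qed
  also have "\<dots> = - \<phi>' (y \<bullet> x) * (P \<bullet> y) - \<phi>' (y \<bullet> x) * (y \<bullet> x) * (DIM('a) - y \<bullet> y)
      + \<phi>'' (y \<bullet> x) * (P \<bullet> x) - \<phi>'' (y \<bullet> x) * (y \<bullet> x) * (P \<bullet> y)"
    by (simp only: sum.distrib sum_subtractf sum_distrib_left[symmetric] sum_Basis_inner_mult sum_constant)
       simp
  also have "P \<bullet> y = 0" using y by (simp add: P_def sproj_inner_self)
  also have "P \<bullet> x = x \<bullet> x - (y \<bullet> x)\<^sup>2"
    by (simp add: P_def sproj_def inner_diff_left inner_diff_right power2_eq_square inner_commute)
  finally show "slaplacian (\<lambda>y. \<phi> (y \<bullet> x)) y =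
      \<phi>'' (y \<bullet> x) * (x \<bullet> x - (y \<bullet> x)\<^sup>2) - (real DIM('a) - 1) * (y \<bullet> x) * \<phi>' (y \<bullet> x)"
    by (simp add: inner_y algebra_simps)
qed

lemma slaplacian_mult:
  fixes F G :: "'a::euclidean_space \<Rightarrow> real"
  assumes F: "C2_sphere F" and G: "C2_sphere G"
  shows "C2_sphere (\<lambda>x. F x * G x)"
    "norm x = 1 \<Longrightarrow> slaplacian (\<lambda>x. F x * G x) x = F x * slaplacian G x + slaplacian F x * G x
      + 2 * (\<Sum>b\<in>Basis. sderiv F x b * sderiv G x b)"
proof -
  have F1: "C1_sphere F" "C1_sphere (\<lambda>x. sderiv F x b)" and G1: "C1_sphere G" "C1_sphere (\<lambda>x. sderiv G x b)" for b
    using F G by (auto simp: C2_sphere_def)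
  define H where "H b x = F x * sderiv G x b + sderiv F x b * G x" for b x
  have H: "C1_sphere (H b)" "norm x = 1 \<Longrightarrow> sderiv (H b) x v =
      (F x * sderiv (\<lambda>x. sderiv G x b) x v + sderiv F x v * sderiv G x b)
      + (sderiv F x b * sderiv G x v + sderiv (\<lambda>x. sderiv F x b) x v * G x)" for b x v
    unfolding H_def using F1 G1 by (auto simp: C1_sphere_add C1_sphere_mult)
  have eq: "norm x = 1 \<Longrightarrow> sderiv (\<lambda>x. F x * G x) x b = H b x" for x b
    by (simp add: C1_sphere_mult F1 G1 H_def)
  have "C1_sphere (\<lambda>x. sderiv (\<lambda>x. F x * G x) x b)" for b
    by (rule C1_sphere_cong[OF _ H(1)]) (simp add: eq)
  then show C2: "C2_sphere (\<lambda>x. F x * G x)" using C1_sphere_mult F1 G1 by (auto simp: C2_sphere_def)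
  assume x: "norm x = 1"
  have "slaplacian (\<lambda>x. F x * G x) x = (\<Sum>b\<in>Basis. sderiv (H b) x b)"
    unfolding slaplacian_eq[OF C2 x] by (intro sum.cong refl sderiv_cong eq x)
  also have "\<dots> = (\<Sum>b\<in>Basis. F x * sderiv (\<lambda>x. sderiv G x b) x b + sderiv (\<lambda>x. sderiv F x b) x b * G x
      + 2 * (sderiv F x b * sderiv G x b))"
    using x by (intro sum.cong) (simp_all add: H algebra_simps)
  finally show "slaplacian (\<lambda>x. F x * G x) x = F x * slaplacian G x + slaplacian F x * G x
      + 2 * (\<Sum>b\<in>Basis. sderiv F x b * sderiv G x b)"
    using x F G by (simp add: slaplacian_eq sum.distrib sum_distrib_left sum_distrib_right)
qed

lemma integral_slaplacian_commute:
  fixes F G :: "real^'n::{finite,wellorder} \<Rightarrow> real"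
  assumes "C2_sphere F" "C2_sphere G"
  shows "(\<integral>x. G x * slaplacian F x \<partial>\<sigma>) = (\<integral>x. F x * slaplacian G x \<partial>\<sigma>)"
  using assms by (simp add: integral_slaplacian C2_sphere_def mult.commute)

lemma integral_slaplacian_eq_0:
  fixes F :: "real^'n::{finite,wellorder} \<Rightarrow> real"
  assumes "C2_sphere F"
  shows "(\<integral>x. slaplacian F x \<partial>\<sigma>) = 0"
proof -
  have "(\<integral>x. 1 * slaplacian F x \<partial>\<sigma>) = - (\<integral>x. (\<Sum>b\<in>Basis. sderiv (\<lambda>_. 1 :: real) x b * sderiv F x b) \<partial>(\<sigma> :: (real^'n::_) measure))"
    by (intro integral_slaplacian assms C1_sphere_const)
  also have "(\<integral>x. (\<Sum>b\<in>Basis. sderiv (\<lambda>_. 1 :: real) x b * sderiv F x b) \<partial>(\<sigma> :: (real^'n::_) measure)) = (\<integral>x. 0 \<partial>(\<sigma> :: (real^'n::_) measure))"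
    by (intro Bochner_Integration.integral_cong refl sum.neutral ballI) (simp add: C1_sphere_const)
  finally show ?thesis by simp
qed

section \<open>The logarithmic kernel on the 2-sphere and its regularization\<close>

text \<open>On the 2-sphere the Laplacian of \<open>y \<mapsto> ln (1 - x \<bullet> y)\<close> is a multiple of the Dirac mass at \<open>x\<close>
  minus a constant. The shift by \<open>e > 0\<close> replaces the Dirac mass by the smooth kernel \<open>dirac_ker e\<close>, which has
  constant mass. The functions with a prime are derivatives.\<close>

definition log_ker :: "real \<Rightarrow> real \<Rightarrow> real" where "log_ker e s = ln (1 + e - s)"
definition log_ker' :: "real \<Rightarrow> real \<Rightarrow> real" where "log_ker' e s = - (1 / (1 + e - s))"
definition dirac_ker :: "real \<Rightarrow> real \<Rightarrow> real" where "dirac_ker e s = (2 * e + e\<^sup>2) / (1 + e - s)^2"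
definition dirac_ker' :: "real \<Rightarrow> real \<Rightarrow> real" where "dirac_ker' e s = 2 * (2 * e + e\<^sup>2) / (1 + e - s)^3"

abbreviation "sphere_area \<equiv> measure \<sigma> (sphere 0 (1::real) :: (real^3) set)"

lemma log_ker_derivatives:
  assumes "e > 0" "s \<le> 1"
  shows "(log_ker e has_real_derivative log_ker' e s) (at s)"
    "(log_ker' e has_real_derivative - (1 / (1 + e - s)^2)) (at s)"
    "((\<lambda>s. - (1 / (1 + e - s)^2)) has_real_derivative - (2 / (1 + e - s)^3)) (at s)"
    "(dirac_ker e has_real_derivative dirac_ker' e s) (at s)"
  unfolding log_ker_def[abs_def] log_ker'_def[abs_def] dirac_ker_def[abs_def] dirac_ker'_def[abs_def]
  using assms
  by (auto intro!: derivative_eq_intros simp: divide_simps power2_eq_square power3_eq_cube)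
     (auto simp: algebra_simps)

lemma log_ker_continuous:
  assumes "e > 0"
  shows "continuous_on {..1} (log_ker e)" "continuous_on {..1} (log_ker' e)" "continuous_on {..1} (dirac_ker e)"
    "continuous_on {..1} (dirac_ker' e)" "continuous_on {..1} (\<lambda>s. - (1 / (1 + e - s)^2))"
    "continuous_on {..1} (\<lambda>s. - (2 / (1 + e - s)^3))"
  unfolding log_ker_def[abs_def] log_ker'_def[abs_def] dirac_ker_def[abs_def] dirac_ker'_def[abs_def]
  using assms by (auto intro!: continuous_intros)

context
  fixes x :: "real^3" and e :: real
  assumes x: "norm x = 1" and e: "e > 0"
begin

lemma inner_le_1: "norm y = 1 \<Longrightarrow> y \<bullet> x \<le> 1" using inner_unit_bound[of y x] x by simp

lemma zonal_continuous:
  assumes "continuous_on {..1} \<phi>"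
  shows "continuous_on (sphere 0 1) (\<lambda>y. \<phi> (y \<bullet> x))"
  by (rule continuous_on_compose2[OF assms]) (auto intro!: continuous_intros inner_le_1)

text \<open>With u = 1 + e - s the zonal formula gives (-(1 - s^2) + 2 s u) / u^2. Adding u^2 to the
  numerator leaves (1 + e)^2 - 1 = 2 e + e^2, which is the origin of the constant in
  \<open>dirac_ker\<close>.\<close>

lemma C2_log_ker: "C2_sphere (\<lambda>y. log_ker e (y \<bullet> x))"
  and slaplacian_log_ker: "norm y = 1 \<Longrightarrow> slaplacian (\<lambda>y. log_ker e (y \<bullet> x)) y = dirac_ker e (y \<bullet> x) - 1"
proof -
  note * = slaplacian_zonal[where x=x and \<phi>="log_ker e" and \<phi>'="log_ker' e" and \<phi>''="\<lambda>s. - (1 / (1 + e - s)^2)"]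
  have 1: "s \<in> {-norm x..norm x} \<Longrightarrow> s \<le> 1" for s using x by auto
  have 2: "continuous_on {-norm x..norm x} (\<lambda>s. - (1 / (1 + e - s)^2))"
    using log_ker_continuous(5)[OF e] by (rule continuous_on_subset) (use x in auto)
  show "C2_sphere (\<lambda>y. log_ker e (y \<bullet> x))"
    using e 1 by (intro * log_ker_derivatives 2) auto
  assume y: "norm y = 1"
  have "slaplacian (\<lambda>y. log_ker e (y \<bullet> x)) y =
     - (1 / (1 + e - y \<bullet> x)^2) * (x \<bullet> x - (y \<bullet> x)\<^sup>2) - (real DIM(real^3) - 1) * (y \<bullet> x) * log_ker' e (y \<bullet> x)"
    using e 1 by (intro * log_ker_derivatives 2 y) auto
  also have "\<dots> = dirac_ker e (y \<bullet> x) - 1"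
    using inner_le_1[OF y] e x
    by (simp add: log_ker'_def dirac_ker_def dot_square_norm divide_simps power2_eq_square)
       (auto simp: algebra_simps)
  finally show "slaplacian (\<lambda>y. log_ker e (y \<bullet> x)) y = dirac_ker e (y \<bullet> x) - 1" .
qed

lemma C1_dirac_ker: "C1_sphere (\<lambda>y. dirac_ker e (y \<bullet> x))"
  and sderiv_dirac_ker: "norm y = 1 \<Longrightarrow> sderiv (\<lambda>y. dirac_ker e (y \<bullet> x)) y w = dirac_ker' e (y \<bullet> x) * (sproj y w \<bullet> x)"
proof -
  note * = C1_sphere_zonal[where x=x and \<phi>="dirac_ker e" and \<phi>'="dirac_ker' e"]
  have 1: "s \<in> {-norm x..norm x} \<Longrightarrow> s \<le> 1" for s using x by auto
  have 2: "continuous_on {-norm x..norm x} (dirac_ker' e)"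
    using log_ker_continuous(4)[OF e] by (rule continuous_on_subset) (use x in auto)
  show "C1_sphere (\<lambda>y. dirac_ker e (y \<bullet> x))"
    using e 1 by (intro * log_ker_derivatives 2) auto
  show "norm y = 1 \<Longrightarrow> sderiv (\<lambda>y. dirac_ker e (y \<bullet> x)) y w = dirac_ker' e (y \<bullet> x) * (sproj y w \<bullet> x)"
    using e 1 by (intro * log_ker_derivatives 2) auto
qed

text \<open>This is the identity for \<open>log_ker\<close> differentiated in x along the tangent
  direction v. It is verified by the product rule; the orthogonality of v and x evaluates the
  product of the gradients of y . x and y . v.\<close>

lemma C2_log_ker'_mult: "v \<bullet> x = 0 \<Longrightarrow> C2_sphere (\<lambda>y. log_ker' e (y \<bullet> x) * (y \<bullet> v))"
  and slaplacian_log_ker'_mult: "v \<bullet> x = 0 \<Longrightarrow> norm y = 1 \<Longrightarrow>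
    slaplacian (\<lambda>y. log_ker' e (y \<bullet> x) * (y \<bullet> v)) y = dirac_ker' e (y \<bullet> x) * (y \<bullet> v)"
proof -
  let ?\<phi>' = "\<lambda>s. - (1 / (1 + e - s)^2)" and ?\<phi>'' = "\<lambda>s. - (2 / (1 + e - s)^3)"
  note * = slaplacian_zonal[where x=x and \<phi>="log_ker' e" and \<phi>'="?\<phi>'" and \<phi>''="?\<phi>''"]
  have 1: "s \<in> {-norm x..norm x} \<Longrightarrow> s \<le> 1" for s using x by auto
  have 2: "continuous_on {-norm x..norm x} ?\<phi>''"
    using log_ker_continuous(6)[OF e] by (rule continuous_on_subset) (use x in auto)
  have 3: "continuous_on {-norm x..norm x} ?\<phi>'"
    using log_ker_continuous(5)[OF e] by (rule continuous_on_subset) (use x in auto)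
  have F: "C2_sphere (\<lambda>y. log_ker' e (y \<bullet> x))"
    using e 1 by (intro * log_ker_derivatives 2) auto
  have lin: "C2_sphere (\<lambda>y. y \<bullet> v)" "norm y = 1 \<Longrightarrow> slaplacian (\<lambda>y. y \<bullet> v) y = - 2 * (y \<bullet> v)" for y
    using slaplacian_zonal[of v "\<lambda>s. s" "\<lambda>_. 1" "\<lambda>_. 0"] by auto
  show "C2_sphere (\<lambda>y. log_ker' e (y \<bullet> x) * (y \<bullet> v))"
    by (rule slaplacian_mult(1)[OF F lin(1)])
  assume v: "v \<bullet> x = 0" and y: "norm y = 1"
  have u: "1 + e - y \<bullet> x > 0" using inner_le_1[OF y] e by simp
  have d: "sderiv (\<lambda>y. log_ker' e (y \<bullet> x)) y b = ?\<phi>' (y \<bullet> x) * (sproj y b \<bullet> x)" for b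
    using e 1 y by (intro C1_sphere_zonal log_ker_derivatives 3) auto
  have "(\<Sum>b\<in>Basis. sderiv (\<lambda>y. log_ker' e (y \<bullet> x)) y b * sderiv (\<lambda>y. y \<bullet> v) y b)
      = ?\<phi>' (y \<bullet> x) * (\<Sum>b\<in>Basis. (sproj y x \<bullet> b) * (sproj y v \<bullet> b))"
    unfolding sum_distrib_left d C1_sphere_inner(2)[OF y]
  proof (intro sum.cong refl)
    fix b :: "real^3"
    have "sproj y b \<bullet> x = sproj y x \<bullet> b" "sproj y b \<bullet> v = sproj y v \<bullet> b"
      by (simp_all add: inner_sproj_commute inner_commute[of _ b])
    then show "?\<phi>' (y \<bullet> x) * (sproj y b \<bullet> x) * (sproj y b \<bullet> v) = ?\<phi>' (y \<bullet> x) * ((sproj y x \<bullet> b) * (sproj y v \<bullet> b))"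
      by simp
  qed
  also have "\<dots> = ?\<phi>' (y \<bullet> x) * (- (y \<bullet> x) * (y \<bullet> v))"
  proof -
    have "sproj y x \<bullet> sproj y v = x \<bullet> sproj y v" using y by (simp add: inner_sproj_commute sproj_sproj)
    also have "\<dots> = - (y \<bullet> x) * (y \<bullet> v)" using v by (simp add: sproj_def inner_diff_right inner_commute)
    finally show ?thesis by (simp only: sum_Basis_inner_mult)
  qed
  finally have cross: "(\<Sum>b\<in>Basis. sderiv (\<lambda>y. log_ker' e (y \<bullet> x)) y b * sderiv (\<lambda>y. y \<bullet> v) y b)
      = ?\<phi>' (y \<bullet> x) * (- (y \<bullet> x) * (y \<bullet> v))" .
  have L: "slaplacian (\<lambda>y. log_ker' e (y \<bullet> x)) y = ?\<phi>'' (y \<bullet> x) * (x \<bullet> x - (y \<bullet> x)\<^sup>2)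
      - (real DIM(real^3) - 1) * (y \<bullet> x) * ?\<phi>' (y \<bullet> x)"
    using e 1 by (intro * log_ker_derivatives 2 y) auto
  have "slaplacian (\<lambda>y. log_ker' e (y \<bullet> x) * (y \<bullet> v)) y =
      (log_ker' e (y \<bullet> x) * (- 2) + (?\<phi>'' (y \<bullet> x) * (1 - (y \<bullet> x)\<^sup>2)
      - 2 * (y \<bullet> x) * ?\<phi>' (y \<bullet> x)) + 2 * (?\<phi>' (y \<bullet> x) * (- (y \<bullet> x)))) * (y \<bullet> v)"
    unfolding slaplacian_mult(2)[OF F lin(1) y] cross L lin(2)[OF y]
    using x by (simp add: dot_square_norm algebra_simps)
  also have "log_ker' e s * (- 2) + (?\<phi>'' s * (1 - s\<^sup>2) - 2 * s * ?\<phi>' s) + 2 * (?\<phi>' s * (- s)) = dirac_ker' e s"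
    if "1 + e - s > 0" for s
  proof -
    define u where "u = 1 + e - s"
    have s: "s = 1 + e - u" by (simp add: u_def)
    have "u > 0" using that by (simp add: u_def)
    then show ?thesis
      unfolding log_ker'_def dirac_ker'_def u_def[symmetric]
      by (simp add: divide_simps power2_eq_square power3_eq_cube) (simp add: s algebra_simps)
  qed
  finally show "slaplacian (\<lambda>y. log_ker' e (y \<bullet> x) * (y \<bullet> v)) y = dirac_ker' e (y \<bullet> x) * (y \<bullet> v)"
    using u by simp
qed

text \<open>Green's second identity for \<open>log_ker\<close> and h. The first summand does not
  depend on e, so differences of regularizations see only the Laplacian of h.\<close>

lemma integral_dirac_ker:
  assumes h: "C2_sphere h"
  shows "(\<integral>y. dirac_ker e (y \<bullet> x) * h y \<partial>\<sigma>) =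
    (\<integral>y. h y \<partial>\<sigma>) + (\<integral>y. log_ker e (y \<bullet> x) * slaplacian h y \<partial>\<sigma>)"
proof -
  have ch: "continuous_on (sphere 0 1) h" using h by (simp add: C2_sphere_def C1_sphere_continuous)
  have "(\<integral>y. log_ker e (y \<bullet> x) * slaplacian h y \<partial>\<sigma>) =
      (\<integral>y. h y * slaplacian (\<lambda>y. log_ker e (y \<bullet> x)) y \<partial>\<sigma>)"
    by (rule integral_slaplacian_commute[OF h C2_log_ker])
  also have "\<dots> = (\<integral>y. dirac_ker e (y \<bullet> x) * h y - h y \<partial>\<sigma>)"
    by (intro Bochner_Integration.integral_cong) (auto simp: slaplacian_log_ker algebra_simps)
  also have "\<dots> = (\<integral>y. dirac_ker e (y \<bullet> x) * h y \<partial>\<sigma>) - (\<integral>y. h y \<partial>\<sigma>)"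
    using ch by (intro Bochner_Integration.integral_diff continuous_on_sphere_integrable continuous_intros
        zonal_continuous log_ker_continuous e)
  finally show ?thesis by simp
qed

text \<open>The representation of h differentiated in x along v, in which the integral of h has
  dropped out.\<close>

lemma integral_dirac_ker'_mult:
  assumes h: "C2_sphere h" and v: "v \<bullet> x = 0"
  shows "(\<integral>y. dirac_ker' e (y \<bullet> x) * (y \<bullet> v) * h y \<partial>\<sigma>) =
    (\<integral>y. log_ker' e (y \<bullet> x) * (y \<bullet> v) * slaplacian h y \<partial>\<sigma>)"
proof -
  have "(\<integral>y. log_ker' e (y \<bullet> x) * (y \<bullet> v) * slaplacian h y \<partial>\<sigma>) =
      (\<integral>y. h y * slaplacian (\<lambda>y. log_ker' e (y \<bullet> x) * (y \<bullet> v)) y \<partial>\<sigma>)"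
    by (rule integral_slaplacian_commute[OF h C2_log_ker'_mult[OF v]])
  also have "\<dots> = (\<integral>y. dirac_ker' e (y \<bullet> x) * (y \<bullet> v) * h y \<partial>\<sigma>)"
    using v by (intro Bochner_Integration.integral_cong refl) (simp add: slaplacian_log_ker'_mult)
  finally show ?thesis by simp
qed

text \<open>The representation formula for the constant 1, whose Laplacian vanishes.\<close>

lemma integral_dirac_ker_1: "(\<integral>y. dirac_ker e (y \<bullet> x) \<partial>\<sigma>) = sphere_area"
proof -
  have c: "C2_sphere (\<lambda>_ :: real^3. 1 :: real)"
    using slaplacian_zonal(1)[of "0 :: real^3" "\<lambda>_. 1" "\<lambda>_. 0" "\<lambda>_. 0"] by simp
  have "slaplacian (\<lambda>_ :: real^3. 1 :: real) y = 0" if "norm y = 1" for y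
    using slaplacian_zonal(2)[of "0 :: real^3" "\<lambda>_. 1" "\<lambda>_. 0" "\<lambda>_. 0" y] that by simp
  then have "(\<integral>y. log_ker e (y \<bullet> x) * slaplacian (\<lambda>_ :: real^3. 1 :: real) y \<partial>\<sigma>) = (\<integral>y. 0 \<partial>(\<sigma> :: (real^3) measure))"
    by (intro Bochner_Integration.integral_cong) auto
  then show ?thesis using integral_dirac_ker[OF c] by simp
qed

text \<open>Integration by parts along a rotation field has no divergence term. By antisymmetry of
  \<open>rotgen\<close>, rotating y in y . x amounts to rotating x backwards, so regularization
  commutes with rotational derivatives.\<close>

lemma integral_dirac_ker_rotgen:
  assumes h: "C1_sphere h"
  shows "(\<integral>y. dirac_ker e (y \<bullet> x) * sderiv h y (rotgen i j y) \<partial>\<sigma>) =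
    (\<integral>y. dirac_ker' e (y \<bullet> x) * (y \<bullet> rotgen i j x) * h y \<partial>\<sigma>)"
proof -
  note c = continuous_on_sphere_integrable continuous_intros zonal_continuous log_ker_continuous e
    C1_sphere_continuous h
  have ch: "continuous_on (sphere 0 1) (\<lambda>y. sderiv h y (rotgen i j y))"
  proof (rule continuous_on_eq)
    show "continuous_on (sphere 0 1) (\<lambda>y. y $ i * sderiv h y (axis j 1) - y $ j * sderiv h y (axis i 1))"
      by (intro continuous_intros C1_sphere_continuous_sderiv h)
  qed (use linear_diff[OF linear_sderiv[OF h]] linear_scale[OF linear_sderiv[OF h]] in \<open>simp add: rotgen_def\<close>)
  have r: "rotgen i j y \<bullet> x = - (y \<bullet> rotgen i j x)" for y
    by (simp add: rotgen_def inner_diff_left inner_diff_right inner_axis inner_axis')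
  have i: "integrable \<sigma> (\<lambda>y. dirac_ker e (y \<bullet> x) * sderiv h y (rotgen i j y))"
    by (intro c ch)
  have i': "integrable \<sigma> (\<lambda>y. dirac_ker' e (y \<bullet> x) * (y \<bullet> rotgen i j x) * h y)"
    by (intro c)
  have "0 = (\<integral>y. sderiv (\<lambda>y. dirac_ker e (y \<bullet> x) * h y) y (rotgen i j y) \<partial>\<sigma>)"
    by (rule integral_sderiv_rotgen[OF C1_sphere_mult(1)[OF C1_dirac_ker h], symmetric])
  also have "\<dots> = (\<integral>y. dirac_ker e (y \<bullet> x) * sderiv h y (rotgen i j y) -
      dirac_ker' e (y \<bullet> x) * (y \<bullet> rotgen i j x) * h y \<partial>\<sigma>)"
    by (intro Bochner_Integration.integral_cong)
      (auto simp: C1_sphere_mult[OF C1_dirac_ker h] sderiv_dirac_ker sproj_id rotgen_inner_self r)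
  finally show ?thesis using i i' by simp
qed

text \<open>The bound is uniform in e. The Laplacian of \<open>(1 + e - s) powr (1 - b)\<close>, s =
  y . x, integrates to 0, and divided by 1 - b it is at least 2 - 2 b times the integrand minus a
  constant.\<close>

lemma integral_powr_kernel_le:
  assumes b: "0 \<le> b" "b < 1" and e1: "e \<le> 1"
  shows "(\<integral>y. (1 + e - y \<bullet> x) powr (-b) \<partial>\<sigma>) \<le> 3 / (1 - b) * sphere_area"
proof -
  define u where "u s = 1 + e - s" for s
  define \<phi> where "\<phi> s = u s powr (1 - b)" for s
  define \<phi>' where "\<phi>' s = - (1 - b) * u s powr (-b)" for s
  define \<phi>'' where "\<phi>'' s = - (1 - b) * b * u s powr (-b - 1)" for s
  have u: "s \<le> 1 \<Longrightarrow> u s > 0" for s using e by (simp add: u_def)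
  have 1: "s \<in> {-norm x..norm x} \<Longrightarrow> s \<le> 1" for s using x by auto
  have d: "(\<phi> has_real_derivative \<phi>' s) (at s)" "(\<phi>' has_real_derivative \<phi>'' s) (at s)" if "s \<le> 1" for s
  proof -
    have du: "(u has_real_derivative -1) (at s)"
      unfolding u_def[abs_def] by (auto intro!: derivative_eq_intros)
    have p: "((\<lambda>s. u s powr r) has_real_derivative r * u s powr (r - 1) * (-1)) (at s)" for r
      by (rule DERIV_chain2[OF has_real_derivative_powr[OF u[OF that]] du])
    show "(\<phi> has_real_derivative \<phi>' s) (at s)"
      using p[of "1 - b"] by (simp add: \<phi>_def[abs_def] \<phi>'_def algebra_simps)
    show "(\<phi>' has_real_derivative \<phi>'' s) (at s)"
      using DERIV_cmult[OF p[of "-b"], of "- (1 - b)"] by (simp add: \<phi>'_def[abs_def] \<phi>''_def algebra_simps)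
  qed
  have c: "continuous_on {-norm x..norm x} \<phi>''"
    unfolding \<phi>''_def[abs_def] u_def[abs_def]
    using e x by (auto intro!: continuous_intros)
  have C2: "C2_sphere (\<lambda>y. \<phi> (y \<bullet> x))"
    by (rule slaplacian_zonal(1)[OF d(1) d(2) c]) (use 1 in auto)
  have L: "slaplacian (\<lambda>y. \<phi> (y \<bullet> x)) y = \<phi>'' (y \<bullet> x) * (1 - (y \<bullet> x)\<^sup>2) - 2 * (y \<bullet> x) * \<phi>' (y \<bullet> x)"
    if "norm y = 1" for y
    using slaplacian_zonal(2)[OF d(1) d(2) c that] 1 x by (auto simp: dot_square_norm)
  have cont: "continuous_on (sphere 0 1) (\<lambda>y. u (y \<bullet> x) powr (-b))"
    unfolding u_def using inner_le_1 e by (fastforce intro!: continuous_intros)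
  \<comment> \<open>Twice 1 - s is replaced by the larger u. The constant 3 bounds u, as e <= 1 and
    -1 <= s, and then also \<open>u s powr (1 - b)\<close>.\<close>
  have key: "(2 - 2 * b) * u s powr (-b) - (2 - b) * 3 \<le> (\<phi>'' s * (1 - s\<^sup>2) - 2 * s * \<phi>' s) / (1 - b)"
    if s: "s \<le> 1" "s \<ge> -1" for s
  proof -
    have us: "u s > 0" "u s \<le> 3" using s e e1 by (auto simp: u_def)
    have p1: "u s powr (-b) = u s * u s powr (-b - 1)"
      using us powr_mult_base[of "u s" "-b - 1"] by simp
    have "(\<phi>'' s * (1 - s\<^sup>2) - 2 * s * \<phi>' s) / (1 - b) = - (b * u s powr (-b - 1) * (1 - s\<^sup>2)) + 2 * s * u s powr (-b)"
      using b by (simp add: \<phi>''_def \<phi>'_def field_simps)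
    then have E: "(\<phi>'' s * (1 - s\<^sup>2) - 2 * s * \<phi>' s) / (1 - b) =
      - (b * u s powr (-b - 1) * ((1 - s) * (1 + s))) + 2 * s * u s powr (-b)"
      by (simp add: power2_eq_square algebra_simps)
    have "- (b * u s powr (-b - 1) * ((1 - s) * (1 + s))) + 2 * s * u s powr (-b)
        \<ge> - (b * u s powr (-b - 1) * (u s * (1 + s))) + 2 * s * u s powr (-b)"
      using b s e by (intro add_right_mono le_imp_neg_le mult_left_mono mult_right_mono) (auto simp: u_def)
    then have "- (b * u s powr (-b - 1) * ((1 - s) * (1 + s))) + 2 * s * u s powr (-b) \<ge> (2 * s - b * (1 + s)) * u s powr (-b)"
      using p1 by (simp add: algebra_simps)
    moreover have "(2 * s - b * (1 + s)) * u s powr (-b) \<ge> ((2 - 2 * b) - (2 - b) * u s) * u s powr (-b)"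
    proof (rule mult_right_mono)
      have "(2 - b) * (1 - s) \<le> (2 - b) * u s" using b e by (intro mult_left_mono) (auto simp: u_def)
      then show "(2 - 2 * b) - (2 - b) * u s \<le> 2 * s - b * (1 + s)" by (simp add: algebra_simps)
    qed auto
    moreover have "u s * u s powr (-b) \<le> 3"
    proof -
      have "u s * u s powr (-b) = u s powr (1 - b)" using us powr_mult_base[of "u s" "-b"] by simp
      also have "\<dots> \<le> 3 powr (1 - b)" using us b by (intro powr_mono2) auto
      also have "\<dots> \<le> 3 powr 1" using b by (intro powr_mono) auto
      finally show ?thesis by simp
    qed
    then have "(2 - b) * (u s * u s powr (-b)) \<le> (2 - b) * 3" using b by (intro mult_left_mono) auto
    moreover have "((2 - 2 * b) - (2 - b) * u s) * u s powr (-b) = (2 - 2 * b) * u s powr (-b) - (2 - b) * (u s * u s powr (-b))"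
      by (simp add: algebra_simps)
    ultimately show ?thesis unfolding E by linarith
  qed
  have i: "integrable \<sigma> (\<lambda>y. u (y \<bullet> x) powr (-b))" by (intro continuous_on_sphere_integrable cont)
  have i2: "integrable \<sigma> (slaplacian (\<lambda>y. \<phi> (y \<bullet> x)))"
    by (intro continuous_on_sphere_integrable slaplacian_continuous C2)
  have "(\<integral>y. (2 - 2 * b) * u (y \<bullet> x) powr (-b) - (2 - b) * 3 \<partial>\<sigma>) \<le>
      (\<integral>y. slaplacian (\<lambda>y. \<phi> (y \<bullet> x)) y / (1 - b) \<partial>\<sigma>)"
  proof (rule integral_mono)
    fix y :: "real^3" assume "y \<in> space \<sigma>"
    then have y: "norm y = 1" by simp
    show "(2 - 2 * b) * u (y \<bullet> x) powr (-b) - (2 - b) * 3 \<le> slaplacian (\<lambda>y. \<phi> (y \<bullet> x)) y / (1 - b)"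
      unfolding L[OF y] using inner_unit_bound[OF y, of x] x by (intro key) auto
  qed (use i i2 in auto)
  also have "\<dots> = 0" using integral_slaplacian_eq_0[OF C2] by simp
  finally have "(2 - 2 * b) * (\<integral>y. u (y \<bullet> x) powr (-b) \<partial>\<sigma>) \<le> (2 - b) * 3 * sphere_area"
    using i by (simp add: mult.commute)
  also have "\<dots> \<le> 2 * 3 * sphere_area" using b by (intro mult_right_mono) auto
  finally show ?thesis using b unfolding u_def by (simp add: field_simps)
qed

end

section \<open>Approximation of the identity and mean estimates for kernel differences\<close>

lemma sproj_axis: "norm x = 1 \<Longrightarrow> sproj x (axis j 1) = (\<Sum>i\<in>UNIV. x $ i *\<^sub>R rotgen i j x)"
proof -
  assume x: "norm x = 1"
  have "(\<Sum>i\<in>UNIV. x $ i *\<^sub>R rotgen i j x) = (x \<bullet> x) *\<^sub>R axis j 1 - x $ j *\<^sub>R (\<Sum>i\<in>UNIV. x $ i *\<^sub>R axis i 1)"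
    by (simp add: rotgen_def scaleR_diff_right sum_subtractf inner_vec_def scaleR_sum_left scaleR_sum_right
        mult.commute)
  also have "(\<Sum>i\<in>UNIV. x $ i *\<^sub>R axis i 1) = x"
    by (simp add: vec_eq_iff axis_def if_distrib cong: if_cong)
  finally show ?thesis using x by (simp add: sproj_def inner_axis' dot_square_norm)
qed

text \<open>An approximate identity: the mass is constant in e, continuity of g handles y near x,
  and away from x the kernel is at most a multiple of e.\<close>

lemma dirac_ker_tendsto:
  assumes g: "continuous_on (sphere 0 1) g" and x: "norm (x :: real^3) = 1"
    and \<epsilon>: "\<epsilon> \<longlonglongrightarrow> 0" "\<And>n. 0 < \<epsilon> n" "\<And>n. \<epsilon> n \<le> 1"
  shows "(\<lambda>n. \<integral>y. dirac_ker (\<epsilon> n) (y \<bullet> x) * g y \<partial>\<sigma>) \<longlonglongrightarrow> sphere_area * g x"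
proof (rule LIMSEQ_I)
  fix r :: real assume r: "r > 0"
  note c = continuous_on_sphere_integrable continuous_intros zonal_continuous[OF x] log_ker_continuous g
  have m: "sphere_area > 0" by (rule measure_sphere_measure_pos)
  have "compact (g ` sphere 0 1)" using g by (intro compact_continuous_image) auto
  then obtain B where B: "B > 0" "\<And>y. norm y = 1 \<Longrightarrow> \<bar>g y\<bar> \<le> B"
    using bounded_pos[of "g ` sphere 0 1"] compact_imp_bounded by auto
  \<comment> \<open>Integrated against the kernel of mass \<open>sphere_area\<close> this tolerance
    gives half of r.\<close>
  define r' where "r' = r / (2 * sphere_area)"
  have r': "r' > 0" using r m by (simp add: r'_def)
  obtain d where d: "d > 0" "\<And>y. norm y = 1 \<Longrightarrow> norm (y - x) < d \<Longrightarrow> \<bar>g y - g x\<bar> < r'"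
    using g[unfolded continuous_on_iff, rule_format, of x r'] x r' by (auto simp: dist_norm)
  \<comment> \<open>For unit vectors the squared distance is 2 - 2 (y . x), so a point y at distance
    at least d from x has 1 - y . x >= D.\<close>
  define D where "D = d\<^sup>2 / 2"
  have D: "D > 0" using d by (simp add: D_def)
  have bound: "\<bar>dirac_ker e (y \<bullet> x) * (g y - g x)\<bar> \<le> r' * dirac_ker e (y \<bullet> x) + 2 * B * (3 * e / D\<^sup>2)"
    if e: "0 < e" "e \<le> 1" and y: "norm y = 1" for e y
  proof -
    have "y \<bullet> x \<le> 1" using inner_unit_bound[OF y, of x] x by simp
    then have K: "dirac_ker e (y \<bullet> x) \<ge> 0" using e by (simp add: dirac_ker_def)
    have nn: "2 * B * (3 * e / D\<^sup>2) \<ge> 0" using B e by simp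
    show ?thesis
    proof (cases "norm (y - x) < d")
      case True
      then have "\<bar>dirac_ker e (y \<bullet> x) * (g y - g x)\<bar> \<le> dirac_ker e (y \<bullet> x) * r'"
        using d(2)[OF y] K by (simp add: abs_mult mult_left_mono less_imp_le)
      then show ?thesis using nn by (simp add: mult.commute)
    next
      case False
      have "(norm (y - x))\<^sup>2 = 2 - 2 * (y \<bullet> x)"
      proof -
        have "y \<bullet> y = 1" "x \<bullet> x = 1" using x y by (simp_all add: dot_square_norm)
        then show ?thesis
          unfolding power2_norm_eq_inner by (simp add: inner_diff_left inner_diff_right inner_commute[of x y])
      qed
      moreover have "d\<^sup>2 \<le> (norm (y - x))\<^sup>2" using False d by (intro power_mono) auto
      ultimately have "D \<le> 1 + e - y \<bullet> x" using e by (simp add: D_def)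
      then have "D\<^sup>2 \<le> (1 + e - y \<bullet> x)\<^sup>2" using D by (intro power_mono) auto
      moreover have "2 * e + e\<^sup>2 \<le> 3 * e" using e by (simp add: power2_eq_square)
      ultimately have "dirac_ker e (y \<bullet> x) \<le> 3 * e / D\<^sup>2"
        unfolding dirac_ker_def using e D by (intro frac_le) auto
      moreover have "\<bar>g y - g x\<bar> \<le> 2 * B" using B(2)[OF y] B(2)[OF x] by linarith
      ultimately have "\<bar>dirac_ker e (y \<bullet> x) * (g y - g x)\<bar> \<le> 3 * e / D\<^sup>2 * (2 * B)"
        unfolding abs_mult using K B(1) e by (intro mult_mono) auto
      moreover have "0 \<le> r' * dirac_ker e (y \<bullet> x)" using r' K by simp
      ultimately show ?thesis by (simp add: mult.commute)
    qed
  qed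
  have int: "\<bar>(\<integral>y. dirac_ker e (y \<bullet> x) * g y \<partial>\<sigma>) - sphere_area * g x\<bar> \<le>
     r / 2 + 2 * B * (3 * e / D\<^sup>2) * sphere_area" if e: "0 < e" "e \<le> 1" for e
  proof -
    have i: "integrable \<sigma> (\<lambda>y. dirac_ker e (y \<bullet> x))" "integrable \<sigma> (\<lambda>y. dirac_ker e (y \<bullet> x) * g y)"
      using e by (intro c; simp)+
    have "(\<integral>y. dirac_ker e (y \<bullet> x) * g y \<partial>\<sigma>) - sphere_area * g x =
        (\<integral>y. dirac_ker e (y \<bullet> x) * (g y - g x) \<partial>\<sigma>)"
      using i integral_dirac_ker_1[OF x e(1)] by (simp add: right_diff_distrib)
    also have "\<bar>\<dots>\<bar> \<le> (\<integral>y. \<bar>dirac_ker e (y \<bullet> x) * (g y - g x)\<bar> \<partial>\<sigma>)" by (rule integral_abs_bound)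
    also have "\<dots> \<le> (\<integral>y. r' * dirac_ker e (y \<bullet> x) + 2 * B * (3 * e / D\<^sup>2) \<partial>\<sigma>)"
    proof (rule integral_mono)
      show "integrable \<sigma> (\<lambda>y. \<bar>dirac_ker e (y \<bullet> x) * (g y - g x)\<bar>)"
        using e by (intro c) auto
    qed (use bound[OF e] i in auto)
    also have "\<dots> = r' * sphere_area + 2 * B * (3 * e / D\<^sup>2) * sphere_area"
      using i integral_dirac_ker_1[OF x e(1)] by simp
    finally show ?thesis using m by (simp add: r'_def)
  qed
  have "(\<lambda>n. 2 * B * (3 * \<epsilon> n / D\<^sup>2) * sphere_area) \<longlonglongrightarrow> 2 * B * (3 * 0 / D\<^sup>2) * sphere_area"
    using D by (intro tendsto_intros \<epsilon>) auto
  then have "\<forall>\<^sub>F n in sequentially. 2 * B * (3 * \<epsilon> n / D\<^sup>2) * sphere_area < r / 2"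
    using r by (intro order_tendstoD(2)) auto
  then have "\<forall>\<^sub>F n in sequentially. norm ((\<integral>y. dirac_ker (\<epsilon> n) (y \<bullet> x) * g y \<partial>\<sigma>) - sphere_area * g x) < r"
  proof eventually_elim
    case (elim n)
    then show ?case using int[OF \<epsilon>(2,3), of n] field_sum_of_halves[of r] unfolding real_norm_def by linarith
  qed
  then show "\<exists>N. \<forall>n\<ge>N. norm ((\<integral>y. dirac_ker (\<epsilon> n) (y \<bullet> x) * g y \<partial>\<sigma>) - sphere_area * g x) < r"
    by (simp add: eventually_sequentially)
qed

text \<open>The difference of the logarithms is \<open>ln (1 + z)\<close> with z at most e / u,
  hence at most \<open>(e / u) powr a / a\<close> for any a in (0, 1]. Its q-th power is then
  bounded by the power kernel with exponent a q; the factor 6 is 3 / (1 - 1/2).\<close>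

lemma log_ker_diff_powr_le:
  assumes y: "norm (y :: real^3) = 1" and de: "0 < d" "d \<le> e" "e \<le> 1" and q: "1 \<le> q"
  shows "(\<integral>x. \<bar>log_ker e (y \<bullet> x) - log_ker d (y \<bullet> x)\<bar> powr q \<partial>\<sigma>) \<le>
    (2 * q) powr q * 6 * sphere_area * e powr (1/2)"
proof -
  \<comment> \<open>Makes a q = 1/2, an integrable exponent that still leaves a positive power of
    e.\<close>
  define a where "a = 1 / (2 * q)"
  have a: "0 < a" "a \<le> 1" "a * q = 1/2" using q by (auto simp: a_def)
  have bound: "\<bar>log_ker e (y \<bullet> x) - log_ker d (y \<bullet> x)\<bar> powr q \<le> (2 * q) powr q * e powr (1/2) * (1 + d - x \<bullet> y) powr (-(1/2))"
    if x: "norm x = 1" for x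
  proof -
    define u where "u = 1 + d - x \<bullet> y"
    have u: "u > 0" using inner_unit_bound[OF x, of y] y de by (simp add: u_def)
    define z where "z = (e - d) / u"
    have z: "0 \<le> z" "z \<le> e / u" using u de by (auto simp: z_def divide_right_mono)
    have "log_ker e (y \<bullet> x) - log_ker d (y \<bullet> x) = ln (1 + z)"
    proof -
      have "1 + e - y \<bullet> x = u * (1 + z)" using u by (simp add: z_def u_def field_simps inner_commute)
      moreover have "1 + d - y \<bullet> x = u" by (simp add: u_def inner_commute)
      ultimately show ?thesis using u z by (simp add: log_ker_def ln_mult)
    qed
    \<comment> \<open>The product a ln (1 + z) is the logarithm of (1 + z)^a, and (1 + z)^a <= 1 +
      z^a because a <= 1.\<close>
    moreover have "ln (1 + z) \<le> (1 / a) * (e / u) powr a"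
    proof -
      have "a * ln (1 + z) = ln ((1 + z) powr a)" using z by (simp add: ln_powr)
      also have "\<dots> \<le> ln (1 + z powr a)"
      proof -
        have "(1 + z) powr a \<le> 1 + z powr a"
        proof (cases "z = 0")
          case False
          then have "z > 0" using z by simp
          have "(1 + z) powr a = (1 + z) * (1 + z) powr (a - 1)" using z powr_mult_base[of "1+z" "a-1"] by simp
          also have "\<dots> = (1 + z) powr (a - 1) + z * (1 + z) powr (a - 1)" by (simp add: algebra_simps)
          also have "\<dots> \<le> 1 powr (a - 1) + z * z powr (a - 1)"
            using z a \<open>z > 0\<close> by (intro add_mono mult_left_mono powr_mono2') auto
          also have "\<dots> = 1 + z powr a" using z powr_mult_base[of z "a-1"] by simp
          finally show ?thesis .
        qed simp
        then show ?thesis using z by (intro ln_mono) (auto simp: add_pos_nonneg)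
      qed
      also have "\<dots> \<le> z powr a" using ln_add_one_self_le_self[of "z powr a"] by simp
      also have "\<dots> \<le> (e / u) powr a" using z a by (intro powr_mono2) auto
      finally show ?thesis using a by (simp add: field_simps)
    qed
    moreover have "0 \<le> ln (1 + z)" using z by simp
    ultimately have "\<bar>log_ker e (y \<bullet> x) - log_ker d (y \<bullet> x)\<bar> powr q \<le> ((1 / a) * (e / u) powr a) powr q"
      using q by (intro powr_mono2) auto
    also have "\<dots> = (2 * q) powr q * (e powr (1/2) * u powr (-(1/2)))"
    proof -
      have "((e / u) powr a) powr q = (e / u) powr (1/2)" unfolding powr_powr a(3) ..
      also have "\<dots> = e powr (1/2) * u powr (-(1/2))" using u de by (simp add: powr_divide powr_minus_divide)
      finally show ?thesis using a q by (simp add: powr_mult a_def)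
    qed
    finally show ?thesis by (simp add: u_def)
  qed
  have cont: "continuous_on (sphere 0 1) (\<lambda>x. (1 + d - x \<bullet> y) powr (-(1/2)))"
    using inner_le_1[OF y] de by (fastforce intro!: continuous_intros)
  have "continuous_on (sphere 0 1) (\<lambda>x. \<bar>log_ker e (x \<bullet> y) - log_ker d (x \<bullet> y)\<bar> powr q)"
    using de q by (intro continuous_on_powr' continuous_intros zonal_continuous[OF y] log_ker_continuous) auto
  then have c2: "continuous_on (sphere 0 1) (\<lambda>x. \<bar>log_ker e (y \<bullet> x) - log_ker d (y \<bullet> x)\<bar> powr q)"
    by (simp add: inner_commute)
  have "(\<integral>x. \<bar>log_ker e (y \<bullet> x) - log_ker d (y \<bullet> x)\<bar> powr q \<partial>\<sigma>) \<le>
      (\<integral>x. (2 * q) powr q * e powr (1/2) * (1 + d - x \<bullet> y) powr (-(1/2)) \<partial>\<sigma>)"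
  proof (rule integral_mono)
    show "integrable \<sigma> (\<lambda>x. \<bar>log_ker e (y \<bullet> x) - log_ker d (y \<bullet> x)\<bar> powr q)"
      by (intro continuous_on_sphere_integrable c2)
    show "integrable \<sigma> (\<lambda>x. (2 * q) powr q * e powr (1/2) * (1 + d - x \<bullet> y) powr (-(1/2)))"
      by (intro continuous_on_sphere_integrable continuous_on_mult_left cont)
  qed (rule bound, simp)
  also have "\<dots> = (2 * q) powr q * e powr (1/2) * (\<integral>x. (1 + d - x \<bullet> y) powr (-(1/2)) \<partial>\<sigma>)" by simp
  also have "\<dots> \<le> (2 * q) powr q * e powr (1/2) * (3 / (1 - 1/2) * sphere_area)"
    using de by (intro mult_left_mono integral_powr_kernel_le y) auto
  finally show ?thesis by (simp add: mult_ac)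
qed

text \<open>\<open>log_ker'\<close> is of order 1 / u, but the factor
  \<open>y \<bullet> sproj x w\<close> is at most sqrt (1 - s^2), of order sqrt u. The gradient
  kernel is thus of order \<open>u powr (-1/2)\<close>, and its p-th power has bounded integrals for
  p < 2. Part of the remaining margin buys a positive power of e.\<close>

lemma log_ker'_diff_powr_le:
  assumes y: "norm (y :: real^3) = 1" and de: "0 < d" "d \<le> e" "e \<le> 1" and p: "1 \<le> p" "p < 2" and w: "norm w = 1"
  shows "(\<integral>x. \<bar>log_ker' e (y \<bullet> x) * (y \<bullet> sproj x w) - log_ker' d (y \<bullet> x) * (y \<bullet> sproj x w)\<bar> powr p \<partial>\<sigma>) \<le>
    2 powr p * (12 / (2 - p)) * sphere_area * e powr ((2 - p) / 4)"
proof -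
  \<comment> \<open>Half of the gap between p/2 and 1 is spent: the resulting exponent
    \<open>(1/2 + a) * p\<close> is b, the midpoint of p/2 and 1.\<close>
  define a where "a = (2 - p) / (4 * p)"
  define b where "b = (2 + p) / 4"
  have a: "0 < a" "a \<le> 1" "a * p = (2 - p) / 4" using p by (auto simp: a_def field_simps)
  have b: "0 \<le> b" "b < 1" "(1/2 + a) * p = b" "1 - b = (2 - p) / 4"
    using p by (auto simp: b_def a_def field_simps)
  let ?k = "\<lambda>x. log_ker' e (y \<bullet> x) * (y \<bullet> sproj x w) - log_ker' d (y \<bullet> x) * (y \<bullet> sproj x w)"
  have bound: "\<bar>?k x\<bar> powr p \<le> 2 powr p * e powr ((2 - p) / 4) * (1 + d - x \<bullet> y) powr (-b)"
    if x: "norm x = 1" for x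
  proof -
    define s where "s = x \<bullet> y"
    define u where "u = 1 + d - s"
    have s1: "s \<le> 1" "-1 \<le> s" using inner_unit_bound[OF x, of y] y by (auto simp: s_def)
    have u: "u > 0" using s1 de by (simp add: u_def)
    define v where "v = 1 + e - s"
    have v: "v \<ge> u" "v \<ge> e" using s1 de by (auto simp: u_def v_def)
    have "\<bar>log_ker' e (y \<bullet> x) - log_ker' d (y \<bullet> x)\<bar> = (e - d) / (u * v)"
    proof -
      have "log_ker' e (y \<bullet> x) - log_ker' d (y \<bullet> x) = 1 / u - 1 / v"
        by (simp add: log_ker'_def u_def v_def s_def inner_commute)
      also have "\<dots> = (e - d) / (u * v)" using u v by (simp add: divide_simps) (simp add: u_def v_def)
      finally show ?thesis using de u v by simp
    qed
    also have "\<dots> = 1 / u * ((e - d) / v)" by simp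
    \<comment> \<open>The quotient e / v is at most 1, so lowering its exponent from 1 to a enlarges
      it.\<close>
    also have "\<dots> \<le> 1 / u * (e / u) powr a"
    proof (rule mult_left_mono)
      have "(e - d) / v \<le> e / v" using u v de by (simp add: divide_right_mono)
      also have "\<dots> \<le> (e / v) powr a"
        using u v de a powr_mono'[of a 1 "e / v"] by simp
      also have "\<dots> \<le> (e / u) powr a" using u v de a by (intro powr_mono2 divide_left_mono) auto
      finally show "(e - d) / v \<le> (e / u) powr a" .
    qed (use u in simp)
    finally have 1: "\<bar>log_ker' e (y \<bullet> x) - log_ker' d (y \<bullet> x)\<bar> \<le> 1 / u * (e / u) powr a" .
    \<comment> \<open>The projection is moved to y and has length sqrt (1 - s^2); the factor 1 - s
      is at most u and 1 + s at most 4.\<close>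
    have 2: "\<bar>y \<bullet> sproj x w\<bar> \<le> 2 * u powr (1/2)"
    proof -
      have "y \<bullet> sproj x w = sproj x y \<bullet> w" by (simp add: inner_sproj_commute)
      then have "\<bar>y \<bullet> sproj x w\<bar> \<le> norm (sproj x y)" using Cauchy_Schwarz_ineq2[of "sproj x y" w] w by simp
      also have "norm (sproj x y) = sqrt (1 - s\<^sup>2)"
      proof -
        have "sproj x y \<bullet> sproj x y = y \<bullet> sproj x y" using x by (simp add: inner_sproj_commute sproj_sproj)
        also have "\<dots> = 1 - s\<^sup>2"
          using y by (simp add: sproj_def inner_diff_right s_def inner_commute dot_square_norm power2_eq_square)
        finally show ?thesis by (simp add: norm_eq_sqrt_inner)
      qed
      also have "\<dots> \<le> sqrt (4 * u)"
      proof (rule real_sqrt_le_mono)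
        have "1 - s\<^sup>2 = (1 - s) * (1 + s)" by (simp add: power2_eq_square algebra_simps)
        also have "\<dots> \<le> u * 4" using s1 de by (intro mult_mono) (auto simp: u_def)
        finally show "1 - s\<^sup>2 \<le> 4 * u" by simp
      qed
      also have "\<dots> = 2 * u powr (1/2)" using u by (simp add: real_sqrt_mult powr_half_sqrt)
      finally show ?thesis .
    qed
    have "\<bar>?k x\<bar> = \<bar>log_ker' e (y \<bullet> x) - log_ker' d (y \<bullet> x)\<bar> * \<bar>y \<bullet> sproj x w\<bar>"
      by (simp add: left_diff_distrib[symmetric] abs_mult)
    also have "\<dots> \<le> (1 / u * (e / u) powr a) * (2 * u powr (1/2))"
      using u by (intro mult_mono 1 2) auto
    also have "\<dots> = 2 * (e powr a * u powr (-(1/2 + a)))"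
    proof -
      have "(1 / u * (e / u) powr a) * (2 * u powr (1/2)) = 2 * (e powr a * (u powr (-1) * u powr (-a) * u powr (1/2)))"
        using u de by (simp add: powr_divide powr_minus_divide)
      also have "u powr (-1) * u powr (-a) * u powr (1/2) = u powr (-(1/2 + a))"
        by (simp only: powr_add[symmetric]) simp
      finally show ?thesis .
    qed
    finally have "\<bar>?k x\<bar> powr p \<le> (2 * (e powr a * u powr (-(1/2 + a)))) powr p"
      using p by (intro powr_mono2) auto
    also have "\<dots> = 2 powr p * (e powr (a * p) * u powr (- ((1/2 + a) * p)))"
      by (simp add: powr_mult powr_powr algebra_simps)
    finally show ?thesis unfolding a(3) b(3) by (simp add: u_def s_def)
  qed
  have cont: "continuous_on (sphere 0 1) (\<lambda>x. (1 + d - x \<bullet> y) powr (-b))"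
    using inner_le_1[OF y] de by (fastforce intro!: continuous_intros)
  have "continuous_on (sphere 0 1) (\<lambda>x. \<bar>log_ker' e (x \<bullet> y) * (y \<bullet> sproj x w) - log_ker' d (x \<bullet> y) * (y \<bullet> sproj x w)\<bar> powr p)"
    unfolding sproj_def
    using de p by (intro continuous_on_powr' continuous_intros zonal_continuous[OF y] log_ker_continuous) auto
  then have c2: "continuous_on (sphere 0 1) (\<lambda>x. \<bar>?k x\<bar> powr p)"
    by (simp add: inner_commute)
  have "(\<integral>x. \<bar>?k x\<bar> powr p \<partial>\<sigma>) \<le>
      (\<integral>x. 2 powr p * e powr ((2 - p) / 4) * (1 + d - x \<bullet> y) powr (-b) \<partial>\<sigma>)"
  proof (rule integral_mono)
    show "integrable \<sigma> (\<lambda>x. \<bar>?k x\<bar> powr p)"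
      by (intro continuous_on_sphere_integrable c2)
    show "integrable \<sigma> (\<lambda>x. 2 powr p * e powr ((2 - p) / 4) * (1 + d - x \<bullet> y) powr (-b))"
      by (intro continuous_on_sphere_integrable continuous_on_mult_left cont)
  qed (rule bound, simp)
  also have "\<dots> = 2 powr p * e powr ((2 - p) / 4) * (\<integral>x. (1 + d - x \<bullet> y) powr (-b) \<partial>\<sigma>)" by simp
  also have "\<dots> \<le> 2 powr p * e powr ((2 - p) / 4) * (3 / (1 - b) * sphere_area)"
    using de b by (intro mult_left_mono integral_powr_kernel_le y) auto
  finally show ?thesis by (simp add: b(4) mult_ac)
qed

section \<open>Compactness\<close>

lemma powr_inverse_tendsto_0: "c > 0 \<Longrightarrow> (\<lambda>n. inverse (real (Suc n)) powr c) \<longlonglongrightarrow> 0"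
  using tendsto_powr'[OF LIMSEQ_inverse_real_of_nat tendsto_const[of c]] by simp

text \<open>The regularizations of the functions and of their three derivatives enter one diagonal
  extraction, so a single s serves every exponent and every direction.\<close>

theorem supersolution_subsequence:
  fixes h :: "nat \<Rightarrow> real^3 \<Rightarrow> real"
  assumes h: "\<And>k. C2_sphere (h k)" and pos: "\<And>k x. norm x = 1 \<Longrightarrow> 0 \<le> h k x"
    and super: "\<And>k x. norm x = 1 \<Longrightarrow> slaplacian (h k) x \<le> h k x"
    and bd: "\<And>k. (\<integral>x. h k x \<partial>\<sigma>) \<le> C"
  obtains s where "strict_mono (s :: nat \<Rightarrow> nat)"
    "\<And>p e. 1 \<le> p \<Longrightarrow> e > 0 \<Longrightarrow> \<exists>N. \<forall>k\<ge>N. \<forall>l\<ge>N.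
       (\<integral>x. \<bar>h (s k) x - h (s l) x\<bar> powr p \<partial>\<sigma>) < e"
    "\<And>p e b. 1 \<le> p \<Longrightarrow> p < 2 \<Longrightarrow> e > 0 \<Longrightarrow> b \<in> Basis \<Longrightarrow> \<exists>N. \<forall>k\<ge>N. \<forall>l\<ge>N.
       (\<integral>x. \<bar>sderiv (h (s k)) x b - sderiv (h (s l)) x b\<bar> powr p \<partial>\<sigma>) < e"
proof -
  define m where "m = sphere_area"
  have m: "m > 0" unfolding m_def by (rule measure_sphere_measure_pos)
  define \<epsilon> where "\<epsilon> n = inverse (real (Suc n))" for n
  have \<epsilon>: "0 < \<epsilon> n" "\<epsilon> n \<le> 1" for n by (auto simp: \<epsilon>_def inverse_le_1_iff)
  have \<epsilon>0: "\<epsilon> \<longlonglongrightarrow> 0" unfolding \<epsilon>_def by (rule LIMSEQ_inverse_real_of_nat)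
  have \<epsilon>mono: "\<epsilon> k \<le> \<epsilon> n" if "n \<le> k" for n k using that by (simp add: \<epsilon>_def)
  \<comment> \<open>The summand 1 makes the bound positive, as the kernel estimates require.\<close>
  define C' where "C' = 2 * \<bar>C\<bar> + 1"
  have C': "C' > 0" by (simp add: C'_def)
  have ch: "continuous_on (sphere 0 1) (h k)" for k using h[of k] by (simp add: C2_sphere_def C1_sphere_continuous)
  have cL: "continuous_on (sphere 0 1) (slaplacian (h k))" for k using h[of k] by (rule slaplacian_continuous)
  have cd: "continuous_on (sphere 0 1) (\<lambda>x. sderiv (h k) x b)" for k b
    using h[of k] by (simp add: C2_sphere_def C1_sphere_continuous_sderiv)
  have absh: "(\<integral>x. \<bar>h k x\<bar> \<partial>\<sigma>) = (\<integral>x. h k x \<partial>\<sigma>)" for k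
    using pos by (intro Bochner_Integration.integral_cong) auto
  have absL: "(\<integral>x. \<bar>slaplacian (h k) x\<bar> \<partial>\<sigma>) \<le> C'" for k
  proof -
    have i: "integrable \<sigma> (h k)" "integrable \<sigma> (slaplacian (h k))"
      by (intro continuous_on_sphere_integrable ch cL)+
    \<comment> \<open>Where the Laplacian is negative this rests on 0 <= h, where it is positive on
      its being at most h.\<close>
    have "(\<integral>x. \<bar>slaplacian (h k) x\<bar> \<partial>\<sigma>) \<le> (\<integral>x. 2 * h k x - slaplacian (h k) x \<partial>\<sigma>)"
    proof (rule integral_mono)
      fix x :: "real^3" assume "x \<in> space \<sigma>"
      then show "\<bar>slaplacian (h k) x\<bar> \<le> 2 * h k x - slaplacian (h k) x"
        using pos[of x k] super[of x k] by simp
    qed (use i in auto)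
    also have "\<dots> = 2 * (\<integral>x. h k x \<partial>\<sigma>)"
      using i integral_slaplacian_eq_0[OF h] by simp
    finally show ?thesis using bd[of k] by (simp add: C'_def)
  qed
  define a\<^sub>0 b\<^sub>0 where "a\<^sub>0 n x y = dirac_ker (\<epsilon> n) (y \<bullet> x) / m" and "b\<^sub>0 n x y = log_ker (\<epsilon> n) (y \<bullet> x) / m"
    for n and x y :: "real^3"
  \<comment> \<open>\<open>a\<^sub>1\<close> and \<open>b\<^sub>1\<close> are the derivatives of
    \<open>a\<^sub>0\<close> and \<open>b\<^sub>0\<close> in x along the tangential part of the axis
    j.\<close>
  define a\<^sub>1 b\<^sub>1 where "a\<^sub>1 j n x y = dirac_ker' (\<epsilon> n) (y \<bullet> x) * (y \<bullet> sproj x (axis j 1)) / m"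
    and "b\<^sub>1 j n x y = log_ker' (\<epsilon> n) (y \<bullet> x) * (y \<bullet> sproj x (axis j 1)) / m" for j n and x y :: "real^3"
  have zc: "continuous_on (sphere 0 1 \<times> sphere 0 1) (\<lambda>q :: (real^3) \<times> (real^3). \<phi> (snd q \<bullet> fst q))"
    if "continuous_on {..1} \<phi>" for \<phi> :: "real \<Rightarrow> real"
  proof (rule continuous_on_compose2[OF that])
    have "snd q \<bullet> fst q \<le> 1" if "q \<in> sphere 0 1 \<times> sphere 0 1" for q :: "(real^3) \<times> (real^3)"
      using inner_unit_bound[of "snd q" "fst q"] that by auto
    then show "(\<lambda>q :: (real^3) \<times> (real^3). snd q \<bullet> fst q) ` (sphere 0 1 \<times> sphere 0 1) \<subseteq> {..1}" by blast
  qed (intro continuous_intros)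
  have ca0: "continuous_on (sphere 0 1 \<times> sphere 0 1) (case_prod (a\<^sub>0 n))"
    and cb0: "continuous_on (sphere 0 1 \<times> sphere 0 1) (case_prod (b\<^sub>0 n))" for n
    unfolding a\<^sub>0_def b\<^sub>0_def case_prod_beta'
    using m \<epsilon>(1) by (intro continuous_intros zc log_ker_continuous; simp)+
  have ca1: "continuous_on (sphere 0 1 \<times> sphere 0 1) (case_prod (a\<^sub>1 j n))"
    and cb1: "continuous_on (sphere 0 1 \<times> sphere 0 1) (case_prod (b\<^sub>1 j n))" for j n
    unfolding a\<^sub>1_def b\<^sub>1_def case_prod_beta' sproj_def
    using m \<epsilon>(1) by (intro continuous_intros zc log_ker_continuous; simp)+
  \<comment> \<open>\<open>None\<close> stands for the function itself and \<open>Some j\<close> for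
    its j-th derivative.\<close>
  define \<kappa> where "\<kappa> i = (case i of (n, None) \<Rightarrow> a\<^sub>0 n | (n, Some j) \<Rightarrow> a\<^sub>1 j n)" for i :: "nat \<times> 3 option"
  have \<kappa>c: "continuous_on (sphere 0 1 \<times> sphere 0 1) (case_prod (\<kappa> i))" for i
    by (cases i; cases "snd i") (auto simp: \<kappa>_def ca0 ca1)
  have bd': "(\<integral>x. \<bar>h k x\<bar> \<partial>\<sigma>) \<le> C" for k by (simp add: absh bd)
  define Q where "Q s i e \<longleftrightarrow> (\<exists>N. \<forall>k\<ge>N. \<forall>l\<ge>N. \<forall>x. norm x = 1 \<longrightarrow>
      \<bar>(\<integral>y. \<kappa> i x y * h (s k) y \<partial>\<sigma>) - (\<integral>y. \<kappa> i x y * h (s l) y \<partial>\<sigma>)\<bar> < e)"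
    for s :: "nat \<Rightarrow> nat" and i e
  have "\<exists>s. strict_mono s \<and> (\<forall>i e. e > 0 \<longrightarrow> Q s i e)"
    unfolding Q_def by (rule kernel_diagonal_subsequence[of \<kappa> h C, OF \<kappa>c ch bd'])
  then obtain s where s: "strict_mono s" and sC: "\<And>i e. e > 0 \<Longrightarrow> Q s i e" by blast
  show thesis
  proof (rule that[OF s])
    fix p e :: real assume p: "1 \<le> p" and e: "e > 0"
    define D where "D = (1 / m) powr p * ((2 * p) powr p * 6 * m)"
    have D: "D \<ge> 0" using m by (simp add: D_def)
    show "\<exists>N. \<forall>k\<ge>N. \<forall>l\<ge>N. (\<integral>x. \<bar>h (s k) x - h (s l) x\<bar> powr p \<partial>\<sigma>) < e"
    proof (rule kernel_regularization_Cauchy[where a=a\<^sub>0 and b=b\<^sub>0 and h="\<lambda>k. h (s k)" and \<psi>="\<lambda>k. h (s k)"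
          and \<mu>="\<lambda>k. slaplacian (h (s k))" and C=C' and p=p and \<rho>="\<lambda>n. D * \<epsilon> n powr (1/2)"])
      fix k and x :: "real^3" assume x: "norm x = 1"
      have "(\<lambda>n. (\<integral>y. dirac_ker (\<epsilon> n) (y \<bullet> x) * h (s k) y \<partial>\<sigma>) / m) \<longlonglongrightarrow> m * h (s k) x / m"
        unfolding m_def using m by (intro tendsto_divide tendsto_const dirac_ker_tendsto ch x \<epsilon> \<epsilon>0) (simp add: m_def)
      then show "(\<lambda>n. \<integral>y. a\<^sub>0 n x y * h (s k) y \<partial>\<sigma>) \<longlonglongrightarrow> h (s k) x"
        using m by (simp add: a\<^sub>0_def)
    next
      fix k n n' and x :: "real^3" assume x: "norm x = 1"
      have i: "integrable \<sigma> (\<lambda>y. log_ker (\<epsilon> n) (y \<bullet> x) * slaplacian (h (s k)) y)" for n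
        by (intro continuous_on_sphere_integrable continuous_intros zonal_continuous[OF x \<epsilon>(1)] log_ker_continuous \<epsilon>(1) cL)
      \<comment> \<open>The integral of \<open>h (s k)\<close> is the same for all n and cancels in
        the difference below.\<close>
      have "(\<integral>y. a\<^sub>0 n x y * h (s k) y \<partial>\<sigma>) =
        ((\<integral>y. h (s k) y \<partial>\<sigma>) + (\<integral>y. log_ker (\<epsilon> n) (y \<bullet> x) * slaplacian (h (s k)) y \<partial>\<sigma>)) / m" for n
        using integral_dirac_ker[OF x \<epsilon>(1) h, of n] by (simp add: a\<^sub>0_def)
      then have "(\<integral>y. a\<^sub>0 n x y * h (s k) y \<partial>\<sigma>) - (\<integral>y. a\<^sub>0 n' x y * h (s k) y \<partial>\<sigma>) =
        ((\<integral>y. log_ker (\<epsilon> n) (y \<bullet> x) * slaplacian (h (s k)) y \<partial>\<sigma>) -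
         (\<integral>y. log_ker (\<epsilon> n') (y \<bullet> x) * slaplacian (h (s k)) y \<partial>\<sigma>)) / m"
        by (simp add: diff_divide_distrib[symmetric])
      also have "\<dots> = (\<integral>y. (log_ker (\<epsilon> n) (y \<bullet> x) * slaplacian (h (s k)) y - log_ker (\<epsilon> n') (y \<bullet> x) * slaplacian (h (s k)) y) / m \<partial>\<sigma>)"
        using i by simp
      also have "\<dots> = (\<integral>y. (b\<^sub>0 n x y - b\<^sub>0 n' x y) * slaplacian (h (s k)) y \<partial>\<sigma>)"
        by (intro Bochner_Integration.integral_cong) (auto simp: b\<^sub>0_def diff_divide_distrib left_diff_distrib)
      finally show "(\<integral>y. a\<^sub>0 n x y * h (s k) y \<partial>\<sigma>) - (\<integral>y. a\<^sub>0 n' x y * h (s k) y \<partial>\<sigma>) =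
        (\<integral>y. (b\<^sub>0 n x y - b\<^sub>0 n' x y) * slaplacian (h (s k)) y \<partial>\<sigma>)" .
    next
      fix n n' :: nat and y :: "real^3" assume n: "n \<le> n'" and y: "norm y = 1"
      have "(\<integral>x. \<bar>b\<^sub>0 n x y - b\<^sub>0 n' x y\<bar> powr p \<partial>\<sigma>) =
        (\<integral>x. (1 / m) powr p * \<bar>log_ker (\<epsilon> n) (y \<bullet> x) - log_ker (\<epsilon> n') (y \<bullet> x)\<bar> powr p \<partial>\<sigma>)"
        using m by (intro Bochner_Integration.integral_cong)
          (auto simp: b\<^sub>0_def powr_mult[symmetric] diff_divide_distrib[symmetric])
      also have "\<dots> \<le> (1 / m) powr p * ((2 * p) powr p * 6 * m * \<epsilon> n powr (1/2))"
        unfolding m_def using log_ker_diff_powr_le[OF y \<epsilon>(1) \<epsilon>mono[OF n] \<epsilon>(2) p] by (simp add: mult_left_mono)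
      finally show "(\<integral>x. \<bar>b\<^sub>0 n x y - b\<^sub>0 n' x y\<bar> powr p \<partial>\<sigma>) \<le> D * \<epsilon> n powr (1/2)"
        by (simp add: D_def mult.assoc)
    next
      fix n and e :: real assume "e > 0"
      then show "\<exists>N. \<forall>k\<ge>N. \<forall>l\<ge>N. \<forall>x. norm x = 1 \<longrightarrow>
        \<bar>(\<integral>y. a\<^sub>0 n x y * h (s k) y \<partial>\<sigma>) - (\<integral>y. a\<^sub>0 n x y * h (s l) y \<partial>\<sigma>)\<bar> < e"
        using sC[of e "(n, None)", unfolded Q_def] by (simp add: \<kappa>_def)
    next
      show "(\<lambda>n. D * \<epsilon> n powr (1/2)) \<longlonglongrightarrow> 0"
        using tendsto_mult[OF tendsto_const[of D] powr_inverse_tendsto_0[of "1/2"]] by (simp add: \<epsilon>_def)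
    qed (use ca0 cb0 ch cL absL C' p e D in auto)
  next
    fix p e :: real and b :: "real^3" assume p: "1 \<le> p" "p < 2" and e: "e > 0" and "b \<in> Basis"
    then obtain j where b: "b = axis j 1" by (auto simp: Basis_vec_def)
    have nb: "norm b = 1" using \<open>b \<in> Basis\<close> by simp
    define D where "D = (1 / m) powr p * (2 powr p * (12 / (2 - p)) * m)"
    have D: "D \<ge> 0" using m p by (simp add: D_def)
    show "\<exists>N. \<forall>k\<ge>N. \<forall>l\<ge>N. (\<integral>x. \<bar>sderiv (h (s k)) x b - sderiv (h (s l)) x b\<bar> powr p \<partial>\<sigma>) < e"
    proof (rule kernel_regularization_Cauchy[where a="a\<^sub>1 j" and b="b\<^sub>1 j" and h="\<lambda>k. h (s k)" and \<psi>="\<lambda>k x. sderiv (h (s k)) x b"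
          and \<mu>="\<lambda>k. slaplacian (h (s k))" and C=C' and p=p and \<rho>="\<lambda>n. D * \<epsilon> n powr ((2 - p) / 4)"])
      fix k and x :: "real^3" assume x: "norm x = 1"
      have C1: "C1_sphere (h (s k))" using h by (simp add: C2_sphere_def)
      have crot: "continuous_on (sphere 0 1) (\<lambda>y. sderiv (h (s k)) y (rotgen i j y))" for i
      proof (rule continuous_on_eq)
        show "continuous_on (sphere 0 1) (\<lambda>y. y $ i * sderiv (h (s k)) y (axis j 1) - y $ j * sderiv (h (s k)) y (axis i 1))"
          by (intro continuous_intros cd)
      qed (use linear_diff[OF linear_sderiv[OF C1]] linear_scale[OF linear_sderiv[OF C1]] in \<open>simp add: rotgen_def\<close>)
      have i: "integrable \<sigma> (\<lambda>y. dirac_ker' (\<epsilon> n) (y \<bullet> x) * (y \<bullet> rotgen i j x) * h (s k) y)" for n i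
        by (intro continuous_on_sphere_integrable continuous_intros zonal_continuous[OF x \<epsilon>(1)] log_ker_continuous \<epsilon>(1) ch)
      \<comment> \<open>Expanding the tangential part of the axis j in rotation fields turns
        \<open>a\<^sub>1\<close> into Dirac kernels acting on derivatives of \<open>h (s k)\<close>,
        whose limits are known.\<close>
      have "(\<integral>y. a\<^sub>1 j n x y * h (s k) y \<partial>\<sigma>) =
          (\<Sum>i\<in>UNIV. x $ i * (\<integral>y. dirac_ker (\<epsilon> n) (y \<bullet> x) * sderiv (h (s k)) y (rotgen i j y) \<partial>\<sigma>)) / m" for n
      proof -
        have "(\<integral>y. a\<^sub>1 j n x y * h (s k) y \<partial>\<sigma>) =
            (\<integral>y. (\<Sum>i\<in>UNIV. x $ i * (dirac_ker' (\<epsilon> n) (y \<bullet> x) * (y \<bullet> rotgen i j x) * h (s k) y)) / m \<partial>\<sigma>)"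
          by (intro Bochner_Integration.integral_cong)
            (auto simp: a\<^sub>1_def sproj_axis[OF x] inner_sum_right sum_distrib_left sum_distrib_right mult_ac intro!: sum.cong)
        also have "\<dots> = (\<Sum>i\<in>UNIV. x $ i * (\<integral>y. dirac_ker' (\<epsilon> n) (y \<bullet> x) * (y \<bullet> rotgen i j x) * h (s k) y \<partial>\<sigma>)) / m"
          using i by simp
        finally show ?thesis using integral_dirac_ker_rotgen[OF x \<epsilon>(1) C1] by simp
      qed
      moreover have "(\<lambda>n. (\<Sum>i\<in>UNIV. x $ i * (\<integral>y. dirac_ker (\<epsilon> n) (y \<bullet> x) * sderiv (h (s k)) y (rotgen i j y) \<partial>\<sigma>)) / m)
        \<longlonglongrightarrow> (\<Sum>i\<in>UNIV. x $ i * (m * sderiv (h (s k)) x (rotgen i j x))) / m"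
        unfolding m_def using m
        by (intro tendsto_divide tendsto_sum tendsto_mult tendsto_const dirac_ker_tendsto crot x \<epsilon> \<epsilon>0) (simp add: m_def)
      moreover have "(\<Sum>i\<in>UNIV. x $ i * (m * sderiv (h (s k)) x (rotgen i j x))) / m = sderiv (h (s k)) x b"
      proof -
        have "sderiv (h (s k)) x b = sderiv (h (s k)) x (sproj x b)"
          using C1 x by (simp add: sderiv_sproj C1_sphere_def)
        also have "\<dots> = (\<Sum>i\<in>UNIV. x $ i * sderiv (h (s k)) x (rotgen i j x))"
          unfolding b sproj_axis[OF x] linear_sum[OF linear_sderiv[OF C1 x]] linear_scale[OF linear_sderiv[OF C1 x]] by simp
        also have "(\<Sum>i\<in>UNIV. x $ i * (m * sderiv (h (s k)) x (rotgen i j x))) = m * (\<Sum>i\<in>UNIV. x $ i * sderiv (h (s k)) x (rotgen i j x))"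
          by (simp add: sum_distrib_left mult_ac)
        ultimately show ?thesis using m by simp
      qed
      ultimately show "(\<lambda>n. \<integral>y. a\<^sub>1 j n x y * h (s k) y \<partial>\<sigma>) \<longlonglongrightarrow> sderiv (h (s k)) x b" by simp
    next
      fix k n n' and x :: "real^3" assume x: "norm x = 1"
      let ?v = "sproj x (axis j 1)"
      have v: "?v \<bullet> x = 0" using x by (rule sproj_inner_self)
      have i: "integrable \<sigma> (\<lambda>y. log_ker' (\<epsilon> n) (y \<bullet> x) * (y \<bullet> ?v) * slaplacian (h (s k)) y)" for n
        by (intro continuous_on_sphere_integrable continuous_intros zonal_continuous[OF x \<epsilon>(1)] log_ker_continuous \<epsilon>(1) cL)
      have "(\<integral>y. a\<^sub>1 j n x y * h (s k) y \<partial>\<sigma>) =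
        (\<integral>y. log_ker' (\<epsilon> n) (y \<bullet> x) * (y \<bullet> ?v) * slaplacian (h (s k)) y \<partial>\<sigma>) / m" for n
        using integral_dirac_ker'_mult[OF x \<epsilon>(1) h v, of n] by (simp add: a\<^sub>1_def)
      then have "(\<integral>y. a\<^sub>1 j n x y * h (s k) y \<partial>\<sigma>) - (\<integral>y. a\<^sub>1 j n' x y * h (s k) y \<partial>\<sigma>) =
        ((\<integral>y. log_ker' (\<epsilon> n) (y \<bullet> x) * (y \<bullet> ?v) * slaplacian (h (s k)) y \<partial>\<sigma>) -
         (\<integral>y. log_ker' (\<epsilon> n') (y \<bullet> x) * (y \<bullet> ?v) * slaplacian (h (s k)) y \<partial>\<sigma>)) / m"
        by (simp add: diff_divide_distrib[symmetric])
      also have "\<dots> = (\<integral>y. (log_ker' (\<epsilon> n) (y \<bullet> x) * (y \<bullet> ?v) * slaplacian (h (s k)) y -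
          log_ker' (\<epsilon> n') (y \<bullet> x) * (y \<bullet> ?v) * slaplacian (h (s k)) y) / m \<partial>\<sigma>)"
        using i by simp
      also have "\<dots> = (\<integral>y. (b\<^sub>1 j n x y - b\<^sub>1 j n' x y) * slaplacian (h (s k)) y \<partial>\<sigma>)"
        by (intro Bochner_Integration.integral_cong) (auto simp: b\<^sub>1_def diff_divide_distrib left_diff_distrib)
      finally show "(\<integral>y. a\<^sub>1 j n x y * h (s k) y \<partial>\<sigma>) - (\<integral>y. a\<^sub>1 j n' x y * h (s k) y \<partial>\<sigma>) =
        (\<integral>y. (b\<^sub>1 j n x y - b\<^sub>1 j n' x y) * slaplacian (h (s k)) y \<partial>\<sigma>)" .
    next
      fix n n' :: nat and y :: "real^3" assume n: "n \<le> n'" and y: "norm y = 1"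
      have "(\<integral>x. \<bar>b\<^sub>1 j n x y - b\<^sub>1 j n' x y\<bar> powr p \<partial>\<sigma>) =
        (\<integral>x. (1 / m) powr p * \<bar>log_ker' (\<epsilon> n) (y \<bullet> x) * (y \<bullet> sproj x b) - log_ker' (\<epsilon> n') (y \<bullet> x) * (y \<bullet> sproj x b)\<bar> powr p \<partial>\<sigma>)"
        using m by (intro Bochner_Integration.integral_cong)
          (auto simp: b\<^sub>1_def b powr_mult[symmetric] diff_divide_distrib[symmetric])
      also have "\<dots> \<le> (1 / m) powr p * (2 powr p * (12 / (2 - p)) * m * \<epsilon> n powr ((2 - p) / 4))"
        unfolding m_def integral_mult_right_zero by (intro mult_left_mono log_ker'_diff_powr_le y \<epsilon> \<epsilon>mono[OF n] p nb) auto
      finally show "(\<integral>x. \<bar>b\<^sub>1 j n x y - b\<^sub>1 j n' x y\<bar> powr p \<partial>\<sigma>) \<le> D * \<epsilon> n powr ((2 - p) / 4)"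
        by (simp add: D_def mult.assoc)
    next
      fix n and e :: real assume "e > 0"
      then show "\<exists>N. \<forall>k\<ge>N. \<forall>l\<ge>N. \<forall>x. norm x = 1 \<longrightarrow>
        \<bar>(\<integral>y. a\<^sub>1 j n x y * h (s k) y \<partial>\<sigma>) - (\<integral>y. a\<^sub>1 j n x y * h (s l) y \<partial>\<sigma>)\<bar> < e"
        using sC[of e "(n, Some j)", unfolded Q_def] by (simp add: \<kappa>_def)
    next
      show "(\<lambda>n. D * \<epsilon> n powr ((2 - p) / 4)) \<longlonglongrightarrow> 0"
        using tendsto_mult[OF tendsto_const[of D] powr_inverse_tendsto_0[of "(2 - p) / 4"]] p by (simp add: \<epsilon>_def)
    qed (use ca1 cb1 ch cL cd absL C' p e D in auto)
  qed
qed

text \<open>\<open>h\<close> is the extracted subsequence, \<open>\<eta>\<close> its limit and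
  \<open>w\<close> the limit of the gradients. Lower bound and tangency hold at every point of the
  sphere, not just almost everywhere, so that pointwise tensor algebra applies to the limit
  metric.\<close>

locale supersolution_limit =
  fixes h :: "nat \<Rightarrow> real^3 \<Rightarrow> real" and \<eta> :: "real^3 \<Rightarrow> real" and w :: "real^3 \<Rightarrow> real^3" and c :: real
  assumes c: "0 < c"
    and h: "\<And>k. C2_sphere (h k)" and h_ge: "\<And>k x. norm x = 1 \<Longrightarrow> c \<le> h k x"
    and super: "\<And>k x. norm x = 1 \<Longrightarrow> slaplacian (h k) x \<le> h k x"
    and \<eta>_measurable: "\<eta> \<in> borel_measurable \<sigma>"
    and \<eta>_ge: "\<And>x. norm x = 1 \<Longrightarrow> c \<le> \<eta> x"
    and \<eta>_powr: "\<And>q. 1 \<le> q \<Longrightarrow> integrable \<sigma> (\<lambda>x. \<bar>\<eta> x\<bar> powr q)"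
    and h_lim: "\<And>q. 1 \<le> q \<Longrightarrow> (\<lambda>k. \<integral>x. \<bar>h k x - \<eta> x\<bar> powr q \<partial>\<sigma>) \<longlonglongrightarrow> 0"
    and w_measurable: "w \<in> borel_measurable \<sigma>"
    and w_tangent: "\<And>x. norm x = 1 \<Longrightarrow> w x \<bullet> x = 0"
    and w_powr: "\<And>p b. 1 \<le> p \<Longrightarrow> p < 2 \<Longrightarrow> b \<in> Basis \<Longrightarrow> integrable \<sigma> (\<lambda>x. \<bar>w x \<bullet> b\<bar> powr p)"
    and dh_lim: "\<And>p b. 1 \<le> p \<Longrightarrow> p < 2 \<Longrightarrow> b \<in> Basis \<Longrightarrow>
      (\<lambda>k. \<integral>x. \<bar>sderiv (h k) x b - w x \<bullet> b\<bar> powr p \<partial>\<sigma>) \<longlonglongrightarrow> 0"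

section \<open>Construction of the limit function and its gradient\<close>

lemma continuous_on_sphere_powr_integrable:
  fixes F :: "'a::euclidean_space \<Rightarrow> real"
  shows "continuous_on (sphere 0 1) F \<Longrightarrow> 1 \<le> p \<Longrightarrow> integrable \<sigma> (\<lambda>x. \<bar>F x\<bar> powr p)"
  by (intro continuous_on_sphere_integrable continuous_on_powr' continuous_intros) auto

theorem supersolution_limit_exists:
  fixes h :: "nat \<Rightarrow> real^3 \<Rightarrow> real"
  assumes c: "0 < c" and h: "\<And>k. C2_sphere (h k)" and h_ge: "\<And>k x. norm x = 1 \<Longrightarrow> c \<le> h k x"
    and super: "\<And>k x. norm x = 1 \<Longrightarrow> slaplacian (h k) x \<le> h k x"
    and bd: "\<And>k. (\<integral>x. h k x \<partial>\<sigma>) \<le> C"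
  shows "\<exists>s \<eta> w. strict_mono (s :: nat \<Rightarrow> nat) \<and> supersolution_limit (\<lambda>k. h (s k)) \<eta> w c"
proof -
  have pos: "norm x = 1 \<Longrightarrow> 0 \<le> h k x" for k x using h_ge[of x k] c by simp
  obtain s where s: "strict_mono (s :: nat \<Rightarrow> nat)"
    and s1: "\<And>p e. 1 \<le> p \<Longrightarrow> e > 0 \<Longrightarrow> \<exists>N. \<forall>k\<ge>N. \<forall>l\<ge>N.
       (\<integral>x. \<bar>h (s k) x - h (s l) x\<bar> powr p \<partial>\<sigma>) < e"
    and s2: "\<And>p e b. 1 \<le> p \<Longrightarrow> p < 2 \<Longrightarrow> e > 0 \<Longrightarrow> b \<in> Basis \<Longrightarrow> \<exists>N. \<forall>k\<ge>N. \<forall>l\<ge>N.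
       (\<integral>x. \<bar>sderiv (h (s k)) x b - sderiv (h (s l)) x b\<bar> powr p \<partial>\<sigma>) < e"
  proof (rule supersolution_subsequence[of h C])
    fix s :: "nat \<Rightarrow> nat"
    assume "strict_mono s"
      and "\<And>p e. 1 \<le> p \<Longrightarrow> e > 0 \<Longrightarrow> \<exists>N. \<forall>k\<ge>N. \<forall>l\<ge>N.
       (\<integral>x. \<bar>h (s k) x - h (s l) x\<bar> powr p \<partial>\<sigma>) < e"
      and "\<And>p e b. 1 \<le> p \<Longrightarrow> p < 2 \<Longrightarrow> e > 0 \<Longrightarrow> b \<in> Basis \<Longrightarrow> \<exists>N. \<forall>k\<ge>N. \<forall>l\<ge>N.
       (\<integral>x. \<bar>sderiv (h (s k)) x b - sderiv (h (s l)) x b\<bar> powr p \<partial>\<sigma>) < e"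
    then show thesis by (rule that)
  qed (rule h pos super bd | assumption)+
  have ch: "continuous_on (sphere 0 1) (h k)" for k using h[of k] by (simp add: C2_sphere_def C1_sphere_continuous)
  have cd: "continuous_on (sphere 0 1) (\<lambda>x. sderiv (h k) x b)" for k b
    using h[of k] by (simp add: C2_sphere_def C1_sphere_continuous_sderiv)
  obtain r g where r: "strict_mono (r :: nat \<Rightarrow> nat)" and g: "g \<in> borel_measurable \<sigma>"
    and rlim: "AE x in sphere_measure. (\<lambda>n. h (s (r n)) x) \<longlonglongrightarrow> g x"
    and gi: "\<And>p. p \<in> {1..} \<Longrightarrow> integrable \<sigma> (\<lambda>x. \<bar>g x\<bar> powr p)"
    and gl: "\<And>p. p \<in> {1..} \<Longrightarrow> (\<lambda>n. \<integral>x. \<bar>h (s n) x - g x\<bar> powr p \<partial>\<sigma>) \<longlonglongrightarrow> 0"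
  proof (rule Cauchy_mean_limit[where f="\<lambda>k. h (s k)" and P="{1..}" and M=\<sigma>])
    show "integrable \<sigma> (\<lambda>x. \<bar>h (s n) x\<bar> powr p)" if "p \<in> {1..}" for n p
      using that ch by (intro continuous_on_sphere_powr_integrable) auto
    show "\<exists>N. \<forall>k\<ge>N. \<forall>l\<ge>N. (\<integral>x. \<bar>h (s k) x - h (s l) x\<bar> powr p \<partial>\<sigma>) < e"
      if "p \<in> {1..}" "e > 0" for p e using s1[of p e] that by simp
  qed (use ch in \<open>auto intro: continuous_on_sphere_measurable\<close>)
  \<comment> \<open>The limit in the mean is at least c almost everywhere; truncation makes this
    hold everywhere.\<close>
  define \<eta> where "\<eta> x = max c (g x)" for x
  have \<eta>g: "AE x in sphere_measure. \<eta> x = g x"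
    using rlim
  proof (rule AE_mp, intro AE_I2 impI)
    fix x :: "real^3" assume "x \<in> space \<sigma>" and l: "(\<lambda>n. h (s (r n)) x) \<longlonglongrightarrow> g x"
    then have "norm x = 1" by simp
    then have "c \<le> g x" using l h_ge by (intro LIMSEQ_le_const[OF l]) auto
    then show "\<eta> x = g x" by (simp add: \<eta>_def)
  qed
  have \<eta>m: "\<eta> \<in> borel_measurable \<sigma>" unfolding \<eta>_def using g by measurable
  have "\<exists>G. \<forall>b\<in>Basis. G b \<in> borel_measurable \<sigma> \<and>
      (\<forall>p. 1 \<le> p \<and> p < 2 \<longrightarrow> integrable \<sigma> (\<lambda>x. \<bar>G b x\<bar> powr p) \<and>
        (\<forall>n. integrable \<sigma> (\<lambda>x. \<bar>sderiv (h (s n)) x b - G b x\<bar> powr p)) \<and>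
        (\<lambda>n. \<integral>x. \<bar>sderiv (h (s n)) x b - G b x\<bar> powr p \<partial>\<sigma>) \<longlonglongrightarrow> 0)"
  proof (rule bchoice, rule ballI)
    fix b :: "real^3" assume b: "b \<in> Basis"
    show "\<exists>G. G \<in> borel_measurable \<sigma> \<and>
      (\<forall>p. 1 \<le> p \<and> p < 2 \<longrightarrow> integrable \<sigma> (\<lambda>x. \<bar>G x\<bar> powr p) \<and>
        (\<forall>n. integrable \<sigma> (\<lambda>x. \<bar>sderiv (h (s n)) x b - G x\<bar> powr p)) \<and>
        (\<lambda>n. \<integral>x. \<bar>sderiv (h (s n)) x b - G x\<bar> powr p \<partial>\<sigma>) \<longlonglongrightarrow> 0)"
    proof (rule Cauchy_mean_limit[where f="\<lambda>k x. sderiv (h (s k)) x b" and P="{1..<2}" and M=\<sigma>])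
      show "integrable \<sigma> (\<lambda>x. \<bar>sderiv (h (s n)) x b\<bar> powr p)" if "p \<in> {1..<2}" for n p
        using that cd by (intro continuous_on_sphere_powr_integrable) auto
      show "\<exists>N. \<forall>k\<ge>N. \<forall>l\<ge>N. (\<integral>x. \<bar>sderiv (h (s k)) x b - sderiv (h (s l)) x b\<bar> powr p \<partial>\<sigma>) < e"
        if "p \<in> {1..<2}" "e > 0" for p e using s2[of p e b] that b by simp
      show "(\<lambda>x. sderiv (h (s n)) x b) \<in> borel_measurable \<sigma>" for n
        by (intro continuous_on_sphere_measurable cd)
      fix r' :: "nat \<Rightarrow> nat" and G :: "real^3 \<Rightarrow> real"
      assume "G \<in> borel_measurable \<sigma>"
        "\<And>p. p \<in> {1..<2} \<Longrightarrow> integrable \<sigma> (\<lambda>x. \<bar>G x\<bar> powr p)"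
        "\<And>n p. p \<in> {1..<2} \<Longrightarrow> integrable \<sigma> (\<lambda>x. \<bar>sderiv (h (s n)) x b - G x\<bar> powr p)"
        "\<And>p. p \<in> {1..<2} \<Longrightarrow> (\<lambda>n. \<integral>x. \<bar>sderiv (h (s n)) x b - G x\<bar> powr p \<partial>\<sigma>) \<longlonglongrightarrow> 0"
      then show ?thesis by (intro exI[of _ G]) simp
    qed auto
  qed
  then obtain G where Gm: "\<And>b. b \<in> Basis \<Longrightarrow> G b \<in> borel_measurable \<sigma>"
    and Gi: "\<And>b p. b \<in> Basis \<Longrightarrow> 1 \<le> p \<Longrightarrow> p < 2 \<Longrightarrow> integrable \<sigma> (\<lambda>x. \<bar>G b x\<bar> powr p)"
    and Gd: "\<And>b p n. b \<in> Basis \<Longrightarrow> 1 \<le> p \<Longrightarrow> p < 2 \<Longrightarrow> integrable \<sigma> (\<lambda>x. \<bar>sderiv (h (s n)) x b - G b x\<bar> powr p)"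
    and Gl: "\<And>b p. b \<in> Basis \<Longrightarrow> 1 \<le> p \<Longrightarrow> p < 2 \<Longrightarrow> (\<lambda>n. \<integral>x. \<bar>sderiv (h (s n)) x b - G b x\<bar> powr p \<partial>\<sigma>) \<longlonglongrightarrow> 0"
    by blast
  define w' where "w' x = (\<Sum>b\<in>Basis. G b x *\<^sub>R b)" for x
  \<comment> \<open>The limit is replaced by 0 where it fails to be tangent, which happens on a null
    set only.\<close>
  define w where "w x = (if w' x \<bullet> x = 0 then w' x else 0)" for x
  have w'b: "w' x \<bullet> b = G b x" if "b \<in> Basis" for x b
    using that by (simp add: w'_def inner_sum_left inner_Basis if_distrib cong: if_cong)
  have w'm: "w' \<in> borel_measurable \<sigma>" unfolding w'_def using Gm by measurable
  have idm: "(\<lambda>x :: real^3. x) \<in> borel_measurable \<sigma>"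
    by (intro continuous_on_sphere_measurable continuous_on_id)
  have wm: "w \<in> borel_measurable \<sigma>" unfolding w_def using w'm idm by measurable
  \<comment> \<open>The gradients of \<open>h (s n)\<close> are tangent, so the normal component of
    the limit is at most the L^1 error, for every n.\<close>
  have AE0: "AE x in sphere_measure. w' x \<bullet> x = 0"
  proof -
    have wx: "w' x \<bullet> x = (\<Sum>b\<in>Basis. G b x * (x \<bullet> b))" for x by (simp add: w'_def inner_sum_left inner_commute[of x])
    have iG: "integrable \<sigma> (\<lambda>x. \<bar>sderiv (h (s n)) x b - G b x\<bar>)" if "b \<in> Basis" for b n
      using Gd[OF that, of 1 n] by simp
    have le: "\<bar>w' x \<bullet> x\<bar> \<le> (\<Sum>b\<in>Basis. \<bar>sderiv (h (s n)) x b - G b x\<bar>)" if x: "norm x = 1" for x n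
    proof -
      have "w' x \<bullet> x = (\<Sum>b\<in>Basis. (G b x - sderiv (h (s n)) x b) * (x \<bullet> b))"
        using sum_sderiv_normal[of "h (s n)" x] h[of "s n"] x
        by (simp add: wx left_diff_distrib sum_subtractf C2_sphere_def)
      also have "\<bar>\<dots>\<bar> \<le> (\<Sum>b\<in>Basis. \<bar>(G b x - sderiv (h (s n)) x b) * (x \<bullet> b)\<bar>)" by (rule sum_abs)
      also have "\<dots> \<le> (\<Sum>b\<in>Basis. \<bar>sderiv (h (s n)) x b - G b x\<bar>)"
      proof (rule sum_mono)
        fix b :: "real^3" assume "b \<in> Basis"
        then have "\<bar>x \<bullet> b\<bar> \<le> 1" using Basis_le_norm[of b x] x by simp
        then show "\<bar>(G b x - sderiv (h (s n)) x b) * (x \<bullet> b)\<bar> \<le> \<bar>sderiv (h (s n)) x b - G b x\<bar>"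
          using mult_left_mono[of "\<bar>x \<bullet> b\<bar>" 1 "\<bar>G b x - sderiv (h (s n)) x b\<bar>"]
          by (simp add: abs_mult abs_minus_commute)
      qed
      finally show ?thesis .
    qed
    have wxm: "(\<lambda>x. w' x \<bullet> x) \<in> borel_measurable \<sigma>" using w'm idm by measurable
    have isum: "integrable \<sigma> (\<lambda>x. \<Sum>b\<in>Basis. \<bar>sderiv (h (s n)) x b - G b x\<bar>)" for n
      using iG by (intro Bochner_Integration.integrable_sum)
    have i: "integrable \<sigma> (\<lambda>x. \<bar>w' x \<bullet> x\<bar>)"
      using wxm le[of _ 0] by (intro Bochner_Integration.integrable_bound[OF isum[of 0]]) (auto intro!: AE_I2 sum_nonneg)
    have "(\<integral>x. \<bar>w' x \<bullet> x\<bar> \<partial>\<sigma>) \<le> (\<Sum>b\<in>Basis. \<integral>x. \<bar>sderiv (h (s n)) x b - G b x\<bar> \<partial>\<sigma>)" for n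
    proof -
      have "(\<integral>x. \<bar>w' x \<bullet> x\<bar> \<partial>\<sigma>) \<le> (\<integral>x. (\<Sum>b\<in>Basis. \<bar>sderiv (h (s n)) x b - G b x\<bar>) \<partial>\<sigma>)"
        using le by (intro integral_mono i isum) auto
      then show ?thesis using iG by simp
    qed
    moreover have "(\<lambda>n. \<Sum>b\<in>Basis. \<integral>x. \<bar>sderiv (h (s n)) x b - G b x\<bar> \<partial>\<sigma>) \<longlonglongrightarrow> (\<Sum>b\<in>(Basis :: (real^3) set). 0)"
      using Gl[where p=1] by (intro tendsto_sum) simp
    ultimately have "(\<integral>x. \<bar>w' x \<bullet> x\<bar> \<partial>\<sigma>) \<le> 0"
      using LIMSEQ_le_const by fastforce
    then have "(\<integral>x. \<bar>w' x \<bullet> x\<bar> \<partial>\<sigma>) = 0"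
      by (intro antisym Bochner_Integration.integral_nonneg) auto
    then show ?thesis using integral_nonneg_eq_0_iff_AE[OF i] by simp
  qed
  have ww': "AE x in sphere_measure. w x = w' x" using AE0 by eventually_elim (simp add: w_def)
  have "supersolution_limit (\<lambda>k. h (s k)) \<eta> w c"
  proof
    fix q :: real assume q: "1 \<le> q"
    have "integrable \<sigma> (\<lambda>x. \<bar>\<eta> x\<bar> powr q) \<longleftrightarrow> integrable \<sigma> (\<lambda>x. \<bar>g x\<bar> powr q)"
      using \<eta>g \<eta>m g by (intro integrable_cong_AE) auto
    then show "integrable \<sigma> (\<lambda>x. \<bar>\<eta> x\<bar> powr q)" using gi q by simp
    have "(\<integral>x. \<bar>h (s k) x - \<eta> x\<bar> powr q \<partial>\<sigma>) = (\<integral>x. \<bar>h (s k) x - g x\<bar> powr q \<partial>\<sigma>)" for k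
      using \<eta>g \<eta>m g continuous_on_sphere_measurable[OF ch[of "s k"]] by (intro integral_cong_AE) auto
    then show "(\<lambda>k. \<integral>x. \<bar>h (s k) x - \<eta> x\<bar> powr q \<partial>\<sigma>) \<longlonglongrightarrow> 0" using gl q by simp
  next
    fix p :: real and b :: "real^3" assume p: "1 \<le> p" "p < 2" and b: "b \<in> Basis"
    have wG: "AE x in sphere_measure. w x \<bullet> b = G b x" using ww' by eventually_elim (simp add: w'b b)
    have wbm: "(\<lambda>x. w x \<bullet> b) \<in> borel_measurable \<sigma>" using wm by measurable
    have "integrable \<sigma> (\<lambda>x. \<bar>w x \<bullet> b\<bar> powr p) \<longleftrightarrow> integrable \<sigma> (\<lambda>x. \<bar>G b x\<bar> powr p)"
      using wG wbm Gm[OF b] by (intro integrable_cong_AE) auto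
    then show "integrable \<sigma> (\<lambda>x. \<bar>w x \<bullet> b\<bar> powr p)" using Gi p b by simp
    have "(\<integral>x. \<bar>sderiv (h (s k)) x b - w x \<bullet> b\<bar> powr p \<partial>\<sigma>) =
        (\<integral>x. \<bar>sderiv (h (s k)) x b - G b x\<bar> powr p \<partial>\<sigma>)" for k
      using wG wbm Gm[OF b] continuous_on_sphere_measurable[OF cd[of "s k" b]] by (intro integral_cong_AE) auto
    then show "(\<lambda>k. \<integral>x. \<bar>sderiv (h (s k)) x b - w x \<bullet> b\<bar> powr p \<partial>\<sigma>) \<longlonglongrightarrow> 0"
      using Gl p b by simp
  qed (use c h h_ge super \<eta>m wm in \<open>auto simp: \<eta>_def w_def\<close>)
  with s show ?thesis by blast
qed

section \<open>Products of sequences converging in the mean\<close>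

lemma mult_le_scaled_Young:
  fixes x y t :: real
  assumes "0 \<le> x" "0 \<le> y" "0 < t"
  shows "x * y \<le> t * x powr 3 + t powr (-1/2) * y powr (3/2)"
\<comment> \<open>Young's inequality for the conjugate exponents 3 and 3/2 with a free weight t:
  both terms on the right agree with x y at y = t x^2, and on either side of this curve one of them
  dominates it.\<close>
proof (cases "y \<le> t * x\<^sup>2")
  case True
  then have "x * y \<le> x * (t * x\<^sup>2)" using assms by (intro mult_left_mono)
  also have "\<dots> = t * x powr 3"
    using assms by (cases "x = 0") (simp_all add: powr_numeral power2_eq_square power3_eq_cube)
  finally show ?thesis using assms by (simp add: add_increasing2)
next
  case False
  then have y: "y > 0" using assms by (smt (verit) zero_le_power2 mult_nonneg_nonneg)
  have "x\<^sup>2 \<le> y / t" using False assms by (simp add: field_simps)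
  then have "x \<le> sqrt (y / t)" by (rule real_le_rsqrt)
  also have "\<dots> = t powr (-1/2) * y powr (1/2)"
    using assms y by (simp add: real_sqrt_divide powr_half_sqrt[symmetric] powr_minus_divide)
  finally have "x * y \<le> t powr (-1/2) * y powr (1/2) * y" using assms by (intro mult_right_mono)
  also have "\<dots> = t powr (-1/2) * y powr (3/2)" using y powr_mult_base[of y "1/2"] by (simp add: mult.commute)
  finally show ?thesis using assms by (simp add: add_increasing)
qed

text \<open>As the weight in the Young inequality is free, it is enough that one factor tends to 0
  in its mean while the other stays bounded. The exponent 3/2 lies below 2 and so admits the
  gradients.\<close>

lemma mean_mult_tendsto_0:
  fixes f g :: "nat \<Rightarrow> 'a \<Rightarrow> real"
  assumes m: "\<And>k. f k \<in> borel_measurable M" "\<And>k. g k \<in> borel_measurable M"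
    and i: "\<And>k. integrable M (\<lambda>x. \<bar>f k x\<bar> powr 3)" "\<And>k. integrable M (\<lambda>x. \<bar>g k x\<bar> powr (3/2))"
    and bd: "\<And>k. (\<integral>x. \<bar>f k x\<bar> powr 3 \<partial>M) \<le> A" "\<And>k. (\<integral>x. \<bar>g k x\<bar> powr (3/2) \<partial>M) \<le> A"
    and lim: "(\<lambda>k. \<integral>x. \<bar>f k x\<bar> powr 3 \<partial>M) \<longlonglongrightarrow> 0 \<or> (\<lambda>k. \<integral>x. \<bar>g k x\<bar> powr (3/2) \<partial>M) \<longlonglongrightarrow> 0"
  shows "integrable M (\<lambda>x. f k x * g k x)" "(\<lambda>k. \<integral>x. \<bar>f k x * g k x\<bar> \<partial>M) \<longlonglongrightarrow> 0"
proof -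
  let ?F = "\<lambda>k. \<integral>x. \<bar>f k x\<bar> powr 3 \<partial>M" and ?G = "\<lambda>k. \<integral>x. \<bar>g k x\<bar> powr (3/2) \<partial>M"
  have Y: "\<bar>f k x * g k x\<bar> \<le> t * \<bar>f k x\<bar> powr 3 + t powr (-1/2) * \<bar>g k x\<bar> powr (3/2)" if "t > 0" for t k x
    using mult_le_scaled_Young[of "\<bar>f k x\<bar>" "\<bar>g k x\<bar>" t] that by (simp add: abs_mult)
  have iY: "integrable M (\<lambda>x. t * \<bar>f k x\<bar> powr 3 + t powr (-1/2) * \<bar>g k x\<bar> powr (3/2))" for t k
    using i by simp
  show int: "integrable M (\<lambda>x. f k x * g k x)" for k
    using m Y[of 1 k] by (intro Bochner_Integration.integrable_bound[OF iY[of 1 k]]) auto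
  have le: "(\<integral>x. \<bar>f k x * g k x\<bar> \<partial>M) \<le> t * ?F k + t powr (-1/2) * ?G k" if "t > 0" for t k
  proof -
    have "(\<integral>x. \<bar>f k x * g k x\<bar> \<partial>M) \<le> (\<integral>x. t * \<bar>f k x\<bar> powr 3 + t powr (-1/2) * \<bar>g k x\<bar> powr (3/2) \<partial>M)"
      using int iY Y[OF that] by (intro integral_mono) auto
    then show ?thesis using i by simp
  qed
  have A: "A \<ge> 0" using order_trans[OF _ bd(1)[of 0]] by simp
  show "(\<lambda>k. \<integral>x. \<bar>f k x * g k x\<bar> \<partial>M) \<longlonglongrightarrow> 0"
  proof (rule LIMSEQ_I)
    fix e :: real assume e: "e > 0"
    have "\<forall>\<^sub>F k in sequentially. (\<integral>x. \<bar>f k x * g k x\<bar> \<partial>M) < e"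
      using lim
    proof
      assume l: "?F \<longlonglongrightarrow> 0"
      \<comment> \<open>Large enough to bring the bounded term with g down to e / 2; A + 1 instead
        of A keeps t positive.\<close>
      define t where "t = (2 * (A + 1) / e)\<^sup>2"
      have t: "t > 0" using e A by (simp add: t_def)
      have tA: "t powr (-1/2) * (A + 1) = e / 2"
      proof -
        have "t powr (-1/2) = 1 / sqrt t" using t by (simp add: powr_minus_divide powr_half_sqrt)
        also have "sqrt t = 2 * (A + 1) / e" using e A by (simp add: t_def real_sqrt_abs)
        finally show ?thesis using e A by (simp add: field_simps)
      qed
      have "(\<lambda>k. t * ?F k) \<longlonglongrightarrow> t * 0" by (intro tendsto_intros l)
      then have "\<forall>\<^sub>F k in sequentially. t * ?F k < e / 2" using e by (intro order_tendstoD(2)) auto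
      then show ?thesis
      proof eventually_elim
        case (elim k)
        have "t powr (-1/2) * ?G k \<le> t powr (-1/2) * (A + 1)" using bd(2)[of k] by (intro mult_left_mono) auto
        then show ?case using le[OF t, of k] elim tA by linarith
      qed
    next
      assume l: "?G \<longlonglongrightarrow> 0"
      define t where "t = e / (2 * (A + 1))"
      have t: "t > 0" using e A by (simp add: t_def)
      have tA: "t * (A + 1) = e / 2" using A by (simp add: t_def field_simps)
      have "(\<lambda>k. t powr (-1/2) * ?G k) \<longlonglongrightarrow> t powr (-1/2) * 0" by (intro tendsto_intros l)
      then have "\<forall>\<^sub>F k in sequentially. t powr (-1/2) * ?G k < e / 2" using e by (intro order_tendstoD(2)) auto
      then show ?thesis
      proof eventually_elim
        case (elim k)
        have "t * ?F k \<le> t * (A + 1)" using bd(1)[of k] t by (intro mult_left_mono) auto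
        then show ?case using le[OF t, of k] elim tA by linarith
      qed
    qed
    then show "\<exists>N. \<forall>k\<ge>N. norm ((\<integral>x. \<bar>f k x * g k x\<bar> \<partial>M) - 0) < e"
      by (simp add: eventually_sequentially)
  qed
qed

lemma tendsto_imp_bounded_above: "X \<longlonglongrightarrow> (l::real) \<Longrightarrow> \<exists>A. \<forall>k. X k \<le> A"
  using Bseq_def convergentI convergent_imp_Bseq by (metis abs_le_D1 real_norm_def)

text \<open>The difference of products is one product of differences plus two products with a fixed
  limit; each falls under \<open>mean_mult_tendsto_0\<close>.\<close>

lemma mean_mult_tendsto:
  fixes f g :: "nat \<Rightarrow> 'a \<Rightarrow> real"
  assumes m: "\<And>k. f k \<in> borel_measurable M" "\<And>k. g k \<in> borel_measurable M" "F \<in> borel_measurable M" "G \<in> borel_measurable M"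
    and i: "\<And>k. integrable M (\<lambda>x. \<bar>f k x - F x\<bar> powr 3)" "\<And>k. integrable M (\<lambda>x. \<bar>g k x - G x\<bar> powr (3/2))"
      "integrable M (\<lambda>x. \<bar>F x\<bar> powr 3)" "integrable M (\<lambda>x. \<bar>G x\<bar> powr (3/2))"
    and lim: "(\<lambda>k. \<integral>x. \<bar>f k x - F x\<bar> powr 3 \<partial>M) \<longlonglongrightarrow> 0" "(\<lambda>k. \<integral>x. \<bar>g k x - G x\<bar> powr (3/2) \<partial>M) \<longlonglongrightarrow> 0"
  shows "integrable M (\<lambda>x. F x * G x)" "(\<lambda>k. \<integral>x. \<bar>f k x * g k x - F x * G x\<bar> \<partial>M) \<longlonglongrightarrow> 0"
proof -
  obtain A1 where A1: "\<And>k. (\<integral>x. \<bar>f k x - F x\<bar> powr 3 \<partial>M) \<le> A1" using tendsto_imp_bounded_above[OF lim(1)] by blast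
  obtain A2 where A2: "\<And>k. (\<integral>x. \<bar>g k x - G x\<bar> powr (3/2) \<partial>M) \<le> A2" using tendsto_imp_bounded_above[OF lim(2)] by blast
  define A where "A = max (max A1 A2) (max (\<integral>x. \<bar>F x\<bar> powr 3 \<partial>M) (\<integral>x. \<bar>G x\<bar> powr (3/2) \<partial>M))"
  have bd: "(\<integral>x. \<bar>f k x - F x\<bar> powr 3 \<partial>M) \<le> A" "(\<integral>x. \<bar>g k x - G x\<bar> powr (3/2) \<partial>M) \<le> A"
    "(\<integral>x. \<bar>F x\<bar> powr 3 \<partial>M) \<le> A" "(\<integral>x. \<bar>G x\<bar> powr (3/2) \<partial>M) \<le> A" for k
    using A1[of k] A2[of k] by (auto simp: A_def)
  have m': "(\<lambda>x. f k x - F x) \<in> borel_measurable M" "(\<lambda>x. g k x - G x) \<in> borel_measurable M" for k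
    using m by measurable
  note T = mean_mult_tendsto_0[where A=A and M=M]
  note t1 = T[where f="\<lambda>k x. f k x - F x" and g="\<lambda>k x. g k x - G x", OF m' i(1,2) bd(1,2), OF disjI1[OF lim(1)]]
  note t2 = T[where f="\<lambda>_. F" and g="\<lambda>k x. g k x - G x", OF m(3) m'(2) i(3,2) bd(3,2), OF disjI2[OF lim(2)]]
  note t3 = T[where f="\<lambda>k x. f k x - F x" and g="\<lambda>_. G", OF m'(1) m(4) i(1,4) bd(1,4), OF disjI1[OF lim(1)]]
  show FG: "integrable M (\<lambda>x. F x * G x)"
  proof (rule Bochner_Integration.integrable_bound)
    show "integrable M (\<lambda>x. 1 * \<bar>F x\<bar> powr 3 + 1 powr (-1/2) * \<bar>G x\<bar> powr (3/2))" using i by simp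
    show "AE x in M. norm (F x * G x) \<le> norm (1 * \<bar>F x\<bar> powr 3 + 1 powr (-1/2) * \<bar>G x\<bar> powr (3/2))"
    proof (rule AE_I2)
      fix x
      have "\<bar>F x\<bar> * \<bar>G x\<bar> \<le> 1 * \<bar>F x\<bar> powr 3 + 1 powr (-1/2) * \<bar>G x\<bar> powr (3/2)"
        by (rule mult_le_scaled_Young) auto
      then show "norm (F x * G x) \<le> norm (1 * \<bar>F x\<bar> powr 3 + 1 powr (-1/2) * \<bar>G x\<bar> powr (3/2))"
        by (simp add: abs_mult)
    qed
  qed (use m in measurable)
  let ?S = "\<lambda>k x. (f k x - F x) * (g k x - G x) + F x * (g k x - G x) + (f k x - F x) * G x"
  have S: "f k x * g k x - F x * G x = ?S k x" for k x by (simp add: algebra_simps)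
  have iS: "integrable M (?S k)" for k using t1(1)[of k] t2(1)[of k] t3(1)[of k] by simp
  show "(\<lambda>k. \<integral>x. \<bar>f k x * g k x - F x * G x\<bar> \<partial>M) \<longlonglongrightarrow> 0"
  proof (rule tendsto_sandwich[OF _ _ tendsto_const])
    show "(\<lambda>k. (\<integral>x. \<bar>(f k x - F x) * (g k x - G x)\<bar> \<partial>M) + (\<integral>x. \<bar>F x * (g k x - G x)\<bar> \<partial>M) + (\<integral>x. \<bar>(f k x - F x) * G x\<bar> \<partial>M)) \<longlonglongrightarrow> 0"
      using tendsto_add[OF tendsto_add[OF t1(2) t2(2)] t3(2)] by simp
    show "\<forall>\<^sub>F k in sequentially. (\<integral>x. \<bar>f k x * g k x - F x * G x\<bar> \<partial>M) \<le>
      (\<integral>x. \<bar>(f k x - F x) * (g k x - G x)\<bar> \<partial>M) + (\<integral>x. \<bar>F x * (g k x - G x)\<bar> \<partial>M) + (\<integral>x. \<bar>(f k x - F x) * G x\<bar> \<partial>M)"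
    proof (rule always_eventually, rule allI)
      fix k
      have "(\<integral>x. \<bar>f k x * g k x - F x * G x\<bar> \<partial>M) \<le>
         (\<integral>x. \<bar>(f k x - F x) * (g k x - G x)\<bar> + \<bar>F x * (g k x - G x)\<bar> + \<bar>(f k x - F x) * G x\<bar> \<partial>M)"
        unfolding S using iS[of k] t1(1)[of k] t2(1)[of k] t3(1)[of k] by (intro integral_mono) auto
      then show "(\<integral>x. \<bar>f k x * g k x - F x * G x\<bar> \<partial>M) \<le>
      (\<integral>x. \<bar>(f k x - F x) * (g k x - G x)\<bar> \<partial>M) + (\<integral>x. \<bar>F x * (g k x - G x)\<bar> \<partial>M) + (\<integral>x. \<bar>(f k x - F x) * G x\<bar> \<partial>M)"
        using t1(1)[of k] t2(1)[of k] t3(1)[of k] by simp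
    qed
  qed (auto intro!: always_eventually)
qed

section \<open>First-order calculus on the product manifold\<close>

lemma retr_id: "p \<in> S2xS1 \<Longrightarrow> retr p = p"
  by (auto simp: retr_def sgn_id mem_Times_iff prod_eq_iff)

lemma retr_in: "fst q \<noteq> 0 \<Longrightarrow> snd q \<noteq> 0 \<Longrightarrow> retr q \<in> S2xS1"
  by (simp add: retr_def norm_sgn)

lemma retr_retr: "retr (retr q) = retr q"
  by (simp add: retr_def sgn_sgn_normed)

lemma open_punctured: "open {q :: amb. fst q \<noteq> 0 \<and> snd q \<noteq> 0}"
  by (intro open_Collect_conj open_Collect_neq continuous_intros)

lemma S2xS1_punctured: "p \<in> S2xS1 \<Longrightarrow> p \<in> {q :: amb. fst q \<noteq> 0 \<and> snd q \<noteq> 0}"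
  by (auto simp: mem_Times_iff)

lemma retr_has_derivative:
  assumes "p \<in> S2xS1" shows "(retr has_derivative tproj p) (at p)"
proof -
  have n: "norm (fst p) = 1" "norm (snd p) = 1" using assms by (auto simp: mem_Times_iff)
  have "((\<lambda>q. sgn (fst q)) has_derivative (\<lambda>v. sproj (fst p) (fst v))) (at p)"
    by (rule has_derivative_compose[OF has_derivative_fst[OF has_derivative_ident] has_derivative_sgn[OF n(1)]])
  moreover have "((\<lambda>q. sgn (snd q)) has_derivative (\<lambda>v. sproj (snd p) (snd v))) (at p)"
    by (rule has_derivative_compose[OF has_derivative_snd[OF has_derivative_ident] has_derivative_sgn[OF n(2)]])
  ultimately show ?thesis
    unfolding retr_def[abs_def] tproj_def[abs_def] by (rule has_derivative_Pair)
qed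

lemma M_has_derivative_cong:
  assumes "\<And>q. q \<in> S2xS1 \<Longrightarrow> F q = G q" "p \<in> S2xS1"
  shows "((\<lambda>q. F (retr q)) has_derivative D) (at p) \<longleftrightarrow> ((\<lambda>q. G (retr q)) has_derivative D) (at p)"
proof -
  have "F (retr q) = G (retr q)" if "q \<in> {q :: amb. fst q \<noteq> 0 \<and> snd q \<noteq> 0}" for q
    using that assms(1)[OF retr_in] by simp
  then show ?thesis
    using has_derivative_transform_within_open[OF _ open_punctured S2xS1_punctured[OF assms(2)]]
    by (metis (no_types, lifting))
qed

lemma mderiv_cong:
  assumes "\<And>q. q \<in> S2xS1 \<Longrightarrow> F q = G q" "p \<in> S2xS1"
  shows "mderiv F p v = mderiv G p v"
  unfolding mderiv_def frechet_derivative_def by (subst M_has_derivative_cong[OF assms]) auto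

lemma mderiv_eqI:
  "((\<lambda>q. F (retr q)) has_derivative D) (at p) \<Longrightarrow> mderiv F p v = D v"
  by (metis frechet_derivative_at mderiv_def)

lemma M_differentiable_iff:
  "(\<lambda>q. F (retr q)) differentiable (at p) \<longleftrightarrow> ((\<lambda>q. F (retr q)) has_derivative mderiv F p) (at p)"
proof -
  have "mderiv F p = frechet_derivative (\<lambda>q. F (retr q)) (at p)" by (rule ext) (simp add: mderiv_def)
  then show ?thesis by (simp add: frechet_derivative_works)
qed

lemma linear_tproj: "linear (tproj p)"
  by (rule linearI) (simp_all add: tproj_def linear_add[OF linear_sproj] linear_scale[OF linear_sproj])

lemma tproj_tproj: "p \<in> S2xS1 \<Longrightarrow> tproj p (tproj p v) = tproj p v"
  by (simp add: tproj_def mem_Times_iff sproj_sproj)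

lemma inner_tproj_commute: "tproj p v \<bullet> w = v \<bullet> tproj p w"
  by (simp add: tproj_def inner_prod_def inner_sproj_commute)

text \<open>As on the sphere: \<open>retr\<close> is idempotent and has the derivative
  \<open>tproj\<close>.\<close>

lemma mderiv_tproj:
  assumes "((\<lambda>q. F (retr q)) has_derivative D) (at p)" "p \<in> S2xS1"
  shows "D (tproj p v) = D v"
proof -
  have "((\<lambda>q. F (retr q)) has_derivative D) (at (retr p))" using assms by (simp add: retr_id)
  from has_derivative_compose[OF retr_has_derivative[OF assms(2)] this]
  have "((\<lambda>q. F (retr q)) has_derivative (\<lambda>v. D (tproj p v))) (at p)" by (simp only: retr_retr)
  from has_derivative_unique[OF this assms(1)] show ?thesis by metis
qed

definition C1_M :: "(amb \<Rightarrow> real) \<Rightarrow> bool" where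
  "C1_M F \<longleftrightarrow> (\<forall>p\<in>S2xS1. (\<lambda>q. F (retr q)) differentiable (at p)) \<and> (\<forall>v. continuous_on S2xS1 (\<lambda>p. mderiv F p v))"

lemma C1_M_has_derivative:
  "C1_M F \<Longrightarrow> p \<in> S2xS1 \<Longrightarrow> ((\<lambda>q. F (retr q)) has_derivative mderiv F p) (at p)"
  unfolding C1_M_def M_differentiable_iff by blast

lemma C1_M_continuous_mderiv: "C1_M F \<Longrightarrow> continuous_on S2xS1 (\<lambda>p. mderiv F p v)"
  unfolding C1_M_def by blast

lemma C1_M_continuous:
  assumes "C1_M F" shows "continuous_on S2xS1 F"
proof (rule continuous_on_eq)
  show "continuous_on S2xS1 (\<lambda>q. F (retr q))"
    using assms by (intro continuous_at_imp_continuous_on ballI) (blast dest: C1_M_has_derivative has_derivative_continuous)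
qed (simp add: retr_id)

lemma C1_MI:
  assumes "\<And>p. p \<in> S2xS1 \<Longrightarrow> ((\<lambda>q. F (retr q)) has_derivative D p) (at p)"
    and "\<And>v. continuous_on S2xS1 (\<lambda>p. D p v)"
  shows "C1_M F" "p \<in> S2xS1 \<Longrightarrow> mderiv F p v = D p v"
proof -
  have *: "mderiv F p v = D p v" if "p \<in> S2xS1" for p v using mderiv_eqI assms(1) that by blast
  then show "p \<in> S2xS1 \<Longrightarrow> mderiv F p v = D p v" .
  have "continuous_on S2xS1 (\<lambda>p. mderiv F p v)" for v
    using assms(2)[of v] by (rule continuous_on_eq) (rule *[symmetric])
  then show "C1_M F" using assms(1) unfolding C1_M_def differentiable_def by blast
qed

lemma C1_M_cong:
  assumes "\<And>q. q \<in> S2xS1 \<Longrightarrow> F q = G q" "C1_M F"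
  shows "C1_M G"
proof (rule C1_MI(1))
  show "((\<lambda>q. G (retr q)) has_derivative mderiv F p) (at p)" if "p \<in> S2xS1" for p
    using M_has_derivative_cong[of F G p "mderiv F p"] assms that by (simp add: C1_M_has_derivative)
qed (rule C1_M_continuous_mderiv[OF assms(2)])

lemma C1_M_const: "C1_M (\<lambda>_. c)" "p \<in> S2xS1 \<Longrightarrow> mderiv (\<lambda>_. c) p v = 0"
  for c :: real
  by (rule C1_MI[where D="\<lambda>_ _. 0"]; simp)+

lemma C1_M_add:
  assumes "C1_M F" "C1_M G"
  shows "C1_M (\<lambda>x. F x + G x)" "p \<in> S2xS1 \<Longrightarrow> mderiv (\<lambda>x. F x + G x) p v = mderiv F p v + mderiv G p v"
proof -
  have 1: "((\<lambda>q. F (retr q) + G (retr q)) has_derivative (\<lambda>v. mderiv F p v + mderiv G p v)) (at p)"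
    if "p \<in> S2xS1" for p
    using that by (intro has_derivative_add C1_M_has_derivative assms)
  have 2: "continuous_on S2xS1 (\<lambda>p. mderiv F p v + mderiv G p v)" for v
    by (intro continuous_intros C1_M_continuous_mderiv assms)
  show "C1_M (\<lambda>x. F x + G x)" "p \<in> S2xS1 \<Longrightarrow> mderiv (\<lambda>x. F x + G x) p v = mderiv F p v + mderiv G p v"
    using C1_MI[OF 1 2] by blast+
qed

lemma C1_M_mult:
  assumes "C1_M F" "C1_M G"
  shows "C1_M (\<lambda>x. F x * G x)"
    "p \<in> S2xS1 \<Longrightarrow> mderiv (\<lambda>x. F x * G x) p v = F p * mderiv G p v + mderiv F p v * G p"
proof -
  have 1: "((\<lambda>q. F (retr q) * G (retr q)) has_derivative (\<lambda>v. F p * mderiv G p v + mderiv F p v * G p)) (at p)"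
    if "p \<in> S2xS1" for p
    using has_derivative_mult[OF C1_M_has_derivative[OF assms(1) that] C1_M_has_derivative[OF assms(2) that]]
    by (simp only: retr_id[OF that])
  have 2: "continuous_on S2xS1 (\<lambda>p. F p * mderiv G p v + mderiv F p v * G p)" for v
    by (intro continuous_intros C1_M_continuous C1_M_continuous_mderiv assms)
  show "C1_M (\<lambda>x. F x * G x)"
    "p \<in> S2xS1 \<Longrightarrow> mderiv (\<lambda>x. F x * G x) p v = F p * mderiv G p v + mderiv F p v * G p"
    using C1_MI[OF 1 2] by blast+
qed

lemma C1_M_sum:
  assumes "finite I" "\<And>i. i \<in> I \<Longrightarrow> C1_M (F i)"
  shows "C1_M (\<lambda>x. \<Sum>i\<in>I. F i x) \<and> (p \<in> S2xS1 \<longrightarrow> mderiv (\<lambda>x. \<Sum>i\<in>I. F i x) p v = (\<Sum>i\<in>I. mderiv (F i) p v))"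
  using assms by (induction I) (auto simp: C1_M_const C1_M_add)

lemma C1_M_fst:
  assumes "C1_sphere \<alpha>"
  shows "C1_M (\<lambda>p. \<alpha> (fst p))" "p \<in> S2xS1 \<Longrightarrow> mderiv (\<lambda>p. \<alpha> (fst p)) p v = sderiv \<alpha> (fst p) (fst v)"
proof -
  have 1: "((\<lambda>q. \<alpha> (fst (retr q))) has_derivative (\<lambda>v. sderiv \<alpha> (fst p) (fst v))) (at p)" if "p \<in> S2xS1" for p
  proof -
    have "norm (fst p) = 1" using that by (simp add: mem_Times_iff)
    from has_derivative_compose[OF has_derivative_fst[OF has_derivative_ident] C1_sphere_has_derivative[OF assms this]]
    show ?thesis by (simp add: retr_def)
  qed
  have 2: "continuous_on S2xS1 (\<lambda>p. sderiv \<alpha> (fst p) (fst v))" for v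
    by (rule continuous_on_compose2[OF C1_sphere_continuous_sderiv[OF assms]]) (auto intro!: continuous_intros)
  show "C1_M (\<lambda>p. \<alpha> (fst p))" "p \<in> S2xS1 \<Longrightarrow> mderiv (\<lambda>p. \<alpha> (fst p)) p v = sderiv \<alpha> (fst p) (fst v)"
    using C1_MI[OF 1 2] by blast+
qed

lemma smooth_on_M_imp_C1:
  fixes F :: "amb \<Rightarrow> 'b::real_inner"
  assumes "smooth_on_M F"
  shows "C1_M (\<lambda>p. F p \<bullet> b)" "p \<in> S2xS1 \<Longrightarrow> ((\<lambda>q. F (retr q)) has_derivative mderiv F p) (at p)"
    "p \<in> S2xS1 \<Longrightarrow> mderiv (\<lambda>p. F p \<bullet> b) p v = mderiv F p v \<bullet> b"
proof -
  let ?U = "{q :: amb. fst q \<noteq> 0 \<and> snd q \<noteq> 0}"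
  have "Ck_on (Suc 0) (\<lambda>q. F (retr q)) ?U" using assms unfolding smooth_on_M_def smooth_open_def by blast
  then have d: "\<And>p. p \<in> ?U \<Longrightarrow> (\<lambda>q. F (retr q)) differentiable (at p)" and cd: "\<And>v. continuous_on ?U (\<lambda>p. mderiv F p v)"
    unfolding mderiv_def by auto
  show D: "((\<lambda>q. F (retr q)) has_derivative mderiv F p) (at p)" if "p \<in> S2xS1" for p
    using d[OF S2xS1_punctured[OF that]] by (simp add: M_differentiable_iff)
  have 1: "((\<lambda>q. F (retr q) \<bullet> b) has_derivative (\<lambda>v. mderiv F p v \<bullet> b)) (at p)" if "p \<in> S2xS1" for p
    using D[OF that] by (rule has_derivative_inner_left)
  have 2: "continuous_on S2xS1 (\<lambda>p. mderiv F p v \<bullet> b)" for v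
    by (intro continuous_intros continuous_on_subset[OF cd]) (auto simp: mem_Times_iff)
  show "C1_M (\<lambda>p. F p \<bullet> b)" "p \<in> S2xS1 \<Longrightarrow> mderiv (\<lambda>p. F p \<bullet> b) p v = mderiv F p v \<bullet> b"
    using C1_MI[OF 1 2] by blast+
qed

text \<open>Freezing one variable reduces the divergence theorem on the product to the one on each
  sphere.\<close>

lemma C1_M_slices:
  assumes F: "C1_M F"
  shows "norm y = 1 \<Longrightarrow> C1_sphere (\<lambda>x. F (x, y))"
    "norm x = 1 \<Longrightarrow> norm y = 1 \<Longrightarrow> sderiv (\<lambda>x. F (x, y)) x v = mderiv F (x, y) (v, 0)"
    "norm x = 1 \<Longrightarrow> C1_sphere (\<lambda>y. F (x, y))"
    "norm x = 1 \<Longrightarrow> norm y = 1 \<Longrightarrow> sderiv (\<lambda>y. F (x, y)) y u = mderiv F (x, y) (0, u)"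
proof -
  have 1: "((\<lambda>x. F (sgn x, y)) has_derivative (\<lambda>v. mderiv F (x, y) (v, 0))) (at x)"
    if "norm y = 1" "norm x = 1" for x y
  proof -
    have "((\<lambda>x. (x, y)) has_derivative (\<lambda>v. (v, 0))) (at x)" by (auto intro!: derivative_eq_intros)
    from has_derivative_compose[OF this C1_M_has_derivative[OF F]] that show ?thesis by (simp add: retr_def sgn_id)
  qed
  have 2: "continuous_on (sphere 0 1) (\<lambda>x. mderiv F (x, y) v)" if "norm y = 1" for y v
    using that by (intro continuous_on_compose2[OF C1_M_continuous_mderiv[OF F], of _ "\<lambda>x. (x, y)"] continuous_intros) auto
  show "norm y = 1 \<Longrightarrow> C1_sphere (\<lambda>x. F (x, y))"
    "norm x = 1 \<Longrightarrow> norm y = 1 \<Longrightarrow> sderiv (\<lambda>x. F (x, y)) x v = mderiv F (x, y) (v, 0)"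
    using C1_sphereI[OF 1 2] by blast+
  have 3: "((\<lambda>y. F (x, sgn y)) has_derivative (\<lambda>v. mderiv F (x, y) (0, v))) (at y)"
    if "norm x = 1" "norm y = 1" for x y
  proof -
    have "((\<lambda>y. (x, y)) has_derivative (\<lambda>v. (0, v))) (at y)" by (auto intro!: derivative_eq_intros)
    from has_derivative_compose[OF this C1_M_has_derivative[OF F]] that show ?thesis by (simp add: retr_def sgn_id)
  qed
  have 4: "continuous_on (sphere 0 1) (\<lambda>y. mderiv F (x, y) v)" if "norm x = 1" for x v
    using that by (intro continuous_on_compose2[OF C1_M_continuous_mderiv[OF F], of _ "\<lambda>y. (x, y)"] continuous_intros) auto
  show "norm x = 1 \<Longrightarrow> C1_sphere (\<lambda>y. F (x, y))"
    "norm x = 1 \<Longrightarrow> norm y = 1 \<Longrightarrow> sderiv (\<lambda>y. F (x, y)) y u = mderiv F (x, y) (0, u)"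
    using C1_sphereI[OF 3 4] by blast+
qed

section \<open>Integration on the product manifold\<close>

lemma space_mu0 [simp]: "space mu0 = S2xS1"
  by (simp add: mu0_def space_pair_measure)

lemma continuous_on_M_measurable:
  fixes F :: "amb \<Rightarrow> 'b::topological_space"
  shows "continuous_on S2xS1 F \<Longrightarrow> F \<in> borel_measurable mu0"
  unfolding mu0_def by (rule continuous_on_pair_sphere_measurable)

lemma continuous_on_M_integrable:
  fixes F :: "amb \<Rightarrow> 'b::{banach, second_countable_topology}"
  shows "continuous_on S2xS1 F \<Longrightarrow> integrable mu0 F"
  unfolding mu0_def by (rule continuous_on_pair_sphere_integrable)

lemma measurable_fst_mu0: "fst \<in> measurable mu0 \<sigma>"
  unfolding mu0_def by simp

abbreviation "circle_length \<equiv> measure \<sigma> (sphere 0 (1::real) :: (real^2) set)"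

lemma integrable_mu0_fst:
  fixes f :: "real^3 \<Rightarrow> 'b::{banach, second_countable_topology}"
  assumes "integrable \<sigma> f"
  shows "integrable mu0 (\<lambda>p. f (fst p))" "(\<integral>p. f (fst p) \<partial>mu0) = circle_length *\<^sub>R (\<integral>x. f x \<partial>\<sigma>)"
proof -
  have m: "(\<lambda>p :: amb. f (fst p)) \<in> borel_measurable (\<sigma> \<Otimes>\<^sub>M \<sigma>)"
    using measurable_compose[OF measurable_fst borel_measurable_integrable[OF assms]] .
  show i: "integrable mu0 (\<lambda>p. f (fst p))"
    unfolding mu0_def using assms m by (intro sphere_pair.Fubini_integrable) auto
  have "(\<integral>p. f (fst p) \<partial>mu0) = (\<integral>x. (\<integral>y. f x \<partial>(\<sigma> :: (real^2) measure)) \<partial>\<sigma>)"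
    using sphere_pair.integral_fst'[OF i[unfolded mu0_def]] by (simp add: mu0_def)
  then show "(\<integral>p. f (fst p) \<partial>mu0) = circle_length *\<^sub>R (\<integral>x. f x \<partial>\<sigma>)" using assms by simp
qed

lemma sum_Basis_amb: "(\<Sum>b\<in>Basis. f b) = (\<Sum>u\<in>Basis. f (u, 0)) + (\<Sum>v\<in>Basis. f (0, v))"
  for f :: "amb \<Rightarrow> 'b::comm_monoid_add"
proof -
  have "inj_on (\<lambda>u. (u :: real^3, 0 :: real^2)) Basis" "inj_on (\<lambda>v. (0 :: real^3, v :: real^2)) Basis"
    by (auto intro!: inj_onI)
  then show ?thesis
    unfolding Basis_prod_def by (subst sum.union_disjoint) (auto simp: sum.reindex)
qed

section \<open>The divergence theorem on the product\<close>

definition C1_field :: "(amb \<Rightarrow> amb) \<Rightarrow> bool" where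
  "C1_field X \<longleftrightarrow> (\<forall>b. C1_M (\<lambda>p. X p \<bullet> b)) \<and> (\<forall>p\<in>S2xS1. tproj p (X p) = X p)"

text \<open>The flat trace of the component derivatives, free of any connection; for smooth tangent
  fields it is the Riemannian divergence, by \<open>div1_eq_divM\<close>.\<close>

definition divM :: "(amb \<Rightarrow> amb) \<Rightarrow> amb \<Rightarrow> real" where
  "divM X p = (\<Sum>b\<in>Basis. mderiv (\<lambda>q. X q \<bullet> b) p b)"

lemma C1_field_continuous: "C1_field X \<Longrightarrow> continuous_on S2xS1 X"
  by (subst continuous_on_componentwise) (auto simp: C1_field_def C1_M_continuous)

lemma divM_continuous: "C1_field X \<Longrightarrow> continuous_on S2xS1 (divM X)"
  unfolding divM_def[abs_def] by (intro continuous_intros C1_M_continuous_mderiv) (auto simp: C1_field_def)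

lemma tangent_iff: "p \<in> S2xS1 \<Longrightarrow> tproj p v = v \<longleftrightarrow> fst v \<bullet> fst p = 0 \<and> snd v \<bullet> snd p = 0"
  by (auto simp: tproj_def sproj_def prod_eq_iff mem_Times_iff)

text \<open>The trace splits into the directions of the two factors. Each part is integrated first
  over its own factor, where the corresponding component of X is a tangent field on a
  sphere.\<close>

lemma integral_divM_eq_0:
  assumes X: "C1_field X"
  shows "(\<integral>p. divM X p \<partial>mu0) = 0"
proof -
  have C1: "C1_M (\<lambda>p. X p \<bullet> b)" for b using X unfolding C1_field_def by blast
  have tan: "fst (X (x, y)) \<bullet> x = 0" "snd (X (x, y)) \<bullet> y = 0" if "norm x = 1" "norm y = 1" for x y
    using X tangent_iff[of "(x, y)" "X (x, y)"] that by (auto simp: C1_field_def)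
  define D1 where "D1 p = (\<Sum>u\<in>Basis. mderiv (\<lambda>q. X q \<bullet> (u, 0)) p (u, 0))" for p
  define D2 where "D2 p = (\<Sum>v\<in>Basis. mderiv (\<lambda>q. X q \<bullet> (0, v)) p (0, v))" for p
  have i: "integrable mu0 D1" "integrable mu0 D2"
    unfolding D1_def D2_def by (intro continuous_on_M_integrable continuous_intros C1_M_continuous_mderiv C1)+
  have "(\<integral>p. D1 p \<partial>mu0) = (\<integral>y. (\<integral>x. D1 (x, y) \<partial>\<sigma>) \<partial>\<sigma>)"
    using sphere_pair.integral_snd[of "\<lambda>x y. D1 (x, y)"] i(1) by (simp add: mu0_def)
  also have "\<dots> = (\<integral>y. 0 \<partial>(\<sigma> :: (real^2) measure))"
  proof (intro Bochner_Integration.integral_cong refl)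
    fix y :: "real^2" assume "y \<in> space \<sigma>"
    then have y: "norm y = 1" by simp
    have "(\<integral>x. D1 (x, y) \<partial>\<sigma>) = (\<integral>x. (\<Sum>u\<in>Basis. sderiv (\<lambda>x. X (x, y) \<bullet> (u, 0)) x u) \<partial>\<sigma>)"
      using y by (intro Bochner_Integration.integral_cong) (auto simp: D1_def C1_M_slices[OF C1])
    also have "\<dots> = 0"
    proof (rule integral_sphere_divergence_eq_0)
      fix x :: "real^3" assume x: "norm x = 1"
      have "(\<Sum>u\<in>Basis. (X (x, y) \<bullet> (u, 0)) * (x \<bullet> u)) = fst (X (x, y)) \<bullet> x"
        by (simp add: inner_prod_def sum_Basis_inner_mult)
      then show "(\<Sum>u\<in>Basis. (X (x, y) \<bullet> (u, 0)) * (x \<bullet> u)) = 0" using tan x y by simp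
    qed (use C1_M_slices(1)[OF C1 y] in auto)
    finally show "(\<integral>x. D1 (x, y) \<partial>\<sigma>) = 0" .
  qed
  finally have 1: "(\<integral>p. D1 p \<partial>mu0) = 0" by simp
  have "(\<integral>p. D2 p \<partial>mu0) = (\<integral>x. (\<integral>y. D2 (x, y) \<partial>\<sigma>) \<partial>\<sigma>)"
    using sphere_pair.integral_fst[of "\<lambda>x y. D2 (x, y)"] i(2) by (simp add: mu0_def)
  also have "\<dots> = (\<integral>x. 0 \<partial>(\<sigma> :: (real^3) measure))"
  proof (intro Bochner_Integration.integral_cong refl)
    fix x :: "real^3" assume "x \<in> space \<sigma>"
    then have x: "norm x = 1" by simp
    have "(\<integral>y. D2 (x, y) \<partial>\<sigma>) = (\<integral>y. (\<Sum>v\<in>Basis. sderiv (\<lambda>y. X (x, y) \<bullet> (0, v)) y v) \<partial>\<sigma>)"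
      using x by (intro Bochner_Integration.integral_cong) (auto simp: D2_def C1_M_slices[OF C1])
    also have "\<dots> = 0"
    proof (rule integral_sphere_divergence_eq_0)
      fix y :: "real^2" assume y: "norm y = 1"
      have "(\<Sum>v\<in>Basis. (X (x, y) \<bullet> (0, v)) * (y \<bullet> v)) = snd (X (x, y)) \<bullet> y"
        by (simp add: inner_prod_def sum_Basis_inner_mult)
      then show "(\<Sum>v\<in>Basis. (X (x, y) \<bullet> (0, v)) * (y \<bullet> v)) = 0" using tan x y by simp
    qed (use C1_M_slices(3)[OF C1 x] in auto)
    finally show "(\<integral>y. D2 (x, y) \<partial>\<sigma>) = 0" .
  qed
  finally have 2: "(\<integral>p. D2 p \<partial>mu0) = 0" by simp
  have "divM X p = D1 p + D2 p" for p unfolding divM_def sum_Basis_amb D1_def D2_def ..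
  then show ?thesis using 1 2 i by simp
qed

lemma C1_field_scale:
  assumes F: "C1_M F" and X: "C1_field X"
  shows "C1_field (\<lambda>p. F p *\<^sub>R X p)"
    "p \<in> S2xS1 \<Longrightarrow> divM (\<lambda>p. F p *\<^sub>R X p) p = F p * divM X p + mderiv F p (X p)"
proof -
  have C1: "C1_M (\<lambda>p. X p \<bullet> b)" for b using X unfolding C1_field_def by blast
  show "C1_field (\<lambda>p. F p *\<^sub>R X p)"
    unfolding C1_field_def
  proof (intro conjI allI ballI)
    show "C1_M (\<lambda>p. (F p *\<^sub>R X p) \<bullet> b)" for b
      unfolding inner_scaleR_left by (rule C1_M_mult(1)[OF F C1])
    show "tproj p (F p *\<^sub>R X p) = F p *\<^sub>R X p" if "p \<in> S2xS1" for p
    proof -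
      have "tproj p (X p) = X p" using X that unfolding C1_field_def by blast
      then show ?thesis unfolding linear_scale[OF linear_tproj] by simp
    qed
  qed
  assume p: "p \<in> S2xS1"
  have lin: "linear (mderiv F p)" using C1_M_has_derivative[OF F p] has_derivative_linear by blast
  have "mderiv F p (X p) = mderiv F p (\<Sum>b\<in>Basis. (X p \<bullet> b) *\<^sub>R b)" by (simp only: euclidean_representation)
  also have "\<dots> = (\<Sum>b\<in>Basis. (X p \<bullet> b) * mderiv F p b)"
    by (simp only: linear_sum[OF lin] linear_scale[OF lin]) simp
  finally have "mderiv F p (X p) = (\<Sum>b\<in>Basis. (X p \<bullet> b) * mderiv F p b)" .
  then show "divM (\<lambda>p. F p *\<^sub>R X p) p = F p * divM X p + mderiv F p (X p)"
    using p by (simp add: divM_def C1_M_mult[OF F C1] sum.distrib sum_distrib_left mult.commute)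
qed

text \<open>A weak gradient for functions of the sphere variable, tested on the whole product. Test
  fields of class C1 are allowed, so that products of fields with C1 functions and contractions of
  smooth tensors are among them.\<close>

definition weak_gradient :: "(real^3 \<Rightarrow> real) \<Rightarrow> (real^3 \<Rightarrow> real^3) \<Rightarrow> bool" where
  "weak_gradient \<alpha> w \<longleftrightarrow> integrable \<sigma> \<alpha> \<and> integrable \<sigma> w \<and>
     (\<forall>x. norm x = 1 \<longrightarrow> w x \<bullet> x = 0) \<and>
     (\<forall>X. C1_field X \<longrightarrow> (\<integral>p. w (fst p) \<bullet> fst (X p) \<partial>mu0) = - (\<integral>p. \<alpha> (fst p) * divM X p \<partial>mu0))"

lemma continuous_on_M_bounded:
  fixes F :: "amb \<Rightarrow> 'b::real_normed_vector"
  assumes "continuous_on S2xS1 F"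
  shows "\<exists>B>0. \<forall>p\<in>S2xS1. norm (F p) \<le> B"
proof -
  have "compact (F ` S2xS1)" using assms by (intro compact_continuous_image compact_Times) auto
  then have "bounded (F ` S2xS1)" by (rule compact_imp_bounded)
  then show ?thesis unfolding bounded_pos by blast
qed

lemma integrable_mult_continuous:
  fixes f :: "real^3 \<Rightarrow> 'b::euclidean_space" and G :: "amb \<Rightarrow> 'b"
  assumes f: "integrable \<sigma> f" and G: "continuous_on S2xS1 G"
  shows "integrable mu0 (\<lambda>p. f (fst p) \<bullet> G p)"
proof -
  obtain B where B: "B > 0" "\<And>p. p \<in> S2xS1 \<Longrightarrow> norm (G p) \<le> B" using continuous_on_M_bounded[OF G] by blast
  have i: "integrable mu0 (\<lambda>p. B * norm (f (fst p)))"
    using integrable_mu0_fst(1)[OF integrable_norm[OF f]] by simp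
  show ?thesis
  proof (rule Bochner_Integration.integrable_bound[OF i])
    have "(\<lambda>p. f (fst p)) \<in> borel_measurable mu0" using integrable_mu0_fst(1)[OF f] by simp
    then show "(\<lambda>p. f (fst p) \<bullet> G p) \<in> borel_measurable mu0"
      using continuous_on_M_measurable[OF G] by measurable
    show "AE p in mu0. norm (f (fst p) \<bullet> G p) \<le> norm (B * norm (f (fst p)))"
    proof (rule AE_I2)
      fix p assume "p \<in> space mu0"
      then have "norm (f (fst p)) * norm (G p) \<le> norm (f (fst p)) * B" using B by (intro mult_left_mono) auto
      then show "norm (f (fst p) \<bullet> G p) \<le> norm (B * norm (f (fst p)))"
        using Cauchy_Schwarz_ineq2[of "f (fst p)" "G p"] B(1) by (simp add: abs_mult mult.commute)
    qed
  qed
qed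

lemma integral_mult_continuous_tendsto:
  fixes f :: "nat \<Rightarrow> real^3 \<Rightarrow> 'b::euclidean_space" and G :: "amb \<Rightarrow> 'b"
  assumes f: "\<And>k. integrable \<sigma> (f k)" "integrable \<sigma> g" and G: "continuous_on S2xS1 G"
    and lim: "(\<lambda>k. \<integral>x. norm (f k x - g x) \<partial>\<sigma>) \<longlonglongrightarrow> 0"
  shows "(\<lambda>k. \<integral>p. f k (fst p) \<bullet> G p \<partial>mu0) \<longlonglongrightarrow> (\<integral>p. g (fst p) \<bullet> G p \<partial>mu0)"
proof -
  obtain B where B: "B > 0" "\<And>p. p \<in> S2xS1 \<Longrightarrow> norm (G p) \<le> B" using continuous_on_M_bounded[OF G] by blast
  have d: "integrable \<sigma> (\<lambda>x. f k x - g x)" for k using f by simp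
  have le: "\<bar>(\<integral>p. f k (fst p) \<bullet> G p \<partial>mu0) - (\<integral>p. g (fst p) \<bullet> G p \<partial>mu0)\<bar> \<le>
      B * (circle_length * (\<integral>x. norm (f k x - g x) \<partial>\<sigma>))" for k
  proof -
    have "(\<integral>p. f k (fst p) \<bullet> G p \<partial>mu0) - (\<integral>p. g (fst p) \<bullet> G p \<partial>mu0) = (\<integral>p. (f k (fst p) - g (fst p)) \<bullet> G p \<partial>mu0)"
      using integrable_mult_continuous[OF f(1) G] integrable_mult_continuous[OF f(2) G] by (simp add: inner_diff_left)
    also have "\<bar>\<dots>\<bar> \<le> (\<integral>p. \<bar>(f k (fst p) - g (fst p)) \<bullet> G p\<bar> \<partial>mu0)" by (rule integral_abs_bound)
    also have "\<dots> \<le> (\<integral>p. B * norm (f k (fst p) - g (fst p)) \<partial>mu0)"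
    proof (rule integral_mono)
      show "integrable mu0 (\<lambda>p. \<bar>(f k (fst p) - g (fst p)) \<bullet> G p\<bar>)"
        using integrable_mult_continuous[OF d[of k] G] by simp
      show "integrable mu0 (\<lambda>p. B * norm (f k (fst p) - g (fst p)))"
        using integrable_mu0_fst(1)[OF integrable_norm[OF d[of k]]] by simp
      fix p assume "p \<in> space mu0"
      then have "norm (f k (fst p) - g (fst p)) * norm (G p) \<le> norm (f k (fst p) - g (fst p)) * B"
        using B by (intro mult_left_mono) auto
      then show "\<bar>(f k (fst p) - g (fst p)) \<bullet> G p\<bar> \<le> B * norm (f k (fst p) - g (fst p))"
        using Cauchy_Schwarz_ineq2[of "f k (fst p) - g (fst p)" "G p"] by (simp add: mult.commute)
    qed
    also have "\<dots> = B * (circle_length * (\<integral>x. norm (f k x - g x) \<partial>\<sigma>))"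
      using integrable_mu0_fst(2)[OF integrable_norm[OF d[of k]]] by simp
    finally show ?thesis .
  qed
  have lim0: "(\<lambda>k. B * (circle_length * (\<integral>x. norm (f k x - g x) \<partial>\<sigma>))) \<longlonglongrightarrow> 0"
    using tendsto_mult[OF tendsto_const[of B] tendsto_mult[OF tendsto_const[of circle_length] lim]] by simp
  have "(\<lambda>k. (\<integral>p. f k (fst p) \<bullet> G p \<partial>mu0) - (\<integral>p. g (fst p) \<bullet> G p \<partial>mu0)) \<longlonglongrightarrow> 0"
  proof (rule Lim_null_comparison[OF always_eventually lim0], rule allI)
    fix k
    show "norm ((\<integral>p. f k (fst p) \<bullet> G p \<partial>mu0) - (\<integral>p. g (fst p) \<bullet> G p \<partial>mu0)) \<le>
        B * (circle_length * (\<integral>x. norm (f k x - g x) \<partial>\<sigma>))"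
      using le[of k] by (simp only: real_norm_def)
  qed
  then show ?thesis by (simp add: LIM_zero_iff)
qed

lemma C1_field_fst_continuous: "C1_field X \<Longrightarrow> continuous_on S2xS1 (\<lambda>p. fst (X p))"
  by (intro continuous_intros C1_field_continuous)

lemma sgrad_continuous: "C1_sphere \<alpha> \<Longrightarrow> continuous_on (sphere 0 1) (sgrad \<alpha>)"
  unfolding sgrad_def[abs_def] by (intro continuous_intros C1_sphere_continuous_sderiv)

text \<open>The product rule for the divergence of \<alpha> X, whose integral is 0.\<close>

lemma weak_gradient_C1:
  assumes \<alpha>: "C1_sphere \<alpha>" shows "weak_gradient \<alpha> (sgrad \<alpha>)"
  unfolding weak_gradient_def
proof (intro conjI allI impI)
  show "integrable \<sigma> \<alpha>" "integrable \<sigma> (sgrad \<alpha>)"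
    using \<alpha> by (auto intro: continuous_on_sphere_integrable C1_sphere_continuous sgrad_continuous)
  show "sgrad \<alpha> x \<bullet> x = 0" if "norm x = 1" for x
    using sum_sderiv_normal[OF \<alpha> that] by (simp add: sgrad_def inner_sum_left inner_commute[of x])
  fix X assume X: "C1_field X"
  note i = integrable_mult_continuous[OF continuous_on_sphere_integrable]
  have i1: "integrable mu0 (\<lambda>p. \<alpha> (fst p) * divM X p)"
    using i[OF C1_sphere_continuous[OF \<alpha>] divM_continuous[OF X]] by simp
  have i2: "integrable mu0 (\<lambda>p. sgrad \<alpha> (fst p) \<bullet> fst (X p))"
    by (rule i[OF sgrad_continuous[OF \<alpha>] C1_field_fst_continuous[OF X]])
  have "0 = (\<integral>p. divM (\<lambda>p. \<alpha> (fst p) *\<^sub>R X p) p \<partial>mu0)"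
    by (rule integral_divM_eq_0[OF C1_field_scale(1)[OF C1_M_fst(1)[OF \<alpha>] X], symmetric])
  also have "\<dots> = (\<integral>p. \<alpha> (fst p) * divM X p + sgrad \<alpha> (fst p) \<bullet> fst (X p) \<partial>mu0)"
    by (intro Bochner_Integration.integral_cong refl)
      (auto simp: C1_field_scale(2)[OF C1_M_fst(1)[OF \<alpha>] X] C1_M_fst(2)[OF \<alpha>] sgrad_inner[OF \<alpha>] mem_Times_iff)
  finally show "(\<integral>p. sgrad \<alpha> (fst p) \<bullet> fst (X p) \<partial>mu0) = - (\<integral>p. \<alpha> (fst p) * divM X p \<partial>mu0)"
    using i1 i2 by simp
qed

text \<open>Both sides of the defining identity are continuous under L^1 convergence, because X and
  its divergence are bounded.\<close>

lemma weak_gradient_limit: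
  assumes W: "\<And>k. weak_gradient (\<alpha> k) (w k)"
    and a: "integrable \<sigma> a" "(\<lambda>k. \<integral>x. \<bar>\<alpha> k x - a x\<bar> \<partial>\<sigma>) \<longlonglongrightarrow> 0"
    and v: "integrable \<sigma> v" "(\<lambda>k. \<integral>x. norm (w k x - v x) \<partial>\<sigma>) \<longlonglongrightarrow> 0"
    and tan: "\<And>x. norm x = 1 \<Longrightarrow> v x \<bullet> x = 0"
  shows "weak_gradient a v"
  unfolding weak_gradient_def
proof (intro conjI allI impI)
  fix X assume X: "C1_field X"
  have i: "integrable \<sigma> (\<alpha> k)" "integrable \<sigma> (w k)" for k
    using W[of k] by (auto simp: weak_gradient_def)
  have "(\<lambda>k. \<integral>p. w k (fst p) \<bullet> fst (X p) \<partial>mu0) \<longlonglongrightarrow> (\<integral>p. v (fst p) \<bullet> fst (X p) \<partial>mu0)"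
    by (rule integral_mult_continuous_tendsto[OF i(2) v(1) C1_field_fst_continuous[OF X] v(2)])
  moreover have "(\<lambda>k. \<integral>p. \<alpha> k (fst p) \<bullet> divM X p \<partial>mu0) \<longlonglongrightarrow> (\<integral>p. a (fst p) \<bullet> divM X p \<partial>mu0)"
    using a by (intro integral_mult_continuous_tendsto[OF i(1) a(1) divM_continuous[OF X]]) simp
  moreover have "(\<integral>p. w k (fst p) \<bullet> fst (X p) \<partial>mu0) = - (\<integral>p. \<alpha> k (fst p) \<bullet> divM X p \<partial>mu0)" for k
    using W[of k] X by (simp add: weak_gradient_def)
  ultimately show "(\<integral>p. v (fst p) \<bullet> fst (X p) \<partial>mu0) = - (\<integral>p. a (fst p) * divM X p \<partial>mu0)"
    using LIMSEQ_unique[OF _ tendsto_minus] by fastforce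
qed (use assms in auto)

section \<open>Linear algebra of warped products\<close>

lemma sum_Basis_linear:
  fixes f :: "'a::euclidean_space \<Rightarrow> 'b::real_vector"
  assumes "linear f" shows "(\<Sum>b\<in>Basis. (u \<bullet> b) *\<^sub>R f b) = f u"
proof -
  have "f u = f (\<Sum>b\<in>Basis. (u \<bullet> b) *\<^sub>R b)" by (simp only: euclidean_representation)
  then show ?thesis by (simp only: linear_sum[OF assms] linear_scale[OF assms])
qed

lemma sum_Basis_linear_real:
  fixes f :: "'a::euclidean_space \<Rightarrow> real"
  assumes "linear f" shows "(\<Sum>b\<in>Basis. (u \<bullet> b) * f b) = f u"
  using sum_Basis_linear[OF assms, of u] by simp

lemma sum_sproj_trace: "norm x = 1 \<Longrightarrow> (\<Sum>b\<in>Basis. sproj x b \<bullet> b) = real DIM('a) - 1" for x :: "'a::euclidean_space"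
proof -
  assume x: "norm x = 1"
  have "(\<Sum>b\<in>Basis. sproj x b \<bullet> b) = (\<Sum>b\<in>(Basis :: 'a set). 1 - (x \<bullet> b) * (x \<bullet> b))"
    by (intro sum.cong) (auto simp: sproj_def inner_diff_left inner_diff_right inner_commute)
  also have "\<dots> = real DIM('a) - 1"
    using x by (simp add: sum_subtractf sum_Basis_inner_mult dot_square_norm)
  finally show ?thesis .
qed

lemma sproj_zero [simp]: "sproj x 0 = 0"
  by (simp add: sproj_def)

text \<open>Combination of the round metrics of the two factors. The warped metric has the
  coefficients 1 and \<eta>^2, its inverse 1 and 1 / \<eta>^2, the Ricci tensor of \<open>g0\<close>
  1 and 0. Contraction multiplies coefficients (\<open>sum_bform_bform\<close>), so index
  computations become arithmetic.\<close>

definition bform :: "real \<Rightarrow> real \<Rightarrow> amb \<Rightarrow> amb \<Rightarrow> amb \<Rightarrow> real" where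
  "bform \<alpha> \<beta> p a b = \<alpha> * (sproj (fst p) (fst a) \<bullet> fst b) + \<beta> * (sproj (snd p) (snd a) \<bullet> snd b)"

text \<open>The endomorphism representing \<open>bform\<close> in the flat inner product;
  contracting a linear form with \<open>bform\<close> over \<open>Basis\<close> means evaluating it
  at this vector.\<close>

definition bmap :: "real \<Rightarrow> real \<Rightarrow> amb \<Rightarrow> amb \<Rightarrow> amb" where
  "bmap \<alpha> \<beta> p a = (\<alpha> *\<^sub>R sproj (fst p) (fst a), \<beta> *\<^sub>R sproj (snd p) (snd a))"

lemma bform_bmap: "bform \<alpha> \<beta> p a b = bmap \<alpha> \<beta> p a \<bullet> b"
  by (simp add: bform_def bmap_def inner_prod_def)

lemma bform_commute: "bform \<alpha> \<beta> p a b = bform \<alpha> \<beta> p b a"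
  by (simp add: bform_def inner_sproj_commute inner_commute[of "fst a"] inner_commute[of "snd a"])

lemma M_norms: "p \<in> S2xS1 \<Longrightarrow> norm (fst p) = 1" "p \<in> S2xS1 \<Longrightarrow> norm (snd p) = 1"
  by (auto simp: mem_Times_iff)

lemma bmap_bmap: "p \<in> S2xS1 \<Longrightarrow> bmap \<alpha> \<beta> p (bmap \<gamma> \<delta> p a) = bmap (\<alpha> * \<gamma>) (\<beta> * \<delta>) p a"
  by (simp add: bmap_def linear_scale[OF linear_sproj] sproj_sproj M_norms)

lemma tproj_bmap: "tproj p = bmap 1 1 p"
  by (simp add: tproj_def bmap_def fun_eq_iff)

lemma bform_bmap_left: "p \<in> S2xS1 \<Longrightarrow> bform \<alpha> \<beta> p (bmap \<gamma> \<delta> p a) b = bform (\<alpha> * \<gamma>) (\<beta> * \<delta>) p a b"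
  by (simp add: bform_bmap bmap_bmap)

lemma bform_bmap_right: "p \<in> S2xS1 \<Longrightarrow> bform \<alpha> \<beta> p a (bmap \<gamma> \<delta> p b) = bform (\<alpha> * \<gamma>) (\<beta> * \<delta>) p a b"
  by (metis bform_bmap_left bform_commute)

lemma sum_bform_linear: "linear f \<Longrightarrow> (\<Sum>b\<in>Basis. bform \<alpha> \<beta> p a b * f b) = f (bmap \<alpha> \<beta> p a)"
  by (simp add: bform_bmap sum_Basis_linear_real)

lemma linear_bform: "linear (bform \<alpha> \<beta> p a)" "linear (\<lambda>a. bform \<alpha> \<beta> p a b)"
proof -
  show 1: "linear (bform \<alpha> \<beta> p a)" for a
    by (rule linearI) (simp_all add: bform_bmap inner_add_right)
  show "linear (\<lambda>a. bform \<alpha> \<beta> p a b)"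
    using 1[of b] by (simp add: bform_commute[of _ _ _ _ b])
qed

lemma sum_bform_bform: "p \<in> S2xS1 \<Longrightarrow>
    (\<Sum>c\<in>Basis. bform \<alpha> \<beta> p a c * bform \<gamma> \<delta> p c b) = bform (\<alpha> * \<gamma>) (\<beta> * \<delta>) p a b"
  by (subst sum_bform_linear[OF linear_bform(2)]) (simp add: bform_bmap_left mult.commute)

text \<open>The coefficients 2 and 1 are the dimensions of the factors, that is, the traces of the
  tangential projections.\<close>

lemma bform_trace: "p \<in> S2xS1 \<Longrightarrow> (\<Sum>c\<in>Basis. bform \<alpha> \<beta> p c c) = 2 * \<alpha> + \<beta>"
  using sum_sproj_trace[of "fst p"] sum_sproj_trace[of "snd p"]
  by (simp add: sum_Basis_amb bform_def sum_distrib_left[symmetric] M_norms)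

lemma tangent2_bform:
  assumes "p \<in> S2xS1" shows "tangent2 p (bform \<alpha> \<beta> p)"
  unfolding tangent2_def
  using linear_bform by (auto simp: bilinear_def tproj_bmap bform_bmap_left[OF assms] bform_bmap_right[OF assms])

lemma inner_sproj_sproj: "norm x = 1 \<Longrightarrow> sproj x v \<bullet> sproj x w = sproj x v \<bullet> w"
  using inner_sproj_commute[of x "sproj x v" w] by (simp add: sproj_sproj)

lemma warped_metric_bform:
  assumes "p \<in> S2xS1" shows "warped_metric \<eta> p a b = bform 1 ((\<eta> (fst p))\<^sup>2) p a b"
  using M_norms[OF assms] by (simp add: warped_metric_def bform_def inner_sproj_sproj)

lemma g0_warped: "g0 = warped_metric (\<lambda>_. 1)"
  by (intro ext) (simp add: g0_def warped_metric_def tproj_def inner_prod_def)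

lemma g0_bform: "p \<in> S2xS1 \<Longrightarrow> g0 p a b = bform 1 1 p a b"
  by (simp add: g0_warped warped_metric_bform)

text \<open>A tangent form is determined by its values on projected arguments, and on these the
  endomorphism of the metric is invertible; this gives the uniqueness behind the definite
  description.\<close>

lemma cometric_warped:
  assumes p: "p \<in> S2xS1" and \<eta>: "\<eta> (fst p) \<noteq> 0"
  shows "cometric (warped_metric \<eta>) p = bform 1 (1 / (\<eta> (fst p))\<^sup>2) p"
  unfolding cometric_def
proof (rule the_equality)
  let ?e = "\<eta> (fst p)"
  show "tangent2 p (bform 1 (1 / ?e\<^sup>2) p) \<and>
      (\<forall>a b. (\<Sum>c\<in>Basis. warped_metric \<eta> p a c * bform 1 (1 / ?e\<^sup>2) p c b) = g0 p a b)"
    using p \<eta> by (simp add: tangent2_bform warped_metric_bform g0_bform sum_bform_bform)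
  fix k assume k: "tangent2 p k \<and> (\<forall>a b. (\<Sum>c\<in>Basis. warped_metric \<eta> p a c * k c b) = g0 p a b)"
  then have lin: "linear (\<lambda>a. k a b)" for b unfolding tangent2_def bilinear_def by blast
  have keq: "k (bmap 1 (?e\<^sup>2) p a) b = bform 1 1 p a b" for a b

  proof -
    have "(\<Sum>c\<in>Basis. warped_metric \<eta> p a c * k c b) = g0 p a b" using k by blast
    then show ?thesis unfolding warped_metric_bform[OF p] g0_bform[OF p] sum_bform_linear[OF lin] .
  qed
  show "k = bform 1 (1 / ?e\<^sup>2) p"
  proof (intro ext)
    fix a b
    have "k a b = k (bmap 1 1 p a) (bmap 1 1 p b)" using k unfolding tangent2_def tproj_bmap by blast
    \<comment> \<open>The projected argument is written as an image under the metric, the form in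
      which \<open>keq\<close> evaluates k.\<close>
    also have "bmap 1 1 p a = bmap 1 (?e\<^sup>2) p (bmap 1 (1 / ?e\<^sup>2) p a)" using p \<eta> by (simp add: bmap_bmap)
    also have "k \<dots> (bmap 1 1 p b) = bform 1 (1 / ?e\<^sup>2) p a b"
      by (simp only: keq) (simp add: p bform_bmap_left bform_bmap_right)
    finally show "k a b = bform 1 (1 / ?e\<^sup>2) p a b" .
  qed
qed

lemma sum_bform_squares: "p \<in> S2xS1 \<Longrightarrow> (\<Sum>a\<in>Basis. \<Sum>b\<in>Basis. (bform \<alpha> \<beta> p a b)\<^sup>2) = 2 * \<alpha>\<^sup>2 + \<beta>\<^sup>2"
proof -
  assume p: "p \<in> S2xS1"
  have "(\<Sum>b\<in>Basis. (bform \<alpha> \<beta> p a b)\<^sup>2) = bform (\<alpha>\<^sup>2) (\<beta>\<^sup>2) p a a" for a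
    using sum_bform_bform[OF p, of \<alpha> \<beta> a \<alpha> \<beta> a]
    by (simp add: power2_eq_square bform_commute[of \<alpha> \<beta> p _ a])
  then show ?thesis using bform_trace[OF p] by simp
qed

section \<open>The volume density\<close>

lemma unit_orthogonal_exists:
  assumes "2 \<le> DIM('a::euclidean_space)"
  shows "\<exists>u :: 'a. norm u = 1 \<and> u \<bullet> x = 0"
proof -
  obtain y :: 'a where "y \<noteq> 0" "orthogonal x y" using orthogonal_to_vector_exists[OF assms] .
  then have "norm (sgn y) = 1 \<and> sgn y \<bullet> x = 0"
    by (simp add: norm_sgn sgn_div_norm orthogonal_def inner_commute)
  then show ?thesis by blast
qed

text \<open>Two tangent directions of the 2-sphere are a unit vector orthogonal to x and its cross
  product with x; the third is tangent to the circle.\<close>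

lemma orthonormal_frame_exists:
  assumes p: "p \<in> S2xS1"
  shows "\<exists>e. orthonormal_frame p e"
proof -
  define x y where "x = fst p" and "y = snd p"
  have x: "norm x = 1" and y: "norm y = 1" using M_norms[OF p] by (auto simp: x_def y_def)
  obtain u where u: "norm u = 1" "u \<bullet> x = 0" using unit_orthogonal_exists[of x] by auto
  have "(norm (cross3 x u))\<^sup>2 = 1" using norm_cross_dot[of x u] x u by (simp add: inner_commute)
  then have v: "norm (cross3 x u) = 1" "cross3 x u \<bullet> x = 0" "cross3 x u \<bullet> u = 0"
    using dot_cross_self by (simp_all add: abs_square_eq_1 power2_eq_1_iff inner_commute)
  obtain t where t: "norm t = 1" "t \<bullet> y = 0" using unit_orthogonal_exists[of y] by auto
  define v where "v = cross3 x u"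
  note v = v[folded v_def]
  define e :: "3 \<Rightarrow> amb" where "e i = (if i = 1 then (u, 0) else if i = 2 then (v, 0) else (0, t))" for i
  have "orthonormal_frame p e"
    unfolding orthonormal_frame_def
  proof (intro conjI allI)
    show "tproj p (e i) = e i" for i
      using u v t by (simp add: tangent_iff[OF p] e_def x_def y_def)
    then have "g0 p (e i) (e j) = e i \<bullet> e j" for i j by (simp add: g0_def)
    moreover have "e i \<bullet> e j = (if i = j then 1 else 0)" for i j
      using exhaust_3[of i] exhaust_3[of j] u v t
      by (auto simp: e_def inner_prod_def dot_square_norm inner_commute[of u v])
    ultimately show "g0 p (e i) (e j) = (if i = j then 1 else 0)" for i j by simp
  qed
  then show ?thesis by blast
qed

text \<open>\<open>vol_density\<close> chooses a frame, so the determinant is computed for an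
  arbitrary one. The matrix is the identity plus s - 1 times the rank-one matrix of the circle
  components v, whence the determinant 1 + (s - 1) |v|^2, and |v| = 1.\<close>

lemma vol_density_warped:
  assumes p: "p \<in> S2xS1"
  shows "vol_density (warped_metric \<eta>) p = \<bar>\<eta> (fst p)\<bar>"
proof -
  define e where "e = (SOME e. orthonormal_frame p e)"
  have "orthonormal_frame p e" unfolding e_def using orthonormal_frame_exists[OF p] by (rule someI_ex)
  then have tan: "tproj p (e i) = e i" and on: "e i \<bullet> e j = (if i = j then 1 else 0)" for i j
    unfolding orthonormal_frame_def g0_def by auto
  define x y where "x = fst p" and "y = snd p"
  have x: "norm x = 1" and y: "norm y = 1" using M_norms[OF p] by (auto simp: x_def y_def)
  have tan': "fst (e i) \<bullet> x = 0" "snd (e i) \<bullet> y = 0" for i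
    using tangent_iff[OF p] tan by (auto simp: x_def y_def)
  have yy: "y $ 1 * y $ 1 + y $ 2 * y $ 2 = 1"
    using y dot_square_norm[of y] by (simp add: inner_vec_def sum_2)
  \<comment> \<open>The unit tangent of the circle at y: y turned by a right angle.\<close>
  define t :: "real^2" where "t = vector [- y $ 2, y $ 1]"
  have tc: "t $ 1 = - y $ 2" "t $ 2 = y $ 1" by (simp_all add: t_def)
  have t: "t \<bullet> t = 1" "t \<bullet> y = 0" using yy by (simp_all add: inner_vec_def sum_2 tc)
  define v where "v i = snd (e i) \<bullet> t" for i
  have snd_e: "snd (e i) = v i *\<^sub>R t" for i
  proof -
    define z where "z = snd (e i)"
    have zy: "z $ 1 * y $ 1 + z $ 2 * y $ 2 = 0" using tan'(2)[of i] by (simp add: z_def inner_vec_def sum_2)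
    have "z $ 1 = (- z $ 1 * y $ 2 + z $ 2 * y $ 1) * (- y $ 2)" "z $ 2 = (- z $ 1 * y $ 2 + z $ 2 * y $ 1) * y $ 1"
      using yy zy by algebra+
    then have "z = (z \<bullet> t) *\<^sub>R t"
      by (simp add: vec_eq_iff forall_2 inner_vec_def sum_2 tc)
    then show ?thesis by (simp add: z_def v_def)
  qed
  have v1: "v 1 * v 1 + v 2 * v 2 + v 3 * v 3 = 1"
  proof -
    \<comment> \<open>The frame and the two unit normals form an orthonormal basis of the
      five-dimensional ambient space; expanding (0, t) in it gives |v| = 1.\<close>
    define B where "B = insert (x, 0) (insert (0, y) (range e))"
    have ne: "e i \<bullet> (x, 0) = 0" "e i \<bullet> (0, y) = 0" for i using tan'[of i] by (simp_all add: inner_prod_def)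
    have nn: "(x, 0 :: real^2) \<bullet> (x, 0) = 1" "(0 :: real^3, y) \<bullet> (0, y) = 1" "(x, 0) \<bullet> (0, y) = 0" "(0, y) \<bullet> (x, 0) = 0"
      using x y by (simp_all add: inner_prod_def dot_square_norm)
    have inj: "inj e"
    proof (rule injI)
      fix i j assume "e i = e j" then show "i = j" using on[of i j] on[of i i] by (auto split: if_splits)
    qed
    have d1: "(x, 0) \<noteq> e i" "(0, y) \<noteq> e i" for i using ne[of i] nn by force+
    have d2: "(x, 0 :: real^2) \<noteq> (0, y)" using nn by force
    have fin: "finite B" by (simp add: B_def)
    have card: "card B = 5"
      using d1 d2 by (simp add: B_def card_image[OF inj] image_iff)
    have orth: "pairwise orthogonal B"
      using on ne nn by (auto simp: B_def pairwise_def orthogonal_def inner_commute[of "(x, 0)" "e _"] inner_commute[of "(0, y)" "e _"])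
    have unit: "norm b = 1" if "b \<in> B" for b
      using that on nn by (auto simp: B_def norm_eq_sqrt_inner)
    have "independent B"
    proof (rule pairwise_orthogonal_independent[OF orth])
      show "0 \<notin> B" using unit[of 0] by auto
    qed
    then have "UNIV \<subseteq> span B"
      using card by (intro card_ge_dim_independent) (auto simp: dim_UNIV)
    then have "(\<Sum>b\<in>B. ((0, t) \<bullet> b) *\<^sub>R b) = (0, t)"
      by (intro orthonormal_basis_expand orth unit fin) auto
    then have "(\<Sum>b\<in>B. ((0, t) \<bullet> b) *\<^sub>R b) \<bullet> (0, t) = t \<bullet> t" by (simp add: inner_prod_def)
    then have "(\<Sum>b\<in>B. ((0, t) \<bullet> b) * ((0, t) \<bullet> b)) = 1"
      by (simp only: inner_commute[of _ "(0, t)"] inner_sum_right inner_scaleR_right t)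
    moreover have "(\<Sum>b\<in>B. ((0, t) \<bullet> b) * ((0, t) \<bullet> b)) = (\<Sum>b\<in>range e. ((0, t) \<bullet> b) * ((0, t) \<bullet> b))"
      using d1 d2 t by (simp add: B_def image_iff inner_prod_def)
    moreover have "\<dots> = (\<Sum>i\<in>UNIV. v i * v i)"
      by (simp add: sum.reindex[OF inj] v_def inner_prod_def inner_commute)
    ultimately show ?thesis by (simp add: sum_3)
  qed
  define s where "s = (\<eta> (fst p))\<^sup>2"
  have m: "warped_metric \<eta> p (e i) (e j) = (if i = j then 1 else 0) + (s - 1) * (v i * v j)" for i j
  proof -
    have "warped_metric \<eta> p (e i) (e j) = fst (e i) \<bullet> fst (e j) + s * (snd (e i) \<bullet> snd (e j))"
      using tan'[of i] tan'[of j] by (simp add: warped_metric_def s_def sproj_id x_def y_def)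
    also have "fst (e i) \<bullet> fst (e j) = e i \<bullet> e j - snd (e i) \<bullet> snd (e j)" by (simp add: inner_prod_def)
    also have "snd (e i) \<bullet> snd (e j) = v i * v j" using t by (simp add: snd_e)
    finally show ?thesis by (simp add: on algebra_simps)
  qed
  have "det (\<chi> i j. warped_metric \<eta> p (e i) (e j) :: real^3^3) = 1 + (s - 1) * (v 1 * v 1 + v 2 * v 2 + v 3 * v 3)"
    unfolding m by (simp add: det_3) (simp add: algebra_simps)
  also have "\<dots> = s" by (simp add: v1)
  finally show ?thesis
    unfolding vol_density_def Let_def e_def[symmetric] by (simp add: s_def)
qed

section \<open>The Levi-Civita connection of a warped product\<close>

lemma mderiv_warped_metric:
  assumes p: "p \<in> S2xS1" and \<eta>: "C1_sphere \<eta>"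
    and Y: "\<And>q. q \<in> S2xS1 \<Longrightarrow> tproj q (Y q) = Y q" "((\<lambda>q. Y (retr q)) has_derivative DY) (at p)"
    and Z: "\<And>q. q \<in> S2xS1 \<Longrightarrow> tproj q (Z q) = Z q" "((\<lambda>q. Z (retr q)) has_derivative DZ) (at p)"
  shows "mderiv (\<lambda>q. warped_metric \<eta> q (Y q) (Z q)) p v =
    fst (DY v) \<bullet> fst (Z p) + fst (Y p) \<bullet> fst (DZ v) + (\<eta> (fst p))\<^sup>2 * (snd (DY v) \<bullet> snd (Z p) + snd (Y p) \<bullet> snd (DZ v))
    + 2 * \<eta> (fst p) * (sgrad \<eta> (fst p) \<bullet> fst v) * (snd (Y p) \<bullet> snd (Z p))"
proof -
  have eq: "warped_metric \<eta> q (Y q) (Z q) = fst (Y q) \<bullet> fst (Z q) + (\<eta> (fst q))\<^sup>2 * (snd (Y q) \<bullet> snd (Z q))"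
    if "q \<in> S2xS1" for q
    using tangent_iff[OF that] Y(1)[OF that] Z(1)[OF that] by (simp add: warped_metric_def sproj_id)
  have d\<eta>: "((\<lambda>q. \<eta> (fst (retr q))) has_derivative (\<lambda>v. sgrad \<eta> (fst p) \<bullet> fst v)) (at p)"
    using C1_M_has_derivative[OF C1_M_fst(1)[OF \<eta>] p]
    by (rule has_derivative_eq_rhs) (simp add: fun_eq_iff C1_M_fst(2)[OF \<eta> p] sgrad_inner[OF \<eta>] M_norms[OF p])
  have "((\<lambda>q. fst (Y (retr q)) \<bullet> fst (Z (retr q)) + (\<eta> (fst (retr q)))\<^sup>2 * (snd (Y (retr q)) \<bullet> snd (Z (retr q)))) has_derivative
    (\<lambda>v. fst (DY v) \<bullet> fst (Z p) + fst (Y p) \<bullet> fst (DZ v) + (\<eta> (fst p))\<^sup>2 * (snd (DY v) \<bullet> snd (Z p) + snd (Y p) \<bullet> snd (DZ v))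
    + 2 * \<eta> (fst p) * (sgrad \<eta> (fst p) \<bullet> fst v) * (snd (Y p) \<bullet> snd (Z p)))) (at p)"
    by (rule has_derivative_eq_rhs, (rule derivative_intros Y Z d\<eta>)+)
      (simp add: fun_eq_iff retr_id[OF p] algebra_simps)
  from mderiv_eqI[of "\<lambda>q. fst (Y q) \<bullet> fst (Z q) + (\<eta> (fst q))\<^sup>2 * (snd (Y q) \<bullet> snd (Z q))", OF this]
  show ?thesis using mderiv_cong[OF eq p] by simp
qed

lemma tfield_tangent: "q \<in> S2xS1 \<Longrightarrow> tproj q (tfield a q) = tfield a q"
  by (simp add: tfield_def tproj_tproj)

lemma retr_fst_snd_derivative:
  assumes p: "p \<in> S2xS1"
  shows "((\<lambda>q. fst (retr q)) has_derivative (\<lambda>v. sproj (fst p) (fst v))) (at p)"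
    "((\<lambda>q. snd (retr q)) has_derivative (\<lambda>v. sproj (snd p) (snd v))) (at p)"
  using has_derivative_fst[OF retr_has_derivative[OF p]] has_derivative_snd[OF retr_has_derivative[OF p]]
  by (simp_all add: tproj_def)

lemma sproj_retr_derivative:
  assumes p: "p \<in> S2xS1"
  shows "((\<lambda>q. sproj (fst (retr q)) u) has_derivative
      (\<lambda>v. - ((u \<bullet> fst p) *\<^sub>R sproj (fst p) (fst v) + (u \<bullet> sproj (fst p) (fst v)) *\<^sub>R fst p))) (at p)"
    "((\<lambda>q. sproj (snd (retr q)) u') has_derivative
      (\<lambda>v. - ((u' \<bullet> snd p) *\<^sub>R sproj (snd p) (snd v) + (u' \<bullet> sproj (snd p) (snd v)) *\<^sub>R snd p))) (at p)"
  unfolding sproj_def[of "fst (retr _)"] sproj_def[of "snd (retr _)"]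
  by (rule has_derivative_eq_rhs, (rule derivative_intros retr_fst_snd_derivative[OF p])+,
      simp add: fun_eq_iff retr_id[OF p] algebra_simps)+

lemma tfield_has_derivative:
  assumes p: "p \<in> S2xS1"
  shows "((\<lambda>q. tfield b (retr q)) has_derivative (\<lambda>v.
    (- ((fst b \<bullet> fst p) *\<^sub>R sproj (fst p) (fst v) + (fst b \<bullet> sproj (fst p) (fst v)) *\<^sub>R fst p),
     - ((snd b \<bullet> snd p) *\<^sub>R sproj (snd p) (snd v) + (snd b \<bullet> sproj (snd p) (snd v)) *\<^sub>R snd p)))) (at p)"
  unfolding tfield_def tproj_def by (intro has_derivative_Pair sproj_retr_derivative p)

text \<open>Beside the connections of the factors there are the gradient of \<eta>, normal to the
  circle fibres, and the logarithmic derivative of \<eta> on mixed terms. The fields only have to be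
  differentiable at p, so that the formula applies again to covariant derivatives when the curvature
  is formed.\<close>

lemma levi_civita_warped:
  assumes p: "p \<in> S2xS1" and \<eta>: "C1_sphere \<eta>" "\<eta> (fst p) \<noteq> 0"
    and X: "\<And>q. q \<in> S2xS1 \<Longrightarrow> tproj q (X q) = X q" "((\<lambda>q. X (retr q)) has_derivative DX) (at p)"
    and Y: "\<And>q. q \<in> S2xS1 \<Longrightarrow> tproj q (Y q) = Y q" "((\<lambda>q. Y (retr q)) has_derivative DY) (at p)"
  defines "n \<equiv> sgrad \<eta> (fst p)" and "e \<equiv> \<eta> (fst p)"
  shows "levi_civita (warped_metric \<eta>) X Y p =
    (sproj (fst p) (fst (DY (X p))) - (e * (snd (X p) \<bullet> snd (Y p))) *\<^sub>R n,
     sproj (snd p) (snd (DY (X p))) + ((n \<bullet> fst (X p)) / e) *\<^sub>R snd (Y p) + ((n \<bullet> fst (Y p)) / e) *\<^sub>R snd (X p))"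
proof -
  define x y where "x = fst p" and "y = snd p"
  have x: "norm x = 1" and y: "norm y = 1" using M_norms[OF p] by (auto simp: x_def y_def)
  have e0: "e \<noteq> 0" using \<eta> by (simp add: e_def)
  have nx: "n \<bullet> x = 0"
    using sgrad_inner[OF \<eta>(1) x, of x] sderiv_self[of \<eta> x] \<eta>(1) x by (simp add: n_def x_def C1_sphere_def)
  have tX: "sproj x (fst (X p)) = fst (X p)" "sproj y (snd (X p)) = snd (X p)"
    and tY: "sproj x (fst (Y p)) = fst (Y p)" "sproj y (snd (Y p)) = snd (Y p)"
    using X(1)[OF p] Y(1)[OF p] by (auto simp: tproj_def x_def y_def prod_eq_iff)
  have n': "sproj x n = n" using nx by (simp add: sproj_id)
  \<comment> \<open>The pair of r1 and r2 is the covariant derivative before projection; the metric,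
    as the endomorphism \<open>bmap 1 (e\<^sup>2) p\<close>, takes it to half the Koszul
    expression.\<close>
  define r1 where "r1 = fst (DY (X p)) - (e * (snd (X p) \<bullet> snd (Y p))) *\<^sub>R n"
  define r2 where "r2 = snd (DY (X p)) + ((n \<bullet> fst (X p)) / e) *\<^sub>R snd (Y p) + ((n \<bullet> fst (Y p)) / e) *\<^sub>R snd (X p)"
  have kos: "koszul (warped_metric \<eta>) X Y (tfield b) p / 2 = bmap 1 (e\<^sup>2) p (r1, r2) \<bullet> b" for b
  proof -
    let ?Z = "tfield b"
    define DZ where "DZ v = (- ((fst b \<bullet> fst p) *\<^sub>R sproj (fst p) (fst v) + (fst b \<bullet> sproj (fst p) (fst v)) *\<^sub>R fst p),
     - ((snd b \<bullet> snd p) *\<^sub>R sproj (snd p) (snd v) + (snd b \<bullet> sproj (snd p) (snd v)) *\<^sub>R snd p))" for v :: amb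
    have Z: "\<And>q. q \<in> S2xS1 \<Longrightarrow> tproj q (?Z q) = ?Z q" "((\<lambda>q. ?Z (retr q)) has_derivative DZ) (at p)"
      using tfield_tangent tfield_has_derivative[OF p, of b] by (auto simp: DZ_def[abs_def])
    have tZ: "sproj x (fst (?Z p)) = fst (?Z p)" "sproj y (snd (?Z p)) = snd (?Z p)"
      using Z(1)[OF p] by (auto simp: tproj_def x_def y_def prod_eq_iff)
    have gl: "warped_metric \<eta> p U V = fst U \<bullet> fst V + e\<^sup>2 * (snd U \<bullet> snd V)"
      if "sproj x (fst V) = fst V" "sproj y (snd V) = snd V" for U V
      using that inner_sproj_commute[of x "fst U" "fst V"] inner_sproj_commute[of y "snd U" "snd V"]
      by (simp add: warped_metric_def x_def y_def e_def)
    note mw = mderiv_warped_metric[OF p \<eta>(1), folded n_def e_def]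
    have m1: "mderiv (\<lambda>q. warped_metric \<eta> q (Y q) (?Z q)) p (X p) =
        fst (DY (X p)) \<bullet> fst (?Z p) + fst (Y p) \<bullet> fst (DZ (X p))
        + e\<^sup>2 * (snd (DY (X p)) \<bullet> snd (?Z p) + snd (Y p) \<bullet> snd (DZ (X p)))
        + 2 * e * (n \<bullet> fst (X p)) * (snd (Y p) \<bullet> snd (?Z p))" by (rule mw[OF Y Z])
    have m2: "mderiv (\<lambda>q. warped_metric \<eta> q (X q) (?Z q)) p (Y p) =
        fst (DX (Y p)) \<bullet> fst (?Z p) + fst (X p) \<bullet> fst (DZ (Y p))
        + e\<^sup>2 * (snd (DX (Y p)) \<bullet> snd (?Z p) + snd (X p) \<bullet> snd (DZ (Y p)))
        + 2 * e * (n \<bullet> fst (Y p)) * (snd (X p) \<bullet> snd (?Z p))" by (rule mw[OF X Z])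
    have m3: "mderiv (\<lambda>q. warped_metric \<eta> q (X q) (Y q)) p (?Z p) =
        fst (DX (?Z p)) \<bullet> fst (Y p) + fst (X p) \<bullet> fst (DY (?Z p))
        + e\<^sup>2 * (snd (DX (?Z p)) \<bullet> snd (Y p) + snd (X p) \<bullet> snd (DY (?Z p)))
        + 2 * e * (n \<bullet> fst (?Z p)) * (snd (X p) \<bullet> snd (Y p))" by (rule mw[OF X Y])
    have kz: "koszul (warped_metric \<eta>) X Y ?Z p = 2 * (fst (DY (X p)) \<bullet> fst (?Z p) + e\<^sup>2 * (snd (DY (X p)) \<bullet> snd (?Z p)))
      + 2 * e * ((n \<bullet> fst (X p)) * (snd (Y p) \<bullet> snd (?Z p)) + (n \<bullet> fst (Y p)) * (snd (X p) \<bullet> snd (?Z p))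
        - (n \<bullet> fst (?Z p)) * (snd (X p) \<bullet> snd (Y p)))"
      unfolding koszul_def lie_bracket_def m1 m2 m3
        mderiv_eqI[OF X(2)] mderiv_eqI[OF Y(2)] mderiv_eqI[OF Z(2)] gl[OF tX] gl[OF tY] gl[OF tZ]
      by (simp add: inner_diff_left inner_commute algebra_simps)
    have "koszul (warped_metric \<eta>) X Y ?Z p / 2 = r1 \<bullet> fst (?Z p) + e\<^sup>2 * (r2 \<bullet> snd (?Z p))"
      unfolding kz using e0 by (simp add: r1_def r2_def inner_diff_left inner_add_left field_simps power2_eq_square)
    also have "\<dots> = bmap 1 (e\<^sup>2) p (r1, r2) \<bullet> b"
      by (simp add: bmap_def tfield_def tproj_def inner_prod_def inner_sproj_commute)
    finally show ?thesis .
  qed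
  have "levi_civita (warped_metric \<eta>) X Y p =
      (\<Sum>a\<in>Basis. (\<Sum>b\<in>Basis. bform 1 (1 / e\<^sup>2) p a b * (bmap 1 (e\<^sup>2) p (r1, r2) \<bullet> b)) *\<^sub>R a)"
    unfolding levi_civita_def kos cometric_warped[of p \<eta>, OF p \<eta>(2)] e_def ..
  also have "\<dots> = (\<Sum>a\<in>Basis. bform 1 1 p a (r1, r2) *\<^sub>R a)"
  proof (intro sum.cong refl arg_cong2[where f=scaleR])
    fix a :: amb
    have "linear (\<lambda>b. bmap 1 (e\<^sup>2) p (r1, r2) \<bullet> b)" by (rule linearI) (simp_all add: inner_add_right)
    from sum_bform_linear[OF this, of 1 "1 / e\<^sup>2" p a]
    show "(\<Sum>b\<in>Basis. bform 1 (1 / e\<^sup>2) p a b * (bmap 1 (e\<^sup>2) p (r1, r2) \<bullet> b)) = bform 1 1 p a (r1, r2)"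
      using e0 bform_bmap_right[OF p, of 1 "e\<^sup>2" "(r1, r2)" 1 "1 / e\<^sup>2" a]
      by (simp add: bform_bmap[symmetric] bform_bmap_right[OF p] bform_commute[of _ _ _ "(r1, r2)"])
  qed
  also have "\<dots> = (\<Sum>a\<in>Basis. (bmap 1 1 p (r1, r2) \<bullet> a) *\<^sub>R a)"
    by (simp only: bform_commute[of 1 1 p _ "(r1, r2)"]) (simp only: bform_bmap)
  also have "\<dots> = bmap 1 1 p (r1, r2)" by (rule euclidean_representation)
  also have "\<dots> = (sproj x (fst (DY (X p))) - (e * (snd (X p) \<bullet> snd (Y p))) *\<^sub>R n,
     sproj y (snd (DY (X p))) + ((n \<bullet> fst (X p)) / e) *\<^sub>R snd (Y p) + ((n \<bullet> fst (Y p)) / e) *\<^sub>R snd (X p))"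
    by (simp add: bmap_def r1_def r2_def x_def[symmetric] y_def[symmetric] linear_diff[OF linear_sproj]
        linear_add[OF linear_sproj] linear_scale[OF linear_sproj] tX tY n')
  finally show ?thesis by (simp add: x_def y_def)
qed

lemma C2_sphere_imp_C1: "C2_sphere \<eta> \<Longrightarrow> C1_sphere \<eta>"
  by (simp add: C2_sphere_def)

section \<open>Curvature of a warped product\<close>

context
  fixes \<eta> :: "real^3 \<Rightarrow> real"
  assumes \<eta>: "C2_sphere \<eta>" and \<eta>0: "\<And>x. norm x = 1 \<Longrightarrow> \<eta> x \<noteq> 0"
begin

text \<open>The covariant derivative of \<open>tfield c\<close> along \<open>tfield b\<close> in
  closed form (\<open>levi_civita_tfield\<close>), as a function of q that can be differentiated
  once more.\<close>

definition nab :: "amb \<Rightarrow> amb \<Rightarrow> amb \<Rightarrow> amb" where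
  "nab b c q = (- ((fst c \<bullet> fst q) *\<^sub>R sproj (fst q) (fst b)) - (\<eta> (fst q) * (snd b \<bullet> sproj (snd q) (snd c))) *\<^sub>R sgrad \<eta> (fst q),
     - ((snd c \<bullet> snd q) *\<^sub>R sproj (snd q) (snd b)) + ((sgrad \<eta> (fst q) \<bullet> fst b) / \<eta> (fst q)) *\<^sub>R sproj (snd q) (snd c)
       + ((sgrad \<eta> (fst q) \<bullet> fst c) / \<eta> (fst q)) *\<^sub>R sproj (snd q) (snd b))"

lemma sgrad_normal: "norm x = 1 \<Longrightarrow> sgrad \<eta> x \<bullet> x = 0"
  using sgrad_inner[OF C2_sphere_imp_C1[OF \<eta>], of x x] sderiv_self[of \<eta> x] C2_sphere_imp_C1[OF \<eta>]
  by (simp add: C1_sphere_def)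

lemma sgrad_sproj: "norm x = 1 \<Longrightarrow> sgrad \<eta> x \<bullet> sproj x v = sgrad \<eta> x \<bullet> v"
  using sgrad_normal[of x] by (simp add: sproj_def inner_diff_right)

lemma levi_civita_tfield:
  assumes q: "q \<in> S2xS1"
  shows "levi_civita (warped_metric \<eta>) (tfield b) (tfield c) q = nab b c q"
proof -
  note n = M_norms[OF q]
  have e: "\<eta> (fst q) \<noteq> 0" using \<eta>0 n by simp
  let ?D = "\<lambda>v. (- ((fst c \<bullet> fst q) *\<^sub>R sproj (fst q) (fst v) + (fst c \<bullet> sproj (fst q) (fst v)) *\<^sub>R fst q),
     - ((snd c \<bullet> snd q) *\<^sub>R sproj (snd q) (snd v) + (snd c \<bullet> sproj (snd q) (snd v)) *\<^sub>R snd q))"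
  have "levi_civita (warped_metric \<eta>) (tfield b) (tfield c) q =
    (sproj (fst q) (fst (?D (tfield b q))) - (\<eta> (fst q) * (snd (tfield b q) \<bullet> snd (tfield c q))) *\<^sub>R sgrad \<eta> (fst q),
     sproj (snd q) (snd (?D (tfield b q))) + ((sgrad \<eta> (fst q) \<bullet> fst (tfield b q)) / \<eta> (fst q)) *\<^sub>R snd (tfield c q)
       + ((sgrad \<eta> (fst q) \<bullet> fst (tfield c q)) / \<eta> (fst q)) *\<^sub>R snd (tfield b q))"
    by (rule levi_civita_warped[OF q C2_sphere_imp_C1[OF \<eta>] e
      tfield_tangent tfield_has_derivative[OF q] tfield_tangent tfield_has_derivative[OF q]])
  also have "\<dots> = nab b c q"
    unfolding nab_def tfield_def tproj_def fst_conv snd_conv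
    by (simp add: sgrad_sproj n linear_neg[OF linear_sproj]
        linear_diff[OF linear_sproj] linear_add[OF linear_sproj] linear_scale[OF linear_sproj]
        sproj_self sproj_sproj inner_sproj_commute)
  finally show ?thesis .
qed

lemma nab_tangent: "q \<in> S2xS1 \<Longrightarrow> tproj q (nab b c q) = nab b c q"
proof -
  assume q: "q \<in> S2xS1"
  note n = M_norms[OF q]
  have s: "sproj (fst q) (sgrad \<eta> (fst q)) = sgrad \<eta> (fst q)" using sgrad_normal n by (simp add: sproj_id)
  show ?thesis
    by (simp add: tproj_def nab_def linear_neg[OF linear_sproj] linear_diff[OF linear_sproj]
        linear_add[OF linear_sproj] linear_scale[OF linear_sproj] sproj_sproj n s)
qed

text \<open>The ambient derivative of the gradient: its tangential part is the Hessian, its normal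
  part is given by \<open>hess_normal\<close>.\<close>

definition hess :: "real^3 \<Rightarrow> real^3 \<Rightarrow> real^3" where "hess x v = sderiv (sgrad \<eta>) x v"

lemma sgrad_derivative: "norm x = 1 \<Longrightarrow> ((\<lambda>y. sgrad \<eta> (sgn y)) has_derivative hess x) (at x)"
proof -
  assume x: "norm x = 1"
  note d = sgrad_has_derivative[OF \<eta> x]
  have "hess x = (\<lambda>v. \<Sum>b\<in>Basis. sderiv (\<lambda>x. sderiv \<eta> x b) x v *\<^sub>R b)"
    using sderiv_eqI[OF d] by (simp add: hess_def fun_eq_iff)
  then show ?thesis using d by simp
qed

lemma linear_hess: "norm x = 1 \<Longrightarrow> linear (hess x)"
  using sgrad_derivative has_derivative_linear by blast

lemma hess_sproj: "norm x = 1 \<Longrightarrow> hess x (sproj x v) = hess x v"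
  unfolding hess_def using sgrad_derivative[of x]
  by (intro sderiv_sproj) (auto simp: differentiable_def)

text \<open>The identity \<open>sgrad \<eta> x \<bullet> x = 0\<close> is differentiated along the
  sphere.\<close>

lemma hess_normal: "norm x = 1 \<Longrightarrow> hess x v \<bullet> x = - (sgrad \<eta> x \<bullet> v)"
proof -
  assume x: "norm x = 1"
  have 1: "((\<lambda>y. sgrad \<eta> (sgn y) \<bullet> sgn y) has_derivative (\<lambda>v. sgrad \<eta> x \<bullet> sproj x v + hess x v \<bullet> x)) (at x)"
    using has_derivative_inner[OF sgrad_derivative[OF x] has_derivative_sgn[OF x]] x by (simp add: sgn_id)
  have 2: "((\<lambda>y. sgrad \<eta> (sgn y) \<bullet> sgn y) has_derivative (\<lambda>v. 0)) (at x)"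
    by (subst has_derivative_sphere_cong[where F="\<lambda>y. sgrad \<eta> y \<bullet> y" and G="\<lambda>_. 0"])
      (use x sgrad_normal in auto)
  have "sgrad \<eta> x \<bullet> sproj x v + hess x v \<bullet> x = 0"
    using fun_cong[OF has_derivative_unique[OF 1 2]] .
  then show ?thesis using sgrad_sproj[OF x] by simp
qed

lemma slaplacian_hess: "slaplacian \<eta> x = (\<Sum>b\<in>Basis. sproj x (hess x b) \<bullet> b)"
  by (simp add: slaplacian_def sdiv_def hess_def)

text \<open>The product rule applied to \<open>nab\<close>; \<open>db1\<close>, \<open>db2\<close>
  and \<open>dc2\<close> are the derivatives of \<open>sproj x (fst b)\<close>,
  \<open>sproj y (snd b)\<close> and \<open>sproj y (snd c)\<close>.\<close>

definition dnab :: "amb \<Rightarrow> amb \<Rightarrow> amb \<Rightarrow> amb \<Rightarrow> amb" where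
  "dnab b c q v = (let x = fst q; y = snd q; v1 = sproj x (fst v); v2 = sproj y (snd v); n = sgrad \<eta> x; e = \<eta> x;
      db1 = - ((fst b \<bullet> x) *\<^sub>R v1 + (fst b \<bullet> v1) *\<^sub>R x);
      db2 = - ((snd b \<bullet> y) *\<^sub>R v2 + (snd b \<bullet> v2) *\<^sub>R y);
      dc2 = - ((snd c \<bullet> y) *\<^sub>R v2 + (snd c \<bullet> v2) *\<^sub>R y)
    in (- ((fst c \<bullet> x) *\<^sub>R db1 + (fst c \<bullet> v1) *\<^sub>R sproj x (fst b))
        - ((e * (snd b \<bullet> sproj y (snd c))) *\<^sub>R hess x (fst v)
           + (e * (snd b \<bullet> dc2) + (n \<bullet> fst v) * (snd b \<bullet> sproj y (snd c))) *\<^sub>R n),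
        - ((snd c \<bullet> y) *\<^sub>R db2 + (snd c \<bullet> v2) *\<^sub>R sproj y (snd b))
        + (((n \<bullet> fst b) / e) *\<^sub>R dc2 + ((hess x (fst v) \<bullet> fst b) / e - (n \<bullet> fst b) * (n \<bullet> fst v) / e\<^sup>2) *\<^sub>R sproj y (snd c))
        + (((n \<bullet> fst c) / e) *\<^sub>R db2 + ((hess x (fst v) \<bullet> fst c) / e - (n \<bullet> fst c) * (n \<bullet> fst v) / e\<^sup>2) *\<^sub>R sproj y (snd b))))"

lemma nab_has_derivative:
  assumes p: "p \<in> S2xS1"
  shows "((\<lambda>q. nab b c (retr q)) has_derivative dnab b c p) (at p)"
proof -
  note n = M_norms[OF p]
  have e: "\<eta> (fst p) \<noteq> 0" using \<eta>0 n by simp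
  have C1: "C1_sphere \<eta>" using \<eta> by (rule C2_sphere_imp_C1)
  have dx: "((\<lambda>q. fst (retr q)) has_derivative (\<lambda>v. sproj (fst p) (fst v))) (at p)"
    and dy: "((\<lambda>q. snd (retr q)) has_derivative (\<lambda>v. sproj (snd p) (snd v))) (at p)"
    using retr_fst_snd_derivative[OF p] by auto
  note ds = sproj_retr_derivative[OF p]
  have d\<eta>: "((\<lambda>q. \<eta> (fst (retr q))) has_derivative (\<lambda>v. sgrad \<eta> (fst p) \<bullet> fst v)) (at p)"
    using C1_M_has_derivative[OF C1_M_fst(1)[OF C1] p]
    by (rule has_derivative_eq_rhs) (simp add: fun_eq_iff C1_M_fst(2)[OF C1 p] sgrad_inner[OF C1] n)
  have dn: "((\<lambda>q. sgrad \<eta> (fst (retr q))) has_derivative (\<lambda>v. hess (fst p) (fst v))) (at p)"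
    using has_derivative_compose[OF has_derivative_fst[OF has_derivative_ident] sgrad_derivative[OF n(1)], where s=UNIV]
    by (simp add: retr_def)
  have q: "((\<lambda>q. (sgrad \<eta> (fst (retr q)) \<bullet> u) / \<eta> (fst (retr q))) has_derivative
      (\<lambda>v. (hess (fst p) (fst v) \<bullet> u) / \<eta> (fst p) - (sgrad \<eta> (fst p) \<bullet> u) * (sgrad \<eta> (fst p) \<bullet> fst v) / (\<eta> (fst p))\<^sup>2)) (at p)" for u
  proof -
    have "((\<lambda>q. (sgrad \<eta> (fst (retr q)) \<bullet> u) / \<eta> (fst (retr q))) has_derivative
      (\<lambda>v. - ((sgrad \<eta> (fst p) \<bullet> u) * (inverse (\<eta> (fst p)) * (sgrad \<eta> (fst p) \<bullet> fst v) * inverse (\<eta> (fst p))))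
         + (hess (fst p) (fst v) \<bullet> u) / \<eta> (fst p))) (at p)"
      using has_derivative_divide[OF has_derivative_inner_left[OF dn] d\<eta>, of u] e by (simp add: retr_id[OF p])
    then show ?thesis by (rule has_derivative_eq_rhs) (simp add: fun_eq_iff divide_inverse power2_eq_square)
  qed
  show ?thesis
    unfolding nab_def[abs_def]
    by (rule has_derivative_eq_rhs, (rule derivative_intros dx dy ds d\<eta> dn q)+)
      (simp add: fun_eq_iff retr_id[OF p] dnab_def Let_def algebra_simps)
qed

text \<open>Two terms are kept unsimplified and drop out of the trace: the antisymmetric part of H,
  and the multiple of 1 - n . n, the would-be fibre curvature, whose bracket vanishes on a
  one-dimensional tangent space.\<close>

lemma riemann_tfield:
  assumes p: "p \<in> S2xS1"
  defines "x \<equiv> fst p" and "y \<equiv> snd p" and "e \<equiv> \<eta> (fst p)" and "n \<equiv> sgrad \<eta> (fst p)"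
  defines "H \<equiv> \<lambda>u v. sproj (fst p) (hess (fst p) u) \<bullet> v"
  shows "riemann (warped_metric \<eta>) (tfield a) (tfield b) (tfield c) p =
    ((sproj x (fst b) \<bullet> fst c) *\<^sub>R sproj x (fst a) - (sproj x (fst a) \<bullet> fst c) *\<^sub>R sproj x (fst b)
       - (e * (sproj y (snd b) \<bullet> snd c)) *\<^sub>R sproj x (hess x (fst a)) + (e * (sproj y (snd a) \<bullet> snd c)) *\<^sub>R sproj x (hess x (fst b)),
     - (H (fst b) (fst c) / e) *\<^sub>R sproj y (snd a) + (H (fst a) (fst c) / e) *\<^sub>R sproj y (snd b)
       + ((H (fst a) (fst b) - H (fst b) (fst a)) / e) *\<^sub>R sproj y (snd c)
       + (1 - n \<bullet> n) *\<^sub>R ((sproj y (snd b) \<bullet> snd c) *\<^sub>R sproj y (snd a) - (sproj y (snd a) \<bullet> snd c) *\<^sub>R sproj y (snd b)))"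
proof -
  have x: "norm x = 1" and y: "norm y = 1" using M_norms[OF p] by (auto simp: x_def y_def)
  have e0: "e \<noteq> 0" using \<eta>0 x by (simp add: e_def x_def)
  have C1: "C1_sphere \<eta>" using \<eta> by (rule C2_sphere_imp_C1)
  define i where "i = 1 / e"
  note lins = linear_neg[OF linear_sproj] linear_diff[OF linear_sproj] linear_add[OF linear_sproj] linear_scale[OF linear_sproj]
  have \<eta>p: "\<eta> (fst p) \<noteq> 0" using e0 by (simp add: e_def)
  have mt: "mderiv (tfield d) q v = (- ((fst d \<bullet> fst q) *\<^sub>R sproj (fst q) (fst v) + (fst d \<bullet> sproj (fst q) (fst v)) *\<^sub>R fst q),
     - ((snd d \<bullet> snd q) *\<^sub>R sproj (snd q) (snd v) + (snd d \<bullet> sproj (snd q) (snd v)) *\<^sub>R snd q))" if "q \<in> S2xS1" for d q v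
    by (rule mderiv_eqI[OF tfield_has_derivative[OF that]])
  \<comment> \<open>Closed form of the bracket of two projected constant fields. It shows that the
    bracket is tangent and differentiable, as \<open>levi_civita_warped\<close> requires.\<close>
  define Lf where "Lf a b q = (- ((fst b \<bullet> fst q) *\<^sub>R sproj (fst q) (fst a) - (fst a \<bullet> fst q) *\<^sub>R sproj (fst q) (fst b)),
      - ((snd b \<bullet> snd q) *\<^sub>R sproj (snd q) (snd a) - (snd a \<bullet> snd q) *\<^sub>R sproj (snd q) (snd b)))" for a b q :: amb
  have bracket: "lie_bracket (tfield a) (tfield b) q = Lf a b q" if q: "q \<in> S2xS1" for a b q
  proof -
    have "fst b \<bullet> sproj (fst q) (sproj (fst q) (fst a)) = fst a \<bullet> sproj (fst q) (sproj (fst q) (fst b))"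
      "snd b \<bullet> sproj (snd q) (sproj (snd q) (snd a)) = snd a \<bullet> sproj (snd q) (sproj (snd q) (snd b))"
      using inner_sproj_commute[of "fst q" "fst b" "fst a"] inner_sproj_commute[of "snd q" "snd b" "snd a"] M_norms[OF q]
      by (simp_all add: sproj_sproj inner_commute)
    then show ?thesis
      by (simp add: lie_bracket_def mt[OF q] Lf_def tfield_def tproj_def sproj_sproj M_norms[OF q])
  qed
  have Lf_tan: "tproj q (Lf a b q) = Lf a b q" if "q \<in> S2xS1" for a b q
    by (simp add: Lf_def tproj_def lins sproj_sproj M_norms[OF that])
  have Lf_diff: "\<exists>D. ((\<lambda>q. Lf a b (retr q)) has_derivative D) (at p)" for a b
    unfolding Lf_def
    by (rule exI, (rule derivative_intros retr_fst_snd_derivative[OF p] sproj_retr_derivative[OF p])+)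
  note tt = tfield_tangent tfield_has_derivative[OF p]
  have bt: "tproj q (lie_bracket (tfield a) (tfield b) q) = lie_bracket (tfield a) (tfield b) q" if "q \<in> S2xS1" for a b q
    using bracket[OF that] Lf_tan[OF that] by simp
  obtain DL where "((\<lambda>q. Lf a b (retr q)) has_derivative DL) (at p)" using Lf_diff by blast
  then have DL: "((\<lambda>q. lie_bracket (tfield a) (tfield b) (retr q)) has_derivative DL) (at p)"
    using M_has_derivative_cong[of "lie_bracket (tfield a) (tfield b)" "Lf a b", OF bracket p] by simp
  have Wt: "tproj q (levi_civita (warped_metric \<eta>) (tfield b) (tfield c) q) = levi_civita (warped_metric \<eta>) (tfield b) (tfield c) q"
    if "q \<in> S2xS1" for b c q
    using levi_civita_tfield[OF that] nab_tangent[OF that] by simp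
  have Wd: "((\<lambda>q. levi_civita (warped_metric \<eta>) (tfield b) (tfield c) (retr q)) has_derivative dnab b c p) (at p)" for b c
    using M_has_derivative_cong[of "levi_civita (warped_metric \<eta>) (tfield b) (tfield c)" "nab b c", OF levi_civita_tfield p]
      nab_has_derivative[OF p] by simp
  have LC1: "levi_civita (warped_metric \<eta>) (tfield a) (levi_civita (warped_metric \<eta>) (tfield b) (tfield c)) p =
     (sproj x (fst (dnab b c p (tfield a p))) - (e * (snd (tfield a p) \<bullet> snd (nab b c p))) *\<^sub>R n,
      sproj y (snd (dnab b c p (tfield a p))) + ((n \<bullet> fst (tfield a p)) / e) *\<^sub>R snd (nab b c p) + ((n \<bullet> fst (nab b c p)) / e) *\<^sub>R snd (tfield a p))" for a b c
    unfolding levi_civita_tfield[OF p, symmetric] x_def y_def e_def n_def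
    by (rule levi_civita_warped[OF p C1 \<eta>p tt Wt Wd])
  have LC2: "levi_civita (warped_metric \<eta>) (lie_bracket (tfield a) (tfield b)) (tfield c) p =
     (sproj x (fst (mderiv (tfield c) p (Lf a b p))) - (e * (snd (Lf a b p) \<bullet> snd (tfield c p))) *\<^sub>R n,
      sproj y (snd (mderiv (tfield c) p (Lf a b p))) + ((n \<bullet> fst (Lf a b p)) / e) *\<^sub>R snd (tfield c p) + ((n \<bullet> fst (tfield c p)) / e) *\<^sub>R snd (Lf a b p))"
    unfolding mt[OF p] bracket[OF p, symmetric] x_def y_def e_def n_def
    by (rule levi_civita_warped[OF p C1 \<eta>p bt DL tt])
  have R: "riemann (warped_metric \<eta>) (tfield a) (tfield b) (tfield c) p =
     (sproj x (fst (dnab b c p (tfield a p))) - (e * (snd (tfield a p) \<bullet> snd (nab b c p))) *\<^sub>R n,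
      sproj y (snd (dnab b c p (tfield a p))) + ((n \<bullet> fst (tfield a p)) / e) *\<^sub>R snd (nab b c p) + ((n \<bullet> fst (nab b c p)) / e) *\<^sub>R snd (tfield a p))
   - (sproj x (fst (dnab a c p (tfield b p))) - (e * (snd (tfield b p) \<bullet> snd (nab a c p))) *\<^sub>R n,
      sproj y (snd (dnab a c p (tfield b p))) + ((n \<bullet> fst (tfield b p)) / e) *\<^sub>R snd (nab a c p) + ((n \<bullet> fst (nab a c p)) / e) *\<^sub>R snd (tfield b p))
   - (sproj x (fst (mderiv (tfield c) p (Lf a b p))) - (e * (snd (Lf a b p) \<bullet> snd (tfield c p))) *\<^sub>R n,
      sproj y (snd (mderiv (tfield c) p (Lf a b p))) + ((n \<bullet> fst (Lf a b p)) / e) *\<^sub>R snd (tfield c p) + ((n \<bullet> fst (tfield c p)) / e) *\<^sub>R snd (Lf a b p))"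
    unfolding riemann_def LC1 LC2 ..
  have xx: "x \<bullet> x = 1" and yy: "y \<bullet> y = 1" using x y by (simp_all add: dot_square_norm)
  have nx: "n \<bullet> x = 0" "x \<bullet> n = 0" using sgrad_normal[OF x] by (simp_all add: n_def x_def inner_commute)
  have hx: "hess x v \<bullet> x = - (n \<bullet> v)" "x \<bullet> hess x v = - (n \<bullet> v)" for v
    using hess_normal[OF x] by (simp_all add: n_def x_def inner_commute)
  have hs: "hess x (sproj x v) = hess x v" "n \<bullet> sproj x v = n \<bullet> v" for v
    using hess_sproj[OF x] sgrad_sproj[OF x] by (simp_all add: n_def x_def)
  note defs = nab_def dnab_def Let_def Lf_def mt[OF p] tfield_def tproj_def fst_conv snd_conv
      x_def[symmetric] y_def[symmetric] H_def
  have en: "\<eta> x = e" "sgrad \<eta> x = n" by (simp_all add: e_def n_def x_def)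
  note proj = lins sproj_sproj[OF x] sproj_sproj[OF y] sproj_self[OF x] sproj_self[OF y] hs sproj_id[OF nx(1)]
  show ?thesis
    unfolding R
  proof (rule prod_eqI, goal_cases)
    case 1
    show ?case
      unfolding fst_diff defs
      \<comment> \<open>Vectors are compared through inner products with an arbitrary vector, so
        that all projections expand to scalar identities.\<close>
      apply (rule vector_eq_ldot[THEN iffD1], rule allI)
      apply (simp add: proj en)
      apply (simp add: sproj_def inner_diff_left inner_diff_right inner_add_left inner_add_right xx yy nx hx inner_commute)
      using e0 apply (simp add: field_simps power2_eq_square)
      done
  next
    case 2
    show ?case
      unfolding snd_diff defs
      apply (rule vector_eq_ldot[THEN iffD1], rule allI)
      apply (simp add: proj en)
      apply (simp add: sproj_def inner_diff_left inner_diff_right inner_add_left inner_add_right xx yy nx hx inner_commute)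
      using e0 apply (simp add: field_simps power2_eq_square)
      done
  qed
qed

text \<open>The trace over sphere directions gives the round metric and, on the circle, -\<eta>
  times the Laplacian; the trace over the circle gives minus the Hessian divided by \<eta>. In the
  latter the fibre curvature terms cancel because the projection to the circle has trace 1.\<close>

lemma ricci_warped:
  assumes p: "p \<in> S2xS1"
  shows "ricci (warped_metric \<eta>) p b c = bform 1 (- \<eta> (fst p) * slaplacian \<eta> (fst p)) p b c
    - (sproj (fst p) (hess (fst p) (fst b)) \<bullet> fst c) / \<eta> (fst p)"
proof -
  define x y e where "x = fst p" and "y = snd p" and "e = \<eta> (fst p)"
  define H where "H u v = sproj x (hess x u) \<bullet> v" for u v
  have x: "norm x = 1" and y: "norm y = 1" using M_norms[OF p] by (auto simp: x_def y_def)
  define B1 B2 where "B1 = sproj x (fst b) \<bullet> fst c" and "B2 = sproj y (snd b) \<bullet> snd c"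
  have h0: "hess x 0 = 0" using linear_0[OF linear_hess[OF x]] .
  have R: "riemann (warped_metric \<eta>) (tfield a) (tfield b) (tfield c) p =
    (B1 *\<^sub>R sproj x (fst a) - (sproj x (fst a) \<bullet> fst c) *\<^sub>R sproj x (fst b)
       - (e * B2) *\<^sub>R sproj x (hess x (fst a)) + (e * (sproj y (snd a) \<bullet> snd c)) *\<^sub>R sproj x (hess x (fst b)),
     - (H (fst b) (fst c) / e) *\<^sub>R sproj y (snd a) + (H (fst a) (fst c) / e) *\<^sub>R sproj y (snd b)
       + ((H (fst a) (fst b) - H (fst b) (fst a)) / e) *\<^sub>R sproj y (snd c)
       + (1 - sgrad \<eta> x \<bullet> sgrad \<eta> x) *\<^sub>R (B2 *\<^sub>R sproj y (snd a) - (sproj y (snd a) \<bullet> snd c) *\<^sub>R sproj y (snd b)))" for a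
    unfolding riemann_tfield[OF p] x_def y_def e_def H_def B1_def B2_def by simp
  have 1: "(\<Sum>u\<in>Basis. riemann (warped_metric \<eta>) (tfield (u, 0)) (tfield b) (tfield c) p \<bullet> (u, 0)) = B1 - e * B2 * slaplacian \<eta> x"
  proof -
    have "(\<Sum>u\<in>Basis. riemann (warped_metric \<eta>) (tfield (u, 0)) (tfield b) (tfield c) p \<bullet> (u, 0)) =
        (\<Sum>u\<in>Basis. B1 * (sproj x u \<bullet> u) - (sproj x (fst c) \<bullet> u) * (sproj x (fst b) \<bullet> u) - (e * B2) * (sproj x (hess x u) \<bullet> u))"
    proof (intro sum.cong refl)
      fix u :: "real^3"
      have "sproj x u \<bullet> fst c = sproj x (fst c) \<bullet> u"
        using inner_sproj_commute[of x u "fst c"] inner_commute[of u] by simp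
      then show "riemann (warped_metric \<eta>) (tfield (u, 0)) (tfield b) (tfield c) p \<bullet> (u, 0) =
        B1 * (sproj x u \<bullet> u) - (sproj x (fst c) \<bullet> u) * (sproj x (fst b) \<bullet> u) - (e * B2) * (sproj x (hess x u) \<bullet> u)"
        unfolding R by (simp add: inner_prod_def inner_diff_left inner_add_left)
    qed
    also have "\<dots> = B1 * 2 - sproj x (fst c) \<bullet> sproj x (fst b) - e * B2 * slaplacian \<eta> x"
      by (simp only: sum_subtractf sum_distrib_left[symmetric] sum_Basis_inner_mult sum_sproj_trace[OF x] slaplacian_hess) simp
    also have "sproj x (fst c) \<bullet> sproj x (fst b) = B1"
      using inner_sproj_sproj[OF x, of "fst b" "fst c"] by (simp add: B1_def inner_commute)
    finally show ?thesis by simp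
  qed
  have 2: "(\<Sum>v\<in>Basis. riemann (warped_metric \<eta>) (tfield (0, v)) (tfield b) (tfield c) p \<bullet> (0, v)) = - (H (fst b) (fst c) / e)"
  proof -
    define k where "k = 1 - sgrad \<eta> x \<bullet> sgrad \<eta> x"
    have "(\<Sum>v\<in>Basis. riemann (warped_metric \<eta>) (tfield (0, v)) (tfield b) (tfield c) p \<bullet> (0, v)) =
        (\<Sum>v\<in>Basis. (k * B2 - H (fst b) (fst c) / e) * (sproj y v \<bullet> v) - k * ((sproj y (snd c) \<bullet> v) * (sproj y (snd b) \<bullet> v)))"
    proof (intro sum.cong refl)
      fix v :: "real^2"
      have "sproj y v \<bullet> snd c = sproj y (snd c) \<bullet> v"
        using inner_sproj_commute[of y v "snd c"] inner_commute[of v] by simp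
      then show "riemann (warped_metric \<eta>) (tfield (0, v)) (tfield b) (tfield c) p \<bullet> (0, v) =
        (k * B2 - H (fst b) (fst c) / e) * (sproj y v \<bullet> v) - k * ((sproj y (snd c) \<bullet> v) * (sproj y (snd b) \<bullet> v))"
        unfolding R k_def[symmetric]
        by (simp add: inner_prod_def inner_diff_left inner_add_left H_def h0 algebra_simps)
    qed
    also have "\<dots> = (k * B2 - H (fst b) (fst c) / e) * 1 - k * (sproj y (snd c) \<bullet> sproj y (snd b))"
      by (simp only: sum_subtractf sum_distrib_left[symmetric] sum_Basis_inner_mult sum_sproj_trace[OF y]) simp
    also have "sproj y (snd c) \<bullet> sproj y (snd b) = B2"
      using inner_sproj_sproj[OF y, of "snd b" "snd c"] by (simp add: B2_def inner_commute)
    finally show ?thesis by simp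
  qed
  show ?thesis
    unfolding ricci_def sum_Basis_amb 1 2
    by (simp add: bform_def B1_def B2_def H_def x_def y_def e_def)
qed

text \<open>The Laplacian divided by \<eta> is subtracted twice: once from the circle component of
  the Ricci tensor and once from the trace of the Hessian.\<close>

lemma scalar_curvature_warped:
  assumes p: "p \<in> S2xS1"
  shows "scalar_curvature (warped_metric \<eta>) p = 2 - 2 * slaplacian \<eta> (fst p) / \<eta> (fst p)"
proof -
  define x e L where "x = fst p" and "e = \<eta> (fst p)" and "L = slaplacian \<eta> (fst p)"
  have x: "norm x = 1" using M_norms[OF p] by (auto simp: x_def)
  have e0: "e \<noteq> 0" using \<eta>0 x by (simp add: e_def x_def)
  have "scalar_curvature (warped_metric \<eta>) p = (\<Sum>b\<in>Basis. \<Sum>c\<in>Basis. bform 1 (1 / e\<^sup>2) p b c * bform 1 (- e * L) p c b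
      - (1 / e) * (bform 1 (1 / e\<^sup>2) p b c * (sproj x (hess x (fst b)) \<bullet> fst c)))"
    unfolding scalar_curvature_def ricci_warped[OF p] cometric_warped[of p \<eta>, OF p e0[unfolded e_def]]
  proof (intro sum.cong refl)
    fix b c :: amb
    show "bform 1 (1 / (\<eta> (fst p))\<^sup>2) p b c * (bform 1 (- \<eta> (fst p) * slaplacian \<eta> (fst p)) p b c
        - sproj (fst p) (hess (fst p) (fst b)) \<bullet> fst c / \<eta> (fst p)) =
      bform 1 (1 / e\<^sup>2) p b c * bform 1 (- e * L) p c b
      - (1 / e) * (bform 1 (1 / e\<^sup>2) p b c * (sproj x (hess x (fst b)) \<bullet> fst c))"
      unfolding bform_commute[of 1 "- e * L" p c b]
      unfolding x_def e_def L_def by (simp add: right_diff_distrib)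
  qed
  also have "\<dots> = (\<Sum>b\<in>Basis. bform 1 (- L / e) p b b - (1 / e) * (sproj x (hess x (fst b)) \<bullet> fst b))"
  proof (intro sum.cong refl)
    fix b :: amb
    have lin: "linear (\<lambda>c :: amb. sproj x (hess x (fst b)) \<bullet> fst c)" by (rule linearI) (simp_all add: inner_add_right)
    have "(\<Sum>c\<in>Basis. bform 1 (1 / e\<^sup>2) p b c * (sproj x (hess x (fst b)) \<bullet> fst c)) = sproj x (hess x (fst b)) \<bullet> sproj x (fst b)"
      unfolding sum_bform_linear[OF lin] by (simp add: bmap_def x_def)
    also have "\<dots> = sproj x (hess x (fst b)) \<bullet> fst b" by (rule inner_sproj_sproj[OF x])
    finally have s: "(\<Sum>c\<in>Basis. bform 1 (1 / e\<^sup>2) p b c * (sproj x (hess x (fst b)) \<bullet> fst c)) = sproj x (hess x (fst b)) \<bullet> fst b" .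
    show "(\<Sum>c\<in>Basis. bform 1 (1 / e\<^sup>2) p b c * bform 1 (- e * L) p c b
      - (1 / e) * (bform 1 (1 / e\<^sup>2) p b c * (sproj x (hess x (fst b)) \<bullet> fst c)))
      = bform 1 (- L / e) p b b - (1 / e) * (sproj x (hess x (fst b)) \<bullet> fst b)"
      unfolding sum_subtractf sum_distrib_left[symmetric] s sum_bform_bform[OF p]
      using e0 by (simp add: power2_eq_square)
  qed
  also have "\<dots> = (2 - L / e) - (1 / e) * (\<Sum>b\<in>(Basis :: amb set). sproj x (hess x (fst b)) \<bullet> fst b)"
    unfolding sum_subtractf bform_trace[OF p] sum_distrib_left[symmetric] by simp
  also have "(\<Sum>b\<in>(Basis :: amb set). sproj x (hess x (fst b)) \<bullet> fst b) = L"
    by (simp add: sum_Basis_amb slaplacian_hess L_def x_def)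
  finally show ?thesis by (simp add: L_def e_def)
qed

lemma total_scalar_curvature_warped:
  assumes pos: "\<And>x. norm x = 1 \<Longrightarrow> 0 < \<eta> x"
  shows "total_scalar_curvature (warped_metric \<eta>) = 2 * circle_length * (\<integral>x. \<eta> x \<partial>\<sigma>)"
proof -
  have C1: "C1_sphere \<eta>" using \<eta> by (rule C2_sphere_imp_C1)
  have c1: "continuous_on (sphere 0 1) (\<lambda>x. 2 - 2 * slaplacian \<eta> x / \<eta> x)"
    using \<eta>0 by (intro continuous_intros slaplacian_continuous \<eta> C1_sphere_continuous C1) auto
  have iL: "integrable \<sigma> (slaplacian \<eta>)" and ie: "integrable \<sigma> \<eta>"
    by (intro continuous_on_sphere_integrable slaplacian_continuous \<eta> C1_sphere_continuous C1)+
  have m1: "(\<lambda>p. 2 - 2 * slaplacian \<eta> (fst p) / \<eta> (fst p)) \<in> borel_measurable mu0"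
    using measurable_compose[OF measurable_fst_mu0 continuous_on_sphere_measurable[OF c1]] .
  have m2: "(\<lambda>p. \<eta> (fst p)) \<in> borel_measurable mu0"
    using measurable_compose[OF measurable_fst_mu0 borel_measurable_integrable[OF ie]] .
  have vm: "vol_measure (warped_metric \<eta>) = density mu0 (\<lambda>p. ennreal (\<eta> (fst p)))"
    unfolding vol_measure_def
  proof (rule measure_eqI)
    fix A assume "A \<in> sets (density mu0 (\<lambda>p. ennreal (vol_density (warped_metric \<eta>) p)))"
    then have A: "A \<in> sets mu0" by simp
    have eq: "ennreal (vol_density (warped_metric \<eta>) p) = ennreal (\<eta> (fst p))" if "p \<in> space mu0" for p
      using pos[of "fst p"] vol_density_warped[of p \<eta>] M_norms(1)[of p] that by simp
    have "(\<lambda>p. ennreal (vol_density (warped_metric \<eta>) p)) \<in> borel_measurable mu0 \<longleftrightarrow> (\<lambda>p. ennreal (\<eta> (fst p))) \<in> borel_measurable mu0"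
      by (rule measurable_cong[OF eq])
    then have "(\<lambda>p. ennreal (vol_density (warped_metric \<eta>) p)) \<in> borel_measurable mu0" using m2 by simp
    moreover have "(\<integral>\<^sup>+p. ennreal (vol_density (warped_metric \<eta>) p) * indicator A p \<partial>mu0) = (\<integral>\<^sup>+p. ennreal (\<eta> (fst p)) * indicator A p \<partial>mu0)"
      by (rule nn_integral_cong) (simp only: eq)
    ultimately show "emeasure (density mu0 (\<lambda>p. ennreal (vol_density (warped_metric \<eta>) p))) A
        = emeasure (density mu0 (\<lambda>p. ennreal (\<eta> (fst p)))) A"
      using A m2 by (simp add: emeasure_density)
  qed simp
  have "total_scalar_curvature (warped_metric \<eta>) =
      (\<integral>p. 2 - 2 * slaplacian \<eta> (fst p) / \<eta> (fst p) \<partial>density mu0 (\<lambda>p. ennreal (\<eta> (fst p))))"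
    unfolding total_scalar_curvature_def vm
    by (intro Bochner_Integration.integral_cong refl scalar_curvature_warped) simp
  also have "\<dots> = (\<integral>p. \<eta> (fst p) * (2 - 2 * slaplacian \<eta> (fst p) / \<eta> (fst p)) \<partial>mu0)"
    using m1 m2 pos M_norms(1) by (subst integral_density) (auto intro!: AE_I2 simp: less_imp_le mem_Times_iff)
  also have "\<dots> = (\<integral>p. 2 * \<eta> (fst p) - 2 * slaplacian \<eta> (fst p) \<partial>mu0)"
  proof (intro Bochner_Integration.integral_cong refl)
    fix p assume "p \<in> space mu0"
    then have "\<eta> (fst p) \<noteq> 0" using \<eta>0[of "fst p"] M_norms(1)[of p] by simp
    then show "\<eta> (fst p) * (2 - 2 * slaplacian \<eta> (fst p) / \<eta> (fst p)) = 2 * \<eta> (fst p) - 2 * slaplacian \<eta> (fst p)"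
      by (simp add: field_simps)
  qed
  also have "\<dots> = 2 * (circle_length * (\<integral>x. \<eta> x \<partial>\<sigma>)) - 2 * (circle_length * (\<integral>x. slaplacian \<eta> x \<partial>\<sigma>))"
    using integrable_mu0_fst[OF iL] integrable_mu0_fst[OF ie] by simp
  also have "(\<integral>x. slaplacian \<eta> x \<partial>\<sigma>) = 0" by (rule integral_slaplacian_eq_0[OF \<eta>])
  finally show ?thesis by simp
qed

end

lemma C2_sphere_const: "C2_sphere (\<lambda>_ :: 'a::euclidean_space. k :: real)" "norm x = 1 \<Longrightarrow> slaplacian (\<lambda>_ :: 'a. k :: real) x = 0"
  using slaplacian_zonal[of "0 :: 'a" "\<lambda>_. k" "\<lambda>_. 0" "\<lambda>_. 0"] by auto

lemma sgrad_const: "norm x = 1 \<Longrightarrow> sgrad (\<lambda>_. k) x = 0"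
  by (simp add: sgrad_def C1_sphere_const)

text \<open>The warped product with \<eta> = 1, whose Hessian vanishes; the curvature of the
  2-sphere remains.\<close>

lemma ricci_g0:
  assumes p: "p \<in> S2xS1" shows "ricci g0 p b c = bform 1 0 p b c"
proof -
  note n = M_norms(1)[OF p]
  have z: "sderiv (sgrad (\<lambda>_ :: real^3. 1 :: real)) (fst p) v = 0" for v
  proof -
    have "sderiv (sgrad (\<lambda>_ :: real^3. 1 :: real)) (fst p) v = sderiv (\<lambda>_. 0 :: real^3) (fst p) v"
      by (rule sderiv_cong[OF _ n]) (rule sgrad_const)
    also have "\<dots> = 0" by (rule sderiv_eqI) simp
    finally show ?thesis .
  qed
  show ?thesis
    unfolding g0_warped
    using ricci_warped[OF C2_sphere_const(1) _ p, of 1] C2_sphere_const(2)[OF n, of 1]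
    by (simp add: hess_def[OF C2_sphere_const(1)] z)
qed

lemma levi_civita_g0:
  assumes p: "p \<in> S2xS1"
    and X: "\<And>q. q \<in> S2xS1 \<Longrightarrow> tproj q (X q) = X q" "((\<lambda>q. X (retr q)) has_derivative DX) (at p)"
    and Y: "\<And>q. q \<in> S2xS1 \<Longrightarrow> tproj q (Y q) = Y q" "((\<lambda>q. Y (retr q)) has_derivative DY) (at p)"
  shows "levi_civita g0 X Y p = tproj p (DY (X p))"
proof -
  have "levi_civita (warped_metric (\<lambda>_. 1)) X Y p =
    (sproj (fst p) (fst (DY (X p))) - (1 * (snd (X p) \<bullet> snd (Y p))) *\<^sub>R sgrad (\<lambda>_. 1) (fst p),
     sproj (snd p) (snd (DY (X p))) + ((sgrad (\<lambda>_. 1) (fst p) \<bullet> fst (X p)) / 1) *\<^sub>R snd (Y p)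
       + ((sgrad (\<lambda>_. 1) (fst p) \<bullet> fst (Y p)) / 1) *\<^sub>R snd (X p))"
    by (rule levi_civita_warped[OF p C1_sphere_const(1) _ X Y]) simp
  then show ?thesis
    by (simp add: g0_warped sgrad_const[OF M_norms(1)[OF p]] tproj_def)
qed

section \<open>Weak derivatives on the product manifold\<close>

text \<open>Cyclicity of the trace for a symmetric P. It moves the tangential projection from the
  value of a derivative to its direction.\<close>

lemma trace_symmetric:
  fixes D P :: "'a::euclidean_space \<Rightarrow> 'a"
  assumes D: "linear D" and P: "\<And>a b. P a \<bullet> b = a \<bullet> P b"
  shows "(\<Sum>a\<in>Basis. D (P a) \<bullet> a) = (\<Sum>a\<in>Basis. D a \<bullet> P a)"
proof -
  have "(\<Sum>a\<in>Basis. D (P a) \<bullet> a) = (\<Sum>a\<in>Basis. \<Sum>b\<in>Basis. (P a \<bullet> b) * (D b \<bullet> a))"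
  proof (intro sum.cong refl)
    fix a :: 'a
    have "D (P a) = (\<Sum>b\<in>Basis. (P a \<bullet> b) *\<^sub>R D b)" by (rule sum_Basis_linear[OF D, symmetric])
    then show "D (P a) \<bullet> a = (\<Sum>b\<in>Basis. (P a \<bullet> b) * (D b \<bullet> a))" by (simp add: inner_sum_left)
  qed
  also have "\<dots> = (\<Sum>b\<in>Basis. \<Sum>a\<in>Basis. (D b \<bullet> a) * (P b \<bullet> a))"
    by (subst sum.swap, intro sum.cong refl) (metis P inner_commute mult.commute)
  also have "\<dots> = (\<Sum>b\<in>Basis. D b \<bullet> P b)" by (simp add: sum_Basis_inner_mult)
  finally show ?thesis .
qed

lemma smooth_vector_field_C1: "smooth_vector_field X \<Longrightarrow> C1_field X"
  unfolding smooth_vector_field_def C1_field_def using smooth_on_M_imp_C1(1) by blast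

text \<open>The covariant derivative projects the value of the flat one. Inside the trace the
  projection moves to the direction, where it has no effect since derivatives through
  \<open>retr\<close> vanish in normal directions.\<close>

lemma div1_eq_divM:
  assumes X: "smooth_vector_field X" and p: "p \<in> S2xS1"
  shows "div1 X p = divM X p"
proof -
  have sm: "smooth_on_M X" and tan: "\<And>q. q \<in> S2xS1 \<Longrightarrow> tproj q (X q) = X q"
    using X unfolding smooth_vector_field_def by blast+
  note d = smooth_on_M_imp_C1(2)[OF sm p]
  have lin: "linear (mderiv X p)" using d by (rule has_derivative_linear)
  have lc: "levi_civita g0 (tfield a) X p = tproj p (mderiv X p a)" for a
  proof -
    have "levi_civita g0 (tfield a) X p = tproj p (mderiv X p (tfield a p))"
      by (rule levi_civita_g0[OF p tfield_tangent tfield_has_derivative[OF p] tan d])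
    then show ?thesis using mderiv_tproj[OF d p] by (simp add: tfield_def)
  qed
  have "div1 X p = (\<Sum>a\<in>Basis. mderiv X p a \<bullet> tproj p a)"
    unfolding div1_def lc by (simp add: inner_tproj_commute)
  also have "\<dots> = (\<Sum>a\<in>Basis. mderiv X p (tproj p a) \<bullet> a)"
    by (rule trace_symmetric[OF lin inner_tproj_commute, symmetric])
  also have "\<dots> = divM X p"
    unfolding divM_def by (intro sum.cong refl) (simp add: mderiv_tproj[OF d p] smooth_on_M_imp_C1(3)[OF sm p])
  finally show ?thesis .
qed

lemma integrable_scaleR_continuous:
  fixes f :: "real^3 \<Rightarrow> 'b::euclidean_space" and G :: "amb \<Rightarrow> real"
  assumes f: "integrable \<sigma> f" and G: "continuous_on S2xS1 G"
  shows "integrable mu0 (\<lambda>p. G p *\<^sub>R f (fst p))"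
proof -
  obtain B where B: "B > 0" "\<And>p. p \<in> S2xS1 \<Longrightarrow> norm (G p) \<le> B" using continuous_on_M_bounded[OF G] by blast
  have i: "integrable mu0 (\<lambda>p. B * norm (f (fst p)))"
    using integrable_mu0_fst(1)[OF integrable_norm[OF f]] by simp
  show ?thesis
  proof (rule Bochner_Integration.integrable_bound[OF i])
    have "(\<lambda>p. f (fst p)) \<in> borel_measurable mu0" using integrable_mu0_fst(1)[OF f] by simp
    then show "(\<lambda>p. G p *\<^sub>R f (fst p)) \<in> borel_measurable mu0"
      using continuous_on_M_measurable[OF G] by measurable
    show "AE p in mu0. norm (G p *\<^sub>R f (fst p)) \<le> norm (B * norm (f (fst p)))"
    proof (rule AE_I2)
      fix p assume "p \<in> space mu0"
      then have "norm (G p) * norm (f (fst p)) \<le> B * norm (f (fst p))" using B by (intro mult_right_mono) auto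
      then show "norm (G p *\<^sub>R f (fst p)) \<le> norm (B * norm (f (fst p)))" using B(1) by simp
    qed
  qed
qed

section \<open>Gradients of test functions and weak gradients of products\<close>

definition gradM :: "(amb \<Rightarrow> real) \<Rightarrow> amb \<Rightarrow> amb" where
  "gradM u p = (\<Sum>b\<in>Basis. mderiv u p b *\<^sub>R b)"

lemma gradM_inner:
  assumes "C1_M u" "p \<in> S2xS1" shows "gradM u p \<bullet> v = mderiv u p v"
proof -
  have lin: "linear (mderiv u p)" using C1_M_has_derivative[OF assms] has_derivative_linear by blast
  have "gradM u p \<bullet> v = (\<Sum>b\<in>Basis. (v \<bullet> b) * mderiv u p b)"
    by (simp add: gradM_def inner_sum_left inner_commute[of v] mult.commute)
  then show ?thesis by (simp only: sum_Basis_linear_real[OF lin])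
qed

lemma gradM_tangent:
  assumes "C1_M u" "p \<in> S2xS1" shows "tproj p (gradM u p) = gradM u p"
proof (rule euclidean_eqI)
  fix b :: amb
  show "tproj p (gradM u p) \<bullet> b = gradM u p \<bullet> b"
    using mderiv_tproj[OF C1_M_has_derivative[OF assms] assms(2)]
    by (simp add: inner_tproj_commute gradM_inner[OF assms])
qed

lemma gradM_continuous: "C1_M u \<Longrightarrow> continuous_on S2xS1 (gradM u)"
  unfolding gradM_def[abs_def] by (intro continuous_intros C1_M_continuous_mderiv)

lemma smooth_real_C1_M: "smooth_on_M u \<Longrightarrow> C1_M u" for u :: "amb \<Rightarrow> real"
  using smooth_on_M_imp_C1(1)[of u 1] by simp

text \<open>The factor u is moved to the test field: u X is again C1, and its divergence contributes
  the term with \<open>gradM u\<close>.\<close>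

lemma has_weak_grad_mult:
  fixes u :: "amb \<Rightarrow> real"
  assumes W: "weak_gradient \<alpha> w" and u: "smooth_on_M u" and v: "\<And>p. p \<in> S2xS1 \<Longrightarrow> v p = u p * \<alpha> (fst p)"
  shows "has_weak_grad v (\<lambda>p. u p *\<^sub>R (w (fst p), 0) + \<alpha> (fst p) *\<^sub>R gradM u p)"
proof -
  have u1: "C1_M u" using u by (rule smooth_real_C1_M)
  have i\<alpha>: "integrable \<sigma> \<alpha>" and iw: "integrable \<sigma> w"
    and tw: "\<And>x. norm x = 1 \<Longrightarrow> w x \<bullet> x = 0" using W unfolding weak_gradient_def by blast+
  have cu: "continuous_on S2xS1 u" using u1 by (rule C1_M_continuous)
  have iw': "integrable \<sigma> (\<lambda>x. (w x, 0 :: real^2))"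
    by (rule integrable_bounded_linear[OF _ iw, of "\<lambda>v. (v, 0)"]) (rule bounded_linear_Pair[OF bounded_linear_ident bounded_linear_zero])
  have i1: "integrable mu0 (\<lambda>p. u p *\<^sub>R (w (fst p), 0 :: real^2))"
    using integrable_scaleR_continuous[OF iw' cu] .
  have i2: "integrable mu0 (\<lambda>p. \<alpha> (fst p) *\<^sub>R gradM u p)"
  proof -
    have "integrable mu0 (\<lambda>p. \<Sum>b\<in>Basis. (mderiv u p b *\<^sub>R \<alpha> (fst p)) *\<^sub>R b)"
      by (intro Bochner_Integration.integrable_sum integrable_scaleR_left integrable_scaleR_continuous i\<alpha> C1_M_continuous_mderiv u1)
    then show ?thesis by (simp add: gradM_def scaleR_sum_right mult.commute)
  qed
  have eq: "(\<integral>p. (u p *\<^sub>R (w (fst p), 0) + \<alpha> (fst p) *\<^sub>R gradM u p) \<bullet> X p \<partial>mu0) = - (\<integral>p. v p * div1 X p \<partial>mu0)"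
    if X: "smooth_vector_field X" for X
  proof -
    have X1: "C1_field X" using X by (rule smooth_vector_field_C1)
    have cX: "continuous_on S2xS1 X" using X1 by (rule C1_field_continuous)
    have cdX: "continuous_on S2xS1 (divM X)" using X1 by (rule divM_continuous)
    have j1: "integrable mu0 (\<lambda>p. w (fst p) \<bullet> fst (u p *\<^sub>R X p))"
      by (intro integrable_mult_continuous iw continuous_intros cu cX)
    have j2: "integrable mu0 (\<lambda>p. \<alpha> (fst p) \<bullet> (gradM u p \<bullet> X p))"
      by (intro integrable_mult_continuous i\<alpha> continuous_intros gradM_continuous u1 cX)
    have j3: "integrable mu0 (\<lambda>p. \<alpha> (fst p) \<bullet> (u p * divM X p))"
      by (intro integrable_mult_continuous i\<alpha> continuous_intros cu cdX)
    have "(\<integral>p. w (fst p) \<bullet> fst (u p *\<^sub>R X p) \<partial>mu0) = - (\<integral>p. \<alpha> (fst p) * divM (\<lambda>p. u p *\<^sub>R X p) p \<partial>mu0)"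
      using W C1_field_scale(1)[OF u1 X1] unfolding weak_gradient_def by blast
    also have "(\<integral>p. \<alpha> (fst p) * divM (\<lambda>p. u p *\<^sub>R X p) p \<partial>mu0) =
        (\<integral>p. \<alpha> (fst p) \<bullet> (u p * divM X p) + \<alpha> (fst p) \<bullet> (gradM u p \<bullet> X p) \<partial>mu0)"
    proof (intro Bochner_Integration.integral_cong refl)
      fix p assume "p \<in> space mu0"
      then have p: "p \<in> S2xS1" by simp
      show "\<alpha> (fst p) * divM (\<lambda>p. u p *\<^sub>R X p) p = \<alpha> (fst p) \<bullet> (u p * divM X p) + \<alpha> (fst p) \<bullet> (gradM u p \<bullet> X p)"
        unfolding C1_field_scale(2)[OF u1 X1 p] gradM_inner[OF u1 p] by (simp add: distrib_left)
    qed
    also have "\<dots> = (\<integral>p. \<alpha> (fst p) \<bullet> (u p * divM X p) \<partial>mu0) + (\<integral>p. \<alpha> (fst p) \<bullet> (gradM u p \<bullet> X p) \<partial>mu0)"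
      using j2 j3 by (rule Bochner_Integration.integral_add[rotated])
    finally have main: "(\<integral>p. w (fst p) \<bullet> fst (u p *\<^sub>R X p) \<partial>mu0) + (\<integral>p. \<alpha> (fst p) \<bullet> (gradM u p \<bullet> X p) \<partial>mu0)
        = - (\<integral>p. \<alpha> (fst p) \<bullet> (u p * divM X p) \<partial>mu0)" by simp
    have "(\<integral>p. (u p *\<^sub>R (w (fst p), 0) + \<alpha> (fst p) *\<^sub>R gradM u p) \<bullet> X p \<partial>mu0) =
      (\<integral>p. w (fst p) \<bullet> fst (u p *\<^sub>R X p) + \<alpha> (fst p) \<bullet> (gradM u p \<bullet> X p) \<partial>mu0)"
      by (intro Bochner_Integration.integral_cong refl) (simp add: inner_add_left inner_prod_def distrib_left)
    also have "\<dots> = - (\<integral>p. \<alpha> (fst p) \<bullet> (u p * divM X p) \<partial>mu0)"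
      using main j1 j2 by (subst Bochner_Integration.integral_add) auto
    also have "(\<integral>p. \<alpha> (fst p) \<bullet> (u p * divM X p) \<partial>mu0) = (\<integral>p. v p * div1 X p \<partial>mu0)"
      by (intro Bochner_Integration.integral_cong refl) (simp add: v div1_eq_divM[OF X] mult_ac)
    finally show ?thesis .
  qed
  have iv: "integrable mu0 v"
  proof -
    have "integrable mu0 (\<lambda>p. u p *\<^sub>R \<alpha> (fst p))" by (rule integrable_scaleR_continuous[OF i\<alpha> cu])
    moreover have "integrable mu0 v \<longleftrightarrow> integrable mu0 (\<lambda>p. u p *\<^sub>R \<alpha> (fst p))"
      by (rule Bochner_Integration.integrable_cong[OF refl]) (simp add: v)
    ultimately show ?thesis by simp
  qed
  have tan: "AE p in mu0. tproj p (u p *\<^sub>R (w (fst p), 0) + \<alpha> (fst p) *\<^sub>R gradM u p) = u p *\<^sub>R (w (fst p), 0) + \<alpha> (fst p) *\<^sub>R gradM u p"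
  proof (rule AE_I2)
    fix p assume "p \<in> space mu0"
    then have p: "p \<in> S2xS1" by simp
    have "tproj p (w (fst p), 0) = (w (fst p), 0)" using tw[OF M_norms(1)[OF p]] by (simp add: tangent_iff[OF p])
    then show "tproj p (u p *\<^sub>R (w (fst p), 0) + \<alpha> (fst p) *\<^sub>R gradM u p) = u p *\<^sub>R (w (fst p), 0) + \<alpha> (fst p) *\<^sub>R gradM u p"
      by (simp only: linear_add[OF linear_tproj] linear_scale[OF linear_tproj] gradM_tangent[OF u1 p])
  qed
  show ?thesis
    unfolding has_weak_grad_def using tan iv i1 i2 eq by (intro conjI allI impI) auto
qed

subsection \<open>Weak covariant derivatives of warped 2-tensors\<close>

text \<open>Both spheres are umbilic: the projection of a constant vector b has as covariant
  derivative, on each factor, minus its normal coefficient times the identity.\<close>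

lemma levi_civita_g0_tfield:
  assumes p: "p \<in> S2xS1"
  shows "levi_civita g0 (tfield a) (tfield b) p = - bmap (fst b \<bullet> fst p) (snd b \<bullet> snd p) p a"
proof -
  let ?D = "\<lambda>v. (- ((fst b \<bullet> fst p) *\<^sub>R sproj (fst p) (fst v) + (fst b \<bullet> sproj (fst p) (fst v)) *\<^sub>R fst p),
     - ((snd b \<bullet> snd p) *\<^sub>R sproj (snd p) (snd v) + (snd b \<bullet> sproj (snd p) (snd v)) *\<^sub>R snd p))"
  have "levi_civita g0 (tfield a) (tfield b) p = tproj p (?D (tfield a p))"
    by (rule levi_civita_g0[OF p tfield_tangent tfield_has_derivative[OF p] tfield_tangent tfield_has_derivative[OF p]])
  also have "\<dots> = - bmap (fst b \<bullet> fst p) (snd b \<bullet> snd p) p a"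
    by (simp add: tfield_def tproj_def bmap_def M_norms[OF p] linear_neg[OF linear_sproj] linear_diff[OF linear_sproj]
        linear_add[OF linear_sproj] linear_scale[OF linear_sproj] sproj_sproj sproj_self)
  finally show ?thesis .
qed

text \<open>Each term of the derivative has a normal vector in one of its two slots and so vanishes
  when contracted with a tangent tensor. This expresses that the forms are parallel for the product
  metric.\<close>

lemma bform_C1: "C1_M (\<lambda>q. bform \<gamma> \<delta> q b c)"
  and bform_mderiv: "p \<in> S2xS1 \<Longrightarrow> mderiv (\<lambda>q. bform \<gamma> \<delta> q b c) p v =
     - (\<gamma> * ((b \<bullet> (fst p, 0)) * (c \<bullet> (sproj (fst p) (fst v), 0)) + (b \<bullet> (sproj (fst p) (fst v), 0)) * (c \<bullet> (fst p, 0)))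
        + \<delta> * ((b \<bullet> (0, snd p)) * (c \<bullet> (0, sproj (snd p) (snd v))) + (b \<bullet> (0, sproj (snd p) (snd v))) * (c \<bullet> (0, snd p))))"
proof -
  let ?D = "\<lambda>p v. - (\<gamma> * ((b \<bullet> (fst p, 0)) * (c \<bullet> (sproj (fst p) (fst v), 0)) + (b \<bullet> (sproj (fst p) (fst v), 0)) * (c \<bullet> (fst p, 0)))
        + \<delta> * ((b \<bullet> (0, snd p)) * (c \<bullet> (0, sproj (snd p) (snd v))) + (b \<bullet> (0, sproj (snd p) (snd v))) * (c \<bullet> (0, snd p))))"
  have 1: "((\<lambda>q. bform \<gamma> \<delta> (retr q) b c) has_derivative ?D p) (at p)" if p: "p \<in> S2xS1" for p :: amb
    unfolding bform_def
    by (rule has_derivative_eq_rhs, (rule derivative_intros sproj_retr_derivative[OF p])+)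
      (simp add: fun_eq_iff inner_prod_def inner_diff_left inner_add_left algebra_simps inner_commute)
  have 2: "continuous_on S2xS1 (\<lambda>p. ?D p v)" for v :: amb
    unfolding sproj_def by (intro continuous_intros)
  show "C1_M (\<lambda>q. bform \<gamma> \<delta> q b c)" by (rule C1_MI(1)[OF 1 2])
  show "p \<in> S2xS1 \<Longrightarrow> mderiv (\<lambda>q. bform \<gamma> \<delta> q b c) p v = ?D p v" by (rule C1_MI(2)[OF 1 2])
qed

lemmas C1_M_sum_I = C1_M_sum[THEN conjunct1]
lemmas mderiv_sum = C1_M_sum[THEN conjunct2, rule_format]

context
  fixes \<Phi> :: tensor3
  assumes \<Phi>: "smooth_tensor3 \<Phi>"
begin

lemma tensor_C1: "C1_M (\<lambda>q. \<Phi> q a b c)"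
  using \<Phi> smooth_real_C1_M unfolding smooth_tensor3_def by blast

lemma tensor_linear:
  assumes p: "p \<in> S2xS1"
  shows "linear (\<lambda>a. \<Phi> p a b c)" "linear (\<lambda>b. \<Phi> p a b c)" "linear (\<lambda>c. \<Phi> p a b c)"
  using \<Phi> p unfolding smooth_tensor3_def tangent3_def bilinear_def by blast+

lemma tensor_tproj:
  assumes p: "p \<in> S2xS1"
  shows "\<Phi> p (tproj p a) b c = \<Phi> p a b c" "\<Phi> p a (tproj p b) c = \<Phi> p a b c" "\<Phi> p a b (tproj p c) = \<Phi> p a b c"
proof -
  have t: "\<Phi> p a b c = \<Phi> p (tproj p a) (tproj p b) (tproj p c)" for a b c
    using \<Phi> p unfolding smooth_tensor3_def tangent3_def by blast
  show "\<Phi> p (tproj p a) b c = \<Phi> p a b c" "\<Phi> p a (tproj p b) c = \<Phi> p a b c" "\<Phi> p a b (tproj p c) = \<Phi> p a b c"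
    by (subst (1 2) t, simp only: tproj_tproj[OF p])+
qed

lemma tensor_zero:
  assumes p: "p \<in> S2xS1"
  shows "\<Phi> p 0 b c = 0" "\<Phi> p a 0 c = 0" "\<Phi> p a b 0 = 0"
  using linear_0[OF tensor_linear(1)[OF p]] linear_0[OF tensor_linear(2)[OF p]] linear_0[OF tensor_linear(3)[OF p]] by auto

lemma tproj_normal:
  assumes p: "p \<in> S2xS1"
  shows "tproj p (fst p, 0) = 0" "tproj p (0, snd p) = 0"
  using M_norms[OF p] by (simp_all add: tproj_def sproj_self zero_prod_def)

lemma tensor_normal:
  assumes p: "p \<in> S2xS1"
  shows "\<Phi> p a (fst p, 0) c = 0" "\<Phi> p a (0, snd p) c = 0" "\<Phi> p a b (fst p, 0) = 0" "\<Phi> p a b (0, snd p) = 0"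
  using tensor_tproj(2)[OF p, of a "(fst p, 0)" c] tensor_tproj(2)[OF p, of a "(0, snd p)" c]
    tensor_tproj(3)[OF p, of a b "(fst p, 0)"] tensor_tproj(3)[OF p, of a b "(0, snd p)"]
  by (simp_all add: tproj_normal[OF p] tensor_zero[OF p])

lemma cov_deriv3_eq:
  assumes p: "p \<in> S2xS1"
  shows "cov_deriv3 \<Phi> p a b c d = mderiv (\<lambda>q. \<Phi> q b c d) p a + \<Phi> p (bmap (fst b \<bullet> fst p) (snd b \<bullet> snd p) p a) c d
     + \<Phi> p b (bmap (fst c \<bullet> fst p) (snd c \<bullet> snd p) p a) d + \<Phi> p b c (bmap (fst d \<bullet> fst p) (snd d \<bullet> snd p) p a)"
proof -
  have "mderiv (\<lambda>q. \<Phi> q (tfield b q) (tfield c q) (tfield d q)) p (tfield a p) = mderiv (\<lambda>q. \<Phi> q b c d) p (tfield a p)"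
    by (rule mderiv_cong[OF _ p]) (simp add: tfield_def tensor_tproj)
  also have "\<dots> = mderiv (\<lambda>q. \<Phi> q b c d) p a"
    using mderiv_tproj[OF C1_M_has_derivative[OF tensor_C1 p] p] by (simp add: tfield_def)
  finally show ?thesis
    by (simp add: cov_deriv3_def levi_civita_g0_tfield[OF p] tfield_def tensor_tproj[OF p]
        linear_neg[OF tensor_linear(1)[OF p]] linear_neg[OF tensor_linear(2)[OF p]] linear_neg[OF tensor_linear(3)[OF p]])
qed

text \<open>Contracting two slots of a test tensor with a parallel form turns it into a test vector
  field.\<close>

definition contract_field :: "real \<Rightarrow> real \<Rightarrow> amb \<Rightarrow> amb" where
  "contract_field \<gamma> \<delta> p = (\<Sum>a\<in>Basis. (\<Sum>b\<in>Basis. \<Sum>c\<in>Basis. bform \<gamma> \<delta> p b c * \<Phi> p a b c) *\<^sub>R a)"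

lemma contract_field_inner:
  assumes p: "p \<in> S2xS1"
  shows "contract_field \<gamma> \<delta> p \<bullet> v = (\<Sum>b\<in>Basis. \<Sum>c\<in>Basis. bform \<gamma> \<delta> p b c * \<Phi> p v b c)"
proof -
  define f where "f v = (\<Sum>b\<in>Basis. \<Sum>c\<in>Basis. bform \<gamma> \<delta> p b c * \<Phi> p v b c)" for v
  have lin: "linear f"
    unfolding f_def
    by (rule linearI) (simp_all add: linear_add[OF tensor_linear(1)[OF p]] linear_scale[OF tensor_linear(1)[OF p]]
        distrib_left sum.distrib sum_distrib_left mult.left_commute)
  have "contract_field \<gamma> \<delta> p \<bullet> v = (\<Sum>a\<in>Basis. (v \<bullet> a) * f a)"
    by (simp add: contract_field_def f_def inner_sum_left inner_commute[of v] mult.commute)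
  then show ?thesis by (simp only: sum_Basis_linear_real[OF lin]) (simp add: f_def)
qed

lemma contract_field_C1: "C1_field (contract_field \<gamma> \<delta>)"
  unfolding C1_field_def
proof (intro conjI allI ballI)
  fix v :: amb
  have "C1_M (\<lambda>p. \<Sum>b\<in>Basis. \<Sum>c\<in>Basis. bform \<gamma> \<delta> p b c * \<Phi> p v b c)"
    by (intro C1_M_sum_I finite_Basis C1_M_mult bform_C1 tensor_C1)
  then show "C1_M (\<lambda>p. contract_field \<gamma> \<delta> p \<bullet> v)"
    by (rule C1_M_cong[rotated]) (simp add: contract_field_inner)
next
  fix p assume p: "p \<in> S2xS1"
  show "tproj p (contract_field \<gamma> \<delta> p) = contract_field \<gamma> \<delta> p"
    by (rule euclidean_eqI) (simp add: inner_tproj_commute contract_field_inner[OF p] tensor_tproj[OF p])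
qed

lemma sum_bilinear_tensor:
  assumes p: "p \<in> S2xS1"
  shows "(\<Sum>b\<in>Basis. \<Sum>c\<in>Basis. ((b \<bullet> s) * (c \<bullet> t)) * \<Phi> p a b c) = \<Phi> p a s t"
proof -
  have "(\<Sum>b\<in>Basis. \<Sum>c\<in>Basis. ((b \<bullet> s) * (c \<bullet> t)) * \<Phi> p a b c) = (\<Sum>b\<in>Basis. (s \<bullet> b) * (\<Sum>c\<in>Basis. (t \<bullet> c) * \<Phi> p a b c))"
    by (simp add: sum_distrib_left inner_commute mult.assoc)
  then show ?thesis
    by (simp only: sum_Basis_linear_real[OF tensor_linear(3)[OF p]] sum_Basis_linear_real[OF tensor_linear(2)[OF p]])
qed

text \<open>As \<open>bform \<gamma> \<delta>\<close> is parallel, contraction with it commutes with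
  the divergence; tests with 3-tensors are thereby reduced to tests with vector fields.\<close>

lemma contract_div3:
  assumes p: "p \<in> S2xS1"
  shows "(\<Sum>b\<in>Basis. \<Sum>c\<in>Basis. bform \<gamma> \<delta> p b c * div3 \<Phi> p b c) = divM (contract_field \<gamma> \<delta>) p"
proof -
  \<comment> \<open>\<open>M c a\<close> is minus the covariant derivative of
    \<open>tfield c\<close> along \<open>tfield a\<close>; \<open>t1\<close>, \<open>t2\<close> and
    \<open>t3\<close> show that the three connection terms of \<open>cov_deriv3\<close> contribute
    nothing.\<close>
  define M where "M c a = bmap (fst c \<bullet> fst p) (snd c \<bullet> snd p) p a" for c a
  define D where "D a b c = mderiv (\<lambda>q. \<Phi> q a b c) p a" for a b c
  have Mlin: "linear (\<lambda>c. M c a)" for a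
    by (rule linearI) (simp_all add: M_def bmap_def inner_add_left scaleR_add_left)
  have M0: "M (bmap \<gamma> \<delta> p c) a = 0" for a c
    by (simp add: M_def bmap_def sproj_inner_self M_norms[OF p] zero_prod_def)
  have t1: "(\<Sum>a\<in>Basis. \<Phi> p (M a a) b c) = 0" for b c
  proof -
    have "(\<Sum>a\<in>Basis. M a a) = (\<Sum>u\<in>Basis. (sproj (fst p) ((fst p \<bullet> u) *\<^sub>R u), 0)) + (\<Sum>v\<in>Basis. (0, sproj (snd p) ((snd p \<bullet> v) *\<^sub>R v)))"
      by (simp add: sum_Basis_amb M_def bmap_def inner_commute linear_scale[OF linear_sproj])
    also have "\<dots> = (sproj (fst p) (\<Sum>u\<in>Basis. (fst p \<bullet> u) *\<^sub>R u), sproj (snd p) (\<Sum>v\<in>Basis. (snd p \<bullet> v) *\<^sub>R v))"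
      by (simp add: prod_eq_iff fst_sum snd_sum linear_sum[OF linear_sproj])
    also have "\<dots> = 0" by (simp add: euclidean_representation sproj_self M_norms[OF p] zero_prod_def)
    finally have "(\<Sum>a\<in>Basis. M a a) = 0" .
    moreover have "\<Phi> p (\<Sum>a\<in>Basis. M a a) b c = (\<Sum>a\<in>Basis. \<Phi> p (M a a) b c)"
      by (rule linear_sum[OF tensor_linear(1)[OF p]])
    ultimately show ?thesis using tensor_zero(1)[OF p] by simp
  qed
  have t2: "(\<Sum>b\<in>Basis. bform \<gamma> \<delta> p b c * \<Phi> p a (M b a) c) = 0" for a c
  proof -
    have lin: "linear (\<lambda>b. \<Phi> p a (M b a) c)"
      using linear_compose[OF Mlin tensor_linear(2)[OF p]] by (simp add: o_def)
    have "(\<Sum>b\<in>Basis. bform \<gamma> \<delta> p b c * \<Phi> p a (M b a) c) = (\<Sum>b\<in>Basis. bform \<gamma> \<delta> p c b * \<Phi> p a (M b a) c)"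
      by (simp add: bform_commute[of \<gamma> \<delta> p _ c])
    then show ?thesis by (simp only: sum_bform_linear[OF lin] M0 tensor_zero[OF p])
  qed
  have t3: "(\<Sum>c\<in>Basis. bform \<gamma> \<delta> p b c * \<Phi> p a b (M c a)) = 0" for a b
  proof -
    have lin: "linear (\<lambda>c. \<Phi> p a b (M c a))"
      using linear_compose[OF Mlin tensor_linear(3)[OF p]] by (simp add: o_def)
    show ?thesis by (simp only: sum_bform_linear[OF lin] M0 tensor_zero[OF p])
  qed
  have "(\<Sum>b\<in>Basis. \<Sum>c\<in>Basis. bform \<gamma> \<delta> p b c * div3 \<Phi> p b c) =
      (\<Sum>b\<in>Basis. \<Sum>c\<in>Basis. (\<Sum>a\<in>Basis. bform \<gamma> \<delta> p b c * D a b c) + bform \<gamma> \<delta> p b c * (\<Sum>a\<in>Basis. \<Phi> p (M a a) b c)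
        + (\<Sum>a\<in>Basis. bform \<gamma> \<delta> p b c * \<Phi> p a (M b a) c) + (\<Sum>a\<in>Basis. bform \<gamma> \<delta> p b c * \<Phi> p a b (M c a)))"
    by (intro sum.cong refl)
      (simp add: div3_def cov_deriv3_eq[OF p] M_def D_def sum.distrib sum_distrib_left distrib_left)
  also have "\<dots> = (\<Sum>b\<in>Basis. \<Sum>c\<in>Basis. \<Sum>a\<in>Basis. bform \<gamma> \<delta> p b c * D a b c)
      + (\<Sum>c\<in>Basis. \<Sum>a\<in>Basis. \<Sum>b\<in>Basis. bform \<gamma> \<delta> p b c * \<Phi> p a (M b a) c)
      + (\<Sum>b\<in>Basis. \<Sum>a\<in>Basis. \<Sum>c\<in>Basis. bform \<gamma> \<delta> p b c * \<Phi> p a b (M c a))"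
  proof -
    have s1: "(\<Sum>b\<in>Basis. \<Sum>c\<in>Basis. \<Sum>a\<in>Basis. bform \<gamma> \<delta> p b c * \<Phi> p a (M b a) c) =
      (\<Sum>c\<in>Basis. \<Sum>a\<in>Basis. \<Sum>b\<in>Basis. bform \<gamma> \<delta> p b c * \<Phi> p a (M b a) c)"
      by (rule trans[OF sum.swap], rule sum.cong[OF refl], rule sum.swap)
    have s2: "(\<Sum>b\<in>Basis. \<Sum>c\<in>Basis. \<Sum>a\<in>Basis. bform \<gamma> \<delta> p b c * \<Phi> p a b (M c a)) =
      (\<Sum>b\<in>Basis. \<Sum>a\<in>Basis. \<Sum>c\<in>Basis. bform \<gamma> \<delta> p b c * \<Phi> p a b (M c a))"
      by (rule sum.cong[OF refl], rule sum.swap)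
    show ?thesis unfolding s1[symmetric] s2[symmetric] t1 by (simp add: sum.distrib)
  qed
  also have "\<dots> = (\<Sum>b\<in>Basis. \<Sum>c\<in>Basis. \<Sum>a\<in>Basis. bform \<gamma> \<delta> p b c * D a b c)" unfolding t2 t3 by simp
  also have "\<dots> = (\<Sum>a\<in>Basis. \<Sum>b\<in>Basis. \<Sum>c\<in>Basis. bform \<gamma> \<delta> p b c * D a b c)"
    by (rule trans[OF _ sum.swap], rule sum.cong[OF refl], rule sum.swap)
  finally have L: "(\<Sum>b\<in>Basis. \<Sum>c\<in>Basis. bform \<gamma> \<delta> p b c * div3 \<Phi> p b c) =
      (\<Sum>a\<in>Basis. \<Sum>b\<in>Basis. \<Sum>c\<in>Basis. bform \<gamma> \<delta> p b c * D a b c)" .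
  have R: "mderiv (\<lambda>q. contract_field \<gamma> \<delta> q \<bullet> a) p a = (\<Sum>b\<in>Basis. \<Sum>c\<in>Basis. bform \<gamma> \<delta> p b c * D a b c)" for a
  proof -
    define B' where "B' b c = mderiv (\<lambda>q. bform \<gamma> \<delta> q b c) p a" for b c
    have "mderiv (\<lambda>q. contract_field \<gamma> \<delta> q \<bullet> a) p a = mderiv (\<lambda>q. \<Sum>b\<in>Basis. \<Sum>c\<in>Basis. bform \<gamma> \<delta> q b c * \<Phi> q a b c) p a"
      by (rule mderiv_cong[OF contract_field_inner p])
    also have "\<dots> = (\<Sum>b\<in>Basis. mderiv (\<lambda>q. \<Sum>c\<in>Basis. bform \<gamma> \<delta> q b c * \<Phi> q a b c) p a)"
      by (intro mderiv_sum[OF finite_Basis _ p] C1_M_sum_I finite_Basis C1_M_mult bform_C1 tensor_C1)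
    also have "\<dots> = (\<Sum>b\<in>Basis. \<Sum>c\<in>Basis. mderiv (\<lambda>q. bform \<gamma> \<delta> q b c * \<Phi> q a b c) p a)"
      by (intro sum.cong refl mderiv_sum[OF finite_Basis _ p] C1_M_mult bform_C1 tensor_C1)
    also have "\<dots> = (\<Sum>b\<in>Basis. \<Sum>c\<in>Basis. bform \<gamma> \<delta> p b c * D a b c + B' b c * \<Phi> p a b c)"
      by (simp add: C1_M_mult(2)[OF bform_C1 tensor_C1 p] D_def B'_def)
    also have "\<dots> = (\<Sum>b\<in>Basis. \<Sum>c\<in>Basis. bform \<gamma> \<delta> p b c * D a b c) + (\<Sum>b\<in>Basis. \<Sum>c\<in>Basis. B' b c * \<Phi> p a b c)"
      by (simp add: sum.distrib)
    also have "(\<Sum>b\<in>Basis. \<Sum>c\<in>Basis. B' b c * \<Phi> p a b c) = 0"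
    proof -
      define s1 s2 where "s1 = (sproj (fst p) (fst a), 0 :: real^2)" and "s2 = (0 :: real^3, sproj (snd p) (snd a))"
      have aux: "- (\<gamma> * (A * B + C * D) + \<delta> * (E * F + G * H)) * P =
          - \<gamma> * (A * B * P) + - \<gamma> * (C * D * P) + - \<delta> * (E * F * P) + - \<delta> * (G * H * P)" for A B C D E F G H P :: real
        by (simp add: algebra_simps)
      let ?T = "\<lambda>s t b c. ((b \<bullet> s) * (c \<bullet> t)) * \<Phi> p a b c"
      have "(\<Sum>b\<in>Basis. \<Sum>c\<in>Basis. B' b c * \<Phi> p a b c) = (\<Sum>b\<in>Basis. \<Sum>c\<in>Basis.
          - \<gamma> * ?T (fst p, 0) s1 b c + - \<gamma> * ?T s1 (fst p, 0) b c + - \<delta> * ?T (0, snd p) s2 b c + - \<delta> * ?T s2 (0, snd p) b c)"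
        unfolding B'_def bform_mderiv[OF p] s1_def s2_def aux ..
      also have "\<dots> = - \<gamma> * \<Phi> p a (fst p, 0) s1 + - \<gamma> * \<Phi> p a s1 (fst p, 0) + - \<delta> * \<Phi> p a (0, snd p) s2 + - \<delta> * \<Phi> p a s2 (0, snd p)"
        unfolding sum.distrib sum_distrib_left[symmetric] sum_bilinear_tensor[OF p] ..
      also have "\<dots> = 0" by (simp add: tensor_normal[OF p])
      finally show ?thesis .
    qed
    finally show ?thesis by simp
  qed
  show ?thesis unfolding L divM_def R ..
qed

end

text \<open>T is a parallel form plus \<alpha> times the parallel form \<open>bform 0 1\<close>, so
  only \<alpha> is differentiated.\<close>

lemma has_weak_cov_warped:
  assumes W: "weak_gradient \<alpha> w"
    and T: "\<And>p. p \<in> S2xS1 \<Longrightarrow> T p = bform 1 (\<alpha> (fst p)) p"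
  shows "has_weak_cov T (\<lambda>p a b c. (w (fst p) \<bullet> fst a) * bform 0 1 p b c)"
proof -
  define S where "S p a b c = (w (fst p) \<bullet> fst a) * bform 0 1 p b c" for p a b c :: amb
  have i\<alpha>: "integrable \<sigma> \<alpha>" and iw: "integrable \<sigma> w"
    and tw: "\<And>x. norm x = 1 \<Longrightarrow> w x \<bullet> x = 0" using W unfolding weak_gradient_def by blast+
  have cb: "continuous_on S2xS1 (\<lambda>p. bform \<gamma> \<delta> p a b)" for \<gamma> \<delta> a b
    by (rule C1_M_continuous[OF bform_C1])
  have split: "bform 1 t p a b = bform 1 0 p a b + t * bform 0 1 p a b" for t p a b
    by (simp add: bform_def)
  have tS: "tangent3 p (S p)" if p: "p \<in> S2xS1" for p
    unfolding tangent3_def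
  proof (intro conjI allI)
    show "bilinear (S p a)" for a
      unfolding bilinear_def S_def
      by (intro conjI allI linear_compose_scale_right[OF linear_bform(1), unfolded real_scaleR_def]
          linear_compose_scale_right[OF linear_bform(2), unfolded real_scaleR_def])
    show "linear (\<lambda>a. S p a b c)" for b c
      unfolding S_def by (rule linearI) (simp_all add: inner_add_right algebra_simps)
    have "w (fst p) \<bullet> fst (tproj p a) = w (fst p) \<bullet> fst a" for a
      using tw[OF M_norms(1)[OF p]] by (simp add: tproj_def sproj_def inner_diff_right)
    then show "S p a b c = S p (tproj p a) (tproj p b) (tproj p c)" for a b c
      by (simp add: S_def tproj_bmap bform_bmap_left[OF p] bform_bmap_right[OF p])
  qed
  have iT: "integrable mu0 (\<lambda>p. T p a b)" for a b
  proof -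
    have "integrable mu0 (\<lambda>p. bform 1 0 p a b + \<alpha> (fst p) \<bullet> bform 0 1 p a b)"
      by (intro Bochner_Integration.integrable_add continuous_on_M_integrable cb integrable_mult_continuous i\<alpha>)
    moreover have "integrable mu0 (\<lambda>p. T p a b) \<longleftrightarrow> integrable mu0 (\<lambda>p. bform 1 0 p a b + \<alpha> (fst p) \<bullet> bform 0 1 p a b)"
      by (rule Bochner_Integration.integrable_cong[OF refl]) (simp add: T split[of "\<alpha> _"])
    ultimately show ?thesis by simp
  qed
  have iS: "integrable mu0 (\<lambda>p. S p a b c)" for a b c
  proof -
    have "integrable mu0 (\<lambda>p. w (fst p) \<bullet> (bform 0 1 p b c *\<^sub>R fst a))"
      by (intro integrable_mult_continuous iw continuous_intros cb)
    then show ?thesis by (simp add: S_def mult.commute)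
  qed
  have eq: "(\<integral>p. (\<Sum>a\<in>Basis. \<Sum>b\<in>Basis. \<Sum>c\<in>Basis. S p a b c * \<Phi> p a b c) \<partial>mu0) =
      - (\<integral>p. (\<Sum>b\<in>Basis. \<Sum>c\<in>Basis. T p b c * div3 \<Phi> p b c) \<partial>mu0)" if \<Phi>: "smooth_tensor3 \<Phi>" for \<Phi>
  proof -
    let ?Z = "contract_field \<Phi> 0 1" and ?Z1 = "contract_field \<Phi> 1 0"
    have C1: "C1_field ?Z" "C1_field ?Z1" using contract_field_C1[OF \<Phi>] by auto
    have "(\<integral>p. (\<Sum>a\<in>Basis. \<Sum>b\<in>Basis. \<Sum>c\<in>Basis. S p a b c * \<Phi> p a b c) \<partial>mu0) = (\<integral>p. w (fst p) \<bullet> fst (?Z p) \<partial>mu0)"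
    proof (intro Bochner_Integration.integral_cong refl)
      fix p
      have "w (fst p) \<bullet> fst (?Z p) = (\<Sum>a\<in>Basis. (\<Sum>b\<in>Basis. \<Sum>c\<in>Basis. bform 0 1 p b c * \<Phi> p a b c) * (w (fst p) \<bullet> fst a))"
        by (simp add: contract_field_def[OF \<Phi>] fst_sum inner_sum_right)
      also have "\<dots> = (\<Sum>a\<in>Basis. \<Sum>b\<in>Basis. \<Sum>c\<in>Basis. S p a b c * \<Phi> p a b c)"
        by (simp add: S_def sum_distrib_left mult_ac)
      finally show "(\<Sum>a\<in>Basis. \<Sum>b\<in>Basis. \<Sum>c\<in>Basis. S p a b c * \<Phi> p a b c) = w (fst p) \<bullet> fst (?Z p)" ..
    qed
    also have "\<dots> = - (\<integral>p. \<alpha> (fst p) * divM ?Z p \<partial>mu0)"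
      using W C1(1) unfolding weak_gradient_def by blast
    \<comment> \<open>\<open>?Z1\<close> belongs to the parallel part of T; its divergence
      integrates to 0 and is inserted to complete T.\<close>
    also have "(\<integral>p. \<alpha> (fst p) * divM ?Z p \<partial>mu0) = (\<integral>p. divM ?Z1 p + \<alpha> (fst p) \<bullet> divM ?Z p \<partial>mu0)"
    proof -
      have "(\<integral>p. divM ?Z1 p + \<alpha> (fst p) \<bullet> divM ?Z p \<partial>mu0) = (\<integral>p. divM ?Z1 p \<partial>mu0) + (\<integral>p. \<alpha> (fst p) \<bullet> divM ?Z p \<partial>mu0)"
        by (intro Bochner_Integration.integral_add continuous_on_M_integrable divM_continuous C1 integrable_mult_continuous i\<alpha>)
      then show ?thesis using integral_divM_eq_0[OF C1(2)] by simp
    qed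
    also have "\<dots> = (\<integral>p. (\<Sum>b\<in>Basis. \<Sum>c\<in>Basis. T p b c * div3 \<Phi> p b c) \<partial>mu0)"
    proof (intro Bochner_Integration.integral_cong refl)
      fix p assume "p \<in> space mu0"
      then have p: "p \<in> S2xS1" by simp
      have "(\<Sum>b\<in>Basis. \<Sum>c\<in>Basis. T p b c * div3 \<Phi> p b c) =
          (\<Sum>b\<in>Basis. \<Sum>c\<in>Basis. bform 1 0 p b c * div3 \<Phi> p b c) + \<alpha> (fst p) * (\<Sum>b\<in>Basis. \<Sum>c\<in>Basis. bform 0 1 p b c * div3 \<Phi> p b c)"
        by (simp add: T[OF p] split[of "\<alpha> _"] distrib_right sum.distrib sum_distrib_left mult.assoc)
      then show "divM ?Z1 p + \<alpha> (fst p) \<bullet> divM ?Z p = (\<Sum>b\<in>Basis. \<Sum>c\<in>Basis. T p b c * div3 \<Phi> p b c)"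
        by (simp add: contract_div3[OF \<Phi> p])
    qed
    finally show ?thesis .
  qed
  have "has_weak_cov T S"
    unfolding has_weak_cov_def
  proof (intro conjI allI impI)
    show "AE p in mu0. tangent2 p (T p)" by (rule AE_I2) (simp add: T tangent2_bform)
    show "AE p in mu0. tangent3 p (S p)" by (rule AE_I2) (simp add: tS)
  qed (use iT iS eq in auto)
  then show ?thesis by (simp add: S_def[abs_def])
qed

section \<open>Weak derivatives of the limit\<close>

lemma tensor_norms:
  assumes p: "p \<in> S2xS1"
  shows "norm2 (bform \<alpha> \<beta> p) = sqrt (2 * \<alpha>\<^sup>2 + \<beta>\<^sup>2)"
    "norm3 (\<lambda>a b c :: amb. (v \<bullet> fst a) * bform 0 1 p b c) = norm v"
proof -
  show "norm2 (bform \<alpha> \<beta> p) = sqrt (2 * \<alpha>\<^sup>2 + \<beta>\<^sup>2)"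
    unfolding norm2_def sum_bform_squares[OF p] ..
  have "(\<Sum>a\<in>(Basis :: amb set). \<Sum>b\<in>Basis. \<Sum>c\<in>Basis. ((v \<bullet> fst a) * bform 0 1 p b c)\<^sup>2) =
      (\<Sum>a\<in>(Basis :: amb set). (v \<bullet> fst a)\<^sup>2 * (\<Sum>b\<in>Basis. \<Sum>c\<in>Basis. (bform 0 1 p b c)\<^sup>2))"
    by (simp add: power_mult_distrib sum_distrib_left)
  also have "\<dots> = (\<Sum>a\<in>(Basis :: amb set). (v \<bullet> fst a)\<^sup>2)" unfolding sum_bform_squares[OF p] by simp
  also have "\<dots> = v \<bullet> v" by (simp add: sum_Basis_amb euclidean_inner[of v v] power2_eq_square)
  finally show "norm3 (\<lambda>a b c :: amb. (v \<bullet> fst a) * bform 0 1 p b c) = norm v"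
    by (simp add: norm3_def norm_eq_sqrt_inner)
qed

lemma warped_metric_bform': "p \<in> S2xS1 \<Longrightarrow> warped_metric \<alpha> p = bform 1 ((\<alpha> (fst p))\<^sup>2) p"
  using warped_metric_bform by (intro ext)

lemma bform_measurable: "(\<lambda>p. bform \<gamma> \<delta> p a b) \<in> borel_measurable mu0"
  by (intro continuous_on_M_measurable C1_M_continuous bform_C1)

lemma bform_fst_measurable:
  assumes "\<alpha> \<in> borel_measurable \<sigma>"
  shows "(\<lambda>p. bform 1 (\<alpha> (fst p)) p a b) \<in> borel_measurable mu0"
proof -
  have "(\<lambda>p. bform 1 0 p a b + \<alpha> (fst p) * bform 0 1 p a b) \<in> borel_measurable mu0"
    using bform_measurable measurable_compose[OF measurable_fst_mu0 assms] by measurable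
  then show ?thesis by (simp add: bform_def)
qed

text \<open>The norm is sqrt (2 + \<alpha>^4), at most 2 + \<alpha>^2, which explains the exponent 2
  q for \<alpha>.\<close>

lemma Lq_tensor_warped:
  assumes q: "1 \<le> q" and \<alpha>: "\<alpha> \<in> borel_measurable \<sigma>" "integrable \<sigma> (\<lambda>x. \<bar>\<alpha> x\<bar> powr (2 * q))"
  shows "Lq_tensor q (warped_metric \<alpha>)"
  unfolding Lq_tensor_def
proof (intro conjI allI)
  have "tangent2 p (warped_metric \<alpha> p) \<and> (\<forall>a b. warped_metric \<alpha> p a b = warped_metric \<alpha> p b a)" if "p \<in> S2xS1" for p
    using tangent2_bform[OF that] bform_commute by (simp add: warped_metric_bform'[OF that])
  then show "AE p in mu0. tangent2 p (warped_metric \<alpha> p) \<and> (\<forall>a b. warped_metric \<alpha> p a b = warped_metric \<alpha> p b a)"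
    by (intro AE_I2) (unfold space_mu0, blast)
  show "(\<lambda>p. warped_metric \<alpha> p a b) \<in> borel_measurable mu0" for a b
    using bform_fst_measurable[of "\<lambda>x. (\<alpha> x)\<^sup>2" a b] \<alpha>(1)
    by (subst measurable_cong[where g="\<lambda>p. bform 1 ((\<alpha> (fst p))\<^sup>2) p a b"]) (simp_all add: warped_metric_bform')
  have e: "(\<alpha> x)\<^sup>2 powr q = \<bar>\<alpha> x\<bar> powr (2 * q)" for x
    by (simp add: powr_powr[symmetric] powr_numeral)
  have "integrable \<sigma> (\<lambda>x. \<bar>2 + (\<alpha> x)\<^sup>2\<bar> powr q)"
    using q \<alpha> by (intro powr_add_integrable(1)) (simp_all add: e)
  then have "integrable \<sigma> (\<lambda>x. sqrt (2 + ((\<alpha> x)\<^sup>2)\<^sup>2) powr q)"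
  proof (rule Bochner_Integration.integrable_bound)
    show "(\<lambda>x. sqrt (2 + ((\<alpha> x)\<^sup>2)\<^sup>2) powr q) \<in> borel_measurable \<sigma>" using \<alpha>(1) by measurable
    have "sqrt (2 + ((\<alpha> x)\<^sup>2)\<^sup>2) \<le> 2 + (\<alpha> x)\<^sup>2" for x
      by (rule real_le_lsqrt) (auto simp: power2_eq_square algebra_simps)
    then have "sqrt (2 + ((\<alpha> x)\<^sup>2)\<^sup>2) powr q \<le> \<bar>2 + (\<alpha> x)\<^sup>2\<bar> powr q" for x
      using q by (intro powr_mono2) (auto intro: order_trans abs_ge_self)
    then show "AE x in sphere_measure. norm (sqrt (2 + ((\<alpha> x)\<^sup>2)\<^sup>2) powr q) \<le> norm (\<bar>2 + (\<alpha> x)\<^sup>2\<bar> powr q)"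
      by simp
  qed
  then have "integrable mu0 (\<lambda>p. sqrt (2 + ((\<alpha> (fst p))\<^sup>2)\<^sup>2) powr q)" by (rule integrable_mu0_fst(1))
  then show "integrable mu0 (\<lambda>p. norm2 (warped_metric \<alpha> p) powr q)"
    by (subst Bochner_Integration.integrable_cong[OF refl, where g="\<lambda>p. sqrt (2 + ((\<alpha> (fst p))\<^sup>2)\<^sup>2) powr q"])
      (simp_all add: warped_metric_bform' tensor_norms)
qed

lemma norm2_warped_diff:
  assumes p: "p \<in> S2xS1"
  shows "norm2 (\<lambda>a b. warped_metric \<alpha> p a b - warped_metric \<beta> p a b) = \<bar>(\<alpha> (fst p))\<^sup>2 - (\<beta> (fst p))\<^sup>2\<bar>"
proof -
  have "(\<lambda>a b. warped_metric \<alpha> p a b - warped_metric \<beta> p a b) = bform 0 ((\<alpha> (fst p))\<^sup>2 - (\<beta> (fst p))\<^sup>2) p"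
    by (simp add: fun_eq_iff warped_metric_bform'[OF p]) (simp add: bform_def left_diff_distrib)
  then show ?thesis by (simp add: tensor_norms[OF p])
qed

section \<open>Chain rule for the limit function and convergence of the metrics\<close>

context supersolution_limit
begin

lemma C1_h: "C1_sphere (h k)"
  by (rule C2_sphere_imp_C1[OF h])

lemma h_continuous: "continuous_on (sphere 0 1) (h k)"
  by (rule C1_sphere_continuous[OF C1_h])

lemma h_measurable: "h k \<in> borel_measurable \<sigma>"
  by (rule continuous_on_sphere_measurable[OF h_continuous])

lemma dh_continuous: "continuous_on (sphere 0 1) (\<lambda>x. sderiv (h k) x b)"
  by (rule C1_sphere_continuous_sderiv[OF C1_h])

lemma diff_powr_integrable: "1 \<le> q \<Longrightarrow> integrable \<sigma> (\<lambda>x. \<bar>h k x - \<eta> x\<bar> powr q)"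
  using powr_add_integrable(1)[of q "h k" \<sigma> "\<lambda>x. - \<eta> x"] h_measurable \<eta>_measurable
    continuous_on_sphere_powr_integrable[OF h_continuous] \<eta>_powr by simp

lemma dh_diff_powr_integrable:
  assumes "1 \<le> p" "p < 2" "b \<in> Basis"
  shows "integrable \<sigma> (\<lambda>x. \<bar>sderiv (h k) x b - w x \<bullet> b\<bar> powr p)"
  using powr_add_integrable(1)[of p "\<lambda>x. sderiv (h k) x b" \<sigma> "\<lambda>x. - (w x \<bullet> b)"] assms w_measurable
    continuous_on_sphere_measurable[OF dh_continuous] continuous_on_sphere_powr_integrable[OF dh_continuous] w_powr by simp

text \<open>Serves for the derivative of the outer function in the chain rule: all values of
  \<open>h k\<close> and \<eta> lie above c, so a Lipschitz bound there preserves mean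
  convergence.\<close>

lemma Lipschitz_tendsto:
  fixes \<phi> :: "real \<Rightarrow> real"
  assumes L: "0 \<le> L" "\<And>s t. c \<le> s \<Longrightarrow> c \<le> t \<Longrightarrow> \<bar>\<phi> s - \<phi> t\<bar> \<le> L * \<bar>s - t\<bar>"
    and m: "\<phi> \<in> borel_measurable borel" and q: "1 \<le> q"
  shows "integrable \<sigma> (\<lambda>x. \<bar>\<phi> (h k x) - \<phi> (\<eta> x)\<bar> powr q)"
    "integrable \<sigma> (\<lambda>x. \<bar>\<phi> (\<eta> x)\<bar> powr q)"
    "(\<lambda>k. \<integral>x. \<bar>\<phi> (h k x) - \<phi> (\<eta> x)\<bar> powr q \<partial>\<sigma>) \<longlonglongrightarrow> 0"
proof -
  have le: "\<bar>\<phi> s - \<phi> t\<bar> powr q \<le> L powr q * \<bar>s - t\<bar> powr q" if "c \<le> s" "c \<le> t" for s t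
    using powr_mono2[OF _ _ L(2)[OF that], of q] q L(1) by (simp add: powr_mult)
  have m\<eta>: "(\<lambda>x. \<phi> (\<eta> x)) \<in> borel_measurable \<sigma>" and mh: "(\<lambda>x. \<phi> (h k x)) \<in> borel_measurable \<sigma>" for k
    using m \<eta>_measurable h_measurable by measurable
  show i: "integrable \<sigma> (\<lambda>x. \<bar>\<phi> (h k x) - \<phi> (\<eta> x)\<bar> powr q)" for k
    by (rule Bochner_Integration.integrable_bound[OF integrable_mult_right[OF diff_powr_integrable[OF q, of k], of "L powr q"]])
      (use m\<eta> mh le h_ge \<eta>_ge in auto)
  have "integrable \<sigma> (\<lambda>x. \<bar>\<eta> x + - c\<bar> powr q)"
    using q \<eta>_measurable \<eta>_powr[OF q] by (intro powr_add_integrable(1)) auto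
  then have "integrable \<sigma> (\<lambda>x. L powr q * \<bar>\<eta> x - c\<bar> powr q)" by simp
  then have "integrable \<sigma> (\<lambda>x. \<bar>\<phi> (\<eta> x) - \<phi> c\<bar> powr q)"
    by (rule Bochner_Integration.integrable_bound) (use m\<eta> le[OF \<eta>_ge order_refl] in auto)
  then have "integrable \<sigma> (\<lambda>x. \<bar>(\<phi> (\<eta> x) - \<phi> c) + \<phi> c\<bar> powr q)"
    using q m\<eta> by (intro powr_add_integrable(1)) auto
  then show "integrable \<sigma> (\<lambda>x. \<bar>\<phi> (\<eta> x)\<bar> powr q)" by simp
  show "(\<lambda>k. \<integral>x. \<bar>\<phi> (h k x) - \<phi> (\<eta> x)\<bar> powr q \<partial>\<sigma>) \<longlonglongrightarrow> 0"
  proof (rule tendsto_sandwich[OF _ _ tendsto_const])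
    show "(\<lambda>k. L powr q * (\<integral>x. \<bar>h k x - \<eta> x\<bar> powr q \<partial>\<sigma>)) \<longlonglongrightarrow> 0"
      using tendsto_mult_right_zero[OF h_lim[OF q]] .
    show "\<forall>\<^sub>F k in sequentially. (\<integral>x. \<bar>\<phi> (h k x) - \<phi> (\<eta> x)\<bar> powr q \<partial>\<sigma>) \<le>
        L powr q * (\<integral>x. \<bar>h k x - \<eta> x\<bar> powr q \<partial>\<sigma>)"
    proof (intro always_eventually allI)
      fix k
      have "(\<integral>x. \<bar>\<phi> (h k x) - \<phi> (\<eta> x)\<bar> powr q \<partial>\<sigma>) \<le> (\<integral>x. L powr q * \<bar>h k x - \<eta> x\<bar> powr q \<partial>\<sigma>)"
        by (intro integral_mono i integrable_mult_right diff_powr_integrable q) (use le h_ge \<eta>_ge in auto)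
      then show "(\<integral>x. \<bar>\<phi> (h k x) - \<phi> (\<eta> x)\<bar> powr q \<partial>\<sigma>) \<le>
        L powr q * (\<integral>x. \<bar>h k x - \<eta> x\<bar> powr q \<partial>\<sigma>)" by simp
    qed
  qed simp
qed

text \<open>The Lipschitz condition is on \<phi>' rather than \<phi>, which admits t^2. For
  \<open>h k\<close> the chain rule is classical; the limit is taken by pairing
  \<open>\<phi>' (h k)\<close> in the exponent 3 with the derivatives of \<open>h k\<close> in the
  exponent 3/2 < 2.\<close>

lemma weak_gradient_compose:
  fixes \<phi> \<phi>' :: "real \<Rightarrow> real"
  assumes d: "\<And>t. c \<le> t \<Longrightarrow> (\<phi> has_real_derivative \<phi>' t) (at t)"
    and L: "0 \<le> L" "\<And>s t. c \<le> s \<Longrightarrow> c \<le> t \<Longrightarrow> \<bar>\<phi>' s - \<phi>' t\<bar> \<le> L * \<bar>s - t\<bar>"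
    and m: "\<phi> \<in> borel_measurable borel" "\<phi>' \<in> borel_measurable borel"
  shows "weak_gradient (\<lambda>x. \<phi> (\<eta> x)) (\<lambda>x. \<phi>' (\<eta> x) *\<^sub>R w x)"
    "(\<lambda>k. \<integral>x. norm (sgrad (\<lambda>x. \<phi> (h k x)) x - \<phi>' (\<eta> x) *\<^sub>R w x) \<partial>\<sigma>) \<longlonglongrightarrow> 0"
proof -
  \<comment> \<open>A first-order Taylor bound at t; its quadratic remainder is absorbed by
    convergence in the exponent 2.\<close>
  have taylor: "\<bar>\<phi> s - \<phi> t\<bar> \<le> \<bar>(s - t) * \<phi>' t\<bar> + L * \<bar>s - t\<bar> powr 2" if st: "c \<le> s" "c \<le> t" for s t
  proof -
    have "norm (\<phi> s - \<phi> t) \<le> (\<bar>\<phi>' t\<bar> + L * \<bar>s - t\<bar>) * norm (s - t)"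
    proof (rule field_differentiable_bound[where S="{min s t..max s t}" and f'=\<phi>'])
      fix z assume z: "z \<in> {min s t..max s t}"
      then have cz: "c \<le> z" using st by auto
      show "(\<phi> has_field_derivative \<phi>' z) (at z within {min s t..max s t})"
        using d[OF cz] by (rule has_field_derivative_at_within)
      have "\<bar>\<phi>' z - \<phi>' t\<bar> \<le> L * \<bar>z - t\<bar>" using L(2)[OF cz st(2)] .
      also have "\<dots> \<le> L * \<bar>s - t\<bar>" using z L(1) by (intro mult_left_mono) auto
      finally show "norm (\<phi>' z) \<le> \<bar>\<phi>' t\<bar> + L * \<bar>s - t\<bar>" by auto
    qed auto
    also have "\<dots> = \<bar>(s - t) * \<phi>' t\<bar> + L * \<bar>s - t\<bar> powr 2"
      by (simp add: abs_mult power2_eq_square abs_mult_self_eq[of "s - t", symmetric] del: abs_mult_self_eq) (simp add: algebra_simps del: abs_mult_self_eq)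
    finally show ?thesis by simp
  qed
  have meas: "(\<lambda>x. \<phi> (\<eta> x)) \<in> borel_measurable \<sigma>" "(\<lambda>x. \<phi>' (\<eta> x)) \<in> borel_measurable \<sigma>"
    "(\<lambda>x. \<phi> (h k x)) \<in> borel_measurable \<sigma>" "(\<lambda>x. \<phi>' (h k x)) \<in> borel_measurable \<sigma>"
    "(\<lambda>x. h k x - \<eta> x) \<in> borel_measurable \<sigma>" for k
    using m \<eta>_measurable h_measurable by measurable
  have \<phi>'L: "integrable \<sigma> (\<lambda>x. \<bar>\<phi>' (h k x) - \<phi>' (\<eta> x)\<bar> powr q)"
    "integrable \<sigma> (\<lambda>x. \<bar>\<phi>' (\<eta> x)\<bar> powr q)"
    "(\<lambda>k. \<integral>x. \<bar>\<phi>' (h k x) - \<phi>' (\<eta> x)\<bar> powr q \<partial>\<sigma>) \<longlonglongrightarrow> 0" if q: "1 \<le> q" for k q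
    using Lipschitz_tendsto[OF L m(2) q] by auto
  have cont\<phi>': "continuous_on {c..} \<phi>'"
    by (rule lipschitz_on_continuous_on[of L], rule lipschitz_onI) (use L in \<open>auto simp: dist_real_def\<close>)
  have hc: "h k ` sphere 0 1 \<subseteq> {c..}" for k using h_ge by auto
  note comp = C1_sphere_compose[where \<phi>=\<phi> and \<phi>'=\<phi>' and F="h _", OF C1_h d[OF h_ge] continuous_on_subset[OF cont\<phi>' hc]]
  have C1: "C1_sphere (\<lambda>x. \<phi> (h k x))" for k by (rule comp(1))
  have sd: "sgrad (\<lambda>x. \<phi> (h k x)) x \<bullet> b = \<phi>' (h k x) * sderiv (h k) x b" if "norm x = 1" for k x b
    unfolding sgrad_inner[OF C1 that] by (rule comp(2)[OF _ that])
  obtain A where A: "\<And>k. (\<integral>x. \<bar>h k x - \<eta> x\<bar> powr 3 \<partial>\<sigma>) \<le> A" using tendsto_imp_bounded_above[OF h_lim[of 3]] by auto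
  define A' where "A' = max A (\<integral>x. \<bar>\<phi>' (\<eta> x)\<bar> powr (3/2) \<partial>\<sigma>)"
  have prod: "integrable \<sigma> (\<lambda>x. (h k x - \<eta> x) * \<phi>' (\<eta> x))"
    "(\<lambda>k. \<integral>x. \<bar>(h k x - \<eta> x) * \<phi>' (\<eta> x)\<bar> \<partial>\<sigma>) \<longlonglongrightarrow> 0" for k
    using mean_mult_tendsto_0[where f="\<lambda>k x. h k x - \<eta> x" and g="\<lambda>k x. \<phi>' (\<eta> x)" and M=\<sigma> and A=A']
      meas diff_powr_integrable[of 3] \<phi>'L(2)[of "3/2"] h_lim[of 3] A
    by (auto simp: A'_def le_max_iff_disj)
  have i\<phi>h: "integrable \<sigma> (\<lambda>x. \<phi> (h k x))" for k
    by (rule continuous_on_sphere_integrable[OF C1_sphere_continuous[OF C1]])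
  have bnd: "integrable \<sigma> (\<lambda>x. \<bar>(h k x - \<eta> x) * \<phi>' (\<eta> x)\<bar> + L * \<bar>h k x - \<eta> x\<bar> powr 2)" for k
    using prod(1)[of k] diff_powr_integrable[of 2 k] by auto
  have id: "integrable \<sigma> (\<lambda>x. \<phi> (h k x) - \<phi> (\<eta> x))" for k
    by (rule Bochner_Integration.integrable_bound[OF bnd[of k]]) (use meas taylor h_ge \<eta>_ge L(1) in auto)
  have i\<phi>\<eta>: "integrable \<sigma> (\<lambda>x. \<phi> (\<eta> x))"
    using Bochner_Integration.integrable_diff[OF i\<phi>h[of 0] id[of 0]] by simp
  have lim\<phi>: "(\<lambda>k. \<integral>x. \<bar>\<phi> (h k x) - \<phi> (\<eta> x)\<bar> \<partial>\<sigma>) \<longlonglongrightarrow> 0"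
  proof (rule tendsto_sandwich[OF _ _ tendsto_const])
    show "(\<lambda>k. (\<integral>x. \<bar>(h k x - \<eta> x) * \<phi>' (\<eta> x)\<bar> \<partial>\<sigma>) + L * (\<integral>x. \<bar>h k x - \<eta> x\<bar> powr 2 \<partial>\<sigma>)) \<longlonglongrightarrow> 0"
      using tendsto_add[OF prod(2) tendsto_mult_right_zero[OF h_lim[of 2], of L]] by simp
    show "\<forall>\<^sub>F k in sequentially. (\<integral>x. \<bar>\<phi> (h k x) - \<phi> (\<eta> x)\<bar> \<partial>\<sigma>) \<le>
        (\<integral>x. \<bar>(h k x - \<eta> x) * \<phi>' (\<eta> x)\<bar> \<partial>\<sigma>) + L * (\<integral>x. \<bar>h k x - \<eta> x\<bar> powr 2 \<partial>\<sigma>)"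
    proof (intro always_eventually allI)
      fix k
      have "(\<integral>x. \<bar>\<phi> (h k x) - \<phi> (\<eta> x)\<bar> \<partial>\<sigma>) \<le> (\<integral>x. \<bar>(h k x - \<eta> x) * \<phi>' (\<eta> x)\<bar> + L * \<bar>h k x - \<eta> x\<bar> powr 2 \<partial>\<sigma>)"
        by (intro integral_mono bnd integrable_abs id) (use taylor h_ge \<eta>_ge in auto)
      then show "(\<integral>x. \<bar>\<phi> (h k x) - \<phi> (\<eta> x)\<bar> \<partial>\<sigma>) \<le>
        (\<integral>x. \<bar>(h k x - \<eta> x) * \<phi>' (\<eta> x)\<bar> \<partial>\<sigma>) + L * (\<integral>x. \<bar>h k x - \<eta> x\<bar> powr 2 \<partial>\<sigma>)"
        using prod(1)[of k] diff_powr_integrable[of 2 k] by simp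
    qed
  qed simp
  have comps: "integrable \<sigma> (\<lambda>x. \<phi>' (\<eta> x) * (w x \<bullet> b))"
    "(\<lambda>k. \<integral>x. \<bar>\<phi>' (h k x) * sderiv (h k) x b - \<phi>' (\<eta> x) * (w x \<bullet> b)\<bar> \<partial>\<sigma>) \<longlonglongrightarrow> 0" if b: "b \<in> Basis" for b
  proof -
    note * = mean_mult_tendsto[where f="\<lambda>k x. \<phi>' (h k x)" and g="\<lambda>k x. sderiv (h k) x b" and F="\<lambda>x. \<phi>' (\<eta> x)" and G="\<lambda>x. w x \<bullet> b" and M=\<sigma>]
    have mw: "(\<lambda>x. w x \<bullet> b) \<in> borel_measurable \<sigma>" using w_measurable by measurable
    show "integrable \<sigma> (\<lambda>x. \<phi>' (\<eta> x) * (w x \<bullet> b))"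
      "(\<lambda>k. \<integral>x. \<bar>\<phi>' (h k x) * sderiv (h k) x b - \<phi>' (\<eta> x) * (w x \<bullet> b)\<bar> \<partial>\<sigma>) \<longlonglongrightarrow> 0"
      by (rule *; (rule meas continuous_on_sphere_measurable[OF dh_continuous] mw \<phi>'L dh_diff_powr_integrable w_powr dh_lim b; simp add: b)?)+
  qed
  have iv: "integrable \<sigma> (\<lambda>x. \<phi>' (\<eta> x) *\<^sub>R w x)"
  proof -
    have "integrable \<sigma> (\<lambda>x. \<Sum>b\<in>Basis. (\<phi>' (\<eta> x) * (w x \<bullet> b)) *\<^sub>R b)"
      by (intro Bochner_Integration.integrable_sum integrable_scaleR_left comps)
    moreover have "(\<Sum>b\<in>Basis. (\<phi>' (\<eta> x) * (w x \<bullet> b)) *\<^sub>R b) = \<phi>' (\<eta> x) *\<^sub>R w x" for x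
      by (simp add: scaleR_scaleR[symmetric] scaleR_sum_right[symmetric] euclidean_representation del: scaleR_scaleR)
    ultimately show ?thesis by simp
  qed
  have ig: "integrable \<sigma> (sgrad (\<lambda>x. \<phi> (h k x)))" for k
    by (rule continuous_on_sphere_integrable[OF sgrad_continuous[OF C1]])
  have iabs: "integrable \<sigma> (\<lambda>x. \<bar>\<phi>' (h k x) * sderiv (h k) x b - \<phi>' (\<eta> x) * (w x \<bullet> b)\<bar>)" if b: "b \<in> Basis" for k b
  proof -
    have "continuous_on (sphere 0 1) (\<lambda>x. \<phi>' (h k x))"
      using continuous_on_compose2[OF cont\<phi>' h_continuous hc] .
    then show ?thesis
      by (intro integrable_abs Bochner_Integration.integrable_diff comps b continuous_on_sphere_integrable continuous_on_mult dh_continuous)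
  qed
  show limg: "(\<lambda>k. \<integral>x. norm (sgrad (\<lambda>x. \<phi> (h k x)) x - \<phi>' (\<eta> x) *\<^sub>R w x) \<partial>\<sigma>) \<longlonglongrightarrow> 0"
  proof (rule tendsto_sandwich[OF _ _ tendsto_const])
    show "(\<lambda>k. \<Sum>b\<in>Basis. \<integral>x. \<bar>\<phi>' (h k x) * sderiv (h k) x b - \<phi>' (\<eta> x) * (w x \<bullet> b)\<bar> \<partial>\<sigma>) \<longlonglongrightarrow> 0"
      using tendsto_sum[OF comps(2)] by simp
    show "\<forall>\<^sub>F k in sequentially. (\<integral>x. norm (sgrad (\<lambda>x. \<phi> (h k x)) x - \<phi>' (\<eta> x) *\<^sub>R w x) \<partial>\<sigma>) \<le>
        (\<Sum>b\<in>Basis. \<integral>x. \<bar>\<phi>' (h k x) * sderiv (h k) x b - \<phi>' (\<eta> x) * (w x \<bullet> b)\<bar> \<partial>\<sigma>)"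
    proof (intro always_eventually allI)
      fix k
      have "(\<integral>x. norm (sgrad (\<lambda>x. \<phi> (h k x)) x - \<phi>' (\<eta> x) *\<^sub>R w x) \<partial>\<sigma>) \<le>
        (\<integral>x. (\<Sum>b\<in>Basis. \<bar>\<phi>' (h k x) * sderiv (h k) x b - \<phi>' (\<eta> x) * (w x \<bullet> b)\<bar>) \<partial>\<sigma>)"
      proof (intro integral_mono Bochner_Integration.integrable_sum iabs integrable_norm Bochner_Integration.integrable_diff ig iv)
        fix x :: "real^3" assume "x \<in> space \<sigma>"
        then have x: "norm x = 1" by simp
        show "norm (sgrad (\<lambda>x. \<phi> (h k x)) x - \<phi>' (\<eta> x) *\<^sub>R w x) \<le>
            (\<Sum>b\<in>Basis. \<bar>\<phi>' (h k x) * sderiv (h k) x b - \<phi>' (\<eta> x) * (w x \<bullet> b)\<bar>)"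
          using norm_le_l1[of "sgrad (\<lambda>x. \<phi> (h k x)) x - \<phi>' (\<eta> x) *\<^sub>R w x"] by (simp add: inner_diff_left sd[OF x])
      qed
      then show "(\<integral>x. norm (sgrad (\<lambda>x. \<phi> (h k x)) x - \<phi>' (\<eta> x) *\<^sub>R w x) \<partial>\<sigma>) \<le>
        (\<Sum>b\<in>Basis. \<integral>x. \<bar>\<phi>' (h k x) * sderiv (h k) x b - \<phi>' (\<eta> x) * (w x \<bullet> b)\<bar> \<partial>\<sigma>)"
        by (simp add: Bochner_Integration.integral_sum iabs)
    qed
  qed simp
  show "weak_gradient (\<lambda>x. \<phi> (\<eta> x)) (\<lambda>x. \<phi>' (\<eta> x) *\<^sub>R w x)"
    by (rule weak_gradient_limit[OF weak_gradient_C1[OF C1] i\<phi>\<eta> lim\<phi> iv limg]) (simp add: w_tangent)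
qed

lemma weak_gradient_\<eta>: "weak_gradient \<eta> w"
  and sgrad_lim: "(\<lambda>k. \<integral>x. norm (sgrad (h k) x - w x) \<partial>\<sigma>) \<longlonglongrightarrow> 0"
  using weak_gradient_compose[of "\<lambda>t. t" "\<lambda>_. 1" 0] by (simp_all add: DERIV_ident)

lemma weak_gradient_square: "weak_gradient (\<lambda>x. (\<eta> x)\<^sup>2) (\<lambda>x. (2 * \<eta> x) *\<^sub>R w x)"
proof (rule weak_gradient_compose(1)[where L=2])
  show "\<bar>2 * s - 2 * t\<bar> \<le> 2 * \<bar>s - t\<bar>" for s t :: real
    by (cases "s \<le> t") auto
qed (auto intro!: derivative_eq_intros)

lemma weak_gradient_inverse_square: "weak_gradient (\<lambda>x. 1 / (\<eta> x)\<^sup>2) (\<lambda>x. (- 2 / (\<eta> x) ^ 3) *\<^sub>R w x)"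
\<comment> \<open>The second derivative 6 / t^4 of 1 / t^2 is largest at t = c.\<close>
proof (rule weak_gradient_compose(1)[where L="6 / c ^ 4"])
  show "((\<lambda>t. 1 / t\<^sup>2) has_real_derivative - 2 / t ^ 3) (at t)" if "c \<le> t" for t
    using c that by (auto intro!: derivative_eq_intros simp: power2_eq_square power3_eq_cube)
  show "\<bar>- 2 / s ^ 3 - - 2 / t ^ 3\<bar> \<le> 6 / c ^ 4 * \<bar>s - t\<bar>" if "c \<le> s" "c \<le> t" for s t :: real
  proof -
    have "norm ((- 2 / s ^ 3) - (- 2 / t ^ 3)) \<le> 6 / c ^ 4 * norm (s - t)"
    proof (rule field_differentiable_bound[where S="{c..}" and f="\<lambda>t. - 2 / t ^ 3" and f'="\<lambda>t. 6 / t ^ 4"])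
      fix z assume z: "z \<in> {c..}"
      then have "z > 0" using c by auto
      then show "((\<lambda>t. - 2 / t ^ 3) has_field_derivative 6 / z ^ 4) (at z within {c..})"
        by (auto intro!: derivative_eq_intros simp: field_simps eval_nat_numeral)
      show "norm (6 / z ^ 4) \<le> 6 / c ^ 4" using z c by (auto intro!: divide_left_mono power_mono mult_pos_pos)
    qed (use that in auto)
    then show ?thesis by simp
  qed
qed (use c in auto)

lemma w_norm_powr: "1 \<le> p \<Longrightarrow> p < 2 \<Longrightarrow> integrable \<sigma> (\<lambda>x. norm (w x) powr p)"
proof -
  assume p: "1 \<le> p" "p < 2"
  have m: "(\<lambda>x. \<bar>w x \<bullet> b\<bar>) \<in> borel_measurable \<sigma>" for b using w_measurable by measurable
  have "integrable \<sigma> (\<lambda>x. \<bar>\<Sum>b\<in>B. \<bar>w x \<bullet> b\<bar>\<bar> powr p)" if "B \<subseteq> Basis" for B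
    using finite_subset[OF that finite_Basis] that
  proof (induction B rule: finite_induct)
    case (insert b B)
    then show ?case
      using p m w_powr[OF p] powr_add_integrable(1)[of p "\<lambda>x. \<bar>w x \<bullet> b\<bar>" \<sigma> "\<lambda>x. \<Sum>b\<in>B. \<bar>w x \<bullet> b\<bar>"]
      by simp
  qed simp
  from this[OF order_refl] show ?thesis
  proof (rule Bochner_Integration.integrable_bound)
    show "(\<lambda>x. norm (w x) powr p) \<in> borel_measurable \<sigma>" using w_measurable by measurable
    have "norm (w x) powr p \<le> \<bar>\<Sum>b\<in>Basis. \<bar>w x \<bullet> b\<bar>\<bar> powr p" for x
      using p norm_le_l1[of "w x"] by (intro powr_mono2) auto
    then show "AE x in sphere_measure. norm (norm (w x) powr p) \<le> norm (\<bar>\<Sum>b\<in>Basis. \<bar>w x \<bullet> b\<bar>\<bar> powr p)" by simp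
  qed
qed

text \<open>\<open>w\<close> lies in L^r for some r between p and 2 and \<eta> in every L^s, so a
  bound of Hoelder type by a sum of two powers applies.\<close>

lemma \<eta>w_powr:
  assumes p: "1 \<le> p" "p < 2"
  shows "integrable \<sigma> (\<lambda>x. norm ((2 * \<eta> x) *\<^sub>R w x) powr p)"
proof -
  \<comment> \<open>r is the midpoint of p and 2, and s solves 1/p = 1/r + 1/s.\<close>
  define r s where "r = (p + 2) / 2" and "s = p * r / (r - p)"
  have r: "p < r" "r < 2" "1 \<le> r" using p by (auto simp: r_def)
  have s: "1 \<le> s" "p + p * (p / (r - p)) = s"
  proof -
    show "p + p * (p / (r - p)) = s" using r by (simp add: s_def field_simps)
    then show "1 \<le> s" using p r by (smt (verit) divide_nonneg_nonneg mult_nonneg_nonneg)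
  qed
  have le: "norm ((2 * \<eta> x) *\<^sub>R w x) powr p \<le> 2 powr p * (norm (w x) powr r + \<bar>\<eta> x\<bar> powr s)" for x
  proof -
    have "\<bar>\<eta> x\<bar> powr p * norm (w x) powr p \<le> norm (w x) powr r + \<bar>\<eta> x\<bar> powr s"
    proof (cases "\<bar>\<eta> x\<bar> powr p \<le> norm (w x) powr (r - p)")
      case True
      then have "\<bar>\<eta> x\<bar> powr p * norm (w x) powr p \<le> norm (w x) powr (r - p) * norm (w x) powr p"
        by (intro mult_right_mono) auto
      also have "\<dots> = norm (w x) powr r" by (simp add: powr_add[symmetric])
      finally show ?thesis by (simp add: add_increasing2)
    next
      case False
      then have "(norm (w x) powr (r - p)) powr (p / (r - p)) \<le> (\<bar>\<eta> x\<bar> powr p) powr (p / (r - p))"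
        using p r by (intro powr_mono2) auto
      then have "norm (w x) powr p \<le> \<bar>\<eta> x\<bar> powr (p * (p / (r - p)))" using r by (simp add: powr_powr)
      then have "\<bar>\<eta> x\<bar> powr p * norm (w x) powr p \<le> \<bar>\<eta> x\<bar> powr p * \<bar>\<eta> x\<bar> powr (p * (p / (r - p)))"
        by (intro mult_left_mono) auto
      also have "\<dots> = \<bar>\<eta> x\<bar> powr s" by (simp only: powr_add[symmetric] s(2))
      finally show ?thesis by (simp add: add_increasing)
    qed
    moreover have "norm ((2 * \<eta> x) *\<^sub>R w x) powr p = 2 powr p * (\<bar>\<eta> x\<bar> powr p * norm (w x) powr p)"
      by (simp add: powr_mult abs_mult mult.assoc)
    ultimately show ?thesis by simp
  qed
  have "integrable \<sigma> (\<lambda>x. 2 powr p * (norm (w x) powr r + \<bar>\<eta> x\<bar> powr s))"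
    using w_norm_powr[of r] \<eta>_powr[of s] r s by simp
  then show ?thesis
  proof (rule Bochner_Integration.integrable_bound)
    show "(\<lambda>x. norm ((2 * \<eta> x) *\<^sub>R w x) powr p) \<in> borel_measurable \<sigma>"
      using w_measurable \<eta>_measurable by measurable
  qed (use le in auto)
qed

abbreviation S_metric :: tensor3 where
  "S_metric p a b d \<equiv> (((2 * \<eta> (fst p)) *\<^sub>R w (fst p)) \<bullet> fst a) * bform 0 1 p b d"

abbreviation S_cometric :: tensor3 where
  "S_cometric p a b d \<equiv> (((- 2 / (\<eta> (fst p)) ^ 3) *\<^sub>R w (fst p)) \<bullet> fst a) * bform 0 1 p b d"

lemma \<eta>_pos: "norm x = 1 \<Longrightarrow> 0 < \<eta> x"
  using c \<eta>_ge by (rule less_le_trans)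

lemma has_weak_cov_metric: "has_weak_cov (warped_metric \<eta>) S_metric"
  by (rule has_weak_cov_warped[OF weak_gradient_square]) (rule warped_metric_bform')

lemma has_weak_cov_cometric: "has_weak_cov (cometric (warped_metric \<eta>)) S_cometric"
  by (rule has_weak_cov_warped[OF weak_gradient_inverse_square], rule cometric_warped) (use \<eta>_pos M_norms in force)+

lemma W1p: "1 \<le> p \<Longrightarrow> p < 2 \<Longrightarrow> W1p_tensor p (warped_metric \<eta>)"
  unfolding W1p_tensor_def
proof (intro conjI exI)
  assume p: "1 \<le> p" "p < 2"
  show "Lq_tensor p (warped_metric \<eta>)" using p by (intro Lq_tensor_warped \<eta>_measurable \<eta>_powr) auto
  show "has_weak_cov (warped_metric \<eta>) S_metric" by (rule has_weak_cov_metric)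
  show "integrable mu0 (\<lambda>x. norm3 (S_metric x) powr p)"
    using integrable_mu0_fst(1)[OF \<eta>w_powr[OF p]]
    by (subst Bochner_Integration.integrable_cong[OF refl, where g="\<lambda>x. norm ((2 * \<eta> (fst x)) *\<^sub>R w (fst x)) powr p"])
      (simp_all only: tensor_norms space_mu0)
qed

text \<open>The difference of squares is factored: \<open>h k - \<eta>\<close> tends to 0 in the
  exponent 3 q and \<open>h k + \<eta>\<close> is bounded in the exponent 3 q / 2, so
  \<open>mean_mult_tendsto_0\<close> applies to the q-th powers.\<close>

lemma Lq_lim:
  assumes q: "1 \<le> q"
  shows "Lq_tendsto q (\<lambda>k. warped_metric (h k)) (warped_metric \<eta>)"
  unfolding Lq_tendsto_def
proof (intro conjI allI)
  show "Lq_tensor q (warped_metric (h n))" for n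
    using q by (intro Lq_tensor_warped h_measurable continuous_on_sphere_powr_integrable h_continuous) auto
  show "Lq_tensor q (warped_metric \<eta>)" using q by (intro Lq_tensor_warped \<eta>_measurable \<eta>_powr) auto
  define r where "r = 3 * q / 2"
  have r: "1 \<le> r" "1 \<le> 3 * q" using q by (auto simp: r_def)
  have m: "(\<lambda>x. \<bar>h k x - \<eta> x\<bar> powr q) \<in> borel_measurable \<sigma>" "(\<lambda>x. \<bar>h k x + \<eta> x\<bar> powr q) \<in> borel_measurable \<sigma>"
    "(\<lambda>x. h k x - \<eta> x) \<in> borel_measurable \<sigma>" "(\<lambda>x. 2 * \<eta> x) \<in> borel_measurable \<sigma>" for k
    using \<eta>_measurable h_measurable by measurable
  have i2: "integrable \<sigma> (\<lambda>x. \<bar>2 * \<eta> x\<bar> powr r)" using \<eta>_powr[OF r(1)] by (simp add: abs_mult powr_mult)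
  note sum = powr_add_integrable[where p=r and M=\<sigma> and g="\<lambda>x. 2 * \<eta> x" and f="\<lambda>x. h _ x - \<eta> x", OF _ m(3,4) diff_powr_integrable[OF r(1)] i2]
  \<comment> \<open>The sum is written through the difference, whose means are bounded because they
    converge.\<close>
  have e: "(h k x - \<eta> x) + 2 * \<eta> x = h k x + \<eta> x" for k x by simp
  have pw: "\<bar>\<bar>t\<bar> powr q\<bar> powr 3 = \<bar>t\<bar> powr (3 * q)" "\<bar>\<bar>t\<bar> powr q\<bar> powr (3/2) = \<bar>t\<bar> powr r" for t :: real
    by (simp_all add: powr_powr r_def mult.commute)
  obtain A1 where A1: "\<And>k. (\<integral>x. \<bar>h k x - \<eta> x\<bar> powr (3 * q) \<partial>\<sigma>) \<le> A1" using tendsto_imp_bounded_above[OF h_lim[OF r(2)]] by auto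
  obtain A2 where A2: "\<And>k. (\<integral>x. \<bar>h k x - \<eta> x\<bar> powr r \<partial>\<sigma>) \<le> A2" using tendsto_imp_bounded_above[OF h_lim[OF r(1)]] by auto
  define A3 where "A3 = 2 powr r * (A2 + (\<integral>x. \<bar>2 * \<eta> x\<bar> powr r \<partial>\<sigma>))"
  have A3: "(\<integral>x. \<bar>h k x + \<eta> x\<bar> powr r \<partial>\<sigma>) \<le> A3" for k
  proof -
    have "(\<integral>x. \<bar>h k x + \<eta> x\<bar> powr r \<partial>\<sigma>) \<le>
        2 powr r * ((\<integral>x. \<bar>h k x - \<eta> x\<bar> powr r \<partial>\<sigma>) + (\<integral>x. \<bar>2 * \<eta> x\<bar> powr r \<partial>\<sigma>))"
      using sum(2)[of k] r unfolding e by simp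
    also have "\<dots> \<le> A3" unfolding A3_def by (intro mult_left_mono add_right_mono A2) auto
    finally show ?thesis .
  qed
  have i1: "integrable \<sigma> (\<lambda>x. \<bar>h k x + \<eta> x\<bar> powr r)" for k using sum(1)[of k] r unfolding e by simp
  have bd: "(\<integral>x. \<bar>\<bar>h k x - \<eta> x\<bar> powr q\<bar> powr 3 \<partial>\<sigma>) \<le> max A1 A3"
    "(\<integral>x. \<bar>\<bar>h k x + \<eta> x\<bar> powr q\<bar> powr (3/2) \<partial>\<sigma>) \<le> max A1 A3" for k
    unfolding pw using A1[of k] A3[of k] by simp_all
  have "integrable \<sigma> (\<lambda>x. \<bar>h k x - \<eta> x\<bar> powr q * \<bar>h k x + \<eta> x\<bar> powr q)"
    and "(\<lambda>k. \<integral>x. \<bar>\<bar>h k x - \<eta> x\<bar> powr q * \<bar>h k x + \<eta> x\<bar> powr q\<bar> \<partial>\<sigma>) \<longlonglongrightarrow> 0" for k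
    by (rule mean_mult_tendsto_0[where A="max A1 A3" and f="\<lambda>k x. \<bar>h k x - \<eta> x\<bar> powr q" and g="\<lambda>k x. \<bar>h k x + \<eta> x\<bar> powr q",
          OF m(1,2) _ _ bd]; unfold pw; use diff_powr_integrable[OF r(2)] i1 h_lim[OF r(2)] in auto)+
  moreover have "\<bar>h k x - \<eta> x\<bar> powr q * \<bar>h k x + \<eta> x\<bar> powr q = \<bar>(h k x)\<^sup>2 - (\<eta> x)\<^sup>2\<bar> powr q" for k x
    by (simp add: powr_mult[symmetric] abs_mult[symmetric] power2_eq_square algebra_simps)
  ultimately have i: "integrable \<sigma> (\<lambda>x. \<bar>(h k x)\<^sup>2 - (\<eta> x)\<^sup>2\<bar> powr q)"
    and lim: "(\<lambda>k. \<integral>x. \<bar>(h k x)\<^sup>2 - (\<eta> x)\<^sup>2\<bar> powr q \<partial>\<sigma>) \<longlonglongrightarrow> 0" for k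
    by simp_all
  have "(\<integral>p. norm2 (\<lambda>a b. warped_metric (h k) p a b - warped_metric \<eta> p a b) powr q \<partial>mu0) =
      circle_length * (\<integral>x. \<bar>(h k x)\<^sup>2 - (\<eta> x)\<^sup>2\<bar> powr q \<partial>\<sigma>)" for k
  proof -
    have "(\<integral>p. norm2 (\<lambda>a b. warped_metric (h k) p a b - warped_metric \<eta> p a b) powr q \<partial>mu0) =
        (\<integral>p. \<bar>(h k (fst p))\<^sup>2 - (\<eta> (fst p))\<^sup>2\<bar> powr q \<partial>mu0)"
      by (intro Bochner_Integration.integral_cong refl) (simp only: norm2_warped_diff space_mu0)
    also have "\<dots> = circle_length * (\<integral>x. \<bar>(h k x)\<^sup>2 - (\<eta> x)\<^sup>2\<bar> powr q \<partial>\<sigma>)"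
      using integrable_mu0_fst(2)[OF i] by simp
    finally show ?thesis .
  qed
  then show "(\<lambda>k. \<integral>p. norm2 (\<lambda>a b. warped_metric (h k) p a b - warped_metric \<eta> p a b) powr q \<partial>mu0) \<longlonglongrightarrow> 0"
    using tendsto_mult_right_zero[OF lim, of circle_length] by simp
qed

end

section \<open>Smooth test objects and uniqueness of weak derivatives\<close>

text \<open>This class is closed under differentiation where both components are non-zero and contains the
  polynomial functions composed with \<open>retr\<close>.\<close>

inductive elementary :: "(amb \<Rightarrow> real) \<Rightarrow> bool" where
  const: "elementary (\<lambda>_. k)"
| inner: "elementary (\<lambda>q. q \<bullet> v)"
| norm_fst: "elementary (\<lambda>q. inverse (norm (fst q)))"
| norm_snd: "elementary (\<lambda>q. inverse (norm (snd q)))"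
| add: "elementary f \<Longrightarrow> elementary g \<Longrightarrow> elementary (\<lambda>q. f q + g q)"
| mult: "elementary f \<Longrightarrow> elementary g \<Longrightarrow> elementary (\<lambda>q. f q * g q)"

abbreviation punctured :: "amb set" where
  "punctured \<equiv> {q. fst q \<noteq> 0 \<and> snd q \<noteq> 0}"

lemma elementary_sum: "finite I \<Longrightarrow> (\<And>i. i \<in> I \<Longrightarrow> elementary (f i)) \<Longrightarrow> elementary (\<lambda>q. \<Sum>i\<in>I. f i q)"
  by (induction I rule: finite_induct) (auto intro: elementary.intros)

lemma elementary_derivative:
  "elementary f \<Longrightarrow> \<exists>f'. (\<forall>q\<in>punctured. (f has_derivative f' q) (at q)) \<and> (\<forall>v. elementary (\<lambda>q. f' q v))"
proof (induction rule: elementary.induct)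
  case (const k)
  show ?case by (rule exI[of _ "\<lambda>q v. 0"]) (auto intro: elementary.const)
next
  case (inner v)
  show ?case by (rule exI[of _ "\<lambda>q w. w \<bullet> v"]) (auto intro!: derivative_eq_intros elementary.const)
next
  case norm_fst
  let ?n = "\<lambda>q :: amb. inverse (norm (fst q))"
  show ?case
  proof (intro exI[of _ "\<lambda>q v. (-1) * ((q \<bullet> (fst v, 0)) * (?n q * (?n q * ?n q)))"] conjI ballI allI)
    show "elementary (\<lambda>q. (-1) * ((q \<bullet> (fst v, 0)) * (?n q * (?n q * ?n q))))" for v
      by (intro elementary.intros)
    fix q :: amb assume "q \<in> punctured"
    then have q: "fst q \<noteq> 0" by simp
    note d = Deriv.has_derivative_inverse[OF _ has_derivative_compose[OF has_derivative_fst[OF has_derivative_ident] has_derivative_norm[OF q]]]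
    show "(?n has_derivative (\<lambda>v. (-1) * ((q \<bullet> (fst v, 0)) * (?n q * (?n q * ?n q))))) (at q)"
      by (rule has_derivative_eq_rhs, rule d) (use q in \<open>simp_all add: inner_prod_def sgn_div_norm inner_commute mult_ac\<close>)
  qed
next
  case norm_snd
  let ?n = "\<lambda>q :: amb. inverse (norm (snd q))"
  show ?case
  proof (intro exI[of _ "\<lambda>q v. (-1) * ((q \<bullet> (0, snd v)) * (?n q * (?n q * ?n q)))"] conjI ballI allI)
    show "elementary (\<lambda>q. (-1) * ((q \<bullet> (0, snd v)) * (?n q * (?n q * ?n q))))" for v
      by (intro elementary.intros)
    fix q :: amb assume "q \<in> punctured"
    then have q: "snd q \<noteq> 0" by simp
    note d = Deriv.has_derivative_inverse[OF _ has_derivative_compose[OF has_derivative_snd[OF has_derivative_ident] has_derivative_norm[OF q]]]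
    show "(?n has_derivative (\<lambda>v. (-1) * ((q \<bullet> (0, snd v)) * (?n q * (?n q * ?n q))))) (at q)"
      by (rule has_derivative_eq_rhs, rule d) (use q in \<open>simp_all add: inner_prod_def sgn_div_norm inner_commute mult_ac\<close>)
  qed
next
  case (add f g)
  then obtain f' g' where "\<forall>q\<in>punctured. (f has_derivative f' q) (at q)" "\<forall>v. elementary (\<lambda>q. f' q v)"
    "\<forall>q\<in>punctured. (g has_derivative g' q) (at q)" "\<forall>v. elementary (\<lambda>q. g' q v)" by blast
  then show ?case
    by (intro exI[of _ "\<lambda>q v. f' q v + g' q v"]) (auto intro!: has_derivative_add elementary.add)
next
  case (mult f g)
  then obtain f' g' where "\<forall>q\<in>punctured. (f has_derivative f' q) (at q)" "\<forall>v. elementary (\<lambda>q. f' q v)"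
    "\<forall>q\<in>punctured. (g has_derivative g' q) (at q)" "\<forall>v. elementary (\<lambda>q. g' q v)" by blast
  then show ?case using mult.hyps
    by (intro exI[of _ "\<lambda>q v. f q * g' q v + f' q v * g q"]) (auto intro!: has_derivative_mult elementary.add elementary.mult)
qed

lemma Ck_on_cong: "open S \<Longrightarrow> (\<And>x. x \<in> S \<Longrightarrow> f x = g x) \<Longrightarrow> Ck_on k f S \<Longrightarrow> Ck_on k g S"
proof (induction k arbitrary: f g)
  case 0
  then show ?case by (simp cong: continuous_on_cong)
next
  case (Suc k)
  have eq: "(f has_derivative D) (at x) \<longleftrightarrow> (g has_derivative D) (at x)" if x: "x \<in> S" for x D
    using has_derivative_transform_within_open[of f D x UNIV S g] has_derivative_transform_within_open[of g D x UNIV S f]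
      Suc.prems(1,2) x by auto
  then have fd: "frechet_derivative f (at x) = frechet_derivative g (at x)" if "x \<in> S" for x
    using that by (simp add: frechet_derivative_def)
  have "Ck_on k (\<lambda>x. frechet_derivative g (at x) v) S" for v
  proof (rule Suc.IH[OF Suc.prems(1)])
    show "Ck_on k (\<lambda>x. frechet_derivative f (at x) v) S" using Suc.prems(3) by simp
  qed (simp add: fd)
  moreover have "\<forall>x\<in>S. g differentiable (at x)"
    using Suc.prems(3) eq by (simp add: differentiable_def)
  ultimately show ?case by simp
qed

text \<open>The induction covers all F at once, since the derivative of an elementary map in a fixed
  direction is again elementary.\<close>

lemma elementary_Ck:
  fixes F :: "amb \<Rightarrow> 'b::euclidean_space"
  shows "(\<And>b. b \<in> Basis \<Longrightarrow> elementary (\<lambda>q. F q \<bullet> b)) \<Longrightarrow> Ck_on k F punctured"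
proof (induction k arbitrary: F)
  case 0
  then have "continuous_on punctured (\<lambda>q. F q \<bullet> b)" if "b \<in> Basis" for b
    using elementary_derivative[OF 0[OF that]] has_derivative_continuous
    by (intro continuous_at_imp_continuous_on) blast
  then show ?case using continuous_on_componentwise[of punctured F] by auto
next
  case (Suc k)
  have "\<forall>b\<in>Basis. \<exists>f'. (\<forall>q\<in>punctured. ((\<lambda>q. F q \<bullet> b) has_derivative f' q) (at q)) \<and> (\<forall>v. elementary (\<lambda>q. f' q v))"
    using elementary_derivative[OF Suc.prems] by blast
  then obtain D where D: "\<And>b q. b \<in> Basis \<Longrightarrow> q \<in> punctured \<Longrightarrow> ((\<lambda>q. F q \<bullet> b) has_derivative D b q) (at q)"
    "\<And>b v. b \<in> Basis \<Longrightarrow> elementary (\<lambda>q. D b q v)"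
    unfolding bchoice_iff by blast
  define F' where "F' q v = (\<Sum>b\<in>Basis. D b q v *\<^sub>R b)" for q v
  have F'b: "F' q v \<bullet> b = D b q v" if "b \<in> Basis" for q v b
    using that by (simp add: F'_def)
  have d: "(F has_derivative F' q) (at q)" if "q \<in> punctured" for q
    using D(1)[OF _ that] by (subst has_derivative_componentwise_within) (simp add: F'b)
  have "Ck_on k (\<lambda>q. F' q v) punctured" for v
    by (rule Suc.IH) (simp add: F'b D(2))
  moreover have "F' q v = frechet_derivative F (at q) v" if "q \<in> punctured" for q v
    using frechet_derivative_at[OF d[OF that]] by simp
  ultimately have "Ck_on k (\<lambda>q. frechet_derivative F (at q) v) punctured" for v
    using Ck_on_cong[OF open_punctured] by (metis (no_types, lifting))
  then show ?case using d unfolding Ck_on.simps differentiable_def by blast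
qed

text \<open>The components of \<open>retr\<close> are elementary, being coordinates divided by
  norms, and polynomials arise from them by sums and products.\<close>

lemma smooth_on_M_polynomial:
  fixes F :: "amb \<Rightarrow> 'b::euclidean_space"
  assumes "\<And>b. b \<in> Basis \<Longrightarrow> real_polynomial_function (\<lambda>p. F p \<bullet> b)"
  shows "smooth_on_M F"
proof -
  have r: "elementary (\<lambda>q. retr q \<bullet> v)" for v
  proof -
    have "elementary (\<lambda>q. (q \<bullet> (fst v, 0)) * inverse (norm (fst q)) + (q \<bullet> (0, snd v)) * inverse (norm (snd q)))"
      by (intro elementary.intros)
    then show ?thesis by (simp add: retr_def inner_prod_def sgn_div_norm divide_inverse mult.commute)
  qed
  have "real_polynomial_function \<phi> \<Longrightarrow> elementary (\<lambda>q. \<phi> (retr q))" for \<phi> :: "amb \<Rightarrow> real"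
  proof (induction rule: real_polynomial_function.induct)
    case (linear f)
    then have "linear f" by (rule bounded_linear.linear)
    from sum_Basis_linear_real[OF this] have "f (retr q) = (\<Sum>b\<in>Basis. (retr q \<bullet> b) * f b)" for q by metis
    then show ?case by (simp only:) (intro elementary_sum elementary.mult r elementary.const finite_Basis)
  qed (auto intro: elementary.intros)
  then have "elementary (\<lambda>q. F (retr q) \<bullet> b)" if "b \<in> Basis" for b using assms[OF that] by blast
  then show ?thesis unfolding smooth_on_M_def smooth_open_def by (intro allI elementary_Ck)
qed

lemma polynomial_inner: "real_polynomial_function (\<lambda>p. p \<bullet> v)" for v :: "'a::euclidean_space"
  by (intro real_polynomial_function.intros(1) bounded_linear_inner_left)

text \<open>\<open>tproj p a\<close> is quadratic in p on the whole ambient space, so projected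
  constant vectors can enter polynomial test objects.\<close>

lemma polynomial_tproj: "real_polynomial_function (\<lambda>p. tproj p a \<bullet> e)"
proof -
  have "real_polynomial_function (\<lambda>p. (a \<bullet> e - (p \<bullet> (fst a, 0)) * (p \<bullet> (fst e, 0))) - (p \<bullet> (0, snd a)) * (p \<bullet> (0, snd e)))"
    by (intro real_polynomial_function_diff real_polynomial_function.intros(4) real_polynomial_function.intros(2) polynomial_inner)
  moreover have "tproj p a \<bullet> e = (a \<bullet> e - (p \<bullet> (fst a, 0)) * (p \<bullet> (fst e, 0))) - (p \<bullet> (0, snd a)) * (p \<bullet> (0, snd e))" for p
    by (simp add: tproj_def sproj_def inner_prod_def inner_diff_left inner_diff_right inner_commute)
  ultimately show ?thesis by simp
qed

lemma smooth_vector_field_polynomial: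
  assumes "real_polynomial_function \<phi>"
  shows "smooth_vector_field (\<lambda>p. \<phi> p *\<^sub>R tproj p e)"
  unfolding smooth_vector_field_def
proof (intro conjI ballI)
  show "tproj p (\<phi> p *\<^sub>R tproj p e) = \<phi> p *\<^sub>R tproj p e" if "p \<in> S2xS1" for p
    by (simp only: linear_scale[OF linear_tproj] tproj_tproj[OF that])
  show "smooth_on_M (\<lambda>p. \<phi> p *\<^sub>R tproj p e)"
    by (rule smooth_on_M_polynomial) (simp, intro real_polynomial_function.intros(4) polynomial_tproj assms)
qed

lemma smooth_tensor3_polynomial:
  assumes "real_polynomial_function \<phi>"
  shows "smooth_tensor3 (\<lambda>p a b c. \<phi> p * (tproj p a \<bullet> e1) * (tproj p b \<bullet> e2) * (tproj p c \<bullet> e3))"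
  unfolding smooth_tensor3_def
proof (intro conjI ballI allI)
  have l: "linear (\<lambda>a. tproj p a \<bullet> e)" for p e
    using linear_compose[OF linear_tproj, of "\<lambda>v. v \<bullet> e" p] by (simp add: o_def bounded_linear.linear bounded_linear_inner_left)
  have sc: "linear f \<Longrightarrow> linear (\<lambda>a. k * f a * m)" "linear f \<Longrightarrow> linear (\<lambda>a. k * f a)"
    "linear f \<Longrightarrow> linear (\<lambda>a. k * f a * m * m')" for f :: "amb \<Rightarrow> real" and k m m'
    by (rule linearI; simp only: linear_add linear_scale real_scaleR_def algebra_simps)+
  fix p :: amb assume p: "p \<in> S2xS1"
  show "tangent3 p (\<lambda>a b c. \<phi> p * (tproj p a \<bullet> e1) * (tproj p b \<bullet> e2) * (tproj p c \<bullet> e3))"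
    unfolding tangent3_def bilinear_def tproj_tproj[OF p]
    by (intro conjI allI refl sc[OF l])
next
  show "smooth_on_M (\<lambda>p. \<phi> p * (tproj p a \<bullet> e1) * (tproj p b \<bullet> e2) * (tproj p c \<bullet> e3))" for a b c
    by (rule smooth_on_M_polynomial) (simp, intro real_polynomial_function.intros(4) polynomial_tproj assms)
qed

section \<open>Integrable functions orthogonal to all polynomials; uniqueness of weak
  derivatives\<close>

lemma sets_mu0_subset:
  assumes "A \<in> sets mu0" shows "\<exists>B\<in>sets borel. A = S2xS1 \<inter> B"
proof -
  have "sets mu0 \<subseteq> sets (restrict_space borel S2xS1)"
    unfolding mu0_def
  proof (rule sets_pair_in_sets)
    fix a :: "(real^3) set" and b :: "(real^2) set"
    assume "a \<in> sets \<sigma>" "b \<in> sets \<sigma>"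
    then obtain a' b' where ab: "a' \<in> sets borel" "b' \<in> sets borel" "a = sphere 0 1 \<inter> a'" "b = sphere 0 1 \<inter> b'"
      by (auto simp: sets_sphere_measure sets_restrict_space)
    then have "a \<times> b = S2xS1 \<inter> (a' \<times> b')" by auto
    moreover have "a' \<times> b' \<in> sets borel" using ab by (simp add: borel_prod[symmetric])
    ultimately show "a \<times> b \<in> sets (restrict_space borel S2xS1)" by (auto simp: sets_restrict_space)
  qed
  then show ?thesis using assms by (auto simp: sets_restrict_space)
qed

text \<open>Orthogonality extends to continuous functions by Stone-Weierstrass, to indicators of
  closed sets by dominated convergence, and to Borel sets because closed sets are stable under
  intersection and generate them; the integrals over Borel sets determine f almost
  everywhere.\<close>

lemma AE_eq_0_if_orthogonal_to_polynomials:
  assumes f: "integrable mu0 f"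
    and orth: "\<And>\<phi>. real_polynomial_function \<phi> \<Longrightarrow> (\<integral>p. f p * \<phi> p \<partial>mu0) = 0"
  shows "AE p in mu0. f p = (0 :: real)"
proof -
  have fm [measurable]: "f \<in> borel_measurable mu0" using f by simp
  have fint: "integrable mu0 (\<lambda>p. f p * \<phi> p)" if "\<phi> \<in> borel_measurable mu0" "\<And>p. p \<in> S2xS1 \<Longrightarrow> \<bar>\<phi> p\<bar> \<le> B" for \<phi> and B :: real
  proof (rule Bochner_Integration.integrable_bound[OF integrable_mult_left[OF integrable_abs[OF f], of B]])
    show "(\<lambda>p. f p * \<phi> p) \<in> borel_measurable mu0" using that(1) by measurable
    have "norm (f p * \<phi> p) \<le> norm (\<bar>f p\<bar> * B)" if "p \<in> S2xS1" for p
      using \<open>\<And>p. p \<in> S2xS1 \<Longrightarrow> \<bar>\<phi> p\<bar> \<le> B\<close>[OF that] by (simp add: abs_mult mult_left_mono)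
    then show "AE p in mu0. norm (f p * \<phi> p) \<le> norm (\<bar>f p\<bar> * B)" by (intro AE_I2) (simp only: space_mu0)
  qed
  have cont: "(\<integral>p. f p * \<phi> p \<partial>mu0) = 0" if c: "continuous_on UNIV \<phi>" for \<phi> :: "amb \<Rightarrow> real"
  proof (rule ccontr)
    assume ne: "(\<integral>p. f p * \<phi> p \<partial>mu0) \<noteq> 0"
    have cS: "continuous_on S2xS1 \<phi>" using c by (rule continuous_on_subset) simp
    define J where "J = (\<integral>p. \<bar>f p\<bar> \<partial>mu0)"
    have J: "0 \<le> J" by (simp add: J_def)
    \<comment> \<open>A polynomial approximation with error e changes the integral by at most J e,
      less than its absolute value.\<close>
    define e where "e = \<bar>\<integral>p. f p * \<phi> p \<partial>mu0\<bar> / (J + 1)"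
    have e: "0 < e" using ne J by (simp add: e_def)
    obtain g where g: "real_polynomial_function g" "\<And>p. p \<in> S2xS1 \<Longrightarrow> \<bar>\<phi> p - g p\<bar> < e"
      using Stone_Weierstrass_real_polynomial_function[OF _ cS e] by (metis compact_Times compact_sphere)
    have gc: "continuous_on S2xS1 g"
      using g(1) by (simp add: real_polynomial_function_eq continuous_on_polymonial_function)
    have ig: "integrable mu0 (\<lambda>p. f p * (\<phi> p - g p))"
      by (rule fint[where B=e]) (use g(2) in \<open>auto intro!: continuous_on_M_measurable continuous_intros cS gc less_imp_le\<close>)
    obtain B where B: "\<And>p. p \<in> S2xS1 \<Longrightarrow> norm (g p) \<le> B" using continuous_on_M_bounded[OF gc] by blast
    have ig': "integrable mu0 (\<lambda>p. f p * g p)"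
      by (rule fint[where B=B]) (use B in \<open>auto intro!: continuous_on_M_measurable gc\<close>)
    have "(\<integral>p. f p * \<phi> p \<partial>mu0) = (\<integral>p. f p * (\<phi> p - g p) + f p * g p \<partial>mu0)"
      by (simp add: algebra_simps)
    also have "\<dots> = (\<integral>p. f p * (\<phi> p - g p) \<partial>mu0)" using ig ig' orth[OF g(1)] by simp
    also have "\<bar>\<dots>\<bar> \<le> (\<integral>p. \<bar>f p * (\<phi> p - g p)\<bar> \<partial>mu0)" by (rule integral_abs_bound)
    also have "\<dots> \<le> (\<integral>p. \<bar>f p\<bar> * e \<partial>mu0)"
    proof (intro integral_mono integrable_abs ig integrable_mult_left f)
      fix p assume "p \<in> space mu0"
      then have "\<bar>\<phi> p - g p\<bar> \<le> e" using g(2)[of p] by simp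
      then show "\<bar>f p * (\<phi> p - g p)\<bar> \<le> \<bar>f p\<bar> * e" by (simp add: abs_mult mult_left_mono)
    qed
    also have "\<dots> = J * e" by (simp add: J_def)
    also have "\<dots> < (J + 1) * e" using e by simp
    also have "\<dots> = \<bar>\<integral>p. f p * \<phi> p \<partial>mu0\<bar>" using J by (simp add: e_def)
    finally show False by simp
  qed
  have bor: "(\<lambda>p. indicat_real B p) \<in> borel_measurable mu0" if "B \<in> sets borel" for B :: "amb set"
  proof -
    have "id \<in> borel_measurable mu0" by (rule continuous_on_M_measurable) (rule continuous_on_id')
    from measurable_compose[OF this borel_measurable_indicator[OF that]] show ?thesis by simp
  qed
  have bint: "integrable mu0 (\<lambda>p. f p * indicat_real B p)" if "B \<in> sets borel" for B
    by (rule fint[where B=1]) (use bor[OF that] in \<open>auto simp: indicator_def\<close>)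
  have closed: "(\<integral>p. f p * indicat_real B p \<partial>mu0) = 0" if B: "closed B" for B
  proof (cases "B = {}")
    case False
    \<comment> \<open>Continuous tents that decrease with n to the indicator of the closed set
      B.\<close>
    define \<phi> where "\<phi> n p = max 0 (1 - real n * infdist p B)" for n p
    have c: "continuous_on UNIV (\<phi> n)" for n unfolding \<phi>_def by (intro continuous_intros)
    have "(\<lambda>n. \<integral>p. f p * \<phi> n p \<partial>mu0) \<longlonglongrightarrow> (\<integral>p. f p * indicat_real B p \<partial>mu0)"
    proof (rule integral_dominated_convergence[where w="\<lambda>p. \<bar>f p\<bar>"])
      show "(\<lambda>p. f p * indicat_real B p) \<in> borel_measurable mu0" using bint B by auto
      show "(\<lambda>p. f p * \<phi> n p) \<in> borel_measurable mu0" for n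
        using continuous_on_M_measurable[OF continuous_on_subset[OF c[of n]]] by measurable
      show "AE p in mu0. norm (f p * \<phi> n p) \<le> \<bar>f p\<bar>" for n
      proof (rule AE_I2)
        fix p
        have "\<bar>\<phi> n p\<bar> \<le> 1" using infdist_nonneg[of p B] by (auto simp: \<phi>_def)
        then show "norm (f p * \<phi> n p) \<le> \<bar>f p\<bar>" by (simp add: abs_mult mult_left_le)
      qed
      show "AE p in mu0. (\<lambda>n. f p * \<phi> n p) \<longlonglongrightarrow> f p * indicat_real B p"
      proof (rule AE_I2)
        fix p
        have "(\<lambda>n. \<phi> n p) \<longlonglongrightarrow> indicat_real B p"
        proof (cases "p \<in> B")
          case True
          then have "\<phi> n p = 1" for n by (simp add: \<phi>_def)
          then show ?thesis using True by simp
        next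
          case out: False
          then have d: "infdist p B > 0" using infdist_pos_not_in_closed[OF B False] by simp
          obtain N where N: "1 / infdist p B < real N" using reals_Archimedean2 by blast
          have "\<phi> n p = 0" if "N \<le> n" for n
          proof -
            have "1 < real N * infdist p B" using N d by (simp add: field_simps)
            also have "\<dots> \<le> real n * infdist p B" using that d by simp
            finally show ?thesis by (simp add: \<phi>_def)
          qed
          then have "\<forall>\<^sub>F n in sequentially. \<phi> n p = indicat_real B p"
            using out by (auto simp: eventually_sequentially)
          then show ?thesis by (rule tendsto_eventually)
        qed
        then show "(\<lambda>n. f p * \<phi> n p) \<longlonglongrightarrow> f p * indicat_real B p" by (intro tendsto_mult_left)
      qed
    qed (use f in auto)
    then show ?thesis using cont[OF c] by (simp add: LIMSEQ_const_iff)
  qed simp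
  have all: "(\<integral>p. f p * indicat_real B p \<partial>mu0) = 0" if B: "B \<in> sigma_sets UNIV (Collect closed)" for B
  proof -
    have closed_sub: "Collect closed \<subseteq> Pow (UNIV :: amb set)" by simp
    have "Int_stable (Collect closed :: amb set set)" by (auto simp: Int_stable_def)
    from this closed_sub B show ?thesis
  proof (induction rule: sigma_sets_induct_disjoint)
    case (basic A) then show ?case using closed by simp
  next
    case (compl A)
    have A: "A \<in> sets borel" using compl.hyps by (simp add: borel_eq_closed)
    have "(\<integral>p. f p * indicat_real (UNIV - A) p \<partial>mu0) = (\<integral>p. f p - f p * indicat_real A p \<partial>mu0)"
      by (intro Bochner_Integration.integral_cong) (auto simp: indicator_def)
    also have "\<dots> = 0" using bint[OF A] f compl.IH orth[OF real_polynomial_function.intros(2)[of 1]] by simp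
    finally show ?case .
  next
    case (union A)
    have A: "A i \<in> sets borel" for i using union.hyps(2) by (auto simp: borel_eq_closed)
    have "(\<lambda>n. \<integral>p. f p * indicat_real (\<Union>i<n. A i) p \<partial>mu0) \<longlonglongrightarrow> (\<integral>p. f p * indicat_real (\<Union>i. A i) p \<partial>mu0)"
    proof (rule integral_dominated_convergence[where w="\<lambda>p. \<bar>f p\<bar>"])
      show "AE p in mu0. (\<lambda>n. f p * indicat_real (\<Union>i<n. A i) p) \<longlonglongrightarrow> f p * indicat_real (\<Union>i. A i) p"
        by (intro AE_I2 tendsto_mult_left LIMSEQ_indicator_UN)
      show "(\<lambda>p. f p * indicat_real (\<Union>i<n. A i) p) \<in> borel_measurable mu0" for n
        using bint[of "\<Union>i<n. A i"] A by auto
      show "(\<lambda>p. f p * indicat_real (\<Union>i. A i) p) \<in> borel_measurable mu0"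
        using bint[of "\<Union>i. A i"] A by auto
    qed (use f in \<open>auto simp: indicator_def\<close>)
    moreover have "(\<integral>p. f p * indicat_real (\<Union>i<n. A i) p \<partial>mu0) = 0" for n
    proof -
      have "indicat_real (\<Union>i<n. A i) p = (\<Sum>i<n. indicat_real (A i) p)" for p
        using union.hyps(1) by (intro indicator_UN_disjoint) (auto simp: disjoint_family_on_def)
      then have "(\<integral>p. f p * indicat_real (\<Union>i<n. A i) p \<partial>mu0) = (\<integral>p. (\<Sum>i<n. f p * indicat_real (A i) p) \<partial>mu0)"
        by (simp only: sum_distrib_left)
      also have "\<dots> = (\<Sum>i<n. \<integral>p. f p * indicat_real (A i) p \<partial>mu0)"
        by (rule Bochner_Integration.integral_sum) (rule bint[OF A])
      finally show ?thesis by (simp add: union.IH)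
    qed
    ultimately show ?case by (simp add: LIMSEQ_const_iff)
  qed simp
  qed
  have "AE p in mu0. f p = (\<lambda>_. 0) p"
  proof (rule density_unique_real[OF f])
    fix A assume "A \<in> sets mu0"
    then obtain B where B: "B \<in> sets borel" "A = S2xS1 \<inter> B" using sets_mu0_subset by blast
    have "(\<integral>p. indicat_real A p *\<^sub>R f p \<partial>mu0) = (\<integral>p. f p * indicat_real B p \<partial>mu0)"
      by (intro Bochner_Integration.integral_cong) (auto simp: B(2) indicator_def)
    then show "(\<integral>p\<in>A. f p \<partial>mu0) = (\<integral>p\<in>A. (\<lambda>_. 0) p \<partial>mu0)"
      using all[of B] B(1) by (simp add: set_lebesgue_integral_def borel_eq_closed)
  qed simp
  then show ?thesis .
qed

lemma weak_grad_unique: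
  assumes "has_weak_grad v W" "has_weak_grad v W'"
  shows "AE p in mu0. W p = W' p"
proof -
  have t: "AE p in mu0. tproj p (W p) = W p" "AE p in mu0. tproj p (W' p) = W' p"
    and i: "integrable mu0 W" "integrable mu0 W'"
    and eq: "\<And>X. smooth_vector_field X \<Longrightarrow> (\<integral>p. W p \<bullet> X p \<partial>mu0) = (\<integral>p. W' p \<bullet> X p \<partial>mu0)"
    using assms unfolding has_weak_grad_def by auto
  have "AE p in mu0. W p \<bullet> b - W' p \<bullet> b = 0" for b
  proof (rule AE_eq_0_if_orthogonal_to_polynomials)
    show "integrable mu0 (\<lambda>p. W p \<bullet> b - W' p \<bullet> b)" using i by simp
    fix \<phi> :: "amb \<Rightarrow> real" assume \<phi>: "real_polynomial_function \<phi>"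
    let ?X = "\<lambda>p. \<phi> p *\<^sub>R tproj p b"
    have X: "smooth_vector_field ?X" by (rule smooth_vector_field_polynomial[OF \<phi>])
    have cX: "continuous_on S2xS1 ?X" by (rule C1_field_continuous[OF smooth_vector_field_C1[OF X]])
    obtain B where B: "\<And>p. p \<in> S2xS1 \<Longrightarrow> norm (?X p) \<le> B" using continuous_on_M_bounded[OF cX] by blast
    have iX: "integrable mu0 (\<lambda>p. U p \<bullet> ?X p)" if U: "integrable mu0 U" for U :: "amb \<Rightarrow> amb"
    proof (rule Bochner_Integration.integrable_bound[OF integrable_mult_left[OF integrable_norm[OF U], of B]])
      show "(\<lambda>p. U p \<bullet> ?X p) \<in> borel_measurable mu0"
        using U continuous_on_M_measurable[OF cX] by (intro borel_measurable_inner) auto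
      show "AE p in mu0. norm (U p \<bullet> ?X p) \<le> norm (norm (U p) * B)"
        using B by (intro AE_I2) (auto intro!: order_trans[OF Cauchy_Schwarz_ineq2] order_trans[OF _ abs_ge_self] mult_left_mono simp del: inner_scaleR_right norm_scaleR)
    qed
    have "(\<integral>p. (W p \<bullet> b - W' p \<bullet> b) * \<phi> p \<partial>mu0) = (\<integral>p. W p \<bullet> ?X p - W' p \<bullet> ?X p \<partial>mu0)"
    proof (rule integral_cong_AE)
      show "(\<lambda>p. (W p \<bullet> b - W' p \<bullet> b) * \<phi> p) \<in> borel_measurable mu0"
        using i \<phi> continuous_on_M_measurable[of \<phi>]
        by (intro borel_measurable_times borel_measurable_diff borel_measurable_inner)
          (auto simp: real_polynomial_function_eq continuous_on_polymonial_function)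
      show "(\<lambda>p. W p \<bullet> ?X p - W' p \<bullet> ?X p) \<in> borel_measurable mu0"
        using iX[OF i(1)] iX[OF i(2)] by (intro borel_measurable_diff) (simp_all only: borel_measurable_integrable)
      show "AE p in mu0. (W p \<bullet> b - W' p \<bullet> b) * \<phi> p = W p \<bullet> ?X p - W' p \<bullet> ?X p"
        using t by eventually_elim (simp add: inner_tproj_commute[symmetric] algebra_simps)
    qed
    also have "\<dots> = 0" using iX[OF i(1)] iX[OF i(2)] eq[OF X] by (simp only: Bochner_Integration.integral_diff)
    finally show "(\<integral>p. (W p \<bullet> b - W' p \<bullet> b) * \<phi> p \<partial>mu0) = 0" .
  qed
  then have "AE p in mu0. \<forall>b\<in>Basis. W p \<bullet> b - W' p \<bullet> b = 0" by (simp add: AE_ball_countable countable_finite)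
  then show ?thesis by eventually_elim (auto intro: euclidean_eqI)
qed

text \<open>Finitely many components determine the form, so equality almost everywhere can be shown
  component by component.\<close>

lemma tangent3_expand:
  assumes "tangent3 p s"
  shows "s a b c = (\<Sum>e1\<in>Basis. (a \<bullet> e1) * (\<Sum>e2\<in>Basis. (b \<bullet> e2) * (\<Sum>e3\<in>Basis. (c \<bullet> e3) * s e1 e2 e3)))"
proof -
  have l: "linear (s a b)" "linear (\<lambda>b. s a b c)" "linear (\<lambda>a. s a b c)" for a b c
    using assms unfolding tangent3_def bilinear_def by blast+
  show ?thesis by (simp only: sum_Basis_linear_real[OF l(1)] sum_Basis_linear_real[OF l(2)] sum_Basis_linear_real[OF l(3)])
qed

text \<open>A test tensor made of a polynomial and three projected covectors picks out one
  component, because a tangent tensor does not see the projections.\<close>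

lemma weak_cov_unique:
  assumes "has_weak_cov T S" "has_weak_cov T S'"
  shows "AE p in mu0. S p = S' p"
proof -
  have t: "AE p in mu0. tangent3 p (S p)" "AE p in mu0. tangent3 p (S' p)"
    and i: "\<And>a b c. integrable mu0 (\<lambda>p. S p a b c)" "\<And>a b c. integrable mu0 (\<lambda>p. S' p a b c)"
    and eq: "\<And>\<Phi>. smooth_tensor3 \<Phi> \<Longrightarrow> (\<integral>p. (\<Sum>a\<in>Basis. \<Sum>b\<in>Basis. \<Sum>c\<in>Basis. S p a b c * \<Phi> p a b c) \<partial>mu0) =
      (\<integral>p. (\<Sum>a\<in>Basis. \<Sum>b\<in>Basis. \<Sum>c\<in>Basis. S' p a b c * \<Phi> p a b c) \<partial>mu0)"
    using assms unfolding has_weak_cov_def by auto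
  have "AE p in mu0. S p e1 e2 e3 - S' p e1 e2 e3 = 0" for e1 e2 e3
  proof (rule AE_eq_0_if_orthogonal_to_polynomials)
    show "integrable mu0 (\<lambda>p. S p e1 e2 e3 - S' p e1 e2 e3)" using i by simp
    fix \<phi> :: "amb \<Rightarrow> real" assume \<phi>: "real_polynomial_function \<phi>"
    have c\<phi>: "continuous_on S2xS1 \<phi>" using \<phi> by (simp add: real_polynomial_function_eq continuous_on_polymonial_function)
    define \<Phi> where "\<Phi> p a b c = \<phi> p * (tproj p a \<bullet> e1) * (tproj p b \<bullet> e2) * (tproj p c \<bullet> e3)" for p a b c
    have sm: "smooth_tensor3 \<Phi>" using smooth_tensor3_polynomial[OF \<phi>] by (simp add: \<Phi>_def[abs_def])
    let ?C = "\<lambda>U p. \<Sum>a\<in>Basis. \<Sum>b\<in>Basis. \<Sum>c\<in>Basis. U p a b c * \<Phi> p a b c"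
    have contr: "?C U p = \<phi> p * U p e1 e2 e3" if "tangent3 p (U p)" for U p
    proof -
      have l: "linear (U p a b)" "linear (\<lambda>b. U p a b c)" "linear (\<lambda>a. U p a b c)" for a b c
        using that unfolding tangent3_def bilinear_def by blast+
      have tp: "tproj p v \<bullet> e = tproj p e \<bullet> v" for v e by (metis inner_commute inner_tproj_commute)
      have "?C U p = \<phi> p * (\<Sum>a\<in>Basis. (tproj p e1 \<bullet> a) * (\<Sum>b\<in>Basis. (tproj p e2 \<bullet> b) * (\<Sum>c\<in>Basis. (tproj p e3 \<bullet> c) * U p a b c)))"
        unfolding \<Phi>_def sum_distrib_left
        by (intro sum.cong refl) (simp only: tp[of _ e1] tp[of _ e2] tp[of _ e3] mult_ac)
      also have "\<dots> = \<phi> p * U p (tproj p e1) (tproj p e2) (tproj p e3)"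
        by (simp only: sum_Basis_linear_real[OF l(1)] sum_Basis_linear_real[OF l(2)] sum_Basis_linear_real[OF l(3)])
      also have "U p (tproj p e1) (tproj p e2) (tproj p e3) = U p e1 e2 e3"
        using that unfolding tangent3_def by metis
      finally show ?thesis .
    qed
    obtain B where B: "\<And>p. p \<in> S2xS1 \<Longrightarrow> norm (\<phi> p) \<le> B" using continuous_on_M_bounded[OF c\<phi>] by blast
    have i\<phi>: "integrable mu0 (\<lambda>p. \<phi> p * f p)" if "integrable mu0 f" for f :: "amb \<Rightarrow> real"
    proof (rule Bochner_Integration.integrable_bound[OF integrable_mult_right[OF integrable_norm[OF that], of B]])
      show "(\<lambda>p. \<phi> p * f p) \<in> borel_measurable mu0"
        using that continuous_on_M_measurable[OF c\<phi>] by auto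
      have "norm (\<phi> p * f p) \<le> norm (B * norm (f p))" if "p \<in> S2xS1" for p
        using B[OF that] by (simp add: abs_mult mult_right_mono)
      then show "AE p in mu0. norm (\<phi> p * f p) \<le> norm (B * norm (f p))" by (intro AE_I2) (simp only: space_mu0)
    qed
    have meas: "?C U \<in> borel_measurable mu0" if "\<And>a b c. integrable mu0 (\<lambda>p. U p a b c)" for U
    proof -
      have "(\<lambda>p. \<Phi> p a b c) \<in> borel_measurable mu0" for a b c
        by (rule continuous_on_M_measurable[OF C1_M_continuous[OF tensor_C1[OF sm]]])
      then show ?thesis using that by (intro borel_measurable_sum borel_measurable_times) auto
    qed
    have "(\<integral>p. ?C U p \<partial>mu0) = (\<integral>p. \<phi> p * U p e1 e2 e3 \<partial>mu0)"
      if "\<And>a b c. integrable mu0 (\<lambda>p. U p a b c)" "AE p in mu0. tangent3 p (U p)" for U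
    proof (rule integral_cong_AE[OF meas[OF that(1)]])
      show "(\<lambda>p. \<phi> p * U p e1 e2 e3) \<in> borel_measurable mu0" using i\<phi>[OF that(1)] by (rule borel_measurable_integrable)
      show "AE p in mu0. ?C U p = \<phi> p * U p e1 e2 e3" using that(2) by eventually_elim (rule contr)
    qed
    from this[OF i(1) t(1)] this[OF i(2) t(2)]
    have "(\<integral>p. \<phi> p * S p e1 e2 e3 \<partial>mu0) = (\<integral>p. \<phi> p * S' p e1 e2 e3 \<partial>mu0)" using eq[OF sm] by simp
    then have "(\<integral>p. \<phi> p * S p e1 e2 e3 - \<phi> p * S' p e1 e2 e3 \<partial>mu0) = 0" using i\<phi>[OF i(1)] i\<phi>[OF i(2)] by simp
    then show "(\<integral>p. (S p e1 e2 e3 - S' p e1 e2 e3) * \<phi> p \<partial>mu0) = 0" by (simp add: algebra_simps)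
  qed
  then have "AE p in mu0. \<forall>e1\<in>Basis. \<forall>e2\<in>Basis. \<forall>e3\<in>Basis. S p e1 e2 e3 - S' p e1 e2 e3 = 0"
    by (simp add: AE_ball_countable countable_finite)
  then show ?thesis using t
  proof eventually_elim
    case (elim p)
    have "S p a b c = S' p a b c" for a b c
      unfolding tangent3_expand[OF elim(2), of a b c] tangent3_expand[OF elim(3), of a b c] using elim(1) by simp
    then show ?case by (intro ext)
  qed
qed

section \<open>The coefficients of the scalar curvature distribution\<close>

text \<open>With \<open>e = \<eta>\<close>, \<open>r = 1 / \<eta>\<close>, \<open>n\<close> the gradient of \<open>\<eta>\<close>, \<open>T\<close> the round metric of the circle and \<open>C\<close> the inverse
  metric, \<open>G\<close> is the tensor \<open>\<Gamma>\<close>.\<close>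

context
  fixes I :: "'i set" and n :: "'i \<Rightarrow> real" and T C :: "'i \<Rightarrow> 'i \<Rightarrow> real" and e r N :: real
  assumes re: "r * e = 1" and sym: "\<And>i j. T i j = T j i" "\<And>i j. C i j = C j i"
    and Tn: "\<And>i. (\<Sum>k\<in>I. T i k * n k) = 0" and TT: "\<And>i j. (\<Sum>k\<in>I. T i k * T j k) = T i j"
    and tr: "(\<Sum>k\<in>I. T k k) = 1" and nn: "(\<Sum>k\<in>I. n k * n k) = N"
    and Cn: "\<And>i. (\<Sum>k\<in>I. C i k * n k) = n i" and CT: "\<And>i j. (\<Sum>k\<in>I. C i k * T j k) = r * r * T i j"
begin

definition G :: "'i \<Rightarrow> 'i \<Rightarrow> 'i \<Rightarrow> real" where
  "G k i j = r * (n i * T k j + n j * T k i) - e * (n k * T i j)"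

lemmas contract_simps = sum.distrib sum_subtractf sum_negf sum_distrib_left[symmetric] Tn TT tr nn Cn CT

lemma G_eq: "(1/2) * (\<Sum>l\<in>I. C k l * ((2 * e) * n i * T j l + (2 * e) * n j * T i l - (2 * e) * n l * T i j)) = G k i j"
proof -
  have "(\<Sum>l\<in>I. C k l * ((2 * e) * n i * T j l + (2 * e) * n j * T i l - (2 * e) * n l * T i j)) =
    (\<Sum>l\<in>I. (2 * e * n i) * (C k l * T j l) + (2 * e * n j) * (C k l * T i l) - (2 * e * T i j) * (C k l * n l))"
    by (intro sum.cong refl) (simp add: algebra_simps)
  also have "\<dots> = 2 * e * n i * (r * r * T k j) + 2 * e * n j * (r * r * T k i) - 2 * e * T i j * n k"
    unfolding contract_simps ..
  also have "\<dots> = 2 * ((r * e) * r * (n i * T k j + n j * T k i) - e * (n k * T i j))" by (simp add: algebra_simps)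
  finally show ?thesis unfolding re by (simp add: G_def)
qed

text \<open>The derivative of the logarithm of \<eta>, which is the volume density.\<close>

lemma G_trace: "(\<Sum>j\<in>I. G j j i) = r * n i"
proof -
  have "(\<Sum>j\<in>I. G j j i) = (\<Sum>j\<in>I. (r - e) * (T i j * n j) + (r * n i) * T j j)"
    by (intro sum.cong refl) (simp add: G_def sym(1) algebra_simps)
  then show ?thesis unfolding contract_simps by simp
qed

lemma CG: "(\<Sum>i\<in>I. \<Sum>j\<in>I. C i j * G k i j) = - (r * n k)"
proof -
  have "(\<Sum>j\<in>I. C i j * G k i j) = (r * r * r + r) * (T k i * n i) - (e * n k * r * r) * T i i" for i
  proof -
    have "(\<Sum>j\<in>I. C i j * G k i j) = (\<Sum>j\<in>I. (r * n i) * (C i j * T k j) + (r * T k i) * (C i j * n j) - (e * n k) * (C i j * T i j))"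
      by (intro sum.cong refl) (simp add: G_def sym(1) algebra_simps)
    also have "\<dots> = (r * n i) * (r * r * T i k) + (r * T k i) * n i - (e * n k) * (r * r * T i i)"
      unfolding contract_simps ..
    finally show ?thesis by (simp add: sym(1) algebra_simps)
  qed
  then have "(\<Sum>i\<in>I. \<Sum>j\<in>I. C i j * G k i j) = (r * r * r + r) * 0 - (e * n k * r * r) * 1"
    by (simp only: contract_simps)
  also have "\<dots> = - ((r * e) * r * n k)" by simp
  finally show ?thesis unfolding re by simp
qed

lemma V_eq: "(\<Sum>i\<in>I. \<Sum>j\<in>I. C i j * G k i j) - (\<Sum>i\<in>I. \<Sum>j\<in>I. C i k * G j j i) = - 2 * r * n k"
proof -
  have "(\<Sum>i\<in>I. \<Sum>j\<in>I. C i k * G j j i) = (\<Sum>i\<in>I. r * (C k i * n i))"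
    by (intro sum.cong refl) (simp add: sum_distrib_left[symmetric] G_trace sym(2) mult_ac)
  also have "\<dots> = r * n k" unfolding contract_simps ..
  finally show ?thesis unfolding CG by simp
qed

lemma GG: "(\<Sum>k\<in>I. \<Sum>l\<in>I. G k k l * G l i j - G k j l * G l i k) = N * T i j - r * r * (n i * n j)"
proof -
  have a: "(\<Sum>k\<in>I. \<Sum>l\<in>I. G k k l * G l i j) = - N * T i j"
  proof -
    have "(\<Sum>k\<in>I. \<Sum>l\<in>I. G k k l * G l i j) = (\<Sum>l\<in>I. (\<Sum>k\<in>I. G k k l) * G l i j)"
      unfolding sum_distrib_right by (rule sum.swap)
    also have "\<dots> = (\<Sum>l\<in>I. (r * r * n i) * (T j l * n l) + (r * r * n j) * (T i l * n l) - (r * e * T i j) * (n l * n l))"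
      unfolding G_trace by (intro sum.cong refl) (simp add: G_def sym(1) algebra_simps)
    also have "\<dots> = (r * r * n i) * 0 + (r * r * n j) * 0 - (r * e * T i j) * N" unfolding contract_simps ..
    finally show ?thesis unfolding re by simp
  qed
  have b: "(\<Sum>l\<in>I. G k j l * G l i k) =
      (r * r * n j * n i) * T k k + (r * r * n j) * (T i k * n k) - N * (T i k * T j k) - (n i) * (T j k * n k) - T j i * (n k * n k)" for k
  proof -
    have "(\<Sum>l\<in>I. G k j l * G l i k) = (\<Sum>l\<in>I. (r * r * n j * n i) * (T k l * T k l) + (r * r * n j * n k) * (T k l * T i l)
        - (r * e * n j * T i k) * (T k l * n l) + (r * r * T k j * n i) * (T k l * n l) + (r * r * T k j * n k) * (T i l * n l)
        - (r * e * T k j * T i k) * (n l * n l) - (r * e * n k * n i) * (T j l * T k l) - (r * e * n k * n k) * (T j l * T i l)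
        + (e * e * n k * T i k) * (T j l * n l))"
      by (intro sum.cong refl) (simp add: G_def sym(1) algebra_simps)
    also have "\<dots> = (r * r * n j * n i) * T k k + (r * r * n j * n k) * T k i
        - (r * e * n j * T i k) * 0 + (r * r * T k j * n i) * 0 + (r * r * T k j * n k) * 0
        - (r * e * T k j * T i k) * N - (r * e * n k * n i) * T j k - (r * e * n k * n k) * T j i
        + (e * e * n k * T i k) * 0" unfolding contract_simps ..
    finally show ?thesis unfolding re by (simp add: sym(1) algebra_simps)
  qed
  have "(\<Sum>k\<in>I. \<Sum>l\<in>I. G k j l * G l i k) =
      (r * r * n j * n i) * 1 + (r * r * n j) * 0 - N * T i j - n i * 0 - T j i * N"
    unfolding b contract_simps ..
  then show ?thesis unfolding sum_subtractf a by (simp add: sym(1) algebra_simps)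
qed

text \<open>Only the first sum contributes. In the second T annihilates n; in the third, by
  \<open>GG\<close>, the contractions of C with \<open>N * T i j\<close> and with
  \<open>r * r * (n i * n j)\<close> both give N r^2 and cancel.\<close>

lemma F_terms:
  "- (\<Sum>i\<in>I. \<Sum>j\<in>I. \<Sum>k\<in>I. ((- 2 * r * r * r) * n k * T i j) * G k i j)
   + (\<Sum>i\<in>I. \<Sum>j\<in>I. \<Sum>k\<in>I. ((- 2 * r * r * r) * n k * T i k) * G j j i)
   + (\<Sum>i\<in>I. \<Sum>j\<in>I. \<Sum>k\<in>I. \<Sum>l\<in>I. C i j * (G k k l * G l i j - G k j l * G l i k)) = - 2 * r * r * N"
proof -
  have 1: "(\<Sum>i\<in>I. \<Sum>j\<in>I. \<Sum>k\<in>I. ((- 2 * r * r * r) * n k * T i j) * G k i j) = 2 * r * r * N"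
  proof -
    have k: "(\<Sum>k\<in>I. ((- 2 * r * r * r) * n k * T i j) * G k i j) = (2 * r * r * (r * e) * N) * (T i j * T i j)" for i j
    proof -
      have "(\<Sum>k\<in>I. ((- 2 * r * r * r) * n k * T i j) * G k i j) = (\<Sum>k\<in>I. (- 2 * r * r * r * r * T i j * n i) * (T j k * n k)
          + (- 2 * r * r * r * r * T i j * n j) * (T i k * n k) + (2 * r * r * (r * e) * (T i j * T i j)) * (n k * n k))"
        by (intro sum.cong refl) (simp add: G_def sym(1) algebra_simps)
      then show ?thesis unfolding contract_simps by simp
    qed
    show ?thesis unfolding k contract_simps re by simp
  qed
  have 2: "(\<Sum>i\<in>I. \<Sum>j\<in>I. \<Sum>k\<in>I. ((- 2 * r * r * r) * n k * T i k) * G j j i) = 0"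
  proof -
    have k: "(\<Sum>k\<in>I. ((- 2 * r * r * r) * n k * T i k) * G j j i) = 0" for i j
    proof -
      have "(\<Sum>k\<in>I. ((- 2 * r * r * r) * n k * T i k) * G j j i) = (\<Sum>k\<in>I. (- 2 * r * r * r * G j j i) * (T i k * n k))"
        by (intro sum.cong refl) (simp add: algebra_simps)
      then show ?thesis unfolding contract_simps by simp
    qed
    show ?thesis unfolding k by simp
  qed
  have 3: "(\<Sum>i\<in>I. \<Sum>j\<in>I. \<Sum>k\<in>I. \<Sum>l\<in>I. C i j * (G k k l * G l i j - G k j l * G l i k)) = 0"
  proof -
    have j: "(\<Sum>j\<in>I. C i j * (N * T i j - r * r * (n i * n j))) = N * (r * r * T i i) - (r * r) * (n i * n i)" for i
    proof -
      have "(\<Sum>j\<in>I. C i j * (N * T i j - r * r * (n i * n j))) = (\<Sum>j\<in>I. N * (C i j * T i j) - (r * r * n i) * (C i j * n j))"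
        by (intro sum.cong refl) (simp add: algebra_simps)
      then show ?thesis unfolding contract_simps by (simp add: algebra_simps)
    qed
    show ?thesis unfolding sum_distrib_left[symmetric] unfolding GG j unfolding contract_simps by simp
  qed
  show ?thesis unfolding 1 2 3 by simp
qed

end

lemma has_weak_cov_weak_cov: "has_weak_cov T S \<Longrightarrow> has_weak_cov T (weak_cov T)"
  unfolding weak_cov_def by (rule someI[of "has_weak_cov T"])

lemma has_weak_grad_weak_grad: "has_weak_grad v W \<Longrightarrow> has_weak_grad v (weak_grad v)"
  unfolding weak_grad_def by (rule someI[of "has_weak_grad v"])

lemma C1_field_sgrad:
  assumes F: "C2_sphere F"
  shows "C1_field (\<lambda>p. (sgrad F (fst p), 0))" "p \<in> S2xS1 \<Longrightarrow> divM (\<lambda>p. (sgrad F (fst p), 0)) p = slaplacian F (fst p)"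
proof -
  have C1: "C1_sphere F" "C1_sphere (\<lambda>x. sderiv F x v)" for v using F unfolding C2_sphere_def by blast+
  have e: "sderiv F (fst q) (fst b) = (sgrad F (fst q), 0) \<bullet> b" if "q \<in> S2xS1" for q b :: amb
    using sgrad_inner[OF C1(1) M_norms(1)[OF that]] by (simp add: inner_prod_def)
  show "C1_field (\<lambda>p. (sgrad F (fst p), 0))"
    unfolding C1_field_def
  proof (intro conjI allI ballI)
    show "C1_M (\<lambda>p. (sgrad F (fst p), 0) \<bullet> b)" for b :: amb
      by (rule C1_M_cong[OF e C1_M_fst(1)[OF C1(2)]])
    show "tproj p (sgrad F (fst p), 0) = (sgrad F (fst p), 0)" if "p \<in> S2xS1" for p
      using sgrad_inner[OF C1(1) M_norms(1)[OF that], of "fst p"] sderiv_self[of F "fst p"] C1(1) M_norms(1)[OF that]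
      by (simp add: tangent_iff[OF that] C1_sphere_def)
  qed
  assume p: "p \<in> S2xS1"
  have "divM (\<lambda>p. (sgrad F (fst p), 0)) p = (\<Sum>b\<in>(Basis :: amb set). sderiv (\<lambda>x. sderiv F x (fst b)) (fst p) (fst b))"
    unfolding divM_def
  proof (rule sum.cong[OF refl])
    fix b :: amb
    have "mderiv (\<lambda>q. (sgrad F (fst q), 0) \<bullet> b) p b = mderiv (\<lambda>q. sderiv F (fst q) (fst b)) p b"
      by (rule mderiv_cong[OF e[symmetric] p])
    then show "mderiv (\<lambda>q. (sgrad F (fst q), 0) \<bullet> b) p b = sderiv (\<lambda>x. sderiv F x (fst b)) (fst p) (fst b)"
      by (simp only: C1_M_fst(2)[OF C1(2) p])
  qed
  also have "\<dots> = slaplacian F (fst p)"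
  proof -
    have "sderiv (\<lambda>x. sderiv F x 0) (fst p) 0 = 0"
      by (rule linear_0[OF linear_sderiv[OF C1(2) M_norms(1)[OF p]]])
    then show ?thesis by (simp add: sum_Basis_amb slaplacian_eq[OF F M_norms(1)[OF p]])
  qed
  finally show "divM (\<lambda>p. (sgrad F (fst p), 0)) p = slaplacian F (fst p)" .
qed

section \<open>The scalar curvature pairing of the limit metric\<close>

context supersolution_limit
begin

abbreviation g_lim :: tensor2 where "g_lim \<equiv> warped_metric \<eta>"

lemma weak_cov_AE:
  "AE p in mu0. weak_cov g_lim p = (\<lambda>i j l. (((2 * \<eta> (fst p)) *\<^sub>R w (fst p)) \<bullet> fst i) * bform 0 1 p j l)"
  "AE p in mu0. weak_cov (cometric g_lim) p = (\<lambda>k i j. (((- 2 / (\<eta> (fst p)) ^ 3) *\<^sub>R w (fst p)) \<bullet> fst k) * bform 0 1 p i j)"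
  by (rule weak_cov_unique[OF has_weak_cov_weak_cov[OF has_weak_cov_metric] has_weak_cov_metric])
    (rule weak_cov_unique[OF has_weak_cov_weak_cov[OF has_weak_cov_cometric] has_weak_cov_cometric])

lemma vol_density_g_lim: "p \<in> S2xS1 \<Longrightarrow> vol_density g_lim p = \<eta> (fst p)"
  using vol_density_warped[of p \<eta>] \<eta>_pos M_norms by fastforce

lemma has_weak_grad_vol:
  assumes "smooth_on_M u"
  shows "has_weak_grad (\<lambda>q. u q * vol_density g_lim q) (\<lambda>p. u p *\<^sub>R (w (fst p), 0) + \<eta> (fst p) *\<^sub>R gradM u p)"
  by (rule has_weak_grad_mult[OF weak_gradient_\<eta> assms]) (simp add: vol_density_g_lim)

text \<open>The vector term contributes 2 r u |v|^2 and the scalar term -2 r^2 e u |v|^2, which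
  cancel because r e = 1. The cancellation takes place at the point p, before any
  integration.\<close>

lemma scal_integrand_eq:
  assumes p: "p \<in> S2xS1"
    and S: "weak_cov g_lim p = (\<lambda>i j l. (((2 * \<eta> (fst p)) *\<^sub>R w (fst p)) \<bullet> fst i) * bform 0 1 p j l)"
      "weak_cov (cometric g_lim) p = (\<lambda>k i j. (((- 2 / (\<eta> (fst p)) ^ 3) *\<^sub>R w (fst p)) \<bullet> fst k) * bform 0 1 p i j)"
    and W: "weak_grad (\<lambda>q. u q * vol_density g_lim q) p = u p *\<^sub>R (w (fst p), 0) + \<eta> (fst p) *\<^sub>R gradM u p"
  shows "scal_integrand g_lim u p = 2 * (w (fst p) \<bullet> fst (gradM u p)) + 2 * (\<eta> (fst p) * u p)"
proof -
  define e r v where "e = \<eta> (fst p)" and "r = 1 / e" and "v = w (fst p)"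
  define n T C where "n k = v \<bullet> fst k" and "T = bform 0 1 p" and "C = bform 1 (r * r) p" for k :: amb
  have e: "e > 0" unfolding e_def by (rule \<eta>_pos[OF M_norms(1)[OF p]])
  then have re: "r * e = 1" by (simp add: r_def)
  have lin: "linear n" unfolding n_def[abs_def] by (rule linearI) (simp_all add: inner_add_right)
  have vp: "v \<bullet> fst p = 0" unfolding v_def by (rule w_tangent[OF M_norms(1)[OF p]])
  have nb: "n (bmap \<alpha> \<beta> p i) = \<alpha> * n i" for \<alpha> \<beta> i
    using vp by (simp add: n_def bmap_def sproj_def inner_diff_right)
  have sym: "T i j = T j i" "C i j = C j i" for i j by (simp_all add: T_def C_def bform_commute[of _ _ p i j])
  have Tn: "(\<Sum>k\<in>Basis. T i k * n k) = 0" for i unfolding T_def sum_bform_linear[OF lin] nb by simp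
  have TT: "(\<Sum>k\<in>Basis. T i k * T j k) = T i j" for i j
    unfolding sym(1)[of j] unfolding T_def sum_bform_bform[OF p] by simp
  have tr: "(\<Sum>k\<in>Basis. T k k) = 1" unfolding T_def bform_trace[OF p] by simp
  have nn: "(\<Sum>k\<in>Basis. n k * n k) = v \<bullet> v" by (simp add: n_def sum_Basis_amb euclidean_inner[of v v])
  have Cn: "(\<Sum>k\<in>Basis. C i k * n k) = n i" for i unfolding C_def sum_bform_linear[OF lin] nb by simp
  have CT: "(\<Sum>k\<in>Basis. C i k * T j k) = r * r * T i j" for i j
  proof -
    have "(\<Sum>k\<in>Basis. C i k * T j k) = bform (1 * 0) (r * r * 1) p i j"
      unfolding sym(1)[of j] unfolding T_def C_def by (rule sum_bform_bform[OF p])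
    then show ?thesis by (simp add: T_def bform_def)
  qed
  note ctx = re sym Tn TT tr nn Cn CT
  have co: "cometric g_lim p = C"
    using cometric_warped[OF p, of \<eta>] e by (simp add: C_def r_def e_def power2_eq_square)
  have S1: "weak_cov g_lim p i j l = (2 * e) * n i * T j l" for i j l
    unfolding S(1) by (simp add: e_def n_def v_def T_def)
  have S2: "weak_cov (cometric g_lim) p k i j = (- 2 * r * r * r) * n k * T i j" for k i j
    unfolding S(2) by (simp add: e_def n_def v_def T_def r_def power3_eq_cube)
  have Gam: "Gam g_lim p k i j = G n T e r k i j" for k i j
    unfolding Gam_def co S1 by (rule G_eq[OF ctx])
  have V: "Vvec g_lim p k = - 2 * r * n k" for k
    unfolding Vvec_def co Gam by (rule V_eq[OF ctx])
  have Ric: "(\<Sum>i\<in>Basis. \<Sum>j\<in>Basis. C i j * ricci g0 p i j) = 2"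
  proof -
    have "(\<Sum>j\<in>Basis. C i j * ricci g0 p i j) = bform (1 * 1) (r * r * 0) p i i" for i
      unfolding ricci_g0[OF p] bform_commute[of 1 0 p i] C_def by (rule sum_bform_bform[OF p])
    then show ?thesis using bform_trace[OF p, of 1 0] by simp
  qed
  have F: "Ffun g_lim p = 2 - 2 * r * r * (v \<bullet> v)"
    using F_terms[OF ctx] unfolding Ffun_def co Gam S2 Ric by linarith
  define X where "X = u p *\<^sub>R (v, 0) + e *\<^sub>R gradM u p"
  have WX: "weak_grad (\<lambda>q. u q * vol_density g_lim q) p = X" unfolding W X_def v_def e_def ..
  have nk: "n k = (v, 0) \<bullet> k" for k by (simp add: n_def inner_prod_def)
  have "(\<Sum>k\<in>Basis. Vvec g_lim p k * (weak_grad (\<lambda>q. u q * vol_density g_lim q) p \<bullet> k)) =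
      - 2 * r * (\<Sum>k\<in>Basis. ((v, 0) \<bullet> k) * (X \<bullet> k))"
    unfolding sum_distrib_left by (intro sum.cong refl) (simp only: V WX nk mult.assoc)
  also have "\<dots> = - 2 * r * ((v, 0) \<bullet> X)" unfolding euclidean_inner[of "(v, 0)" X] ..
  also have "\<dots> = - 2 * r * (u p * (v \<bullet> v)) - 2 * (r * e) * (v \<bullet> fst (gradM u p))"
    by (simp add: X_def inner_prod_def inner_add_right algebra_simps)
  finally have "scal_integrand g_lim u p = 2 * r * (u p * (v \<bullet> v)) + 2 * (v \<bullet> fst (gradM u p))
      + (2 - 2 * r * r * (v \<bullet> v)) * u p * e"
    unfolding scal_integrand_def F vol_density_g_lim[OF p] re by (simp add: e_def)
  also have "\<dots> = 2 * r * (u p * (v \<bullet> v)) + 2 * (v \<bullet> fst (gradM u p)) + 2 * (e * u p) - 2 * r * (r * e) * (u p * (v \<bullet> v))"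
    by (simp add: algebra_simps)
  finally show ?thesis unfolding re by (simp add: v_def e_def)
qed

text \<open>Needed before the integrand may be replaced by one that agrees with it almost
  everywhere. The chosen weak derivatives are measurable because, being weak derivatives, they are
  integrable.\<close>

lemma scal_integrand_measurable:
  assumes u: "smooth_on_M u"
  shows "scal_integrand g_lim u \<in> borel_measurable mu0"
proof -
  have S: "(\<lambda>p. weak_cov g_lim p a b d) \<in> borel_measurable mu0"
    "(\<lambda>p. weak_cov (cometric g_lim) p a b d) \<in> borel_measurable mu0" for a b d
    using has_weak_cov_weak_cov[OF has_weak_cov_metric] has_weak_cov_weak_cov[OF has_weak_cov_cometric]
    unfolding has_weak_cov_def by (blast intro: borel_measurable_integrable)+
  have co: "(\<lambda>p. cometric g_lim p a b) \<in> borel_measurable mu0" for a b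
    using has_weak_cov_cometric unfolding has_weak_cov_def by (blast intro: borel_measurable_integrable)
  have ric: "(\<lambda>p. ricci g0 p a b) \<in> borel_measurable mu0" for a b
    using bform_measurable[of 1 0 a b] by (subst measurable_cong[where g="\<lambda>p. bform 1 0 p a b"]) (simp_all add: ricci_g0)
  have "weak_grad (\<lambda>q. u q * vol_density g_lim q) \<in> borel_measurable mu0"
    using has_weak_grad_weak_grad[OF has_weak_grad_vol[OF u]] unfolding has_weak_grad_def by (blast intro: borel_measurable_integrable)
  then have gr: "(\<lambda>p. weak_grad (\<lambda>q. u q * vol_density g_lim q) p \<bullet> k) \<in> borel_measurable mu0" for k
    by (intro borel_measurable_inner) auto
  have vol: "vol_density g_lim \<in> borel_measurable mu0"
    using measurable_compose[OF measurable_fst_mu0 \<eta>_measurable]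
    by (subst measurable_cong[where g="\<lambda>p. \<eta> (fst p)"]) (simp_all add: vol_density_g_lim)
  have um: "u \<in> borel_measurable mu0"
    by (rule continuous_on_M_measurable[OF C1_M_continuous[OF smooth_real_C1_M[OF u]]])
  show ?thesis
    unfolding scal_integrand_def[abs_def] Ffun_def Vvec_def Gam_def
    by (intro borel_measurable_add borel_measurable_diff borel_measurable_uminus borel_measurable_sum borel_measurable_times
        borel_measurable_const S co ric gr vol um)
qed

lemma pairing_integrable:
  assumes u: "C1_M u" and \<alpha>: "integrable \<sigma> \<alpha>" and v: "integrable \<sigma> v"
  shows "integrable mu0 (\<lambda>p. v (fst p) \<bullet> fst (gradM u p))" "integrable mu0 (\<lambda>p. \<alpha> (fst p) * u p)"
proof -
  show "integrable mu0 (\<lambda>p. v (fst p) \<bullet> fst (gradM u p))"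
    by (intro integrable_mult_continuous v continuous_intros gradM_continuous u)
  show "integrable mu0 (\<lambda>p. \<alpha> (fst p) * u p)"
    using integrable_mult_continuous[OF \<alpha> C1_M_continuous[OF u]] by simp
qed

lemma \<eta>w_integrable: "integrable \<sigma> \<eta>" "integrable \<sigma> w"
  using weak_gradient_\<eta> unfolding weak_gradient_def by blast+

lemma scal_dist_g_lim:
  assumes u: "smooth_on_M u"
  shows "scal_dist_defined g_lim u"
    "scal_dist g_lim u = 2 * (\<integral>p. w (fst p) \<bullet> fst (gradM u p) \<partial>mu0) + 2 * (\<integral>p. \<eta> (fst p) * u p \<partial>mu0)"
proof -
  let ?E = "\<lambda>p. 2 * (w (fst p) \<bullet> fst (gradM u p)) + 2 * (\<eta> (fst p) * u p)"
  note i = pairing_integrable[OF smooth_real_C1_M[OF u] \<eta>w_integrable]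
  have iE: "integrable mu0 ?E" using i by simp
  have "AE p in mu0. p \<in> space mu0" by (rule AE_space)
  moreover have "AE p in mu0. weak_grad (\<lambda>q. u q * vol_density g_lim q) p = u p *\<^sub>R (w (fst p), 0) + \<eta> (fst p) *\<^sub>R gradM u p"
    by (rule weak_grad_unique[OF has_weak_grad_weak_grad[OF has_weak_grad_vol[OF u]] has_weak_grad_vol[OF u]])
  ultimately have eq: "AE p in mu0. scal_integrand g_lim u p = ?E p"
    using weak_cov_AE
  proof eventually_elim
    case (elim p)
    from elim(1) have "p \<in> S2xS1" by simp
    from scal_integrand_eq[OF this elim(3,4,2)] show ?case .
  qed
  note m = scal_integrand_measurable[OF u] borel_measurable_integrable[OF iE]
  have "integrable mu0 (scal_integrand g_lim u)" using integrable_cong_AE[OF m eq] iE by blast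
  then show "scal_dist_defined g_lim u"
    unfolding scal_dist_defined_def using has_weak_cov_metric has_weak_cov_cometric has_weak_grad_vol[OF u] by blast
  show "scal_dist g_lim u = 2 * (\<integral>p. w (fst p) \<bullet> fst (gradM u p) \<partial>mu0) + 2 * (\<integral>p. \<eta> (fst p) * u p \<partial>mu0)"
    unfolding scal_dist_def integral_cong_AE[OF m eq] using i by simp
qed

text \<open>The divergence of u times the gradient of \<open>h k\<close> integrates to 0, so the sum
  is the integral of u times the nonnegative difference of \<open>h k\<close> and its
  Laplacian.\<close>

lemma pairing_h_nonneg:
  assumes u: "C1_M u" and nonneg: "\<And>p. p \<in> S2xS1 \<Longrightarrow> 0 \<le> u p"
  shows "0 \<le> (\<integral>p. sgrad (h k) (fst p) \<bullet> fst (gradM u p) \<partial>mu0) + (\<integral>p. h k (fst p) * u p \<partial>mu0)"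
proof -
  note X = C1_field_sgrad[OF h[of k]]
  have ih: "integrable \<sigma> (h k)" "integrable \<sigma> (sgrad (h k))" "integrable \<sigma> (slaplacian (h k))"
    by (intro continuous_on_sphere_integrable h_continuous sgrad_continuous C1_h slaplacian_continuous h)+
  note i = pairing_integrable[OF u ih(1,2)] pairing_integrable(2)[OF u ih(3,2)]
  have "0 = (\<integral>p. divM (\<lambda>p. u p *\<^sub>R (sgrad (h k) (fst p), 0)) p \<partial>mu0)"
    by (rule integral_divM_eq_0[OF C1_field_scale(1)[OF u X(1)], symmetric])
  also have "\<dots> = (\<integral>p. sgrad (h k) (fst p) \<bullet> fst (gradM u p) + slaplacian (h k) (fst p) * u p \<partial>mu0)"
  proof (intro Bochner_Integration.integral_cong refl)
    fix p assume "p \<in> space mu0"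
    then have p: "p \<in> S2xS1" by simp
    show "divM (\<lambda>p. u p *\<^sub>R (sgrad (h k) (fst p), 0)) p = sgrad (h k) (fst p) \<bullet> fst (gradM u p) + slaplacian (h k) (fst p) * u p"
      unfolding C1_field_scale(2)[OF u X(1) p] X(2)[OF p] gradM_inner[OF u p, symmetric]
      by (simp add: inner_prod_def inner_commute)
  qed
  finally have 0: "0 = (\<integral>p. sgrad (h k) (fst p) \<bullet> fst (gradM u p) \<partial>mu0) + (\<integral>p. slaplacian (h k) (fst p) * u p \<partial>mu0)"
    using i by simp
  have "(\<integral>p. slaplacian (h k) (fst p) * u p \<partial>mu0) \<le> (\<integral>p. h k (fst p) * u p \<partial>mu0)"
    by (intro integral_mono i mult_right_mono super nonneg M_norms) auto
  then show ?thesis using 0 by linarith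
qed

lemma nonneg_scal_dist_g_lim: "nonneg_scal_dist g_lim"
  unfolding nonneg_scal_dist_def
proof (intro allI impI conjI)
  fix u :: "amb \<Rightarrow> real" assume u: "smooth_on_M u"
  show "scal_dist_defined g_lim u" by (rule scal_dist_g_lim(1)[OF u])
  assume nonneg: "\<forall>p\<in>S2xS1. 0 \<le> u p"
  note C1 = smooth_real_C1_M[OF u]
  have ih: "integrable \<sigma> (h k)" "integrable \<sigma> (sgrad (h k))" for k
    by (intro continuous_on_sphere_integrable h_continuous sgrad_continuous C1_h)+
  have "(\<lambda>k. \<integral>p. sgrad (h k) (fst p) \<bullet> fst (gradM u p) \<partial>mu0) \<longlonglongrightarrow> (\<integral>p. w (fst p) \<bullet> fst (gradM u p) \<partial>mu0)"
    by (intro integral_mult_continuous_tendsto ih \<eta>w_integrable sgrad_lim continuous_intros gradM_continuous C1)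
  moreover have "(\<lambda>k. \<integral>p. h k (fst p) \<bullet> u p \<partial>mu0) \<longlonglongrightarrow> (\<integral>p. \<eta> (fst p) \<bullet> u p \<partial>mu0)"
  proof (rule integral_mult_continuous_tendsto[OF ih(1) \<eta>w_integrable(1) C1_M_continuous[OF C1]])
    show "(\<lambda>k. \<integral>x. norm (h k x - \<eta> x) \<partial>\<sigma>) \<longlonglongrightarrow> 0" using h_lim[of 1] by simp
  qed
  ultimately have "0 \<le> (\<integral>p. w (fst p) \<bullet> fst (gradM u p) \<partial>mu0) + (\<integral>p. \<eta> (fst p) \<bullet> u p \<partial>mu0)"
    by (rule LIMSEQ_le_const[OF tendsto_add]) (use pairing_h_nonneg[OF C1] nonneg in auto)
  then show "0 \<le> scal_dist g_lim u" unfolding scal_dist_g_lim(2)[OF u] by simp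
qed

text \<open>Curvature totals and limit pairing all equal \<open>2 * circle_length\<close> times the
  integral of the warping function, so L^1 convergence is enough.\<close>

lemma total_scalar_curvature_tendsto:
  "(\<lambda>k. total_scalar_curvature (warped_metric (h k))) \<longlonglongrightarrow> scal_dist g_lim (\<lambda>_. 1)"
proof -
  have pos: "0 < h k x" if "norm x = 1" for k x using c h_ge[OF that] by (rule less_le_trans)
  have tot: "total_scalar_curvature (warped_metric (h k)) = 2 * circle_length * (\<integral>x. h k x \<partial>\<sigma>)" for k
    using total_scalar_curvature_warped[OF h _ pos] pos by (metis less_irrefl)
  have one: "smooth_on_M (\<lambda>_. 1 :: real)"
    by (rule smooth_on_M_polynomial) (simp add: real_polynomial_function.intros(2))
  have "gradM (\<lambda>_. 1) p = 0" if "p \<in> S2xS1" for p by (simp add: gradM_def C1_M_const(2)[OF that])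
  then have "(\<integral>p. w (fst p) \<bullet> fst (gradM (\<lambda>_. 1) p) \<partial>mu0) = (\<integral>p. 0 \<partial>mu0)"
    by (intro Bochner_Integration.integral_cong refl) (simp only: space_mu0 fst_zero inner_zero_right)
  then have sd: "scal_dist g_lim (\<lambda>_. 1) = 2 * circle_length * (\<integral>x. \<eta> x \<partial>\<sigma>)"
    unfolding scal_dist_g_lim(2)[OF one] using integrable_mu0_fst(2)[OF \<eta>w_integrable(1)] by simp
  have "(\<lambda>k. \<integral>x. h k x \<partial>\<sigma>) \<longlonglongrightarrow> (\<integral>x. \<eta> x \<partial>\<sigma>)"
  proof (rule tendsto_L1_int)
    show "integrable \<sigma> (h k)" for k by (rule continuous_on_sphere_integrable[OF h_continuous])
    show "integrable \<sigma> \<eta>" by (rule \<eta>w_integrable)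
    have "((\<lambda>k. ennreal (\<integral>x. \<bar>h k x - \<eta> x\<bar> \<partial>\<sigma>)) \<longlongrightarrow> 0) sequentially"
      using h_lim[of 1] tendsto_ennrealI by force
    moreover have "(\<integral>\<^sup>+x. ennreal (norm (h k x - \<eta> x)) \<partial>\<sigma>) = ennreal (\<integral>x. \<bar>h k x - \<eta> x\<bar> \<partial>\<sigma>)" for k
      using diff_powr_integrable[of 1 k] by (subst nn_integral_eq_integral) auto
    ultimately show "((\<lambda>k. \<integral>\<^sup>+x. ennreal (norm (h k x - \<eta> x)) \<partial>\<sigma>) \<longlongrightarrow> 0) sequentially" by simp
  qed
  then show ?thesis unfolding tot sd by (rule tendsto_mult_left)
qed

end

text \<open>Nonnegative combinations inherit the differential inequality; the lower bound
  \<open>2 * A 1\<close> comes from the first summand alone, and \<open>K * T\<close> bounds the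
  integrals. Since \<open>f i j\<close> varies with j, compactness is applied to the sums
  \<open>h j\<close> themselves.\<close>

theorem corollary2p5:
  fixes f :: "nat \<Rightarrow> nat \<Rightarrow> real^3 \<Rightarrow> real"
    and A :: "nat \<Rightarrow> real" and T K :: real
    and h :: "nat \<Rightarrow> real^3 \<Rightarrow> real"
    and g :: "nat \<Rightarrow> tensor2"
  assumes "\<And>i j. 1 \<le> i \<Longrightarrow> 1 \<le> j \<Longrightarrow> smooth_on_sphere (f i j)"
    and "\<And>i j x. 1 \<le> i \<Longrightarrow> 1 \<le> j \<Longrightarrow> x \<in> sphere 0 1 \<Longrightarrow> 0 < f i j x"
    and "0 < T"
    and "\<And>i j. 1 \<le> i \<Longrightarrow> 1 \<le> j \<Longrightarrow> (\<integral>x. f i j x \<partial>sphere_measure) \<le> T"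
    and "\<And>i j x. 1 \<le> i \<Longrightarrow> 1 \<le> j \<Longrightarrow> x \<in> sphere 0 1 \<Longrightarrow> 2 \<le> f i j x"
    and "\<And>i j x. 1 \<le> i \<Longrightarrow> 1 \<le> j \<Longrightarrow> x \<in> sphere 0 1 \<Longrightarrow> slaplacian (f i j) x \<le> f i j x"
    and "\<And>i. 1 \<le> i \<Longrightarrow> 0 \<le> A i"
    and "0 < A 1"
    and "(\<lambda>i. A (Suc i)) sums K"
    and "\<And>j. 1 \<le> j \<Longrightarrow> h j = (\<lambda>x. \<Sum>i=1..j. A i * f i j x)"
    and "\<And>j. 1 \<le> j \<Longrightarrow> g j = warped_metric (h j)"
  shows "\<exists>s g_inf. strict_mono (s :: nat \<Rightarrow> nat) \<and> (\<forall>k. 1 \<le> s k) \<and>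
     weak_warped_metric g_inf \<and>
     (\<forall>p. 1 \<le> p \<and> p < 2 \<longrightarrow> W1p_tensor p g_inf) \<and>
     (\<forall>q\<ge>1. Lq_tendsto q (\<lambda>k. g (s k)) g_inf) \<and>
     nonneg_scal_dist g_inf \<and>
     (\<lambda>k. total_scalar_curvature (g (s k))) \<longlonglongrightarrow> scal_dist g_inf (\<lambda>_. 1)"
proof -
  have C2f: "C2_sphere (f i j)" if "1 \<le> i" "1 \<le> j" for i j by (rule smooth_on_sphere_imp_C2[OF assms(1)[OF that]])
  have fint: "integrable \<sigma> (f i j)" if "1 \<le> i" "1 \<le> j" for i j
    by (rule continuous_on_sphere_integrable[OF C1_sphere_continuous[OF C2_sphere_imp_C1[OF C2f[OF that]]]])
  \<comment> \<open>The hypotheses describe the sequence from index 1 on, so it is reindexed by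
    \<open>Suc\<close>, which also makes the final indices positive.\<close>
  have hS: "h (Suc k) = (\<lambda>x. \<Sum>i\<in>{1..Suc k}. A i * f i (Suc k) x)" for k by (rule assms(10)) simp
  have C2: "C2_sphere (h (Suc k))" for k unfolding hS by (rule C2_sphere_sum) (auto intro: C2f)
  have ge: "2 * A 1 \<le> h (Suc k) x" if x: "norm x = 1" for k x
  proof -
    have "A 1 * 2 \<le> A 1 * f 1 (Suc k) x" using assms(5,8) x by (intro mult_left_mono) auto
    also have "\<dots> \<le> (\<Sum>i\<in>{1..Suc k}. A i * f i (Suc k) x)"
      by (rule member_le_sum[where f="\<lambda>i. A i * f i (Suc k) x"]) (use assms(2,7) x in \<open>auto intro!: mult_nonneg_nonneg intro: less_imp_le\<close>)
    finally show ?thesis by (simp add: hS)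
  qed
  have super: "slaplacian (h (Suc k)) x \<le> h (Suc k) x" if x: "norm x = 1" for k x
  proof -
    have "slaplacian (h (Suc k)) x = (\<Sum>i\<in>{1..Suc k}. A i * slaplacian (f i (Suc k)) x)"
      unfolding hS by (rule C2_sphere_sum(2)) (auto intro: C2f x)
    also have "\<dots> \<le> (\<Sum>i\<in>{1..Suc k}. A i * f i (Suc k) x)"
      using assms(6,7) x by (intro sum_mono mult_left_mono) auto
    finally show ?thesis by (simp add: hS)
  qed
  have bd: "(\<integral>x. h (Suc k) x \<partial>\<sigma>) \<le> K * T" for k
  proof -
    have "(\<integral>x. h (Suc k) x \<partial>\<sigma>) = (\<Sum>i\<in>{1..Suc k}. A i * (\<integral>x. f i (Suc k) x \<partial>\<sigma>))"
      unfolding hS by (subst Bochner_Integration.integral_sum) (auto intro: fint)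
    also have "\<dots> \<le> (\<Sum>i\<in>{1..Suc k}. A i * T)"
      using assms(4,7) by (intro sum_mono mult_left_mono) auto
    \<comment> \<open>The partial sums run from 1, the series from 0.\<close>
    also have "\<dots> = (\<Sum>i<Suc k. A (Suc i)) * T"
      unfolding sum_distrib_right by (rule sum.reindex_bij_witness[of _ Suc "\<lambda>i. i - 1"]) auto
    also have "\<dots> \<le> K * T"
    proof (rule mult_right_mono)
      have "(\<Sum>i<Suc k. A (Suc i)) \<le> (\<Sum>i. A (Suc i))"
        using assms(7,9) by (intro sum_le_suminf) (auto simp: sums_iff)
      then show "(\<Sum>i<Suc k. A (Suc i)) \<le> K" using assms(9) by (simp add: sums_iff)
    qed (use assms(3) in simp)
    finally show ?thesis .
  qed
  obtain s \<eta> w where s: "strict_mono (s :: nat \<Rightarrow> nat)"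
    and lim: "supersolution_limit (\<lambda>k. h (Suc (s k))) \<eta> w (2 * A 1)"
    using supersolution_limit_exists[of "2 * A 1" "\<lambda>k. h (Suc k)" "K * T"] C2 ge super bd assms(8) by auto
  interpret supersolution_limit "\<lambda>k. h (Suc (s k))" \<eta> w "2 * A 1" by (rule lim)
  have gS: "g (Suc (s k)) = warped_metric (h (Suc (s k)))" for k by (rule assms(11)) simp
  show ?thesis
  proof (intro exI[of _ "\<lambda>k. Suc (s k)"] exI[of _ "warped_metric \<eta>"] conjI allI impI)
    show "strict_mono (\<lambda>k. Suc (s k))" using s by (simp add: strict_mono_def)
    show "weak_warped_metric (warped_metric \<eta>)"
      unfolding weak_warped_metric_def using \<eta>_measurable \<eta>_pos by (intro exI[of _ \<eta>]) auto
    show "W1p_tensor p (warped_metric \<eta>)" if "1 \<le> p \<and> p < 2" for p using that W1p by blast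
    show "Lq_tendsto q (\<lambda>k. g (Suc (s k))) (warped_metric \<eta>)" if "1 \<le> q" for q unfolding gS by (rule Lq_lim[OF that])
    show "nonneg_scal_dist (warped_metric \<eta>)" by (rule nonneg_scal_dist_g_lim)
    show "(\<lambda>k. total_scalar_curvature (g (Suc (s k)))) \<longlonglongrightarrow> scal_dist (warped_metric \<eta>) (\<lambda>_. 1)"
      unfolding gS by (rule total_scalar_curvature_tendsto)
  qed simp
qed

end
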